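(* There is only a $1$-parameter family of compact homogeneous Lagrangian Engel structures, with parameter $b\in\mathbb{R}$. Precisely: for every compact quotient of a homogeneous Lagrangian Engel structure there exist a canonical $0$-adapted coframing $(\omega_1,\omega_2,\omega_3,\omega_4)$ and a constant $b\in\mathbb{R}$ such that $$d\omega_1=\omega_2\wedge\omega_3,\qquad d\omega_2=\omega_3\wedge\omega_4,\qquad d\omega_3=0,\qquad d\omega_4=b\,\omega_2\wedge\omega_3,$$ and every $b\in\mathbb{R}$ occurs for some such compact quotient.
   Context: Everything is smooth. An Engel structure on a $4$-manifold $M$ is a rank $2$ subbundle $D\subset TM$ such that, writing $I=D^\perp\subset T^*M$ for its annihilator, the first derived system $I^{(1)}$ has rank $1$ and the second derived system $I^{(2)}$ is $0$. Here, for a subbundle $J\subset T^*M$, the derived system $J^{(1)}$ is the kernel of the bundle map $\delta:J\to\Lambda^2(T^*M/J)$ induced by $\omega\mapsto d\omega \bmod J$, and $I^{(2)}=(I^{(1)})^{(1)}$. A Lagrangian Engel structure $(M,\Omega,D)$ is a $4$-manifold with a symplectic form $\Omega$ and an Engel structure $D$ whose $2$-planes are $\Omega$-Lagrangian. A coframing $(\omega_1,\dots,\omega_4)$ is $0$-adapted to $(M,\Omega,D)$ if $\Omega=\omega_1\wedge\omega_3+\omega_2\wedge\omega_4$, $I=\langle\omega_1,\omega_2\rangle$, $I^{(1)}=\langle\omega_1\rangle$. "Canonical" means uniquely determined by the structure $(\Omega,D)$. A symmetry of $(M,\Omega,D)$ is a diffeomorphism of $M$ preserving $\Omega$ and $D$.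 The structure is homogeneous if its group of symmetries acts transitively on $M$ ($M$ connected). A compact homogeneous Lagrangian Engel structure means a compact quotient: a compact manifold $M/\Gamma$ with the induced structure, where $(M,\Omega,D)$ is homogeneous and $\Gamma$ is a discrete group of symmetries acting freely and properly discontinuously on $M$. *)

theory Defs
  imports "HOL-Analysis.Analysis" "HOL-Algebra.Bij"
begin

section \<open>Smooth maps on open subsets of \<open>\<real>\<^sup>4\<close>\<close>

primrec Ck_on :: "nat \<Rightarrow> (real^4) set \<Rightarrow> (real^4 \<Rightarrow> 'v::real_normed_vector) \<Rightarrow> bool" where
  "Ck_on 0 S f = continuous_on S f"
| "Ck_on (Suc k) S f =
    ((\<forall>x\<in>S. f differentiable (at x)) \<and> (\<forall>v. Ck_on k S (\<lambda>x. frechet_derivative f (at x) v)))"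

definition smooth_on :: "(real^4) set \<Rightarrow> (real^4 \<Rightarrow> 'v::real_normed_vector) \<Rightarrow> bool" where
  "smooth_on S f \<longleftrightarrow> (\<forall>k. Ck_on k S f)"


section \<open>Smooth 4-manifolds\<close>

text \<open>A chart \<open>(U, \<phi>)\<close> consists of its domain and its coordinate map; only the values of
  \<open>\<phi>\<close> on \<open>U\<close> matter.\<close>

type_synonym 'a chart = "'a set \<times> ('a \<Rightarrow> real^4)"

record 'a mfd =
  mtop :: "'a topology"
  atlas :: "'a chart set"

abbreviation points :: "'a mfd \<Rightarrow> 'a set" where
  "points M \<equiv> topspace (mtop M)"

definition cdom :: "'a chart \<Rightarrow> (real^4) set" where
  "cdom c = snd c ` fst c"

definition is_chart :: "'a topology \<Rightarrow> 'a chart \<Rightarrow> bool" where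
  "is_chart T c \<longleftrightarrow> openin T (fst c) \<and> open (cdom c) \<and>
     homeomorphic_map (subtopology T (fst c)) (top_of_set (cdom c)) (snd c)"

text \<open>The expression of \<open>f\<close> in a chart \<open>c\<close> of the source and a chart \<open>c'\<close> of the target, and the
  set on which it is meaningful. Transition maps are the case \<open>f = id\<close>.\<close>

definition rep_dom :: "'a chart \<Rightarrow> 'b chart \<Rightarrow> ('a \<Rightarrow> 'b) \<Rightarrow> (real^4) set" where
  "rep_dom c c' f = snd c ` {p \<in> fst c. f p \<in> fst c'}"

definition rep :: "'a chart \<Rightarrow> 'b chart \<Rightarrow> ('a \<Rightarrow> 'b) \<Rightarrow> real^4 \<Rightarrow> real^4" where
  "rep c c' f = snd c' \<circ> f \<circ> inv_into (fst c) (snd c)"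

abbreviation drep :: "'a chart \<Rightarrow> 'b chart \<Rightarrow> ('a \<Rightarrow> 'b) \<Rightarrow> real^4 \<Rightarrow> real^4 \<Rightarrow> real^4" where
  "drep c c' f x \<equiv> frechet_derivative (rep c c' f) (at x)"

definition smooth_manifold :: "'a mfd \<Rightarrow> bool" where
  "smooth_manifold M \<longleftrightarrow>
     Hausdorff_space (mtop M) \<and> second_countable (mtop M) \<and>
     (\<forall>c\<in>atlas M. is_chart (mtop M) c) \<and>
     (\<Union>c\<in>atlas M. fst c) = points M \<and>
     (\<forall>c\<in>atlas M. \<forall>c'\<in>atlas M. smooth_on (rep_dom c c' id) (rep c c' id))"

definition smooth_map :: "'a mfd \<Rightarrow> 'b mfd \<Rightarrow> ('a \<Rightarrow> 'b) \<Rightarrow> bool" where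
  "smooth_map M N f \<longleftrightarrow> continuous_map (mtop M) (mtop N) f \<and>
     (\<forall>c\<in>atlas M. \<forall>c'\<in>atlas N. smooth_on (rep_dom c c' f) (rep c c' f))"

definition diffeo :: "'a mfd \<Rightarrow> 'b mfd \<Rightarrow> ('a \<Rightarrow> 'b) \<Rightarrow> bool" where
  "diffeo M N f \<longleftrightarrow> bij_betw f (points M) (points N) \<and>
     smooth_map M N f \<and> smooth_map N M (inv_into (points M) f)"

definition open_submfd :: "'a mfd \<Rightarrow> 'a set \<Rightarrow> 'a mfd" where
  "open_submfd M W =
     \<lparr>mtop = subtopology (mtop M) W, atlas = (\<lambda>c. (fst c \<inter> W, snd c)) ` atlas M\<rparr>"

definition local_diffeo :: "'a mfd \<Rightarrow> 'b mfd \<Rightarrow> ('a \<Rightarrow> 'b) \<Rightarrow> bool" where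
  "local_diffeo M N f \<longleftrightarrow>
     (\<forall>p\<in>points M. \<exists>W. openin (mtop M) W \<and> p \<in> W \<and> openin (mtop N) (f ` W) \<and>
        diffeo (open_submfd M W) (open_submfd N (f ` W)) f)"


section \<open>Differential forms and distributions\<close>

text \<open>Tensor fields are given by their components in every chart of the atlas, subject to the
  transformation law. In a chart, a covector is given by its coefficients: \<open>\<alpha> :: real^4\<close>
  is the functional \<open>v \<mapsto> \<alpha> \<bullet> v\<close> on coordinate vectors.\<close>

type_synonym 'a form1 = "'a chart \<Rightarrow> real^4 \<Rightarrow> real^4"
type_synonym 'a form2 = "'a chart \<Rightarrow> real^4 \<Rightarrow> real^4 \<Rightarrow> real^4 \<Rightarrow> real"
type_synonym 'a distr = "'a chart \<Rightarrow> real^4 \<Rightarrow> (real^4) set"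

definition wedge :: "real^4 \<Rightarrow> real^4 \<Rightarrow> real^4 \<Rightarrow> real^4 \<Rightarrow> real" where
  "wedge \<alpha> \<beta> u v = (\<alpha> \<bullet> u) * (\<beta> \<bullet> v) - (\<alpha> \<bullet> v) * (\<beta> \<bullet> u)"

text \<open>Exterior derivatives of forms on open subsets of \<open>\<real>\<^sup>4\<close>, evaluated on constant vector
  fields, so that no bracket terms appear.\<close>

definition ext_d1 :: "(real^4 \<Rightarrow> real^4) \<Rightarrow> real^4 \<Rightarrow> real^4 \<Rightarrow> real^4 \<Rightarrow> real" where
  "ext_d1 \<omega> x u v =
     frechet_derivative (\<lambda>y. \<omega> y \<bullet> v) (at x) u - frechet_derivative (\<lambda>y. \<omega> y \<bullet> u) (at x) v"

definition ext_d2 ::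
  "(real^4 \<Rightarrow> real^4 \<Rightarrow> real^4 \<Rightarrow> real) \<Rightarrow> real^4 \<Rightarrow> real^4 \<Rightarrow> real^4 \<Rightarrow> real^4 \<Rightarrow> real" where
  "ext_d2 \<Omega> x u v w =
     frechet_derivative (\<lambda>y. \<Omega> y v w) (at x) u - frechet_derivative (\<lambda>y. \<Omega> y u w) (at x) v
       + frechet_derivative (\<lambda>y. \<Omega> y u v) (at x) w"

text \<open>\<open>f\<^sup>* \<eta> = \<omega>\<close> for 1-forms, \<open>f\<^sup>* \<Theta> = \<Omega>\<close> for 2-forms, and \<open>df (D) = E\<close> for distributions.
  For \<open>f = id\<close> and equal fields these are the transformation laws under change of chart.\<close>

definition pulls_back1 :: "'a mfd \<Rightarrow> 'b mfd \<Rightarrow> ('a \<Rightarrow> 'b) \<Rightarrow> 'b form1 \<Rightarrow> 'a form1 \<Rightarrow> bool" where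
  "pulls_back1 M N f \<eta> \<omega> \<longleftrightarrow>
     (\<forall>c\<in>atlas M. \<forall>c'\<in>atlas N. \<forall>x\<in>rep_dom c c' f. \<forall>u.
        \<eta> c' (rep c c' f x) \<bullet> drep c c' f x u = \<omega> c x \<bullet> u)"

definition pulls_back2 :: "'a mfd \<Rightarrow> 'b mfd \<Rightarrow> ('a \<Rightarrow> 'b) \<Rightarrow> 'b form2 \<Rightarrow> 'a form2 \<Rightarrow> bool" where
  "pulls_back2 M N f \<Theta> \<Omega> \<longleftrightarrow>
     (\<forall>c\<in>atlas M. \<forall>c'\<in>atlas N. \<forall>x\<in>rep_dom c c' f. \<forall>u v.
        \<Theta> c' (rep c c' f x) (drep c c' f x u) (drep c c' f x v) = \<Omega> c x u v)"

definition maps_distr :: "'a mfd \<Rightarrow> 'b mfd \<Rightarrow> ('a \<Rightarrow> 'b) \<Rightarrow> 'a distr \<Rightarrow> 'b distr \<Rightarrow> bool" where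
  "maps_distr M N f D E \<longleftrightarrow>
     (\<forall>c\<in>atlas M. \<forall>c'\<in>atlas N. \<forall>x\<in>rep_dom c c' f.
        drep c c' f x ` D c x = E c' (rep c c' f x))"

definition one_form :: "'a mfd \<Rightarrow> 'a form1 \<Rightarrow> bool" where
  "one_form M \<omega> \<longleftrightarrow> (\<forall>c\<in>atlas M. smooth_on (cdom c) (\<omega> c)) \<and> pulls_back1 M M id \<omega> \<omega>"

definition two_form :: "'a mfd \<Rightarrow> 'a form2 \<Rightarrow> bool" where
  "two_form M \<Omega> \<longleftrightarrow>
     (\<forall>c\<in>atlas M.
        (\<forall>x\<in>cdom c. bilinear (\<Omega> c x) \<and> (\<forall>u. \<Omega> c x u u = 0)) \<and>
        (\<forall>u v. smooth_on (cdom c) (\<lambda>x. \<Omega> c x u v))) \<and>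
     pulls_back2 M M id \<Omega> \<Omega>"

definition symplectic_form :: "'a mfd \<Rightarrow> 'a form2 \<Rightarrow> bool" where
  "symplectic_form M \<Omega> \<longleftrightarrow> two_form M \<Omega> \<and>
     (\<forall>c\<in>atlas M. \<forall>x\<in>cdom c.
        (\<forall>u v w. ext_d2 (\<Omega> c) x u v w = 0) \<and>
        (\<forall>u. (\<forall>v. \<Omega> c x u v = 0) \<longrightarrow> u = 0))"

text \<open>Rank \<open>r\<close> subbundles of the (co)tangent bundle of an open subset \<open>S\<close> of \<open>\<real>\<^sup>4\<close>.\<close>

definition subbundle :: "(real^4) set \<Rightarrow> nat \<Rightarrow> (real^4 \<Rightarrow> (real^4) set) \<Rightarrow> bool" where
  "subbundle S r J \<longleftrightarrow>
     (\<forall>x\<in>S. \<exists>V e. open V \<and> x \<in> V \<and> V \<subseteq> S \<and> (\<forall>i<r. smooth_on V (e i)) \<and>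
        (\<forall>y\<in>V. J y = span ((\<lambda>i::nat. e i y) ` {..<r}) \<and> dim (J y) = r))"

definition distribution :: "'a mfd \<Rightarrow> nat \<Rightarrow> 'a distr \<Rightarrow> bool" where
  "distribution M r D \<longleftrightarrow> (\<forall>c\<in>atlas M. subbundle (cdom c) r (D c)) \<and> maps_distr M M id D D"


section \<open>Lagrangian Engel structures\<close>

definition annihilator :: "(real^4 \<Rightarrow> (real^4) set) \<Rightarrow> real^4 \<Rightarrow> (real^4) set" where
  "annihilator D x = {\<alpha>. \<forall>v\<in>D x. \<alpha> \<bullet> v = 0}"

text \<open>The 2-covectors that vanish modulo \<open>J\<close>, that is the kernel \<open>J \<and> T\<^sup>*\<close> of
  \<open>\<Lambda>\<^sup>2 T\<^sup>* \<rightarrow> \<Lambda>\<^sup>2 (T\<^sup>*/J)\<close>.\<close>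

definition zero_mod :: "(real^4) set \<Rightarrow> (real^4 \<Rightarrow> real^4 \<Rightarrow> real) set" where
  "zero_mod J = {\<eta>. \<exists>n \<alpha> \<beta>. (\<forall>i<n. \<alpha> i \<in> J) \<and>
     \<eta> = (\<lambda>u v. \<Sum>i<(n::nat). wedge (\<alpha> i) (\<beta> i) u v)}"

text \<open>The kernel of the bundle map \<open>\<delta> : J \<rightarrow> \<Lambda>\<^sup>2 (T\<^sup>*/J)\<close> at \<open>x\<close>. The value
  \<open>\<delta> \<alpha> = d\<omega> mod J\<close> does not depend on the local section \<open>\<omega>\<close> of \<open>J\<close> that extends \<open>\<alpha>\<close>.\<close>

definition derived :: "(real^4 \<Rightarrow> (real^4) set) \<Rightarrow> real^4 \<Rightarrow> (real^4) set" where
  "derived J x = {\<alpha>. \<exists>V \<omega>. open V \<and> x \<in> V \<and> smooth_on V \<omega> \<and> (\<forall>y\<in>V. \<omega> y \<in> J y) \<and>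
     \<omega> x = \<alpha> \<and> ext_d1 \<omega> x \<in> zero_mod (J x)}"

definition engel_structure :: "'a mfd \<Rightarrow> 'a distr \<Rightarrow> bool" where
  "engel_structure M D \<longleftrightarrow> distribution M 2 D \<and>
     (\<forall>c\<in>atlas M.
        subbundle (cdom c) 1 (derived (annihilator (D c))) \<and>
        (\<forall>x\<in>cdom c. derived (derived (annihilator (D c))) x = {0}))"

definition lagrangian_engel :: "'a mfd \<Rightarrow> 'a form2 \<Rightarrow> 'a distr \<Rightarrow> bool" where
  "lagrangian_engel M \<Omega> D \<longleftrightarrow>
     smooth_manifold M \<and> symplectic_form M \<Omega> \<and> engel_structure M D \<and>
     (\<forall>c\<in>atlas M. \<forall>x\<in>cdom c. \<forall>u\<in>D c x. \<forall>v\<in>D c x. \<Omega> c x u v = 0)"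

text \<open>Coframings are indexed by \<open>{1..4}\<close>; other indices are irrelevant.\<close>

definition coframing :: "'a mfd \<Rightarrow> (nat \<Rightarrow> 'a form1) \<Rightarrow> bool" where
  "coframing M \<omega> \<longleftrightarrow> (\<forall>i\<in>{1..4}. one_form M (\<omega> i)) \<and>
     (\<forall>c\<in>atlas M. \<forall>x\<in>cdom c.
        inj_on (\<lambda>i. \<omega> i c x) {1..4} \<and> independent ((\<lambda>i. \<omega> i c x) ` {1..4}))"

definition zero_adapted ::
  "'a mfd \<Rightarrow> 'a form2 \<Rightarrow> 'a distr \<Rightarrow> (nat \<Rightarrow> 'a form1) \<Rightarrow> bool" where
  "zero_adapted M \<Omega> D \<omega> \<longleftrightarrow> coframing M \<omega> \<and>
     (\<forall>c\<in>atlas M. \<forall>x\<in>cdom c.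
        (\<forall>u v. \<Omega> c x u v =
           wedge (\<omega> 1 c x) (\<omega> 3 c x) u v + wedge (\<omega> 2 c x) (\<omega> 4 c x) u v) \<and>
        annihilator (D c) x = span {\<omega> 1 c x, \<omega> 2 c x} \<and>
        derived (annihilator (D c)) x = span {\<omega> 1 c x})"

definition coframing_agree ::
  "'a mfd \<Rightarrow> (nat \<Rightarrow> 'a form1) \<Rightarrow> (nat \<Rightarrow> 'a form1) \<Rightarrow> bool" where
  "coframing_agree M \<omega> \<omega>' \<longleftrightarrow> (\<forall>i\<in>{1..4}. \<forall>c\<in>atlas M. \<forall>x\<in>cdom c. \<omega> i c x = \<omega>' i c x)"

definition structure_equations :: "'a mfd \<Rightarrow> real \<Rightarrow> (nat \<Rightarrow> 'a form1) \<Rightarrow> bool" where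
  "structure_equations M b \<omega> \<longleftrightarrow>
     (\<forall>c\<in>atlas M. \<forall>x\<in>cdom c. \<forall>u v.
        ext_d1 (\<omega> 1 c) x u v = wedge (\<omega> 2 c x) (\<omega> 3 c x) u v \<and>
        ext_d1 (\<omega> 2 c) x u v = wedge (\<omega> 3 c x) (\<omega> 4 c x) u v \<and>
        ext_d1 (\<omega> 3 c) x u v = 0 \<and>
        ext_d1 (\<omega> 4 c) x u v = b * wedge (\<omega> 2 c x) (\<omega> 3 c x) u v)"


section \<open>Homogeneous structures and their compact quotients\<close>

text \<open>Elements of \<open>Bij S\<close> are extensional, so a symmetry is determined by its values on \<open>M\<close> and
  composition makes the symmetries a subgroup of \<open>BijGroup (points M)\<close>.\<close>

definition symmetries :: "'a mfd \<Rightarrow> 'a form2 \<Rightarrow> 'a distr \<Rightarrow> ('a \<Rightarrow> 'a) set" where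
  "symmetries M \<Omega> D =
     {f \<in> Bij (points M). diffeo M M f \<and> pulls_back2 M M f \<Omega> \<Omega> \<and> maps_distr M M f D D}"

text \<open>The empty manifold is excluded.\<close>

definition homogeneous :: "'a mfd \<Rightarrow> 'a form2 \<Rightarrow> 'a distr \<Rightarrow> bool" where
  "homogeneous M \<Omega> D \<longleftrightarrow> points M \<noteq> {} \<and> connected_space (mtop M) \<and>
     (\<forall>p\<in>points M. \<forall>q\<in>points M. \<exists>f\<in>symmetries M \<Omega> D. f p = q)"

definition acts_freely :: "'a mfd \<Rightarrow> ('a \<Rightarrow> 'a) set \<Rightarrow> bool" where
  "acts_freely M \<Gamma> \<longleftrightarrow> (\<forall>\<gamma>\<in>\<Gamma>. \<forall>p\<in>points M. \<gamma> p = p \<longrightarrow> \<gamma> = \<one>\<^bsub>BijGroup (points M)\<^esub>)"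

definition acts_properly_discontinuously :: "'a mfd \<Rightarrow> ('a \<Rightarrow> 'a) set \<Rightarrow> bool" where
  "acts_properly_discontinuously M \<Gamma> \<longleftrightarrow>
     (\<forall>K. compactin (mtop M) K \<longrightarrow> finite {\<gamma>\<in>\<Gamma>. \<gamma> ` K \<inter> K \<noteq> {}})"

text \<open>\<open>(N, \<Theta>, E)\<close> with the projection \<open>\<pi>\<close> is the compact quotient \<open>M/\<Gamma>\<close> with the induced
  structure: \<open>\<pi>\<close> is a surjective local diffeomorphism whose fibres are the \<open>\<Gamma>\<close>-orbits, which
  determines \<open>N\<close> up to a unique diffeomorphism over \<open>M/\<Gamma>\<close>. Discreteness of \<open>\<Gamma>\<close> is implied by
  proper discontinuity.\<close>

definition compact_quotient ::
  "'a mfd \<Rightarrow> 'a form2 \<Rightarrow> 'a distr \<Rightarrow> ('a \<Rightarrow> 'a) set \<Rightarrow>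
   ('a \<Rightarrow> 'b) \<Rightarrow> 'b mfd \<Rightarrow> 'b form2 \<Rightarrow> 'b distr \<Rightarrow> bool" where
  "compact_quotient M \<Omega> D \<Gamma> \<pi> N \<Theta> E \<longleftrightarrow>
     subgroup \<Gamma> (BijGroup (points M)) \<and> \<Gamma> \<subseteq> symmetries M \<Omega> D \<and>
     acts_freely M \<Gamma> \<and> acts_properly_discontinuously M \<Gamma> \<and>
     lagrangian_engel N \<Theta> E \<and> compact_space (mtop N) \<and>
     local_diffeo M N \<pi> \<and> \<pi> ` points M = points N \<and>
     (\<forall>p\<in>points M. \<forall>q\<in>points M. \<pi> p = \<pi> q \<longleftrightarrow> (\<exists>\<gamma>\<in>\<Gamma>. \<gamma> p = q)) \<and>
     pulls_back2 M N \<pi> \<Theta> \<Omega> \<and> maps_distr M N \<pi> D E"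

end

theory Submission
  imports Defs
begin

text \<open>Among the adapted coframes, generically a unique one satisfies \<open>d\<omega>\<^sub>1 = \<omega>\<^sub>2 \<and> \<omega>\<^sub>3\<close> modulo \<open>\<omega>\<^sub>1\<close>
  together with four further normalisations of \<open>d\<omega>\<^sub>1\<close> and \<open>d\<omega>\<^sub>2\<close>; otherwise
  \<open>d\<omega>\<^sub>1 \<equiv> \<omega>\<^sub>2 \<and> \<omega>\<^sub>4\<close> modulo \<open>\<omega>\<^sub>1\<close> can be arranged, and only the dual vector \<open>e\<^sub>3\<close> is determined. By homogeneity
  one of the two cases holds everywhere, and in the first one the structure functions are
  constants. A vector field on a compact manifold whose divergence with respect to the volume of
  \<open>\<Omega>\<close> is constant has divergence zero. In the second case \<open>d\<Omega> = 0\<close> forces \<open>e\<^sub>3\<close> to have constant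
  nonzero divergence, so this case does not occur; in the first case all dual vectors are divergence
  free, and these linear relations, \<open>d\<Omega> = 0\<close> and the Jacobi identity leave only the constant \<open>b\<close>.

  Conversely, the structure equations with parameter \<open>b\<close> are those of a semidirect product of
  \<open>\<real>\<close> with \<open>\<real>\<^sup>3\<close> in which \<open>\<real>\<close> acts by \<open>exp (t B)\<close>. This group has a cocompact lattice as soon as
  some \<open>exp (T B)\<close> with \<open>T \<noteq> 0\<close> is conjugate to an integer matrix, and for a suitable \<open>T\<close> it has integer
  trace and a cyclic vector, which suffices.\<close>

text \<open>Homogeneity and compactness live on different manifolds: the symmetries act on
  \<open>M\<close>, while the integration takes place on the compact quotient, to which they need
  not descend. The two are linked by germs. Structure functions of a coframe that is unique depend
  only on the germ of (Omega, D), and any two points of the quotient have lifts related by a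
  symmetry of \<open>M\<close>, so these functions take the same values everywhere. In the
  exceptional case no coframe is unique, but only one dual vector is needed there, and its
  divergence is a number forced by d(d omega_1) = 0 together with d Omega = 0.

  Vanishing divergence of all dual vectors means sum_i C^i_{ji} = 0, that is, unimodularity of the
  Lie algebra with structure constants C. These linear relations are what makes the quadratic Jacobi
  identities solvable one after the other.

  The volume is treated as a density: all adapted coframes have the same determinant up to sign, so
  its absolute value is determined by Omega and no orientation enters.\<close>

lemma has_frechet:
  "f differentiable (at x) \<Longrightarrow> (f has_derivative frechet_derivative f (at x)) (at x)"
  using frechet_derivative_works by blast

lemma frechet_eqI: "(f has_derivative f') (at x) \<Longrightarrow> frechet_derivative f (at x) = f'"
  using frechet_derivative_at by metis

lemma has_derivative_comp_at:
  "(f has_derivative f') (at x) \<Longrightarrow> (g has_derivative g') (at (f x)) \<Longrightarrow>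
    ((\<lambda>x. g (f x)) has_derivative (\<lambda>v. g' (f' v))) (at x)"
  by (rule has_derivative_compose)

lemma linear_axis_expansion:
  fixes h :: "real^'n \<Rightarrow> 'v::real_vector"
  assumes "linear h"
  shows "h u = (\<Sum>i\<in>UNIV. u $ i *\<^sub>R h (axis i 1))"
proof -
  have "h u = h (\<Sum>i\<in>UNIV. u $ i *\<^sub>R axis i 1)"
    by (simp add: basis_expansion scalar_mult_eq_scaleR[symmetric])
  also have "\<dots> = (\<Sum>i\<in>UNIV. u $ i *\<^sub>R h (axis i 1))"
    by (simp add: linear_sum[OF assms] linear_scale[OF assms])
  finally show ?thesis .
qed

section \<open>Smooth functions on open subsets of \<open>\<real>\<^sup>4\<close>\<close>

lemma Ck_on_cong:
  assumes "open S" "\<And>x. x \<in> S \<Longrightarrow> f x = g x" "Ck_on k S f"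
  shows "Ck_on k S g"
  using assms(2,3)
proof (induction k arbitrary: f g)
  case 0
  then show ?case using continuous_on_cong by force
next
  case (Suc k)
  have d: "f differentiable (at x)" if "x \<in> S" for x using Suc.prems that by simp
  have g: "(g has_derivative frechet_derivative f (at x)) (at x)" if "x \<in> S" for x
    using has_derivative_transform_within_open[OF has_frechet[OF d[OF that]] assms(1) that] Suc.prems by simp
  then have fg: "frechet_derivative g (at x) = frechet_derivative f (at x)" if "x \<in> S" for x
    using that frechet_eqI by blast
  show ?case
    using g fg Suc.prems(2) Suc.IH[of "\<lambda>x. frechet_derivative f (at x) v" "\<lambda>x. frechet_derivative g (at x) v" for v]
    by (auto simp: differentiable_def)
qed

lemma Ck_on_imp_continuous_on: "Ck_on k S f \<Longrightarrow> continuous_on S f"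
  by (cases k) (auto intro!: continuous_at_imp_continuous_on differentiable_imp_continuous_within)

lemma Ck_on_SucD: "Ck_on (Suc k) S f \<Longrightarrow> Ck_on k S f"
proof (induction k arbitrary: f)
  case 0
  then show ?case using Ck_on_imp_continuous_on[of "Suc 0"] by auto
qed auto

lemma Ck_on_subset: "Ck_on k S f \<Longrightarrow> T \<subseteq> S \<Longrightarrow> Ck_on k T f"
  by (induction k arbitrary: f) (auto intro: continuous_on_subset)

lemma Ck_on_local:
  assumes "\<And>x. x \<in> S \<Longrightarrow> \<exists>V. open V \<and> x \<in> V \<and> Ck_on k V f"
  shows "Ck_on k S f"
  using assms
proof (induction k arbitrary: f)
  case 0
  have "isCont f x" if "x \<in> S" for x
    using 0[OF that] by (auto simp: continuous_on_eq_continuous_at)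
  then show ?case by (simp add: continuous_at_imp_continuous_on)
next
  case (Suc k)
  show ?case
    unfolding Ck_on.simps
  proof (intro conjI ballI allI)
    show "f differentiable at x" if "x \<in> S" for x
      using Suc.prems[OF that] by auto
    show "Ck_on k S (\<lambda>x. frechet_derivative f (at x) v)" for v
      by (rule Suc.IH) (use Suc.prems in fastforce)
  qed
qed

lemma Ck_on_const: "Ck_on k S (\<lambda>x. c)"
  by (induction k arbitrary: c) auto

lemma Ck_on_linear:
  assumes "bounded_linear h" "open S" "Ck_on k S f"
  shows "Ck_on k S (\<lambda>x. h (f x))"
  using assms(3)
proof (induction k arbitrary: f)
  case 0
  then show ?case using assms(1) by (simp add: bounded_linear.continuous_on)
next
  case (Suc k)
  have d: "((\<lambda>x. h (f x)) has_derivative (\<lambda>v. h (frechet_derivative f (at x) v))) (at x)"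
    if "x \<in> S" for x
    using bounded_linear.has_derivative[OF assms(1) has_frechet] Suc.prems that by auto
  show ?case unfolding Ck_on.simps
  proof (intro conjI ballI allI)
    show "(\<lambda>x. h (f x)) differentiable at x" if "x \<in> S" for x
      using d[OF that] by (auto simp: differentiable_def)
    show "Ck_on k S (\<lambda>x. frechet_derivative (\<lambda>x. h (f x)) (at x) v)" for v
      by (rule Ck_on_cong[OF assms(2), of "\<lambda>x. h (frechet_derivative f (at x) v)"])
        (use Suc frechet_eqI[OF d] in auto)
  qed
qed

lemma Ck_on_ident: "open S \<Longrightarrow> Ck_on k S (\<lambda>x. x)"
  by (cases k) (auto intro: Ck_on_const)

lemma Ck_on_add:
  assumes "open S" "Ck_on k S f" "Ck_on k S g"
  shows "Ck_on k S (\<lambda>x. f x + g x)"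
  using assms(2,3)
proof (induction k arbitrary: f g)
  case 0
  then show ?case by (auto intro: continuous_on_add)
next
  case (Suc k)
  have d: "((\<lambda>x. f x + g x) has_derivative (\<lambda>v. frechet_derivative f (at x) v + frechet_derivative g (at x) v)) (at x)"
    if "x \<in> S" for x
    using Suc.prems that by (intro has_derivative_add has_frechet) auto
  show ?case unfolding Ck_on.simps
  proof (intro conjI ballI allI)
    show "(\<lambda>x. f x + g x) differentiable at x" if "x \<in> S" for x
      using d[OF that] by (auto simp: differentiable_def)
    show "Ck_on k S (\<lambda>x. frechet_derivative (\<lambda>x. f x + g x) (at x) v)" for v
      by (rule Ck_on_cong[OF assms(1), of "\<lambda>x. frechet_derivative f (at x) v + frechet_derivative g (at x) v"])
        (use Suc frechet_eqI[OF d] in auto)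
  qed
qed

lemma Ck_on_bilinear:
  assumes "bounded_bilinear h" "open S" "Ck_on k S f" "Ck_on k S g"
  shows "Ck_on k S (\<lambda>x. h (f x) (g x))"
  using assms(3,4)
proof (induction k arbitrary: f g)
  case 0
  then show ?case by (simp add: bounded_bilinear.continuous_on[OF assms(1)])
next
  case (Suc k)
  have d: "((\<lambda>x. h (f x) (g x)) has_derivative
      (\<lambda>v. h (f x) (frechet_derivative g (at x) v) + h (frechet_derivative f (at x) v) (g x))) (at x)"
    if "x \<in> S" for x
    using Suc.prems that by (intro bounded_bilinear.FDERIV[OF assms(1)] has_frechet) auto
  show ?case unfolding Ck_on.simps
  proof (intro conjI ballI allI)
    show "(\<lambda>x. h (f x) (g x)) differentiable at x" if "x \<in> S" for x
      using d[OF that] by (auto simp: differentiable_def)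
    show "Ck_on k S (\<lambda>x. frechet_derivative (\<lambda>x. h (f x) (g x)) (at x) v)" for v
    proof (rule Ck_on_cong[OF assms(2)])
      show "Ck_on k S (\<lambda>x. h (f x) (frechet_derivative g (at x) v) + h (frechet_derivative f (at x) v) (g x))"
        using Suc.prems by (intro Ck_on_add assms Suc.IH) (auto intro: Ck_on_SucD)
    qed (use frechet_eqI[OF d] in auto)
  qed
qed

lemma Ck_on_sum:
  assumes "open S" "\<And>i. i \<in> I \<Longrightarrow> Ck_on k S (f i)"
  shows "Ck_on k S (\<lambda>x. \<Sum>i\<in>I. f i x)"
  using assms(2) by (induction I rule: infinite_finite_induct) (auto intro: Ck_on_const Ck_on_add assms(1))

text \<open>The derivative of \<open>g\<close> at \<open>F x\<close> is applied to a vector that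
  itself depends on \<open>x\<close>. Expanding that vector along the axes leaves derivatives of
  \<open>g\<close> in fixed directions, to which the induction hypothesis applies, times components
  of the derivative of \<open>F\<close>.\<close>

lemma Ck_on_compose:
  fixes F :: "real^4 \<Rightarrow> real^4"
  assumes "open S" "open T" "F ` S \<subseteq> T" "Ck_on k T g" "Ck_on k S F"
  shows "Ck_on k S (\<lambda>x. g (F x))"
  using assms(4,5)
proof (induction k arbitrary: g)
  case 0
  then show ?case using continuous_on_compose2[of T g S F] assms(3) by auto
next
  case (Suc k)
  have d: "((\<lambda>x. g (F x)) has_derivative (\<lambda>v. frechet_derivative g (at (F x)) (frechet_derivative F (at x) v))) (at x)"
    and lg: "linear (frechet_derivative g (at (F x)))"
    if "x \<in> S" for x
  proof -
    have "F differentiable at x" "g differentiable at (F x)"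
      using Suc.prems that assms(3) by auto
    then show "((\<lambda>x. g (F x)) has_derivative (\<lambda>v. frechet_derivative g (at (F x)) (frechet_derivative F (at x) v))) (at x)"
      "linear (frechet_derivative g (at (F x)))"
      using has_derivative_comp_at[OF has_frechet has_frechet] linear_frechet_derivative by blast+
  qed
  show ?case unfolding Ck_on.simps
  proof (intro conjI ballI allI)
    show "(\<lambda>x. g (F x)) differentiable at x" if "x \<in> S" for x
      using d[OF that] by (auto simp: differentiable_def)
    show "Ck_on k S (\<lambda>x. frechet_derivative (\<lambda>x. g (F x)) (at x) v)" for v
    proof (rule Ck_on_cong[OF assms(1)])
      show "Ck_on k S (\<lambda>x. \<Sum>i\<in>UNIV. frechet_derivative F (at x) v $ i *\<^sub>R frechet_derivative g (at (F x)) (axis i 1))"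
        using Suc.prems Ck_on_SucD[OF Suc.prems(2)]
        by (intro Ck_on_sum Ck_on_bilinear[OF bounded_bilinear_scaleR] assms(1) Ck_on_linear[OF bounded_linear_vec_nth]
            Suc.IH) auto
      show "(\<Sum>i\<in>UNIV. frechet_derivative F (at x) v $ i *\<^sub>R frechet_derivative g (at (F x)) (axis i 1))
          = frechet_derivative (\<lambda>x. g (F x)) (at x) v" if "x \<in> S" for x
        unfolding frechet_eqI[OF d[OF that]] by (rule linear_axis_expansion[OF lg[OF that], symmetric])
    qed
  qed
qed

lemma Ck_on_inverse:
  fixes f :: "real^4 \<Rightarrow> real"
  assumes "open S" "Ck_on k S f" "\<And>x. x \<in> S \<Longrightarrow> f x \<noteq> 0"
  shows "Ck_on k S (\<lambda>x. inverse (f x))"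
  using assms(2)
proof (induction k)
  case 0
  then show ?case using assms(3) by (auto intro: continuous_on_inverse)
next
  case (Suc k)
  have d: "((\<lambda>x. inverse (f x)) has_derivative (\<lambda>v. - (inverse (f x) * frechet_derivative f (at x) v * inverse (f x)))) (at x)"
    if "x \<in> S" for x
    using Suc.prems that assms(3) by (intro Deriv.has_derivative_inverse has_frechet) auto
  show ?case unfolding Ck_on.simps
  proof (intro conjI ballI allI)
    show "(\<lambda>x. inverse (f x)) differentiable at x" if "x \<in> S" for x
      using d[OF that] by (auto simp: differentiable_def)
    show "Ck_on k S (\<lambda>x. frechet_derivative (\<lambda>x. inverse (f x)) (at x) v)" for v
    proof (rule Ck_on_cong[OF assms(1)])
      show "Ck_on k S (\<lambda>x. - (inverse (f x) * frechet_derivative f (at x) v * inverse (f x)))"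
        using Suc Ck_on_SucD[OF Suc.prems] 
        by (intro Ck_on_linear[OF bounded_linear_minus[OF bounded_linear_ident]] Ck_on_bilinear[OF bounded_bilinear_mult] assms(1)) auto
    qed (use frechet_eqI[OF d] in auto)
  qed
qed

lemma Ck_on_root:
  fixes f :: "real^4 \<Rightarrow> real"
  assumes "odd n" "open S" "Ck_on k S f" "\<And>x. x \<in> S \<Longrightarrow> f x \<noteq> 0"
  shows "Ck_on k S (\<lambda>x. root n (f x))"
  using assms(3)
proof (induction k)
  case 0
  then show ?case by (auto intro: continuous_on_real_root)
next
  case (Suc k)
  have n: "n > 0" using assms(1) by (auto intro: odd_pos)
  \<comment> \<open>The derivative of the root is written as the root itself times a rational
    expression in \<open>y\<close>; in this form the induction over \<open>k\<close> closes.\<close>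
  have r: "(root n has_real_derivative root n y * inverse (of_nat n * y)) (at y)" if "y \<noteq> 0" for y
  proof -
    have p: "root n y * root n y ^ (n - Suc 0) = y"
      using odd_real_root_pow[OF assms(1), of y] n by (metis One_nat_def power_eq_if not_gr0)
    have "root n y \<noteq> 0" using that n by simp
    then have "inverse (real n * root n y ^ (n - Suc 0)) = root n y * inverse (of_nat n * (root n y * root n y ^ (n - Suc 0)))"
      using n by (simp add: field_simps)
    then have "inverse (real n * root n y ^ (n - Suc 0)) = root n y * inverse (of_nat n * y)"
      unfolding p .
    then show ?thesis using DERIV_odd_real_root[OF assms(1) that] by (simp only:)
  qed
  have d: "((\<lambda>x. root n (f x)) has_derivative (\<lambda>v. root n (f x) * inverse (of_nat n * f x) * frechet_derivative f (at x) v)) (at x)"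
    if "x \<in> S" for x
    using Suc.prems that assms(4)
    by (intro has_derivative_comp_at[OF has_frechet r[unfolded has_field_derivative_def]]) auto
  show ?case unfolding Ck_on.simps
  proof (intro conjI ballI allI)
    show "(\<lambda>x. root n (f x)) differentiable at x" if "x \<in> S" for x
      using d[OF that] by (auto simp: differentiable_def)
    show "Ck_on k S (\<lambda>x. frechet_derivative (\<lambda>x. root n (f x)) (at x) v)" for v
    proof (rule Ck_on_cong[OF assms(2)])
      show "Ck_on k S (\<lambda>x. root n (f x) * inverse (of_nat n * f x) * frechet_derivative f (at x) v)"
        using Suc Ck_on_SucD[OF Suc.prems] assms(4) n
        by (intro Ck_on_bilinear[OF bounded_bilinear_mult] Ck_on_inverse Ck_on_const assms(2)) auto
    qed (use frechet_eqI[OF d] in auto)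
  qed
qed

text \<open>The induction on \<open>k\<close> runs for all members of the family at once, because
  differentiating one member produces another. The intended family is cosine, sine and a primitive
  of the sine, or their hyperbolic and polynomial counterparts.\<close>

lemma Ck_on_real_family:
  fixes f :: "real^4 \<Rightarrow> real" and H :: "'i \<Rightarrow> real \<Rightarrow> real"
  assumes "open S" "Ck_on k S f" "\<And>i t. (H i has_real_derivative a i * H (s i) t) (at t)"
  shows "Ck_on k S (\<lambda>x. H i (f x))"
  using assms(2)
proof (induction k arbitrary: i)
  case 0
  have "continuous_on UNIV (H i)"
    using assms(3)[of i] by (meson DERIV_isCont continuous_at_imp_continuous_on)
  then show ?case using continuous_on_compose2[of UNIV "H i" S f] 0 by auto
next
  case (Suc k)
  have d: "((\<lambda>x. H i (f x)) has_derivative (\<lambda>v. a i * H (s i) (f x) * frechet_derivative f (at x) v)) (at x)"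
    if "x \<in> S" for x i
    using Suc.prems that
    by (intro has_derivative_comp_at[OF has_frechet assms(3)[unfolded has_field_derivative_def]]) auto
  show ?case unfolding Ck_on.simps
  proof (intro conjI ballI allI)
    show "(\<lambda>x. H i (f x)) differentiable at x" if "x \<in> S" for x
      using d[OF that] by (auto simp: differentiable_def)
    show "Ck_on k S (\<lambda>x. frechet_derivative (\<lambda>x. H i (f x)) (at x) v)" for v
    proof (rule Ck_on_cong[OF assms(1)])
      show "Ck_on k S (\<lambda>x. a i * H (s i) (f x) * frechet_derivative f (at x) v)"
        using Suc Ck_on_SucD[OF Suc.prems]
        by (intro Ck_on_bilinear[OF bounded_bilinear_mult] Ck_on_const assms(1)) auto
    qed (use frechet_eqI[OF d] in auto)
  qed
qed

section \<open>From finite order of differentiability to smoothness\<close>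

lemma smooth_on_cong: "open S \<Longrightarrow> (\<And>x. x \<in> S \<Longrightarrow> f x = g x) \<Longrightarrow> smooth_on S f \<Longrightarrow> smooth_on S g"
  unfolding smooth_on_def using Ck_on_cong by blast

lemma smooth_on_subset: "smooth_on S f \<Longrightarrow> T \<subseteq> S \<Longrightarrow> smooth_on T f"
  unfolding smooth_on_def using Ck_on_subset by blast

lemma smooth_on_local:
  assumes "\<And>x. x \<in> S \<Longrightarrow> \<exists>V. open V \<and> x \<in> V \<and> smooth_on V f"
  shows "smooth_on S f"
  unfolding smooth_on_def
proof (intro allI Ck_on_local)
  fix k x assume "x \<in> S"
  then show "\<exists>V. open V \<and> x \<in> V \<and> Ck_on k V f"
    using assms unfolding smooth_on_def by metis
qed

lemma smooth_on_continuous_on: "smooth_on S f \<Longrightarrow> continuous_on S f"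
  unfolding smooth_on_def using Ck_on_imp_continuous_on by blast

lemma smooth_on_differentiable: "smooth_on S f \<Longrightarrow> x \<in> S \<Longrightarrow> f differentiable (at x)"
  unfolding smooth_on_def by (metis Ck_on.simps(2))

lemma smooth_on_has_derivative:
  "smooth_on S f \<Longrightarrow> x \<in> S \<Longrightarrow> (f has_derivative frechet_derivative f (at x)) (at x)"
  using smooth_on_differentiable has_frechet by blast

lemma smooth_on_linear_frechet: "smooth_on S f \<Longrightarrow> x \<in> S \<Longrightarrow> linear (frechet_derivative f (at x))"
  using smooth_on_differentiable linear_frechet_derivative by blast

named_theorems smooth_rules

lemma smooth_on_frechet [smooth_rules]: "smooth_on S f \<Longrightarrow> smooth_on S (\<lambda>x. frechet_derivative f (at x) v)"
  unfolding smooth_on_def by (metis Ck_on.simps(2))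

lemma smooth_on_const [smooth_rules]: "smooth_on S (\<lambda>x. c)"
  by (simp add: smooth_on_def Ck_on_const)

lemma smooth_on_ident [smooth_rules]: "open S \<Longrightarrow> smooth_on S (\<lambda>x. x)"
  by (simp add: smooth_on_def Ck_on_ident)

lemma smooth_on_add [smooth_rules]: "open S \<Longrightarrow> smooth_on S f \<Longrightarrow> smooth_on S g \<Longrightarrow> smooth_on S (\<lambda>x. f x + g x)"
  by (simp add: smooth_on_def Ck_on_add)

lemma smooth_on_linear: "bounded_linear h \<Longrightarrow> open S \<Longrightarrow> smooth_on S f \<Longrightarrow> smooth_on S (\<lambda>x. h (f x))"
  by (simp add: smooth_on_def Ck_on_linear)

lemma smooth_on_bilinear:
  "bounded_bilinear h \<Longrightarrow> open S \<Longrightarrow> smooth_on S f \<Longrightarrow> smooth_on S g \<Longrightarrow> smooth_on S (\<lambda>x. h (f x) (g x))"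
  by (simp add: smooth_on_def Ck_on_bilinear)

lemmas smooth_on_scaleR [smooth_rules] = smooth_on_bilinear[OF bounded_bilinear_scaleR]
lemmas smooth_on_mult [smooth_rules] = smooth_on_bilinear[OF bounded_bilinear_mult]
lemmas smooth_on_inner [smooth_rules] = smooth_on_bilinear[OF bounded_bilinear_inner]
lemmas smooth_on_minus [smooth_rules] = smooth_on_linear[OF bounded_linear_minus[OF bounded_linear_ident]]
lemmas smooth_on_nth [smooth_rules] = smooth_on_linear[OF bounded_linear_vec_nth]

lemma smooth_on_diff [smooth_rules]: "open S \<Longrightarrow> smooth_on S f \<Longrightarrow> smooth_on S g \<Longrightarrow> smooth_on S (\<lambda>x. f x - g x)"
  using smooth_on_add[of S f "\<lambda>x. - g x"] smooth_on_minus[of S g] by simp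

lemma smooth_on_sum [smooth_rules]:
  "open S \<Longrightarrow> (\<And>i. i \<in> I \<Longrightarrow> smooth_on S (f i)) \<Longrightarrow> smooth_on S (\<lambda>x. \<Sum>i\<in>I. f i x)"
  by (simp add: smooth_on_def Ck_on_sum)

lemma smooth_on_prod [smooth_rules]:
  fixes f :: "'i \<Rightarrow> real^4 \<Rightarrow> real"
  assumes "open S" "\<And>i. i \<in> I \<Longrightarrow> smooth_on S (f i)"
  shows "smooth_on S (\<lambda>x. \<Prod>i\<in>I. f i x)"
  using assms(2)
  by (induction I rule: infinite_finite_induct) (auto intro!: smooth_rules assms(1))

lemma smooth_on_chi [smooth_rules]:
  fixes f :: "'n::finite \<Rightarrow> real^4 \<Rightarrow> real"
  assumes "open S" "\<And>i. smooth_on S (f i)"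
  shows "smooth_on S (\<lambda>x. \<chi> i. f i x)"
proof (rule smooth_on_cong[OF assms(1)])
  show "smooth_on S (\<lambda>x. \<Sum>i\<in>UNIV. f i x *\<^sub>R axis i 1)"
    by (intro smooth_rules assms)
qed (simp add: vec_eq_iff axis_def if_distrib cong: if_cong)

lemma smooth_on_inverse [smooth_rules]:
  fixes f :: "real^4 \<Rightarrow> real"
  shows "open S \<Longrightarrow> smooth_on S f \<Longrightarrow> (\<And>x. x \<in> S \<Longrightarrow> f x \<noteq> 0) \<Longrightarrow> smooth_on S (\<lambda>x. inverse (f x))"
  by (simp add: smooth_on_def Ck_on_inverse)

lemma smooth_on_divide [smooth_rules]:
  fixes f g :: "real^4 \<Rightarrow> real"
  shows "open S \<Longrightarrow> smooth_on S f \<Longrightarrow> smooth_on S g \<Longrightarrow> (\<And>x. x \<in> S \<Longrightarrow> g x \<noteq> 0) \<Longrightarrow> smooth_on S (\<lambda>x. f x / g x)"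
  unfolding divide_inverse by (intro smooth_rules)

lemma smooth_on_power [smooth_rules]:
  fixes f :: "real^4 \<Rightarrow> real"
  shows "open S \<Longrightarrow> smooth_on S f \<Longrightarrow> smooth_on S (\<lambda>x. f x ^ n)"
  by (induction n) (auto intro: smooth_rules)

lemma smooth_on_root:
  fixes f :: "real^4 \<Rightarrow> real"
  shows "odd n \<Longrightarrow> open S \<Longrightarrow> smooth_on S f \<Longrightarrow> (\<And>x. x \<in> S \<Longrightarrow> f x \<noteq> 0) \<Longrightarrow> smooth_on S (\<lambda>x. root n (f x))"
  by (simp add: smooth_on_def Ck_on_root)

lemma smooth_on_real_family:
  fixes f :: "real^4 \<Rightarrow> real" and H :: "'i \<Rightarrow> real \<Rightarrow> real"
  assumes "open S" "smooth_on S f" "\<And>i t. (H i has_real_derivative a i * H (s i) t) (at t)"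
  shows "smooth_on S (\<lambda>x. H i (f x))"
  unfolding smooth_on_def
proof
  show "Ck_on k S (\<lambda>x. H i (f x))" for k
    by (rule Ck_on_real_family[where a = a and s = s]) (use assms in \<open>auto simp: smooth_on_def\<close>)
qed

lemma smooth_on_compose:
  fixes F :: "real^4 \<Rightarrow> real^4"
  shows "open S \<Longrightarrow> open T \<Longrightarrow> F ` S \<subseteq> T \<Longrightarrow> smooth_on T g \<Longrightarrow> smooth_on S F \<Longrightarrow> smooth_on S (\<lambda>x. g (F x))"
  by (simp add: smooth_on_def Ck_on_compose)

text \<open>Near each point \<open>f\<close> keeps its sign, so the absolute value is
  \<open>f\<close> or \<open>- f\<close> there. This serves the density
  \<open>\<bar>vdet w\<bar>\<close>.\<close>

lemma smooth_on_abs: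
  fixes f :: "real^4 \<Rightarrow> real"
  assumes "open S" "smooth_on S f" "\<And>x. x \<in> S \<Longrightarrow> f x \<noteq> 0"
  shows "smooth_on S (\<lambda>x. \<bar>f x\<bar>)"
proof (rule smooth_on_local)
  fix x assume x: "x \<in> S"
  have cont: "continuous_on S f" using assms smooth_on_continuous_on by blast
  show "\<exists>V. open V \<and> x \<in> V \<and> smooth_on V (\<lambda>x. \<bar>f x\<bar>)"
  proof (cases "f x > 0")
    case True
    let ?V = "{y \<in> S. f y > 0}"
    have "open ?V" using continuous_open_preimage[OF cont assms(1), of "{0<..}"]
      by (simp add: vimage_def Int_def)
    moreover have "smooth_on ?V (\<lambda>x. \<bar>f x\<bar>)"
      by (rule smooth_on_cong[of _ f]) (use calculation smooth_on_subset[OF assms(2)] in auto)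
    ultimately show ?thesis using x True by blast
  next
    case False
    then have neg: "f x < 0" using assms(3)[OF x] by simp
    let ?V = "{y \<in> S. f y < 0}"
    have "open ?V" using continuous_open_preimage[OF cont assms(1), of "{..<0}"]
      by (simp add: vimage_def Int_def)
    moreover have "smooth_on ?V (\<lambda>x. \<bar>f x\<bar>)"
      by (rule smooth_on_cong[of _ "\<lambda>x. - f x"])
        (use calculation smooth_on_subset[OF assms(2)] in \<open>auto intro!: smooth_on_minus\<close>)
    ultimately show ?thesis using x neg by blast
  qed
qed

section \<open>Symmetry of second derivatives\<close>

lemma norm_combination_le:
  fixes u v :: "'a::real_normed_vector"
  assumes "0 \<le> a" "a \<le> t" "0 \<le> b" "b \<le> t"
  shows "norm (a *\<^sub>R u + b *\<^sub>R v) \<le> t * (norm u + norm v)"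
proof -
  have "norm (a *\<^sub>R u + b *\<^sub>R v) \<le> a * norm u + b * norm v"
    using norm_triangle_ineq[of "a *\<^sub>R u" "b *\<^sub>R v"] assms by simp
  also have "\<dots> \<le> t * (norm u + norm v)"
    using assms by (simp add: distrib_left add_mono mult_right_mono)
  finally show ?thesis .
qed

text \<open>The second difference over the parallelogram spanned by \<open>t *\<^sub>R u\<close> and
  \<open>t *\<^sub>R v\<close> is a difference in direction \<open>u\<close> of a difference in
  direction \<open>v\<close>; the mean value theorem is applied to each in turn.\<close>

lemma mixed_difference_mean_value:
  fixes f :: "real^4 \<Rightarrow> real"
  assumes "Ck_on 2 (ball x d) f" "0 < t" "t * (norm u + norm v) < d"
  shows "\<exists>\<xi> \<eta>. 0 < \<xi> \<and> \<xi> < t \<and> 0 < \<eta> \<and> \<eta> < t \<and>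
    f (x + t *\<^sub>R u + t *\<^sub>R v) - f (x + t *\<^sub>R u) - f (x + t *\<^sub>R v) + f x
      = t * t * frechet_derivative (\<lambda>y. frechet_derivative f (at y) u) (at (x + \<xi> *\<^sub>R u + \<eta> *\<^sub>R v)) v"
proof -
  let ?fu = "\<lambda>y. frechet_derivative f (at y) u"
  have inb: "x + a *\<^sub>R u + b *\<^sub>R v \<in> ball x d" if "0 \<le> a" "a \<le> t" "0 \<le> b" "b \<le> t" for a b
  proof -
    have "dist (x + a *\<^sub>R u + b *\<^sub>R v) x = norm (a *\<^sub>R u + b *\<^sub>R v)"
      by (metis dist_norm add.assoc add_diff_cancel_left')
    then show ?thesis
      using norm_combination_le[OF that, of u v] assms(3) by (simp add: dist_commute)
  qed
  have df: "f differentiable (at y)" and dfu: "?fu differentiable (at y)" if "y \<in> ball x d" for y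
    using assms(1) that by (auto simp: eval_nat_numeral)
  have D: "((\<lambda>s. h (p + s *\<^sub>R w)) has_real_derivative frechet_derivative h (at (p + s *\<^sub>R w)) w) (at s)"
    if "h differentiable (at (p + s *\<^sub>R w))" for h :: "real^4 \<Rightarrow> real" and p w s
  proof -
    have "((\<lambda>s. p + s *\<^sub>R w) has_derivative (\<lambda>s. s *\<^sub>R w)) (at s)"
      by (auto intro!: derivative_eq_intros)
    from has_derivative_compose[OF this has_frechet[OF that]]
    show ?thesis
      unfolding has_field_derivative_def linear_scale[OF linear_frechet_derivative[OF that]]
      by (simp add: mult_commute_abs)
  qed
  let ?\<phi> = "\<lambda>s. f ((x + t *\<^sub>R v) + s *\<^sub>R u) - f (x + s *\<^sub>R u)"
  have "\<exists>\<xi>. 0 < \<xi> \<and> \<xi> < t \<and> ?\<phi> t - ?\<phi> 0 = (t - 0) * (?fu ((x + t *\<^sub>R v) + \<xi> *\<^sub>R u) - ?fu (x + \<xi> *\<^sub>R u))"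
  proof (rule MVT2[OF assms(2)])
    fix s assume s: "0 \<le> s" "s \<le> t"
    show "(?\<phi> has_real_derivative ?fu ((x + t *\<^sub>R v) + s *\<^sub>R u) - ?fu (x + s *\<^sub>R u)) (at s)"
      using inb[OF s, of t] inb[OF s, of 0] assms(2)
      by (intro DERIV_diff D df) (auto simp: algebra_simps)
  qed
  then obtain \<xi> where \<xi>: "0 < \<xi>" "\<xi> < t" "?\<phi> t - ?\<phi> 0 = t * (?fu ((x + t *\<^sub>R v) + \<xi> *\<^sub>R u) - ?fu (x + \<xi> *\<^sub>R u))"
    by auto
  have "\<exists>\<eta>. 0 < \<eta> \<and> \<eta> < t \<and> ?fu ((x + \<xi> *\<^sub>R u) + t *\<^sub>R v) - ?fu ((x + \<xi> *\<^sub>R u) + 0 *\<^sub>R v)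
      = (t - 0) * frechet_derivative ?fu (at ((x + \<xi> *\<^sub>R u) + \<eta> *\<^sub>R v)) v"
    by (rule MVT2[OF assms(2)]) (use inb \<xi> in \<open>intro D dfu, auto\<close>)
  then obtain \<eta> where "0 < \<eta>" "\<eta> < t" "?fu (x + \<xi> *\<^sub>R u + t *\<^sub>R v) - ?fu (x + \<xi> *\<^sub>R u)
      = t * frechet_derivative ?fu (at (x + \<xi> *\<^sub>R u + \<eta> *\<^sub>R v)) v" by auto
  with \<xi> show ?thesis
    by (intro exI[of _ \<xi>] exI[of _ \<eta>]) (auto simp: algebra_simps)
qed

text \<open>The second difference is symmetric in \<open>u\<close> and \<open>v\<close>, so one
  mixed derivative at some point near \<open>x\<close> equals the other at another such point. By
  continuity this excludes a gap between them at \<open>x\<close>.\<close>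

lemma second_derivative_symmetric:
  fixes f :: "real^4 \<Rightarrow> real"
  assumes "open S" "Ck_on 2 S f" "x \<in> S"
  shows "frechet_derivative (\<lambda>y. frechet_derivative f (at y) u) (at x) v
       = frechet_derivative (\<lambda>y. frechet_derivative f (at y) v) (at x) u" (is "?A x = ?B x")
proof (rule ccontr)
  assume ne: "?A x \<noteq> ?B x"
  obtain d where d: "d > 0" "ball x d \<subseteq> S" using assms openE by blast
  have cA: "isCont ?A x" and cB: "isCont ?B x"
  proof -
    have "continuous_on S ?A" "continuous_on S ?B" using assms(2) by (simp_all add: numeral_2_eq_2)
    then show "isCont ?A x" "isCont ?B x"
      using continuous_on_eq_continuous_at[OF assms(1)] assms(3) by blast+
  qed
  let ?e = "\<bar>?A x - ?B x\<bar> / 2"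
  have e: "?e > 0" using ne by simp
  obtain r1 where r1: "r1 > 0" "\<And>y. dist y x < r1 \<Longrightarrow> dist (?A y) (?A x) < ?e"
    using cA[unfolded continuous_at_eps_delta] e by blast
  obtain r2 where r2: "r2 > 0" "\<And>y. dist y x < r2 \<Longrightarrow> dist (?B y) (?B x) < ?e"
    using cB[unfolded continuous_at_eps_delta] e by blast
  \<comment> \<open>\<open>m\<close> keeps every intermediate point inside \<open>S\<close> and
    within reach of both continuity estimates. The extra 1 in \<open>N\<close> makes it positive
    even for \<open>u = v = 0\<close>.\<close>
  define m where "m = Min {d, r1, r2}"
  have m: "m > 0" "m \<le> d" "m \<le> r1" "m \<le> r2" using d r1 r2 by (auto simp: m_def)
  define N where "N = norm u + norm v + 1"
  have N: "N > 0" by (simp add: N_def add_nonneg_pos)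
  define t where "t = m / (2 * N)"
  have t: "t > 0" using m N by (simp add: t_def)
  have tN: "t * (norm u + norm v) < m"
  proof -
    have "t * (norm u + norm v) \<le> t * N" using t by (simp add: N_def)
    also have "\<dots> < m" using m N by (simp add: t_def)
    finally show ?thesis .
  qed
  have ck: "Ck_on 2 (ball x d) f" using Ck_on_subset assms d by blast
  have td: "t * (norm u + norm v) < d" "t * (norm v + norm u) < d" using tN m by (auto simp: add.commute)
  obtain a b where ab: "0 < a" "a < t" "0 < b" "b < t"
    "f (x + t *\<^sub>R u + t *\<^sub>R v) - f (x + t *\<^sub>R u) - f (x + t *\<^sub>R v) + f x = t * t * ?A (x + a *\<^sub>R u + b *\<^sub>R v)"
    using mixed_difference_mean_value[OF ck t td(1)] by blast
  obtain a' b' where ab': "0 < a'" "a' < t" "0 < b'" "b' < t"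
    "f (x + t *\<^sub>R v + t *\<^sub>R u) - f (x + t *\<^sub>R v) - f (x + t *\<^sub>R u) + f x = t * t * ?B (x + a' *\<^sub>R v + b' *\<^sub>R u)"
    using mixed_difference_mean_value[OF ck t td(2)] by blast
  have "t * t * ?A (x + a *\<^sub>R u + b *\<^sub>R v) = t * t * ?B (x + a' *\<^sub>R v + b' *\<^sub>R u)"
  proof -
    have e: "x + t *\<^sub>R v + t *\<^sub>R u = x + t *\<^sub>R u + t *\<^sub>R v" by simp
    show ?thesis using ab(5) ab'(5)[unfolded e] by linarith
  qed
  then have eq: "?A (x + a *\<^sub>R u + b *\<^sub>R v) = ?B (x + a' *\<^sub>R v + b' *\<^sub>R u)" using t by simp
  have dist_eq: "dist (x + p + q) x = norm (p + q)" for p q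
    by (metis dist_norm add.assoc add_diff_cancel_left')
  have "dist (x + a *\<^sub>R u + b *\<^sub>R v) x < m"
    using norm_combination_le[of a t b u v] ab tN unfolding dist_eq by linarith
  moreover have "dist (x + a' *\<^sub>R v + b' *\<^sub>R u) x < m"
    using norm_combination_le[of a' t b' v u] ab' tN unfolding dist_eq by (simp add: add.commute)
  ultimately have "dist (?A (x + a *\<^sub>R u + b *\<^sub>R v)) (?A x) < ?e" "dist (?B (x + a' *\<^sub>R v + b' *\<^sub>R u)) (?B x) < ?e"
    using r1(2) r2(2) m by auto
  moreover have False if "dist c a < \<bar>a - b\<bar> / 2" "dist c b < \<bar>a - b\<bar> / 2" for a b c :: real
    using that dist_triangle2[of a b c] dist_real_def[of a b] by (simp add: dist_commute)
  ultimately show False unfolding eq by blast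
qed

section \<open>Exterior calculus on open subsets of \<open>\<real>\<^sup>4\<close>\<close>

lemma has_derivative_inner_const:
  "(w has_derivative w') (at x) \<Longrightarrow> ((\<lambda>y. w y \<bullet> v) has_derivative (\<lambda>u. w' u \<bullet> v)) (at x)"
  by (rule has_derivative_inner_left)

lemma ext_d1_eq:
  assumes "w differentiable (at x)"
  shows "ext_d1 w x u v = frechet_derivative w (at x) u \<bullet> v - frechet_derivative w (at x) v \<bullet> u"
  unfolding ext_d1_def
  by (simp add: frechet_eqI[OF has_derivative_inner_const[OF has_frechet[OF assms]]])

lemma ext_d1_alt: "ext_d1 w x v u = - ext_d1 w x u v"
  by (simp add: ext_d1_def)

lemma ext_d1_self: "ext_d1 w x u u = 0"
  by (simp add: ext_d1_def)

lemma bilinear_ext_d1: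
  assumes "w differentiable (at x)"
  shows "bilinear (ext_d1 w x)"
proof -
  note l = linear_frechet_derivative[OF assms]
  show ?thesis
    unfolding bilinear_def ext_d1_eq[OF assms]
    by (intro conjI allI linearI)
      (simp_all add: linear_add[OF l] linear_scale[OF l] inner_add_left inner_add_right algebra_simps)
qed

lemma ext_d1_cong:
  assumes "open S" "x \<in> S" "\<And>y. y \<in> S \<Longrightarrow> w y = w' y"
  shows "ext_d1 w x = ext_d1 w' x"
proof -
  have "frechet_derivative (\<lambda>y. w y \<bullet> v) (at x) = frechet_derivative (\<lambda>y. w' y \<bullet> v) (at x)" for v
  proof -
    have "((\<lambda>y. w y \<bullet> v) has_derivative D) (at x) \<longleftrightarrow> ((\<lambda>y. w' y \<bullet> v) has_derivative D) (at x)" for D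
      using has_derivative_transform_within_open[OF _ assms(1,2), of "\<lambda>y. w y \<bullet> v" D UNIV "\<lambda>y. w' y \<bullet> v"]
        has_derivative_transform_within_open[OF _ assms(1,2), of "\<lambda>y. w' y \<bullet> v" D UNIV "\<lambda>y. w y \<bullet> v"] assms(3)
      by auto
    then show ?thesis unfolding frechet_derivative_def by simp
  qed
  then show ?thesis unfolding ext_d1_def by (intro ext) simp
qed

lemma ext_d1_add:
  assumes "w differentiable (at x)" "w' differentiable (at x)"
  shows "ext_d1 (\<lambda>y. w y + w' y) x u v = ext_d1 w x u v + ext_d1 w' x u v"
proof -
  have d: "((\<lambda>y. w y + w' y) has_derivative (\<lambda>u. frechet_derivative w (at x) u + frechet_derivative w' (at x) u)) (at x)"
    by (intro has_derivative_add has_frechet assms)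
  then have "(\<lambda>y. w y + w' y) differentiable (at x)" by (auto simp: differentiable_def)
  from ext_d1_eq[OF this] show ?thesis
    by (simp add: frechet_eqI[OF d] ext_d1_eq assms inner_add_left)
qed

lemma ext_d1_scaleR:
  assumes "f differentiable (at x)" "w differentiable (at x)"
  shows "ext_d1 (\<lambda>y. f y *\<^sub>R w y) x u v = f x * ext_d1 w x u v
    + frechet_derivative f (at x) u * (w x \<bullet> v) - frechet_derivative f (at x) v * (w x \<bullet> u)"
proof -
  have d: "((\<lambda>y. f y *\<^sub>R w y) has_derivative (\<lambda>u. f x *\<^sub>R frechet_derivative w (at x) u + frechet_derivative f (at x) u *\<^sub>R w x)) (at x)"
    by (intro has_derivative_scaleR has_frechet assms)
  then have "(\<lambda>y. f y *\<^sub>R w y) differentiable (at x)" by (auto simp: differentiable_def)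
  from ext_d1_eq[OF this] show ?thesis
    by (simp add: frechet_eqI[OF d] ext_d1_eq assms inner_add_left algebra_simps)
qed

lemma second_derivative_symmetric_vec:
  fixes F :: "real^4 \<Rightarrow> real^'n"
  assumes "open S" "smooth_on S F" "x \<in> S"
  shows "frechet_derivative (\<lambda>y. frechet_derivative F (at y) u) (at x) v
       = frechet_derivative (\<lambda>y. frechet_derivative F (at y) v) (at x) u"
proof -
  have *: "frechet_derivative (\<lambda>y. frechet_derivative F (at y) u) (at x) v $ i
     = frechet_derivative (\<lambda>y. frechet_derivative (\<lambda>z. F z $ i) (at y) u) (at x) v" for u v i
  proof -
    have d: "((\<lambda>z. F z $ i) has_derivative (\<lambda>v. frechet_derivative F (at y) v $ i)) (at y)" if "y \<in> S" for y
      by (intro bounded_linear.has_derivative[OF bounded_linear_vec_nth] smooth_on_has_derivative[OF assms(2) that])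
    have "((\<lambda>y. frechet_derivative F (at y) u $ i) has_derivative
        (\<lambda>v. frechet_derivative (\<lambda>y. frechet_derivative F (at y) u) (at x) v $ i)) (at x)"
      by (intro bounded_linear.has_derivative[OF bounded_linear_vec_nth]
          smooth_on_has_derivative[OF smooth_on_frechet[OF assms(2)] assms(3)])
    then have "((\<lambda>y. frechet_derivative (\<lambda>z. F z $ i) (at y) u) has_derivative
        (\<lambda>v. frechet_derivative (\<lambda>y. frechet_derivative F (at y) u) (at x) v $ i)) (at x)"
      by (rule has_derivative_transform_within_open[OF _ assms(1,3)]) (simp add: frechet_eqI[OF d])
    from frechet_eqI[OF this] show ?thesis by simp
  qed
  have "Ck_on 2 S (\<lambda>z. F z $ i)" for i
    using smooth_on_nth[OF assms(1,2)] by (simp add: smooth_on_def)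
  then show ?thesis
    by (simp add: vec_eq_iff * second_derivative_symmetric[OF assms(1) _ assms(3)])
qed

text \<open>A covector is stored by its coefficients, so the pullback of a 1-form is assembled from
  its values on the axis vectors.\<close>

definition pull1 :: "(real^4 \<Rightarrow> real^4) \<Rightarrow> (real^4 \<Rightarrow> real^4) \<Rightarrow> real^4 \<Rightarrow> real^4" where
  "pull1 F w y = (\<chi> k. w (F y) \<bullet> frechet_derivative F (at y) (axis k 1))"

lemma pull1_inner:
  assumes "F differentiable (at y)"
  shows "pull1 F w y \<bullet> u = w (F y) \<bullet> frechet_derivative F (at y) u"
proof -
  let ?D = "frechet_derivative F (at y)"
  have "pull1 F w y \<bullet> u = (\<Sum>k\<in>UNIV. w (F y) \<bullet> (u $ k *\<^sub>R ?D (axis k 1)))"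
    by (simp add: pull1_def inner_vec_def[of "vec_lambda _" u] mult.commute)
  also have "\<dots> = w (F y) \<bullet> ?D u"
    unfolding linear_axis_expansion[OF linear_frechet_derivative[OF assms], of u] inner_sum_right ..
  finally show ?thesis .
qed

lemma smooth_on_pull1:
  assumes "open V" "open T" "F ` V \<subseteq> T" "smooth_on V F" "smooth_on T w"
  shows "smooth_on V (pull1 F w)"
proof -
  have "smooth_on V (\<lambda>y. w (F y))" by (rule smooth_on_compose[OF assms(1-3,5,4)])
  then show ?thesis unfolding pull1_def by (intro smooth_rules assms)
qed

text \<open>The product rule produces a term with the second derivative of \<open>F\<close>. That
  derivative is symmetric, so the term cancels in the antisymmetrisation, and the exterior
  derivative commutes with pullback.\<close>

lemma ext_d1_pull1:
  assumes "open V" "open T" "F ` V \<subseteq> T" "smooth_on V F" "smooth_on T w" "y \<in> V"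
  shows "ext_d1 (pull1 F w) y u v
       = ext_d1 w (F y) (frechet_derivative F (at y) u) (frechet_derivative F (at y) v)"
proof -
  let ?D = "\<lambda>y. frechet_derivative F (at y)"
  have Fy: "F y \<in> T" using assms by blast
  have dw: "(w has_derivative frechet_derivative w (at (F y))) (at (F y))"
    by (rule smooth_on_has_derivative[OF assms(5) Fy])
  have d: "((\<lambda>z. pull1 F w z \<bullet> v) has_derivative
      (\<lambda>u. w (F y) \<bullet> frechet_derivative (\<lambda>z. ?D z v) (at y) u + frechet_derivative w (at (F y)) (?D y u) \<bullet> ?D y v)) (at y)" for v
  proof (rule has_derivative_transform_within_open[OF _ assms(1,6)])
    show "((\<lambda>z. w (F z) \<bullet> ?D z v) has_derivative
      (\<lambda>u. w (F y) \<bullet> frechet_derivative (\<lambda>z. ?D z v) (at y) u + frechet_derivative w (at (F y)) (?D y u) \<bullet> ?D y v)) (at y)"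
      by (intro has_derivative_inner has_derivative_comp_at[OF smooth_on_has_derivative[OF assms(4,6)] dw]
          smooth_on_has_derivative[OF smooth_on_frechet[OF assms(4)] assms(6)])
    show "w (F z) \<bullet> ?D z v = pull1 F w z \<bullet> v" if "z \<in> V" for z
      using pull1_inner[OF smooth_on_differentiable[OF assms(4) that]] by simp
  qed
  have "w differentiable (at (F y))" using smooth_on_differentiable[OF assms(5) Fy] .
  from ext_d1_eq[OF this] show ?thesis
    unfolding ext_d1_def frechet_eqI[OF d]
    by (simp add: second_derivative_symmetric_vec[OF assms(1,4,6), of u v])
qed

text \<open>Again by symmetry of second derivatives. This is the source of the Jacobi identity
  below.\<close>

lemma ext_d2_ext_d1:
  assumes "open S" "smooth_on S w" "x \<in> S"
  shows "ext_d2 (ext_d1 w) x u v z = 0"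
proof -
  let ?D = "\<lambda>y. frechet_derivative w (at y)"
  let ?DD = "\<lambda>v. frechet_derivative (\<lambda>y. ?D y v) (at x)"
  have d: "((\<lambda>y. ext_d1 w y u v) has_derivative (\<lambda>z. ?DD u z \<bullet> v - ?DD v z \<bullet> u)) (at x)" for u v
  proof (rule has_derivative_transform_within_open[OF _ assms(1,3)])
    show "((\<lambda>y. ?D y u \<bullet> v - ?D y v \<bullet> u) has_derivative (\<lambda>z. ?DD u z \<bullet> v - ?DD v z \<bullet> u)) (at x)"
      by (intro has_derivative_diff has_derivative_inner_const
          smooth_on_has_derivative[OF smooth_on_frechet[OF assms(2)] assms(3)])
  qed (simp add: ext_d1_eq smooth_on_differentiable[OF assms(2)])
  show ?thesis
    unfolding ext_d2_def frechet_eqI[OF d]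
    using second_derivative_symmetric_vec[OF assms] by simp
qed

lemma has_derivative_wedge:
  assumes "(a has_derivative a') (at x)" "(b has_derivative b') (at x)"
  shows "((\<lambda>y. wedge (a y) (b y) u v) has_derivative (\<lambda>z. wedge (a' z) (b x) u v + wedge (a x) (b' z) u v)) (at x)"
  unfolding wedge_def
  by (rule derivative_eq_intros has_derivative_inner_const assms refl)+ (simp add: algebra_simps)

lemma wedge_differentiable:
  "a differentiable (at x) \<Longrightarrow> b differentiable (at x) \<Longrightarrow> (\<lambda>y. wedge (a y) (b y) u v) differentiable (at x)"
  by (rule differentiableI, rule has_derivative_wedge[OF has_frechet has_frechet])

lemma ext_d2_wedge:
  assumes "a differentiable (at x)" "b differentiable (at x)"
  shows "ext_d2 (\<lambda>y. wedge (a y) (b y)) x u v z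
    = ext_d1 a x u v * (b x \<bullet> z) - ext_d1 a x u z * (b x \<bullet> v) + ext_d1 a x v z * (b x \<bullet> u)
      - (a x \<bullet> u * ext_d1 b x v z - a x \<bullet> v * ext_d1 b x u z + a x \<bullet> z * ext_d1 b x u v)"
  unfolding ext_d2_def frechet_eqI[OF has_derivative_wedge[OF assms[THEN has_frechet]]]
    ext_d1_eq[OF assms(1)] ext_d1_eq[OF assms(2)]
  unfolding wedge_def by (simp add: algebra_simps)

lemma ext_d2_add:
  assumes "\<And>u v. (\<lambda>y. P y u v) differentiable (at x)" "\<And>u v. (\<lambda>y. Q y u v) differentiable (at x)"
  shows "ext_d2 (\<lambda>y u v. P y u v + Q y u v) x u v z = ext_d2 P x u v z + ext_d2 Q x u v z"
  unfolding ext_d2_def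
  by (simp add: frechet_eqI[OF has_derivative_add[OF has_frechet has_frechet, OF assms]])

lemma ext_d2_cmult:
  fixes c :: real
  assumes "\<And>u v. (\<lambda>y. P y u v) differentiable (at x)"
  shows "ext_d2 (\<lambda>y u v. c * P y u v) x u v z = c * ext_d2 P x u v z"
  unfolding ext_d2_def
  by (simp add: frechet_eqI[OF has_derivative_mult_right[OF has_frechet, OF assms]] algebra_simps)

lemma ext_d2_cong:
  assumes "open S" "x \<in> S" "\<And>y. y \<in> S \<Longrightarrow> P y = Q y"
  shows "ext_d2 P x = ext_d2 Q x"
proof -
  have "frechet_derivative (\<lambda>y. P y u v) (at x) = frechet_derivative (\<lambda>y. Q y u v) (at x)" for u v
  proof -
    have "((\<lambda>y. P y u v) has_derivative D) (at x) \<longleftrightarrow> ((\<lambda>y. Q y u v) has_derivative D) (at x)" for D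
      using has_derivative_transform_within_open[OF _ assms(1,2), of "\<lambda>y. P y u v" D UNIV "\<lambda>y. Q y u v"]
        has_derivative_transform_within_open[OF _ assms(1,2), of "\<lambda>y. Q y u v" D UNIV "\<lambda>y. P y u v"] assms(3)
      by auto
    then show ?thesis unfolding frechet_derivative_def by simp
  qed
  then show ?thesis unfolding ext_d2_def by (intro ext) simp
qed

section \<open>Local coframes and their dual frames\<close>

definition vdet :: "('n::finite \<Rightarrow> 'a \<Rightarrow> real^'n) \<Rightarrow> 'a \<Rightarrow> real" where
  "vdet w y = det (\<chi> i. w i y)"

definition coframe :: "(real^4) set \<Rightarrow> (4 \<Rightarrow> real^4 \<Rightarrow> real^4) \<Rightarrow> bool" where
  "coframe V w \<longleftrightarrow> open V \<and> (\<forall>i. smooth_on V (w i)) \<and> (\<forall>y\<in>V. vdet w y \<noteq> 0)"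

text \<open>The columns of the inverse matrix form the basis dual to the rows;
  \<open>frame w j\<close> is the vector field usually written e_j.\<close>

definition frame :: "(4 \<Rightarrow> real^4 \<Rightarrow> real^4) \<Rightarrow> 4 \<Rightarrow> real^4 \<Rightarrow> real^4" where
  "frame w j y = column j (matrix_inv (\<chi> i. w i y))"

text \<open>Structure functions: the (j, k) coefficient of the exterior derivative of
  \<open>w i\<close>, equal to minus the component along e_i of the bracket of e_j and e_k.\<close>

definition sc :: "(4 \<Rightarrow> real^4 \<Rightarrow> real^4) \<Rightarrow> 4 \<Rightarrow> 4 \<Rightarrow> 4 \<Rightarrow> real^4 \<Rightarrow> real" where
  "sc w i j k y = ext_d1 (w i) y (frame w j y) (frame w k y)"

lemma sc_alt: "sc w i k j y = - sc w i j k y"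
  unfolding sc_def by (rule ext_d1_alt)

lemma sc_self: "sc w i j j y = 0"
  unfolding sc_def by (rule ext_d1_self)

lemma smooth_on_det:
  fixes A :: "real^4 \<Rightarrow> real^'n^'n"
  assumes "open S" "\<And>i j. smooth_on S (\<lambda>x. A x $ i $ j)"
  shows "smooth_on S (\<lambda>x. det (A x))"
  unfolding det_def by (intro smooth_rules assms)

lemma matrix_inv_both:
  fixes A :: "real^'n^'n"
  assumes "det A \<noteq> 0"
  shows "A ** matrix_inv A = mat 1" "matrix_inv A ** A = mat 1"
  using assms someI_ex[of "\<lambda>A'. A ** A' = mat 1 \<and> A' ** A = mat 1"]
  unfolding invertible_det_nz[symmetric] invertible_def matrix_inv_def by blast+

lemma frame_dual:
  assumes "vdet w y \<noteq> 0"
  shows "w i y \<bullet> frame w j y = (if i = j then 1 else 0)"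
proof -
  have "((\<chi> i. w i y) ** matrix_inv (\<chi> i. w i y)) $ i $ j = w i y \<bullet> frame w j y"
    by (simp add: matrix_matrix_mult_def frame_def column_def inner_vec_def)
  then show ?thesis unfolding matrix_inv_both(1)[OF assms[unfolded vdet_def]] by (simp add: mat_def)
qed

lemma frame_expansion:
  assumes "vdet w y \<noteq> 0"
  shows "v = (\<Sum>j\<in>UNIV. (w j y \<bullet> v) *\<^sub>R frame w j y)"
proof -
  have "v = (matrix_inv (\<chi> i. w i y) ** (\<chi> i. w i y)) *v v"
    unfolding matrix_inv_both(2)[OF assms[unfolded vdet_def]] by simp
  also have "\<dots> = matrix_inv (\<chi> i. w i y) *v ((\<chi> i. w i y) *v v)"
    by (simp add: matrix_vector_mul_assoc)
  also have "\<dots> = (\<Sum>j\<in>UNIV. (w j y \<bullet> v) *\<^sub>R frame w j y)"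
    by (subst matrix_mult_sum) (simp add: frame_def matrix_vector_mult_def inner_vec_def scalar_mult_eq_scaleR)
  finally show ?thesis .
qed

lemma covector_expansion:
  assumes "vdet w y \<noteq> 0"
  shows "\<alpha> = (\<Sum>i\<in>UNIV. (\<alpha> \<bullet> frame w i y) *\<^sub>R w i y)"
proof -
  have "\<alpha> \<bullet> v = (\<Sum>i\<in>UNIV. (\<alpha> \<bullet> frame w i y) *\<^sub>R w i y) \<bullet> v" for v
    by (subst frame_expansion[OF assms, of v]) (simp add: inner_sum_right inner_sum_left mult.commute)
  then show ?thesis using vector_eq_rdot by blast
qed

lemma covector_eqI:
  assumes "vdet w y \<noteq> 0" "\<And>i. \<alpha> \<bullet> frame w i y = \<beta> \<bullet> frame w i y"
  shows "\<alpha> = \<beta>"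
  using covector_expansion[OF assms(1), of \<alpha>] covector_expansion[OF assms(1), of \<beta>] assms(2) by simp

lemma frame_unique:
  assumes "vdet w y \<noteq> 0" "\<And>i. w i y \<bullet> v = (if i = j then 1 else 0)"
  shows "v = frame w j y"
  using frame_expansion[OF assms(1), of v] by (simp add: assms(2) if_distrib[of "\<lambda>c. c *\<^sub>R _"] cong: if_cong)

lemma det_nonzero_of_dual:
  fixes w e :: "4 \<Rightarrow> real^4"
  assumes "\<And>i j. w i \<bullet> e j = (if i = j then 1 else 0)"
  shows "det (\<chi> i. w i) \<noteq> 0"
proof -
  have "(\<chi> i. w i) ** transpose (\<chi> i. e i) = mat 1"
    using assms by (simp add: vec_eq_iff matrix_matrix_mult_def transpose_def mat_def inner_vec_def)
  then have "det (\<chi> i. w i) * det (transpose (\<chi> i. e i)) = 1"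
    by (metis det_I det_mul)
  then show ?thesis by auto
qed

lemma coframe_det: "coframe V w \<Longrightarrow> y \<in> V \<Longrightarrow> vdet w y \<noteq> 0"
  by (simp add: coframe_def)

lemma coframe_smooth: "coframe V w \<Longrightarrow> smooth_on V (w i)"
  by (simp add: coframe_def)

lemma coframe_open: "coframe V w \<Longrightarrow> open V"
  by (simp add: coframe_def)

text \<open>Cramer's rule exhibits the components of the dual vectors as quotients of determinants
  in the components of \<open>w\<close>.\<close>

lemma smooth_on_frame:
  assumes "coframe V w"
  shows "smooth_on V (frame w j)"
proof (rule smooth_on_cong[OF coframe_open[OF assms]])
  let ?A = "\<lambda>y. (\<chi> i. w i y) :: real^4^4"
  let ?B = "\<lambda>y k. (\<chi> i l. if l = k then axis j (1::real) $ i else ?A y $ i $ l) :: real^4^4"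
  note o = coframe_open[OF assms] and s = coframe_smooth[OF assms]
  show "smooth_on V (\<lambda>y. \<chi> k. det (?B y k) / det (?A y))"
  proof (rule smooth_on_chi[OF o], rule smooth_on_divide[OF o])
    have "smooth_on V (\<lambda>x. ?B x k $ i $ l)" for k i l
      by (cases "l = k") (auto intro!: smooth_on_const smooth_on_nth o s)
    then show "smooth_on V (\<lambda>y. det (?B y k))" for k by (rule smooth_on_det[OF o])
    show "smooth_on V (\<lambda>y. det (?A y))"
      by (rule smooth_on_det[OF o]) (auto intro!: smooth_on_nth o s)
    show "det (?A y) \<noteq> 0" if "y \<in> V" for y
      using coframe_det[OF assms that] by (simp add: vdet_def)
  qed
  show "(\<chi> k. det (?B y k) / det (?A y)) = frame w j y" if y: "y \<in> V" for y
  proof -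
    have "?A y *v frame w j y = axis j 1"
      using frame_dual[OF coframe_det[OF assms y]]
      by (simp add: vec_eq_iff matrix_vector_mult_def inner_vec_def axis_def)
    from iffD1[OF cramer[OF coframe_det[OF assms y, unfolded vdet_def]] this] show ?thesis by (rule sym)
  qed
qed

lemma smooth_on_sc: 
  assumes "coframe V w"
  shows "smooth_on V (sc w i j k)"
proof (rule smooth_on_cong[OF coframe_open[OF assms]])
  note o = coframe_open[OF assms] and s = coframe_smooth[OF assms, of i] and e = smooth_on_frame[OF assms]
  have l: "linear (frechet_derivative (w i) (at y))" if "y \<in> V" for y
    using smooth_on_linear_frechet[OF s that] .
  let ?D = "\<lambda>y j. \<Sum>m\<in>UNIV. frame w j y $ m *\<^sub>R frechet_derivative (w i) (at y) (axis m 1)"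
  show "smooth_on V (\<lambda>y. ?D y j \<bullet> frame w k y - ?D y k \<bullet> frame w j y)"
    by (intro smooth_rules o s e)
  show "?D y j \<bullet> frame w k y - ?D y k \<bullet> frame w j y = sc w i j k y" if "y \<in> V" for y
    unfolding sc_def ext_d1_eq[OF smooth_on_differentiable[OF s that]]
    by (simp add: linear_axis_expansion[OF l[OF that], symmetric])
qed

lemma two_form_expansion:
  assumes "vdet w y \<noteq> 0" "bilinear \<eta>" "\<And>u. \<eta> u u = 0"
  defines "e \<equiv> \<lambda>i. frame w i y"
  shows "\<eta> u v = \<eta> (e 1) (e 2) * wedge (w 1 y) (w 2 y) u v + \<eta> (e 1) (e 3) * wedge (w 1 y) (w 3 y) u v
    + \<eta> (e 1) (e 4) * wedge (w 1 y) (w 4 y) u v + \<eta> (e 2) (e 3) * wedge (w 2 y) (w 3 y) u v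
    + \<eta> (e 2) (e 4) * wedge (w 2 y) (w 4 y) u v + \<eta> (e 3) (e 4) * wedge (w 3 y) (w 4 y) u v"
proof -
  have alt: "\<eta> b a = - \<eta> a b" for a b
  proof -
    have "\<eta> (a + b) (a + b) = \<eta> a a + \<eta> a b + (\<eta> b a + \<eta> b b)"
      by (simp only: bilinear_ladd[OF assms(2)] bilinear_radd[OF assms(2)] add.assoc)
    then show ?thesis by (simp add: assms(3))
  qed
  have "\<eta> u v = (\<Sum>i\<in>UNIV. \<Sum>j\<in>UNIV. (w i y \<bullet> u) * (w j y \<bullet> v) * \<eta> (e i) (e j))"
    by (subst frame_expansion[OF assms(1), of u], subst frame_expansion[OF assms(1), of v])
      (simp only: e_def bilinear_sum[OF assms(2)] sum.cartesian_product[symmetric]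
        bilinear_lmul[OF assms(2)] bilinear_rmul[OF assms(2)] real_scaleR_def mult.assoc mult.left_commute)
  then show ?thesis
    unfolding sum_4 wedge_def
    using assms(3) alt[of "e 1" "e 2"] alt[of "e 1" "e 3"] alt[of "e 1" "e 4"] alt[of "e 2" "e 3"]
      alt[of "e 2" "e 4"] alt[of "e 3" "e 4"]
    by (simp only:) (simp add: algebra_simps)
qed

section \<open>The divergence of a dual frame\<close>

lemma det_has_derivative:
  fixes w :: "'n::finite \<Rightarrow> 'a::real_normed_vector \<Rightarrow> real^'n"
  assumes "\<And>i. (w i has_derivative w' i) (at x)"
  shows "(vdet w has_derivative
     (\<lambda>v. \<Sum>k\<in>UNIV. det (\<chi> i. if i = k then w' k v else w i x))) (at x)"
proof -
  let ?P = "{p. p permutes (UNIV :: 'n set)}"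
  have "((\<lambda>y. \<Sum>p\<in>?P. of_int (sign p) * (\<Prod>i\<in>UNIV. w i y $ p i)) has_derivative
      (\<lambda>v. \<Sum>p\<in>?P. of_int (sign p) * (\<Sum>k\<in>UNIV. w' k v $ p k * (\<Prod>j\<in>UNIV - {k}. w j x $ p j)))) (at x)"
    by (intro has_derivative_sum has_derivative_mult_right has_derivative_prod
        bounded_linear.has_derivative[OF bounded_linear_vec_nth] assms)
  moreover have "(\<Sum>k\<in>UNIV. det (\<chi> i. if i = k then w' k v else w i x))
      = (\<Sum>p\<in>?P. of_int (sign p) * (\<Sum>k\<in>UNIV. w' k v $ p k * (\<Prod>j\<in>UNIV - {k}. w j x $ p j)))" for v
  proof -
    have "(\<Prod>i\<in>UNIV. (if i = k then w' k v else w i x) $ p i) = w' k v $ p k * (\<Prod>j\<in>UNIV - {k}. w j x $ p j)"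
      for k p by (subst prod.remove[of _ k]) (auto intro!: prod.cong)
    then show ?thesis
      unfolding det_def by (simp add: sum_distrib_left) (rule sum.swap)
  qed
  moreover have "vdet w = (\<lambda>y. \<Sum>p\<in>?P. of_int (sign p) * (\<Prod>i\<in>UNIV. w i y $ p i))"
    by (simp add: vdet_def det_def fun_eq_iff)
  ultimately show ?thesis by (simp only:)
qed

text \<open>By multilinearity only the component of \<open>a\<close> along the replaced row
  survives.\<close>

lemma det_replace_row:
  fixes w :: "4 \<Rightarrow> real^4 \<Rightarrow> real^4"
  assumes "vdet w y \<noteq> 0"
  shows "det (\<chi> i. if i = k then a else w i y) = (a \<bullet> frame w k y) * vdet w y"
proof -
  have "a = (\<Sum>i\<in>UNIV. (\<chi> i. a \<bullet> frame w i y) $ i *s row i (\<chi> i. w i y))"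
    using covector_expansion[OF assms, of a] by (simp add: row_def scalar_mult_eq_scaleR vec_nth_inverse)
  then have "(\<chi> i. if i = k then a else w i y) = (\<chi> i. if i = k
      then (\<Sum>i\<in>UNIV. (\<chi> i. a \<bullet> frame w i y) $ i *s row i (\<chi> i. w i y)) else row i (\<chi> i. w i y))"
    by (simp add: row_def vec_eq_iff)
  then show ?thesis using cramer_lemma_transpose[of k "\<chi> i. a \<bullet> frame w i y" "\<chi> i. w i y"] by (simp add: vdet_def)
qed

text \<open>The divergence of e_j for the density \<open>\<bar>vdet w\<bar>\<close> is a trace of
  structure functions. In each \<open>sc w i j i\<close> one of the two derivative terms comes from
  differentiating the density along e_j, the other from the coordinate divergence of e_j.\<close>

lemma divergence_frame:
  assumes "coframe V w" "y \<in> V"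
  shows "(\<Sum>m\<in>UNIV. frechet_derivative (\<lambda>z. (\<bar>vdet w z\<bar> *\<^sub>R frame w j z) $ m) (at y) (axis m 1))
     = \<bar>vdet w y\<bar> * (\<Sum>i\<in>UNIV. sc w i j i y)"
proof -
  note o = coframe_open[OF assms(1)] and s = coframe_smooth[OF assms(1)] and e = smooth_on_frame[OF assms(1)]
    and d0 = coframe_det[OF assms]
  let ?W = "\<lambda>i. frechet_derivative (w i) (at y)" and ?E = "\<lambda>j. frechet_derivative (frame w j) (at y)"
  let ?d = "vdet w"
  have W: "(w i has_derivative ?W i) (at y)" for i by (rule smooth_on_has_derivative[OF s assms(2)])
  have E: "(frame w j has_derivative ?E j) (at y)" for j by (rule smooth_on_has_derivative[OF e assms(2)])
  \<comment> \<open>The pairings of \<open>w i\<close> with e_j are constant; differentiating them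
    trades derivatives of the frame for derivatives of the coframe.\<close>
  have dual: "?W i v \<bullet> frame w j y + w i y \<bullet> ?E j v = 0" for i j v
  proof -
    have "((\<lambda>z. w i z \<bullet> frame w j z) has_derivative (\<lambda>v. w i y \<bullet> ?E j v + ?W i v \<bullet> frame w j y)) (at y)"
      by (rule has_derivative_inner[OF W E])
    moreover have "((\<lambda>z. w i z \<bullet> frame w j z) has_derivative (\<lambda>v. 0)) (at y)"
      by (rule has_derivative_transform_within_open[OF has_derivative_const o assms(2)])
        (simp add: frame_dual[OF coframe_det[OF assms(1)]])
    ultimately have "(\<lambda>v. w i y \<bullet> ?E j v + ?W i v \<bullet> frame w j y) = (\<lambda>v. 0)"
      by (rule has_derivative_unique)
    then show ?thesis by (simp add: fun_eq_iff add.commute)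
  qed
  \<comment> \<open>Jacobi's formula for the derivative of a determinant.\<close>
  define \<delta> where "\<delta> = (\<lambda>v. \<Sum>k\<in>UNIV. (?W k v \<bullet> frame w k y) * ?d y)"
  have det: "(?d has_derivative \<delta>) (at y)"
    using det_has_derivative[of w ?W y, OF W] unfolding det_replace_row[OF d0] \<delta>_def .
  define \<sigma> where "\<sigma> = sgn (?d y)"
  have \<sigma>: "\<sigma> * ?d y = \<bar>?d y\<bar>" by (simp add: \<sigma>_def abs_sgn)
  have absd: "((\<lambda>z. \<bar>?d z\<bar>) has_derivative (\<lambda>v. \<sigma> * \<delta> v)) (at y)"
    using has_derivative_comp_at[OF det has_derivative_norm[OF d0]]
    by (simp add: \<sigma>_def mult.commute)
  have comp: "frechet_derivative (\<lambda>z. (\<bar>?d z\<bar> *\<^sub>R frame w j z) $ m) (at y)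
      = (\<lambda>v. \<bar>?d y\<bar> * ?E j v $ m + \<sigma> * \<delta> v * frame w j y $ m)" for m
    by (rule frechet_eqI) (simp, intro has_derivative_mult absd bounded_linear.has_derivative[OF bounded_linear_vec_nth] E)
  have lE: "linear (?E j)" using smooth_on_linear_frechet[OF e assms(2)] .
  have lW: "linear (?W i)" for i using smooth_on_linear_frechet[OF s assms(2)] .
  have l\<delta>: "linear \<delta>" using det has_derivative_linear by blast
  have trace: "(\<Sum>m\<in>UNIV. ?E j (axis m 1) $ m) = - (\<Sum>i\<in>UNIV. ?W i (frame w i y) \<bullet> frame w j y)"
  proof -
    have "(\<Sum>m\<in>UNIV. ?E j (axis m 1) $ m) = (\<Sum>m\<in>UNIV. \<Sum>i\<in>UNIV. (w i y \<bullet> ?E j (axis m 1)) * frame w i y $ m)"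
      by (subst frame_expansion[OF d0, of "?E j (axis _ 1)"]) simp
    also have "\<dots> = (\<Sum>i\<in>UNIV. w i y \<bullet> (\<Sum>m\<in>UNIV. frame w i y $ m *\<^sub>R ?E j (axis m 1)))"
      by (subst sum.swap) (simp add: inner_sum_right mult.commute)
    also have "\<dots> = (\<Sum>i\<in>UNIV. w i y \<bullet> ?E j (frame w i y))"
      by (simp add: linear_axis_expansion[OF lE, symmetric])
    also have "\<dots> = (\<Sum>i\<in>UNIV. - (?W i (frame w i y) \<bullet> frame w j y))"
      using dual by (intro sum.cong refl) (simp add: eq_neg_iff_add_eq_0 add.commute)
    finally show ?thesis by (simp add: sum_negf)
  qed
  have "(\<Sum>m\<in>UNIV. frame w j y $ m * \<delta> (axis m 1)) = \<delta> (frame w j y)"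
    using linear_axis_expansion[OF l\<delta>, of "frame w j y"] by simp
  from this[symmetric] have grad: "(\<Sum>m\<in>UNIV. \<sigma> * \<delta> (axis m 1) * frame w j y $ m) = \<sigma> * \<delta> (frame w j y)"
    by (simp add: sum_distrib_left mult_ac)
  have "(\<Sum>m\<in>UNIV. frechet_derivative (\<lambda>z. (\<bar>?d z\<bar> *\<^sub>R frame w j z) $ m) (at y) (axis m 1))
     = \<bar>?d y\<bar> * (\<Sum>m\<in>UNIV. ?E j (axis m 1) $ m) + \<sigma> * \<delta> (frame w j y)"
    unfolding comp by (simp add: sum.distrib grad sum_distrib_left)
  also have "\<sigma> * \<delta> (frame w j y) = \<bar>?d y\<bar> * (\<Sum>i\<in>UNIV. ?W i (frame w j y) \<bullet> frame w i y)"
    unfolding \<delta>_def sum_distrib_right[symmetric] using \<sigma> by (simp add: mult.commute mult.left_commute)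
  also have "\<bar>?d y\<bar> * (\<Sum>m\<in>UNIV. ?E j (axis m 1) $ m) + \<bar>?d y\<bar> * (\<Sum>i\<in>UNIV. ?W i (frame w j y) \<bullet> frame w i y)
      = \<bar>?d y\<bar> * (\<Sum>i\<in>UNIV. sc w i j i y)"
    unfolding trace sc_def ext_d1_eq[OF smooth_on_differentiable[OF s assms(2)]]
    by (simp add: sum_subtractf algebra_simps)
  finally show ?thesis .
qed

section \<open>Derived systems in terms of coframes\<close>

lemma in_span_pair_iff: "\<alpha> \<in> span {a, b} \<longleftrightarrow> (\<exists>s t. \<alpha> = s *\<^sub>R a + t *\<^sub>R b)"
  for a b :: "'v::real_vector"
proof
  assume "\<alpha> \<in> span {a, b}"
  then obtain s where "\<alpha> - s *\<^sub>R a \<in> span {b}" using span_breakdown_eq by metis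
  then obtain t where "\<alpha> - s *\<^sub>R a = t *\<^sub>R b" by (auto simp: span_singleton)
  then have "\<alpha> = s *\<^sub>R a + t *\<^sub>R b" by (simp add: algebra_simps)
  then show "\<exists>s t. \<alpha> = s *\<^sub>R a + t *\<^sub>R b" by blast
next
  assume "\<exists>s t. \<alpha> = s *\<^sub>R a + t *\<^sub>R b"
  then show "\<alpha> \<in> span {a, b}" by (auto intro!: span_add span_scale intro: span_base)
qed

lemma in_span_single_iff: "\<alpha> \<in> span {a} \<longleftrightarrow> (\<exists>s. \<alpha> = s *\<^sub>R a)"
  for a :: "'v::real_vector"
  by (auto simp: span_singleton)

lemma zero_mod_vanishes:
  assumes "\<eta> \<in> zero_mod J" "\<And>\<alpha>. \<alpha> \<in> J \<Longrightarrow> \<alpha> \<bullet> u = 0" "\<And>\<alpha>. \<alpha> \<in> J \<Longrightarrow> \<alpha> \<bullet> v = 0"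
  shows "\<eta> u v = 0"
  using assms by (auto simp: zero_mod_def wedge_def)

lemma frame_kernel2:
  assumes "vdet w y \<noteq> 0"
  shows "{v. w 1 y \<bullet> v = 0 \<and> w 2 y \<bullet> v = 0} = span {frame w 3 y, frame w 4 y}"
proof (intro Set.set_eqI iffI)
  fix v assume "v \<in> {v. w 1 y \<bullet> v = 0 \<and> w 2 y \<bullet> v = 0}"
  then have "v = (w 3 y \<bullet> v) *\<^sub>R frame w 3 y + (w 4 y \<bullet> v) *\<^sub>R frame w 4 y"
    using frame_expansion[OF assms, of v] by (simp add: sum_4)
  then show "v \<in> span {frame w 3 y, frame w 4 y}" unfolding in_span_pair_iff by blast
qed (auto simp: in_span_pair_iff inner_add_right frame_dual[OF assms])

lemma span_coframe12:
  assumes "vdet w y \<noteq> 0"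
  shows "\<alpha> \<in> span {w 1 y, w 2 y} \<longleftrightarrow> \<alpha> \<bullet> frame w 3 y = 0 \<and> \<alpha> \<bullet> frame w 4 y = 0"
proof
  assume "\<alpha> \<bullet> frame w 3 y = 0 \<and> \<alpha> \<bullet> frame w 4 y = 0"
  then have "\<alpha> = (\<alpha> \<bullet> frame w 1 y) *\<^sub>R w 1 y + (\<alpha> \<bullet> frame w 2 y) *\<^sub>R w 2 y"
    using covector_expansion[OF assms, of \<alpha>] by (simp add: sum_4)
  then show "\<alpha> \<in> span {w 1 y, w 2 y}" unfolding in_span_pair_iff by blast
qed (auto simp: in_span_pair_iff inner_add_left frame_dual[OF assms])

lemma annihilator_eq:
  assumes "vdet w y \<noteq> 0" "D y = {v. w 1 y \<bullet> v = 0 \<and> w 2 y \<bullet> v = 0}"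
  shows "annihilator D y = span {w 1 y, w 2 y}"
proof (rule Set.set_eqI)
  fix \<alpha>
  have "(\<forall>v\<in>span {frame w 3 y, frame w 4 y}. \<alpha> \<bullet> v = 0) \<longleftrightarrow> \<alpha> \<bullet> frame w 3 y = 0 \<and> \<alpha> \<bullet> frame w 4 y = 0"
    by (auto simp: in_span_pair_iff inner_add_right intro: span_base)
  then show "\<alpha> \<in> annihilator D y \<longleftrightarrow> \<alpha> \<in> span {w 1 y, w 2 y}"
    unfolding annihilator_def assms(2) frame_kernel2[OF assms(1)] span_coframe12[OF assms(1)] by simp
qed

text \<open>Of the six terms of the expansion only the one in \<open>w 3\<close> and
  \<open>w 4\<close> has no factor \<open>w 1\<close> or \<open>w 2\<close>. The witnesses
  \<open>?a\<close> and \<open>?b\<close> collect the other five by their first factor.\<close>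

lemma zero_mod_pair:
  assumes "vdet w y \<noteq> 0" "bilinear \<eta>" "\<And>u. \<eta> u u = 0" "\<eta> (frame w 3 y) (frame w 4 y) = 0"
  shows "\<eta> \<in> zero_mod (span {w 1 y, w 2 y})"
proof -
  let ?e = "\<lambda>i. frame w i y"
  let ?a = "\<lambda>n::nat. if n = 0 then w 1 y else w 2 y"
  let ?b = "\<lambda>n::nat. if n = 0 then \<eta> (?e 1) (?e 2) *\<^sub>R w 2 y + \<eta> (?e 1) (?e 3) *\<^sub>R w 3 y + \<eta> (?e 1) (?e 4) *\<^sub>R w 4 y
     else \<eta> (?e 2) (?e 3) *\<^sub>R w 3 y + \<eta> (?e 2) (?e 4) *\<^sub>R w 4 y"
  have "\<eta> u v = (\<Sum>n<2. wedge (?a n) (?b n) u v)" for u v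
    by (subst two_form_expansion[OF assms(1-3)])
      (simp add: assms(4) eval_nat_numeral wedge_def inner_add_left algebra_simps)
  then have "\<eta> = (\<lambda>u v. \<Sum>n<2. wedge (?a n) (?b n) u v)" by blast
  moreover have "\<forall>n<2. ?a n \<in> span {w 1 y, w 2 y}" by (simp add: span_base)
  ultimately show ?thesis
    unfolding zero_mod_def by (intro CollectI exI[of _ "2::nat"] exI[of _ ?a] exI[of _ ?b] conjI)
qed

lemma zero_mod_single:
  assumes "vdet w y \<noteq> 0" "bilinear \<eta>" "\<And>u. \<eta> u u = 0" "\<eta> (frame w 3 y) (frame w 4 y) = 0"
    "\<eta> (frame w 2 y) (frame w 3 y) = 0" "\<eta> (frame w 2 y) (frame w 4 y) = 0"
  shows "\<eta> \<in> zero_mod (span {w 1 y})"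
proof -
  let ?e = "\<lambda>i. frame w i y"
  let ?b = "\<eta> (?e 1) (?e 2) *\<^sub>R w 2 y + \<eta> (?e 1) (?e 3) *\<^sub>R w 3 y + \<eta> (?e 1) (?e 4) *\<^sub>R w 4 y"
  have "\<eta> u v = (\<Sum>n<1::nat. wedge (w 1 y) ?b u v)" for u v
    by (subst two_form_expansion[OF assms(1-3)])
      (simp add: assms(4-) wedge_def inner_add_left algebra_simps)
  then have "\<eta> = (\<lambda>u v. \<Sum>n<1::nat. wedge (w 1 y) ?b u v)" by blast
  moreover have "\<forall>n<1::nat. w 1 y \<in> span {w 1 y}" by (simp add: span_base)
  ultimately show ?thesis
    unfolding zero_mod_def by (intro CollectI exI[of _ "1::nat"] exI[of _ "\<lambda>_. w 1 y"] exI[of _ "\<lambda>_. ?b"] conjI)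
qed

text \<open>For a section f \<open>w 1\<close> + g \<open>w 2\<close> the terms with df and dg carry
  a factor \<open>w 1\<close> or \<open>w 2\<close> and vanish on the given vectors. So only the
  value of the section at the point counts, which is why the bundle map \<delta> is well
  defined.\<close>

lemma ext_d1_section:
  assumes "coframe V w" "y \<in> V" "open U" "y \<in> U" "smooth_on U \<sigma>" "\<And>z. z \<in> U \<inter> V \<Longrightarrow> \<sigma> z \<in> span {w 1 z, w 2 z}"
    "w 1 y \<bullet> u = 0" "w 1 y \<bullet> v = 0" "w 2 y \<bullet> u = 0" "w 2 y \<bullet> v = 0"
  shows "ext_d1 \<sigma> y u v = (\<sigma> y \<bullet> frame w 1 y) * ext_d1 (w 1) y u v + (\<sigma> y \<bullet> frame w 2 y) * ext_d1 (w 2) y u v"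
proof -
  let ?f = "\<lambda>z. \<sigma> z \<bullet> frame w 1 z" and ?g = "\<lambda>z. \<sigma> z \<bullet> frame w 2 z"
  have o: "open (U \<inter> V)" and yUV: "y \<in> U \<inter> V" using assms coframe_open by auto
  have s: "smooth_on (U \<inter> V) \<sigma>" "smooth_on (U \<inter> V) (w i)" "smooth_on (U \<inter> V) (frame w i)" for i
    using smooth_on_subset[OF assms(5)] smooth_on_subset[OF coframe_smooth[OF assms(1)]]
      smooth_on_subset[OF smooth_on_frame[OF assms(1)]] by simp_all
  have "ext_d1 \<sigma> y = ext_d1 (\<lambda>z. ?f z *\<^sub>R w 1 z + ?g z *\<^sub>R w 2 z) y"
  proof (rule ext_d1_cong[OF o yUV])
    fix z assume z: "z \<in> U \<inter> V"
    then have "vdet w z \<noteq> 0" using coframe_det[OF assms(1)] by blast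
    then show "\<sigma> z = ?f z *\<^sub>R w 1 z + ?g z *\<^sub>R w 2 z"
      using covector_expansion[of w z "\<sigma> z"] assms(6)[OF z] span_coframe12[of w z "\<sigma> z"] by (simp add: sum_4)
  qed
  moreover have d: "?f differentiable (at y)" "?g differentiable (at y)" "w i differentiable (at y)" for i
    by (rule smooth_on_differentiable[OF _ yUV], intro smooth_rules o s)+
  moreover have "(\<lambda>z. ?f z *\<^sub>R w 1 z) differentiable (at y)" "(\<lambda>z. ?g z *\<^sub>R w 2 z) differentiable (at y)"
    by (rule smooth_on_differentiable[OF _ yUV], intro smooth_rules o s)+
  ultimately show ?thesis using assms(7-10) by (simp add: ext_d1_add ext_d1_scaleR)
qed

lemma ext_d1_section1:
  assumes "coframe V w" "y \<in> V" "open U" "y \<in> U" "smooth_on U \<sigma>" "\<And>z. z \<in> U \<inter> V \<Longrightarrow> \<sigma> z \<in> span {w 1 z}"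
    "w 1 y \<bullet> u = 0" "w 1 y \<bullet> v = 0"
  shows "ext_d1 \<sigma> y u v = (\<sigma> y \<bullet> frame w 1 y) * ext_d1 (w 1) y u v"
proof -
  let ?f = "\<lambda>z. \<sigma> z \<bullet> frame w 1 z"
  have o: "open (U \<inter> V)" and yUV: "y \<in> U \<inter> V" using assms coframe_open by auto
  have s: "smooth_on (U \<inter> V) \<sigma>" "smooth_on (U \<inter> V) (w i)" "smooth_on (U \<inter> V) (frame w i)" for i
    using smooth_on_subset[OF assms(5)] smooth_on_subset[OF coframe_smooth[OF assms(1)]]
      smooth_on_subset[OF smooth_on_frame[OF assms(1)]] by simp_all
  have "ext_d1 \<sigma> y = ext_d1 (\<lambda>z. ?f z *\<^sub>R w 1 z) y"
  proof (rule ext_d1_cong[OF o yUV])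
    fix z assume z: "z \<in> U \<inter> V"
    then have "vdet w z \<noteq> 0" using coframe_det[OF assms(1)] by blast
    then show "\<sigma> z = ?f z *\<^sub>R w 1 z"
      using assms(6)[OF z] frame_dual[of w z 1 1] by (auto simp: in_span_single_iff)
  qed
  moreover have d: "?f differentiable (at y)" "w i differentiable (at y)" for i
    by (rule smooth_on_differentiable[OF _ yUV], intro smooth_rules o s)+
  ultimately show ?thesis using assms(7-8) by (simp add: ext_d1_scaleR)
qed

lemma bilinear_ext_d1_coframe: "coframe V w \<Longrightarrow> y \<in> V \<Longrightarrow> bilinear (ext_d1 (w i) y)"
  by (rule bilinear_ext_d1[OF smooth_on_differentiable[OF coframe_smooth]])

text \<open>The Engel conditions are encoded in structure functions: the first one puts
  \<open>w 1\<close> into the derived system, the second keeps \<open>w 2\<close> out of it, and the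
  third makes the derived system of the line spanned by \<open>w 1\<close> vanish.\<close>

definition adapted ::
  "(real^4) set \<Rightarrow> (real^4 \<Rightarrow> real^4 \<Rightarrow> real^4 \<Rightarrow> real) \<Rightarrow> (real^4 \<Rightarrow> (real^4) set) \<Rightarrow> (4 \<Rightarrow> real^4 \<Rightarrow> real^4) \<Rightarrow> bool" where
  "adapted V \<Omega> D w \<longleftrightarrow> coframe V w \<and> (\<forall>y\<in>V.
     (\<forall>u v. \<Omega> y u v = wedge (w 1 y) (w 3 y) u v + wedge (w 2 y) (w 4 y) u v) \<and>
     D y = {v. w 1 y \<bullet> v = 0 \<and> w 2 y \<bullet> v = 0} \<and>
     sc w 1 3 4 y = 0 \<and> sc w 2 3 4 y \<noteq> 0 \<and> (sc w 1 2 3 y \<noteq> 0 \<or> sc w 1 2 4 y \<noteq> 0))"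

lemma adapted_coframe: "adapted V \<Omega> D w \<Longrightarrow> coframe V w"
  by (simp add: adapted_def)

lemma adapted_annihilator:
  assumes "adapted V \<Omega> D w" "y \<in> V"
  shows "annihilator D y = span {w 1 y, w 2 y}"
  using assms coframe_det annihilator_eq unfolding adapted_def by blast

text \<open>Modulo the annihilator a 2-form is determined by its value on e_3 and e_4. For the
  derivatives of \<open>w 1\<close> and \<open>w 2\<close> this value is zero and nonzero
  respectively.\<close>

lemma adapted_derived:
  assumes "adapted V \<Omega> D w" "y \<in> V"
  shows "derived (annihilator D) y = span {w 1 y}"
proof (intro Set.set_eqI iffI)
  note c = adapted_coframe[OF assms(1)] and v0 = coframe_det[OF adapted_coframe[OF assms(1)]]
  have ann: "annihilator D z = span {w 1 z, w 2 z}" if "z \<in> V" for z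
    by (rule adapted_annihilator[OF assms(1) that])
  fix \<alpha>
  { assume "\<alpha> \<in> derived (annihilator D) y"
    then obtain U \<sigma> where U: "open U" "y \<in> U" "smooth_on U \<sigma>" "\<And>z. z \<in> U \<Longrightarrow> \<sigma> z \<in> annihilator D z"
        "\<sigma> y = \<alpha>" "ext_d1 \<sigma> y \<in> zero_mod (annihilator D y)"
      unfolding derived_def by blast
    have sp: "\<alpha> \<in> span {w 1 y, w 2 y}" using U ann assms by blast
    have "ext_d1 \<sigma> y (frame w 3 y) (frame w 4 y) = 0"
      by (rule zero_mod_vanishes[OF U(6)]) (use ann[OF assms(2)] span_coframe12[OF v0[OF assms(2)]] in auto)
    moreover have "ext_d1 \<sigma> y (frame w 3 y) (frame w 4 y)
      = (\<sigma> y \<bullet> frame w 1 y) * ext_d1 (w 1) y (frame w 3 y) (frame w 4 y)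
      + (\<sigma> y \<bullet> frame w 2 y) * ext_d1 (w 2) y (frame w 3 y) (frame w 4 y)"
      by (rule ext_d1_section[OF c assms(2) U(1-3)]) (use U(4) ann frame_dual[OF v0[OF assms(2)]] in auto)
    ultimately have "\<alpha> \<bullet> frame w 2 y = 0"
      using assms U(5) unfolding adapted_def sc_def by auto
    then have "\<alpha> = (\<alpha> \<bullet> frame w 1 y) *\<^sub>R w 1 y"
      using covector_expansion[OF v0[OF assms(2)], of \<alpha>] sp span_coframe12[OF v0[OF assms(2)]] by (simp add: sum_4)
    then show "\<alpha> \<in> span {w 1 y}" unfolding in_span_single_iff by blast }
  { assume "\<alpha> \<in> span {w 1 y}"
    then obtain s where s: "\<alpha> = s *\<^sub>R w 1 y" by (auto simp: in_span_single_iff)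
    have d: "w 1 differentiable (at y)" using smooth_on_differentiable[OF coframe_smooth[OF c] assms(2)] .
    have e: "ext_d1 (\<lambda>z. s *\<^sub>R w 1 z) y u v = s * ext_d1 (w 1) y u v" for u v
      by (subst ext_d1_scaleR) (auto simp: d)
    have "smooth_on V (\<lambda>z. s *\<^sub>R w 1 z)" 
      by (intro smooth_rules coframe_open[OF c] coframe_smooth[OF c])
    moreover have "s *\<^sub>R w 1 z \<in> annihilator D z" if "z \<in> V" for z
      unfolding ann[OF that] by (intro span_scale span_base) simp
    moreover have "ext_d1 (\<lambda>z. s *\<^sub>R w 1 z) y \<in> zero_mod (annihilator D y)"
      unfolding ann[OF assms(2)]
    proof (rule zero_mod_pair[OF v0[OF assms(2)]])
      show "bilinear (ext_d1 (\<lambda>z. s *\<^sub>R w 1 z) y)" by (rule bilinear_ext_d1) (simp add: d)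
      show "ext_d1 (\<lambda>z. s *\<^sub>R w 1 z) y (frame w 3 y) (frame w 4 y) = 0"
        using assms unfolding e adapted_def sc_def by simp
    qed (rule ext_d1_self)
    ultimately show "\<alpha> \<in> derived (annihilator D) y"
      unfolding derived_def using s coframe_open[OF c] assms(2) by blast }
qed

text \<open>Modulo \<open>w 1\<close> the derivative of \<open>w 1\<close> still has the
  coefficients (2,3) and (2,4), one of which is nonzero; so only the zero multiple of
  \<open>w 1\<close> survives.\<close>

lemma adapted_derived2:
  assumes "adapted V \<Omega> D w" "y \<in> V"
  shows "derived (derived (annihilator D)) y = {0}"
proof (intro Set.set_eqI iffI)
  note c = adapted_coframe[OF assms(1)] and v0 = coframe_det[OF adapted_coframe[OF assms(1)] assms(2)]
  fix \<alpha> :: "real^4"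
  { assume "\<alpha> \<in> derived (derived (annihilator D)) y"
    then obtain U \<sigma> where U: "open U" "y \<in> U" "smooth_on U \<sigma>" "\<And>z. z \<in> U \<Longrightarrow> \<sigma> z \<in> derived (annihilator D) z"
        "\<sigma> y = \<alpha>" "ext_d1 \<sigma> y \<in> zero_mod (derived (annihilator D) y)"
      unfolding derived_def[of "derived _"] by blast
    have sp: "\<sigma> z \<in> span {w 1 z}" if "z \<in> U \<inter> V" for z
      using U(4) adapted_derived[OF assms(1)] that by blast
    have *: "(\<alpha> \<bullet> frame w 1 y) * sc w 1 2 j y = 0" if "j = 3 \<or> j = 4" for j
    proof -
      have "ext_d1 \<sigma> y (frame w 2 y) (frame w j y) = 0"
        by (rule zero_mod_vanishes[OF U(6)])
          (use adapted_derived[OF assms] frame_dual[OF v0] that in \<open>auto simp: in_span_single_iff\<close>)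
      moreover have "ext_d1 \<sigma> y (frame w 2 y) (frame w j y)
        = (\<sigma> y \<bullet> frame w 1 y) * ext_d1 (w 1) y (frame w 2 y) (frame w j y)"
        by (rule ext_d1_section1[OF c assms(2) U(1-3) sp]) (use frame_dual[OF v0] that in auto)
      ultimately show ?thesis using U(5) by (simp add: sc_def)
    qed
    have "\<alpha> \<bullet> frame w 1 y = 0" using *[of 3] *[of 4] assms unfolding adapted_def by auto
    moreover have "\<alpha> \<in> span {w 1 y}" using sp U assms by blast
    ultimately show "\<alpha> \<in> {0}" using frame_dual[OF v0, of 1 1] by (auto simp: in_span_single_iff) }
  { assume "\<alpha> \<in> {0}"
    have "ext_d1 (\<lambda>z. 0) y = (\<lambda>u v. \<Sum>i<0::nat. wedge 0 0 u v)"
      by (intro ext) (simp add: ext_d1_def)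
    then have "ext_d1 (\<lambda>z. 0) y \<in> zero_mod (derived (annihilator D) y)"
      unfolding zero_mod_def by (intro CollectI exI[of _ "0::nat"] exI[of _ "\<lambda>_. 0"]) simp
    moreover have "0 \<in> derived (annihilator D) z" if "z \<in> V" for z
      unfolding adapted_derived[OF assms(1) that] by (rule span_zero)
    ultimately show "\<alpha> \<in> derived (derived (annihilator D)) y"
      unfolding derived_def[of "derived _"]
      using \<open>\<alpha> \<in> {0}\<close> coframe_open[OF c] assms(2) smooth_on_const
      by (intro CollectI exI[of _ V] exI[of _ "\<lambda>z. 0"]) auto }
qed

lemma dim_span_pair:
  fixes a b :: "real^4"
  assumes "\<And>s t. s *\<^sub>R a + t *\<^sub>R b = 0 \<Longrightarrow> s = 0 \<and> t = 0"
  shows "dim (span {a, b}) = 2"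
proof -
  have ab: "a \<noteq> b" using assms[of 1 "-1"] by auto
  have "independent {a, b}"
  proof -
    have "a \<notin> span {b}"
    proof
      assume "a \<in> span {b}"
      then obtain k where "a = k *\<^sub>R b" by (auto simp: in_span_single_iff)
      then show False using assms[of 1 "-k"] by simp
    qed
    moreover have "b \<noteq> 0" using assms[of 0 1] by auto
    ultimately show ?thesis by (simp add: independent_insert)
  qed
  then show ?thesis using ab by (simp add: dim_eq_card_independent)
qed

lemma pair_independent_of_dim:
  fixes a b :: "real^4"
  assumes "dim (span {a, b}) = 2" "s *\<^sub>R a + t *\<^sub>R b = 0"
  shows "s = 0 \<and> t = 0"
proof (rule ccontr)
  assume n: "\<not> (s = 0 \<and> t = 0)"
  have *: "dim (span {x, k *\<^sub>R x}) \<le> 1" for x :: "real^4" and k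
  proof -
    have "span {x, k *\<^sub>R x} \<subseteq> span {x}"
      by (rule span_minimal) (auto intro: span_scale span_base)
    then have "dim (span {x, k *\<^sub>R x}) \<le> dim {x}" using dim_subset dim_span by metis
    also have "\<dots> \<le> 1" using dim_le_card'[of "{x}"] by simp
    finally show ?thesis .
  qed
  show False
  proof (cases "t = 0")
    case True
    then have "a = 0 *\<^sub>R b" using n assms(2) by simp
    then show False using *[of b 0] assms(1) by (simp add: insert_commute)
  next
    case False
    have "t *\<^sub>R b = - s *\<^sub>R a" using assms(2) by (simp add: add_eq_0_iff)
    then have "b = (- s / t) *\<^sub>R a" using False by (metis divide_inverse mult.commute real_vector_affinity_eq scaleR_scaleR scaleR_one left_inverse)
    then show False using *[of a "- s / t"] assms(1) by simp
  qed
qed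

lemma adapted_subbundles:
  assumes "\<And>x. x \<in> S \<Longrightarrow> \<exists>V w. x \<in> V \<and> V \<subseteq> S \<and> adapted V \<Omega> D w"
  shows "subbundle S 2 D" "subbundle S 1 (derived (annihilator D))"
proof -
  show "subbundle S 2 D"
    unfolding subbundle_def
  proof
    fix x assume "x \<in> S"
    then obtain V w where V: "x \<in> V" "V \<subseteq> S" "adapted V \<Omega> D w" using assms by blast
    note c = adapted_coframe[OF V(3)]
    let ?e = "\<lambda>i::nat. if i = 0 then frame w 3 else frame w 4"
    have "D y = span ((\<lambda>i. ?e i y) ` {..<2}) \<and> dim (D y) = 2" if "y \<in> V" for y
    proof -
      have v0: "vdet w y \<noteq> 0" using coframe_det[OF c that] .
      have D: "D y = span {frame w 3 y, frame w 4 y}"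
        using V(3) that frame_kernel2[OF v0] unfolding adapted_def by blast
      have "dim (span {frame w 3 y, frame w 4 y}) = 2"
      proof (rule dim_span_pair)
        fix s t assume "s *\<^sub>R frame w 3 y + t *\<^sub>R frame w 4 y = 0"
        then have "w i y \<bullet> (s *\<^sub>R frame w 3 y + t *\<^sub>R frame w 4 y) = 0" for i by simp
        from this[of 3] this[of 4] show "s = 0 \<and> t = 0" by (simp add: inner_add_right frame_dual[OF v0])
      qed
      moreover have "(\<lambda>i. ?e i y) ` {..<2} = {frame w 3 y, frame w 4 y}"
        by (auto simp: image_iff eval_nat_numeral lessThan_Suc)
      ultimately show ?thesis using D by simp
    qed
    then have D: "\<forall>y\<in>V. D y = span ((\<lambda>i. ?e i y) ` {..<2}) \<and> dim (D y) = 2" by blast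
    have "open V" "\<forall>i<2. smooth_on V (?e i)"
      using coframe_open[OF c] smooth_on_frame[OF c] by auto
    with V D show "\<exists>V e. open V \<and> x \<in> V \<and> V \<subseteq> S \<and> (\<forall>i<2. smooth_on V (e i)) \<and>
        (\<forall>y\<in>V. D y = span ((\<lambda>i::nat. e i y) ` {..<2}) \<and> dim (D y) = 2)"
      by (intro exI[of _ V] exI[of _ ?e] conjI)
  qed
  show "subbundle S 1 (derived (annihilator D))"
    unfolding subbundle_def
  proof
    fix x assume "x \<in> S"
    then obtain V w where V: "x \<in> V" "V \<subseteq> S" "adapted V \<Omega> D w" using assms by blast
    note c = adapted_coframe[OF V(3)]
    have "dim (span {w 1 y}) = 1" if "y \<in> V" for y
    proof -
      have "w 1 y \<noteq> 0" using frame_dual[OF coframe_det[OF c that], of 1 1] by auto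
      then have "independent {w 1 y}" by simp
      then show ?thesis using dim_eq_card_independent dim_span by (metis card.empty card_insert_disjoint empty_iff finite.emptyI One_nat_def)
    qed
    then show "\<exists>V e. open V \<and> x \<in> V \<and> V \<subseteq> S \<and> (\<forall>i<1. smooth_on V (e i)) \<and>
        (\<forall>y\<in>V. derived (annihilator D) y = span ((\<lambda>i::nat. e i y) ` {..<1}) \<and> dim (derived (annihilator D) y) = 1)"
      using V coframe_open[OF c] coframe_smooth[OF c] adapted_derived[OF V(3)]
      by (intro exI[of _ V] exI[of _ "\<lambda>_. w 1"]) (auto simp: lessThan_Suc)
  qed
qed

section \<open>Existence of adapted coframes\<close>

text \<open>In the index type \<open>4\<close> the numeral 4 equals 0; the last branch is the one
  for this index.\<close>

definition pick4 :: "'b \<Rightarrow> 'b \<Rightarrow> 'b \<Rightarrow> 'b \<Rightarrow> 4 \<Rightarrow> 'b" where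
  "pick4 a b c d i = (if i = 1 then a else if i = 2 then b else if i = 3 then c else d)"

lemma pick4_simps [simp]: "pick4 a b c d 1 = a" "pick4 a b c d 2 = b" "pick4 a b c d 3 = c" "pick4 a b c d 4 = d"
  by (simp_all add: pick4_def)

lemma pick4_app: "pick4 a b c d i y = pick4 (a y) (b y) (c y) (d y) i"
  by (simp add: pick4_def)

text \<open>A dual family certifies independence and, being unique, is the dual frame. For the
  explicit coframes below this replaces the computation of determinants and inverse
  matrices.\<close>

lemma coframe_of_dual:
  assumes "open V" "\<And>i. smooth_on V (w i)"
    "\<And>y i j. y \<in> V \<Longrightarrow> w i y \<bullet> e j y = (if i = j then 1 else 0)"
  shows "coframe V w" "y \<in> V \<Longrightarrow> frame w j y = e j y"
proof -
  have v0: "vdet w y \<noteq> 0" if "y \<in> V" for y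
    unfolding vdet_def by (rule det_nonzero_of_dual[of "\<lambda>i. w i y" "\<lambda>j. e j y"]) (rule assms(3)[OF that])
  show "coframe V w" unfolding coframe_def using assms(1,2) v0 by blast
  show "frame w j y = e j y" if "y \<in> V"
    by (rule frame_unique[symmetric, OF v0[OF that]]) (rule assms(3)[OF that])
qed

lemma coframe_pick4:
  assumes "open V" "smooth_on V w1" "smooth_on V w2" "smooth_on V w3" "smooth_on V w4"
    "\<And>y. y \<in> V \<Longrightarrow> \<forall>i j. pick4 (w1 y) (w2 y) (w3 y) (w4 y) i \<bullet> pick4 (e1 y) (e2 y) (e3 y) (e4 y) j = (if i = j then 1 else 0)"
  shows "coframe V (pick4 w1 w2 w3 w4)"
    "y \<in> V \<Longrightarrow> frame (pick4 w1 w2 w3 w4) j y = pick4 (e1 y) (e2 y) (e3 y) (e4 y) j"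
proof -
  have s: "smooth_on V (pick4 w1 w2 w3 w4 i)" for i
    using assms(2-5) by (simp add: pick4_def)
  have d: "pick4 w1 w2 w3 w4 i y \<bullet> pick4 (e1 y) (e2 y) (e3 y) (e4 y) j = (if i = j then 1 else 0)" if "y \<in> V" for i j y
    using assms(6)[OF that] by (simp add: pick4_app)
  show "coframe V (pick4 w1 w2 w3 w4)"
    by (rule coframe_of_dual(1)[OF assms(1) s, where e = "\<lambda>j y. pick4 (e1 y) (e2 y) (e3 y) (e4 y) j"]) (rule d)
  show "frame (pick4 w1 w2 w3 w4) j y = pick4 (e1 y) (e2 y) (e3 y) (e4 y) j" if "y \<in> V"
    by (rule coframe_of_dual(2)[OF assms(1) s, where e = "\<lambda>j y. pick4 (e1 y) (e2 y) (e3 y) (e4 y) j"]) (rule d, assumption, rule that)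
qed

lemma numeral4_neq [simp]:
  "(1::4) \<noteq> 2" "(1::4) \<noteq> 3" "(1::4) \<noteq> 4" "(2::4) \<noteq> 1" "(2::4) \<noteq> 3" "(2::4) \<noteq> 4"
  "(3::4) \<noteq> 1" "(3::4) \<noteq> 2" "(3::4) \<noteq> 4" "(4::4) \<noteq> 1" "(4::4) \<noteq> 2" "(4::4) \<noteq> 3"
  by simp_all

text \<open>The structure as seen in a single chart, so that all local arguments take place on an
  open subset of R^4.\<close>

definition lag_engel_on ::
  "(real^4) set \<Rightarrow> (real^4 \<Rightarrow> real^4 \<Rightarrow> real^4 \<Rightarrow> real) \<Rightarrow> (real^4 \<Rightarrow> (real^4) set) \<Rightarrow> bool" where
  "lag_engel_on S \<Omega> D \<longleftrightarrow> open S \<and>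
     (\<forall>x\<in>S. bilinear (\<Omega> x) \<and> (\<forall>u. \<Omega> x u u = 0)) \<and> (\<forall>u v. smooth_on S (\<lambda>x. \<Omega> x u v)) \<and>
     (\<forall>x\<in>S. (\<forall>u v w. ext_d2 \<Omega> x u v w = 0) \<and> (\<forall>u. (\<forall>v. \<Omega> x u v = 0) \<longrightarrow> u = 0)) \<and>
     subbundle S 2 D \<and> subbundle S 1 (derived (annihilator D)) \<and>
     (\<forall>x\<in>S. derived (derived (annihilator D)) x = {0}) \<and>
     (\<forall>x\<in>S. \<forall>u\<in>D x. \<forall>v\<in>D x. \<Omega> x u v = 0)"

definition flat :: "(real^4 \<Rightarrow> real^4 \<Rightarrow> real^4 \<Rightarrow> real) \<Rightarrow> (real^4 \<Rightarrow> real^4) \<Rightarrow> real^4 \<Rightarrow> real^4" where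
  "flat \<Omega> X y = (\<chi> k. \<Omega> y (X y) (axis k 1))"

lemma flat_inner:
  assumes "bilinear (\<Omega> y)"
  shows "flat \<Omega> X y \<bullet> v = \<Omega> y (X y) v"
proof -
  have "linear (\<Omega> y (X y))" using assms by (simp add: bilinear_def)
  from linear_axis_expansion[OF this, of v] show ?thesis
    by (simp add: flat_def inner_vec_def[of "vec_lambda _" v] mult.commute)
qed

lemma smooth_on_flat:
  assumes "open S" "\<And>y. y \<in> S \<Longrightarrow> bilinear (\<Omega> y)" "\<And>u v. smooth_on S (\<lambda>y. \<Omega> y u v)" "smooth_on S X"
  shows "smooth_on S (flat \<Omega> X)"
proof (rule smooth_on_cong[OF assms(1)])
  show "smooth_on S (\<lambda>y. \<chi> k. \<Sum>m\<in>UNIV. X y $ m *\<^sub>R \<Omega> y (axis m 1) (axis k 1))"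
    by (intro smooth_rules assms)
  fix y assume "y \<in> S"
  then have "linear (\<lambda>u. \<Omega> y u v)" for v using assms(2) by (simp add: bilinear_def)
  then show "(\<chi> k. \<Sum>m\<in>UNIV. X y $ m *\<^sub>R \<Omega> y (axis m 1) (axis k 1)) = flat \<Omega> X y"
    unfolding flat_def by (subst linear_axis_expansion[of "\<lambda>u. \<Omega> y u _"]) auto
qed

text \<open>Inverse of \<open>flat\<close> up to sign. The sign is the one for which pairing in the
  second argument of \<open>\<Omega>\<close> returns \<open>\<alpha>\<close>; with it e_3 and e_4 of
  an adapted coframe are the images of \<open>w 1\<close> and \<open>w 2\<close>.\<close>

definition sharp :: "(real^4 \<Rightarrow> real^4 \<Rightarrow> real^4 \<Rightarrow> real) \<Rightarrow> (real^4 \<Rightarrow> real^4) \<Rightarrow> real^4 \<Rightarrow> real^4" where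
  "sharp \<Omega> \<alpha> y = (\<Sum>j\<in>UNIV. \<alpha> y $ j *\<^sub>R frame (\<lambda>i. flat \<Omega> (\<lambda>_. axis i 1)) j y)"

lemma alternating_flip:
  assumes "bilinear \<eta>" "\<And>u. \<eta> u u = 0"
  shows "\<eta> b a = - \<eta> a b"
proof -
  have "\<eta> (a + b) (a + b) = \<eta> a a + \<eta> a b + (\<eta> b a + \<eta> b b)"
    by (simp only: bilinear_ladd[OF assms(1)] bilinear_radd[OF assms(1)] ac_simps)
  then show ?thesis by (simp add: assms(2) eq_neg_iff_add_eq_0 add.commute)
qed

text \<open>Nondegeneracy of \<open>\<Omega>\<close> makes the contractions with the axis vectors
  independent; their dual frame is what \<open>sharp\<close> is built from.\<close>

lemma coframe_flat:
  assumes "lag_engel_on S \<Omega> D"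
  shows "coframe S (\<lambda>i. flat \<Omega> (\<lambda>_. axis i 1))"
  unfolding coframe_def
proof (intro conjI allI ballI)
  show o: "open S" using assms by (simp add: lag_engel_on_def)
  show "smooth_on S (flat \<Omega> (\<lambda>_. axis i 1))" for i
    by (rule smooth_on_flat[OF o]) (use assms in \<open>auto simp: lag_engel_on_def intro: smooth_on_const\<close>)
  fix y assume y: "y \<in> S"
  then have b: "bilinear (\<Omega> y)" and alt: "\<And>u. \<Omega> y u u = 0" and nd: "\<And>u. (\<And>v. \<Omega> y u v = 0) \<Longrightarrow> u = 0"
    using assms by (auto simp: lag_engel_on_def)
  let ?A = "\<chi> i. flat \<Omega> (\<lambda>_. axis i 1) y"
  have "x = 0" if "?A *v x = 0" for x
  proof (rule nd)
    fix v
    have "\<Omega> y (axis i 1) x = 0" for i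
    proof -
      have "(?A *v x) $ i = flat \<Omega> (\<lambda>_. axis i 1) y \<bullet> x"
        by (simp add: matrix_vector_mult_def inner_vec_def)
      then show ?thesis using that flat_inner[of \<Omega> y, OF b] by simp
    qed
    moreover have "linear (\<lambda>u. \<Omega> y u x)" using b by (simp add: bilinear_def)
    ultimately have "\<Omega> y v x = 0" using linear_axis_expansion[of "\<lambda>u. \<Omega> y u x" v] by simp
    then show "\<Omega> y x v = 0" using alternating_flip[OF b alt, of x v] by simp
  qed
  then have "\<exists>B. B ** ?A = mat 1" by (simp only: matrix_left_invertible_ker) blast
  then show "vdet (\<lambda>i. flat \<Omega> (\<lambda>_. axis i 1)) y \<noteq> 0"
    unfolding vdet_def invertible_det_nz[symmetric] by (simp only: invertible_left_inverse)
qed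

lemma smooth_on_sharp:
  assumes "lag_engel_on S \<Omega> D" "V \<subseteq> S" "open V" "smooth_on V \<alpha>"
  shows "smooth_on V (sharp \<Omega> \<alpha>)"
  unfolding sharp_def
  by (intro smooth_rules assms smooth_on_subset[OF smooth_on_frame[OF coframe_flat[OF assms(1)]] assms(2)])

lemma sharp_eq:
  assumes "lag_engel_on S \<Omega> D" "y \<in> S"
  shows "\<Omega> y u (sharp \<Omega> \<alpha> y) = \<alpha> y \<bullet> u"
proof -
  let ?e = "\<lambda>j. frame (\<lambda>i. flat \<Omega> (\<lambda>_. axis i 1)) j y"
  have b: "bilinear (\<Omega> y)" using assms by (auto simp: lag_engel_on_def)
  then have l: "linear (\<Omega> y u)" "linear (\<lambda>u. \<Omega> y u v)" for u v by (simp_all add: bilinear_def)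
  have *: "\<Omega> y (axis i 1) (?e j) = (if i = j then 1 else 0)" for i j
    using frame_dual[OF coframe_det[OF coframe_flat[OF assms(1)] assms(2)], of i j] flat_inner[of \<Omega> y, OF b] by simp
  have "\<Omega> y u (?e j) = u $ j" for j
    by (subst linear_axis_expansion[OF l(2), of u]) (simp add: * if_distrib cong: if_cong)
  then show ?thesis
    unfolding sharp_def by (simp add: linear_sum[OF l(1)] linear_scale[OF l(1)] inner_vec_def[of "\<alpha> y"])
qed

text \<open>Since \<open>D\<close> is Lagrangian, contracting \<open>\<Omega>\<close> with a section
  of \<open>D\<close> gives a form that annihilates \<open>D\<close>. Such a contraction serves as
  \<open>w2\<close>, next to a local generator \<open>w1\<close> of the derived system. These two
  forms are completed to a symplectic basis, and the rank conditions of the Engel structure turn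
  into the conditions on structure functions.\<close>

lemma adapted_exists:
  assumes E: "lag_engel_on S \<Omega> D" and x: "x \<in> S"
  shows "\<exists>V w. x \<in> V \<and> V \<subseteq> S \<and> adapted V \<Omega> D w"
proof -
  have o: "open S" and bil: "\<And>y. y \<in> S \<Longrightarrow> bilinear (\<Omega> y)" and alt: "\<And>y u. y \<in> S \<Longrightarrow> \<Omega> y u u = 0"
    and sm: "\<And>u v. smooth_on S (\<lambda>y. \<Omega> y u v)"
    and nd: "\<And>y u. y \<in> S \<Longrightarrow> (\<And>v. \<Omega> y u v = 0) \<Longrightarrow> u = 0"
    and lag: "\<And>y u v. y \<in> S \<Longrightarrow> u \<in> D y \<Longrightarrow> v \<in> D y \<Longrightarrow> \<Omega> y u v = 0"
    and der2: "\<And>y. y \<in> S \<Longrightarrow> derived (derived (annihilator D)) y = {0}"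
    using E unfolding lag_engel_on_def by blast+
  have sb: "subbundle S 2 D" "subbundle S 1 (derived (annihilator D))"
    using E unfolding lag_engel_on_def by blast+
  from bspec[OF sb(1)[unfolded subbundle_def] x] obtain V1 e where V1: "open V1" "x \<in> V1" "V1 \<subseteq> S"
    "\<forall>i<2. smooth_on V1 (e i)" "\<forall>y\<in>V1. D y = span ((\<lambda>i::nat. e i y) ` {..<2}) \<and> dim (D y) = 2"
    by (elim exE conjE)
  from bspec[OF sb(2)[unfolded subbundle_def] x] obtain V2 g where V2: "open V2" "x \<in> V2" "V2 \<subseteq> S"
    "\<forall>i<1. smooth_on V2 (g i)"
    "\<forall>y\<in>V2. derived (annihilator D) y = span ((\<lambda>i::nat. g i y) ` {..<1}) \<and> dim (derived (annihilator D) y) = 1"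
    by (elim exE conjE)
  define V0 where "V0 = V1 \<inter> V2"
  have V0: "open V0" "x \<in> V0" "V0 \<subseteq> S" using V1 V2 by (auto simp: V0_def)
  define w1 where "w1 = g 0"
  have w1: "smooth_on V0 w1" using V2(4) smooth_on_subset[of V2 "g 0" V0] by (simp add: w1_def V0_def)
  have Dsp: "D y = span {e 0 y, e 1 y}" "dim (D y) = 2" if "y \<in> V0" for y
    using V1(5) that by (auto simp: V0_def eval_nat_numeral lessThan_Suc insert_commute)
  have J: "derived (annihilator D) y = span {w1 y}" "dim (derived (annihilator D) y) = 1" if "y \<in> V0" for y
    using V2(5) that by (auto simp: V0_def w1_def lessThan_Suc)
  have w1_0: "w1 y \<noteq> 0" if "y \<in> V0" for y using J[OF that] by auto
  have w1J: "w1 y \<in> derived (annihilator D) y" if "y \<in> V0" for y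
    unfolding J(1)[OF that] by (rule span_base) simp
  have w1D: "w1 y \<bullet> v = 0" if "y \<in> V0" "v \<in> D y" for y v
    using w1J[OF that(1)] that by (auto simp: derived_def annihilator_def)
  have eD: "e 0 y \<in> D y" "e 1 y \<in> D y" if "y \<in> V0" for y
    unfolding Dsp(1)[OF that] by (auto intro: span_base)
  have se: "smooth_on V0 (e 0)" "smooth_on V0 (e 1)"
    using V1(4) smooth_on_subset[of V1 "e 0" V0] smooth_on_subset[of V1 "e 1" V0] by (simp_all add: V0_def)
  \<comment> \<open>If both contractions were multiples of \<open>w1\<close>, some nontrivial
    combination of the spanning vectors of \<open>D\<close> would lie in the kernel of
    \<open>\<Omega>\<close>.\<close>
  obtain X where X: "X = e 0 \<or> X = e 1" "flat \<Omega> X x \<notin> span {w1 x}"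
  proof (rule ccontr)
    assume "\<not> thesis"
    then have "flat \<Omega> (e 0) x \<in> span {w1 x}" "flat \<Omega> (e 1) x \<in> span {w1 x}" using that by blast+
    then obtain s t where st: "flat \<Omega> (e 0) x = s *\<^sub>R w1 x" "flat \<Omega> (e 1) x = t *\<^sub>R w1 x"
      by (auto simp: in_span_single_iff)
    note b = bil[OF x]
    have val: "\<Omega> x (e 0 x) v = s * (w1 x \<bullet> v)" "\<Omega> x (e 1 x) v = t * (w1 x \<bullet> v)" for v
      using flat_inner[of \<Omega> x "e 0" v, OF b] flat_inner[of \<Omega> x "e 1" v, OF b] st by simp_all
    have "t *\<^sub>R e 0 x + (- s) *\<^sub>R e 1 x = 0"
      by (rule nd[OF x]) (simp only: bilinear_ladd[OF b] bilinear_lmul[OF b] val, simp)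
    then have "s = 0"
      using pair_independent_of_dim[of "e 0 x" "e 1 x" t "- s"] Dsp[OF V0(2)] by simp
    then have "e 0 x = 0" using nd[OF x, of "e 0 x"] val by simp
    then show False
      using pair_independent_of_dim[of "e 0 x" "e 1 x" 1 0] Dsp[OF V0(2)] by simp
  qed
  have XD: "X y \<in> D y" if "y \<in> V0" for y using X(1) eD[OF that] by auto
  have sX: "smooth_on V0 X" using X(1) se by auto
  define w2 where "w2 = flat \<Omega> X"
  have w2: "smooth_on V0 w2" unfolding w2_def
    by (rule smooth_on_flat[OF V0(1) _ _ sX]) (use bil V0 smooth_on_subset[OF sm] in auto)
  have w2X: "w2 y \<bullet> v = \<Omega> y (X y) v" if "y \<in> V0" for y v
    unfolding w2_def using flat_inner[of \<Omega> y, OF bil] that V0 by blast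
  \<comment> \<open>The Gram determinant of \<open>w1\<close> and \<open>w2\<close>: it is nonzero
    exactly where they are independent, which is an open condition.\<close>
  define \<Delta> where "\<Delta> y = (w1 y \<bullet> w1 y) * (w2 y \<bullet> w2 y) - (w1 y \<bullet> w2 y) * (w1 y \<bullet> w2 y)" for y
  have s\<Delta>: "smooth_on V0 \<Delta>" unfolding \<Delta>_def by (intro smooth_rules V0 w1 w2)
  define V where "V = {y \<in> V0. \<Delta> y \<noteq> 0}"
  have oV: "open V"
    using continuous_open_preimage[OF smooth_on_continuous_on[OF s\<Delta>] V0(1), of "- {0}"]
    by (simp add: V_def vimage_def Int_def open_Compl)
  have "\<Delta> x \<noteq> 0"
  proof
    assume 0: "\<Delta> x = 0"
    let ?a = "w1 x" and ?b = "w2 x"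
    let ?r = "(?a \<bullet> ?a) *\<^sub>R ?b - (?a \<bullet> ?b) *\<^sub>R ?a"
    have "?r \<bullet> ?r = (?a \<bullet> ?a) * \<Delta> x"
      by (simp add: \<Delta>_def inner_diff_left inner_diff_right inner_commute algebra_simps)
    then have "(?a \<bullet> ?a) *\<^sub>R ?b = (?a \<bullet> ?b) *\<^sub>R ?a" using 0 by simp
    then have "inverse (?a \<bullet> ?a) *\<^sub>R ((?a \<bullet> ?a) *\<^sub>R ?b) = inverse (?a \<bullet> ?a) *\<^sub>R ((?a \<bullet> ?b) *\<^sub>R ?a)" by simp
    then have "?b = (inverse (?a \<bullet> ?a) * (?a \<bullet> ?b)) *\<^sub>R ?a" using w1_0[OF V0(2)] by simp
    then show False using X(2) unfolding w2_def[symmetric] in_span_single_iff by blast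
  qed
  then have xV: "x \<in> V" using V0 by (simp add: V_def)
  have VV0: "V \<subseteq> V0" by (auto simp: V_def)
  then have VS: "V \<subseteq> S" using V0 by blast
  note s12 = smooth_on_subset[OF w1 VV0] smooth_on_subset[OF w2 VV0]
  have \<Delta>0: "\<Delta> y \<noteq> 0" if "y \<in> V" for y using that by (simp add: V_def)
  \<comment> \<open>The inverse Gram matrix yields vectors dual to \<open>w1\<close> and
    \<open>w2\<close>.\<close>
  define f1 where "f1 y = ((w2 y \<bullet> w2 y) / \<Delta> y) *\<^sub>R w1 y - ((w1 y \<bullet> w2 y) / \<Delta> y) *\<^sub>R w2 y" for y
  define f2 where "f2 y = ((w1 y \<bullet> w1 y) / \<Delta> y) *\<^sub>R w2 y - ((w1 y \<bullet> w2 y) / \<Delta> y) *\<^sub>R w1 y" for y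
  have sf: "smooth_on V f1" "smooth_on V f2"
    unfolding f1_def f2_def by (intro smooth_rules oV s12 smooth_on_subset[OF s\<Delta> VV0] \<Delta>0; assumption)+
  have f: "w1 y \<bullet> f1 y = 1" "w2 y \<bullet> f1 y = 0" "w1 y \<bullet> f2 y = 0" "w2 y \<bullet> f2 y = 1" if "y \<in> V" for y
    using \<Delta>0[OF that] by (simp_all add: f1_def f2_def inner_diff_right inner_commute[of "w2 y" "w1 y"] diff_divide_distrib[symmetric])
      (simp_all add: \<Delta>_def mult.commute)
  define e3 where "e3 = sharp \<Omega> w1"
  \<comment> \<open>\<open>X\<close> is contracted in the first argument of \<open>\<Omega>\<close>
    to give \<open>w2\<close>; the sign moves it to the second argument.\<close>
  define e4 where "e4 y = - X y" for y
  have se3: "smooth_on V e3" unfolding e3_def by (rule smooth_on_sharp[OF E VS oV s12(1)])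
  have se4: "smooth_on V e4" unfolding e4_def by (intro smooth_rules oV smooth_on_subset[OF sX VV0])
  have \<Omega>3: "\<Omega> y u (e3 y) = w1 y \<bullet> u" if "y \<in> V" for y u
    unfolding e3_def using sharp_eq[OF E] that VS by blast
  have flip: "\<Omega> y a b = - \<Omega> y b a" if "y \<in> V" for y a b
    using alternating_flip[OF bil alt] that VS by blast
  have \<Omega>4: "\<Omega> y u (e4 y) = w2 y \<bullet> u" if "y \<in> V" for y u
  proof -
    have "\<Omega> y u (e4 y) = - \<Omega> y u (X y)"
      unfolding e4_def using bilinear_rneg[OF bil] that VS by blast
    also have "\<dots> = \<Omega> y (X y) u" using flip[OF that, of "X y" u] by simp
    finally show ?thesis using w2X that VV0 by auto
  qed
  have e4D: "e4 y \<in> D y" if "y \<in> V" for y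
    unfolding e4_def using XD that VV0 Dsp(1) by (auto intro!: span_neg)
  define s where "s y = \<Omega> y (f1 y) (f2 y)" for y
  have ss: "smooth_on V s"
  proof (rule smooth_on_cong[OF oV])
    have bV: "bilinear (\<Omega> y)" if "y \<in> V" for y using bil that VS by blast
    show "smooth_on V (\<lambda>y. flat \<Omega> f1 y \<bullet> f2 y)"
      by (intro smooth_rules oV sf smooth_on_flat[OF oV bV smooth_on_subset[OF sm VS]])
    show "flat \<Omega> f1 y \<bullet> f2 y = s y" if "y \<in> V" for y
      unfolding s_def by (rule flat_inner[of \<Omega> y, OF bV[OF that]])
  qed
  \<comment> \<open>Subtracting a multiple of \<open>e3\<close> leaves the pairings with
    \<open>w1\<close> and \<open>w2\<close> unchanged and makes \<open>f1\<close> and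
    \<open>e2\<close> orthogonal for \<open>\<Omega>\<close>.\<close>
  define e2 where "e2 y = f2 y - s y *\<^sub>R e3 y" for y
  have se2: "smooth_on V e2" unfolding e2_def by (intro smooth_rules oV sf ss se3)
  define w3 where "w3 = flat \<Omega> f1"
  define w4 where "w4 = flat \<Omega> e2"
  have s34: "smooth_on V w3" "smooth_on V w4"
    unfolding w3_def w4_def
    by (rule smooth_on_flat[OF oV]; use bil VS smooth_on_subset[OF sm VS] sf se2 in blast)+
  have w3v: "w3 y \<bullet> v = \<Omega> y (f1 y) v" "w4 y \<bullet> v = \<Omega> y (e2 y) v" if "y \<in> V" for y v
    unfolding w3_def w4_def using flat_inner[of \<Omega> y, OF bil] that VS by blast+
  have dual: "\<forall>i j. pick4 (w1 y) (w2 y) (w3 y) (w4 y) i \<bullet> pick4 (f1 y) (e2 y) (e3 y) (e4 y) j = (if i = j then 1 else 0)"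
    if y: "y \<in> V" for y
  proof -
    have b: "bilinear (\<Omega> y)" and a: "\<And>u. \<Omega> y u u = 0" using bil alt y VS by blast+
    have 13: "w1 y \<bullet> e3 y = 0" using \<Omega>3[OF y, of "e3 y"] a by simp
    have 14: "w1 y \<bullet> e4 y = 0" using w1D e4D y VV0 by blast
    have 24: "w2 y \<bullet> e4 y = 0" using \<Omega>4[OF y, of "e4 y"] a by simp
    have 23: "w2 y \<bullet> e3 y = 0" using \<Omega>4[OF y, of "e3 y"] \<Omega>3[OF y, of "e4 y"] 14 flip[OF y, of "e3 y" "e4 y"] by simp
    have 12: "w1 y \<bullet> e2 y = 0" "w2 y \<bullet> e2 y = 1"
      unfolding e2_def using f[OF y] 13 23 by (simp_all add: inner_diff_right)
    have 3: "w3 y \<bullet> f1 y = 0" "w3 y \<bullet> e3 y = 1" "w3 y \<bullet> e4 y = 0"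
      unfolding w3v[OF y] using a \<Omega>3[OF y] \<Omega>4[OF y] f[OF y] by simp_all
    have 32: "w3 y \<bullet> e2 y = 0"
      unfolding w3v[OF y] e2_def bilinear_rsub[OF b] bilinear_rmul[OF b]
      using \<Omega>3[OF y] f[OF y] by (simp add: s_def)
    have 4: "w4 y \<bullet> e2 y = 0" "w4 y \<bullet> e3 y = 0" "w4 y \<bullet> e4 y = 1" "w4 y \<bullet> f1 y = 0"
      using a \<Omega>3[OF y] \<Omega>4[OF y] 12 32 flip[OF y, of "e2 y" "f1 y"] by (simp_all add: w3v[OF y])
    show ?thesis
      unfolding forall_4 using f[OF y] 13 14 24 23 12 3 32 4 by simp
  qed
  let ?w = "pick4 w1 w2 w3 w4"
  have c: "coframe V ?w" and fr: "frame ?w j y = pick4 (f1 y) (e2 y) (e3 y) (e4 y) j" if "y \<in> V" for j y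
    using coframe_pick4[OF oV s12 s34 dual] that by blast+
  have c: "coframe V ?w" using c xV by blast
  have "adapted V \<Omega> D ?w"
    unfolding adapted_def
  proof (intro conjI ballI allI)
    show "coframe V ?w" by (rule c)
  next
    fix y u v assume y: "y \<in> V"
    have b: "bilinear (\<Omega> y)" and a: "\<And>u. \<Omega> y u u = 0" using bil alt y VS by blast+
    have d: "w i \<bullet> e = r" if "pick4 (w1 y) (w2 y) (w3 y) (w4 y) i \<bullet> pick4 (f1 y) (e2 y) (e3 y) (e4 y) j = r"
      "w = pick4 (w1 y) (w2 y) (w3 y) (w4 y)" "e = pick4 (f1 y) (e2 y) (e3 y) (e4 y) j" for w i e j r using that by simp
    note D = dual[OF y, unfolded forall_4, simplified]
    show "\<Omega> y u v = wedge (?w 1 y) (?w 3 y) u v + wedge (?w 2 y) (?w 4 y) u v"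
      by (subst two_form_expansion[OF coframe_det[OF c y] b a])
        (use D in \<open>simp add: fr[OF y] w3v[OF y, symmetric] \<Omega>3[OF y] \<Omega>4[OF y]\<close>)
  next
    fix y assume y: "y \<in> V"
    note v0 = coframe_det[OF c y]
    have yV0: "y \<in> V0" using y VV0 by blast
    let ?K = "{v. ?w 1 y \<bullet> v = 0 \<and> ?w 2 y \<bullet> v = 0}"
    \<comment> \<open>Both sides are planes, and the inclusion holds because \<open>w1\<close>
      annihilates \<open>D\<close> and \<open>\<Omega>\<close> vanishes on it.\<close>
    show D: "D y = ?K"
    proof (rule subspace_dim_equal)
      show "subspace (D y)" unfolding Dsp(1)[OF yV0] by (rule subspace_span)
      show "subspace ?K" unfolding frame_kernel2[OF v0] by (rule subspace_span)
      show "D y \<subseteq> ?K"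
        using w1D[OF yV0] w2X[OF yV0] lag[OF _ XD[OF yV0]] y VS by auto
      have "dim ?K \<le> card {frame ?w 3 y, frame ?w 4 y}"
        unfolding frame_kernel2[OF v0] dim_span by (rule dim_le_card') simp
      also have "\<dots> \<le> 2" by (simp add: card_insert_if)
      finally show "dim ?K \<le> dim (D y)" using Dsp(2)[OF yV0] by simp
    qed
    have ann: "annihilator D z = span {?w 1 z, ?w 2 z}" if "z \<in> V" for z
    proof (rule annihilator_eq[OF coframe_det[OF c that]])
      have zV0: "z \<in> V0" using that VV0 by blast
      note v0 = coframe_det[OF c that]
      let ?K = "{v. ?w 1 z \<bullet> v = 0 \<and> ?w 2 z \<bullet> v = 0}"
      show "D z = ?K"
      proof (rule subspace_dim_equal)
        show "subspace (D z)" unfolding Dsp(1)[OF zV0] by (rule subspace_span)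
        show "subspace ?K" unfolding frame_kernel2[OF v0] by (rule subspace_span)
        show "D z \<subseteq> ?K"
          using w1D[OF zV0] w2X[OF zV0] lag[OF _ XD[OF zV0]] that VS by auto
        have "dim ?K \<le> card {frame ?w 3 z, frame ?w 4 z}"
          unfolding frame_kernel2[OF v0] dim_span by (rule dim_le_card') simp
        also have "\<dots> \<le> 2" by (simp add: card_insert_if)
        finally show "dim ?K \<le> dim (D z)" using Dsp(2)[OF zV0] by simp
      qed
    qed
    show 1: "sc ?w 1 3 4 y = 0"
    proof -
      obtain U \<sigma> where U: "open U" "y \<in> U" "smooth_on U \<sigma>" "\<And>z. z \<in> U \<Longrightarrow> \<sigma> z \<in> annihilator D z"
        "\<sigma> y = w1 y" "ext_d1 \<sigma> y \<in> zero_mod (annihilator D y)"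
        using w1J[OF yV0] unfolding derived_def by blast
      have "ext_d1 \<sigma> y (frame ?w 3 y) (frame ?w 4 y) = 0"
        by (rule zero_mod_vanishes[OF U(6)]) (use ann[OF y] span_coframe12[OF v0] in auto)
      moreover have "ext_d1 \<sigma> y (frame ?w 3 y) (frame ?w 4 y)
        = (\<sigma> y \<bullet> frame ?w 1 y) * ext_d1 (?w 1) y (frame ?w 3 y) (frame ?w 4 y)
        + (\<sigma> y \<bullet> frame ?w 2 y) * ext_d1 (?w 2) y (frame ?w 3 y) (frame ?w 4 y)"
        by (rule ext_d1_section[OF c y U(1-3)])
          (use U(4) ann frame_dual[OF v0, of 1 3] frame_dual[OF v0, of 1 4] frame_dual[OF v0, of 2 3]
            frame_dual[OF v0, of 2 4] in auto)
      moreover have "\<sigma> y \<bullet> frame ?w 1 y = 1" "\<sigma> y \<bullet> frame ?w 2 y = 0"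
        using U(5) frame_dual[OF v0, of 1 1] frame_dual[OF v0, of 1 2] by simp_all
      ultimately show ?thesis by (simp add: sc_def)
    qed
    \<comment> \<open>Otherwise \<open>w2\<close> would belong to the derived system, which is only
      the line of \<open>w1\<close>.\<close>
    show "sc ?w 2 3 4 y \<noteq> 0"
    proof
      assume 0: "sc ?w 2 3 4 y = 0"
      have "ext_d1 w2 y \<in> zero_mod (annihilator D y)"
        unfolding ann[OF y]
        by (rule zero_mod_pair[OF v0 bilinear_ext_d1_coframe[OF c y, of 2, simplified] ext_d1_self])
          (use 0 in \<open>simp add: sc_def\<close>)
      moreover have "w2 z \<in> annihilator D z" if "z \<in> V" for z
        unfolding ann[OF that] by (rule span_base) simp
      ultimately have "w2 y \<in> derived (annihilator D) y"
        unfolding derived_def using oV y s12(2) by blast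
      then obtain k where "w2 y = k *\<^sub>R w1 y" unfolding J(1)[OF yV0] in_span_single_iff by blast
      then show False using frame_dual[OF v0, of 2 2] frame_dual[OF v0, of 1 2] by simp
    qed
    \<comment> \<open>Otherwise \<open>w1\<close> would survive in the second derived
      system.\<close>
    show "sc ?w 1 2 3 y \<noteq> 0 \<or> sc ?w 1 2 4 y \<noteq> 0"
    proof (rule ccontr)
      assume "\<not> ?thesis"
      then have "ext_d1 w1 y \<in> zero_mod (span {?w 1 y})"
        by (intro zero_mod_single[OF v0 bilinear_ext_d1_coframe[OF c y, of 1, simplified] ext_d1_self])
          (use 1 in \<open>simp_all add: sc_def\<close>)
      then have "ext_d1 w1 y \<in> zero_mod (derived (annihilator D) y)" using J(1)[OF yV0] by simp
      moreover have "w1 z \<in> derived (annihilator D) z" if "z \<in> V" for z using w1J that VV0 by blast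
      ultimately have "w1 y \<in> derived (derived (annihilator D)) y"
        unfolding derived_def[of "derived _"] using oV y s12(1) by blast
      then show False using der2 w1_0 yV0 y VS by auto
    qed
  qed
  then show ?thesis using xV VS by blast
qed

section \<open>Changes of adapted coframes and normal forms\<close>

definition degenerate_coframe where
  "degenerate_coframe V \<Omega> D w \<longleftrightarrow> adapted V \<Omega> D w \<and> (\<forall>y\<in>V. sc w 1 2 3 y = 0 \<and> sc w 1 2 4 y = 1)"

text \<open>An adapted coframe is determined up to two scalings, a shear of \<open>w 2\<close> by
  \<open>w 1\<close>, and the addition to \<open>w 3\<close>, \<open>w 4\<close> of a combination of
  \<open>w 1\<close>, \<open>w 2\<close> with symmetric matrix. The first three conditions use up
  the scalings and the shear, the last three the symmetric matrix.\<close>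

definition canonical_coframe where
  "canonical_coframe V \<Omega> D w \<longleftrightarrow> adapted V \<Omega> D w \<and>
     (\<forall>y\<in>V. sc w 1 2 3 y = 1 \<and> sc w 1 2 4 y = 0 \<and> sc w 2 3 4 y = 1 \<and>
        sc w 1 1 2 y = 0 \<and> sc w 2 2 3 y = 0 \<and> sc w 2 2 4 y = 0)"

text \<open>In particular e_3 and e_4 are dual to \<open>w 1\<close> and \<open>w 2\<close> through
  \<open>\<Omega>\<close>, so they change only when these two forms do.\<close>

lemma adapted_Omega:
  assumes "adapted V \<Omega> D w" "y \<in> V"
  shows "\<Omega> y u (frame w 3 y) = w 1 y \<bullet> u" "\<Omega> y u (frame w 4 y) = w 2 y \<bullet> u"
    "\<Omega> y u (frame w 1 y) = - (w 3 y \<bullet> u)" "\<Omega> y u (frame w 2 y) = - (w 4 y \<bullet> u)"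
proof -
  have \<Omega>: "\<Omega> y u v = wedge (w 1 y) (w 3 y) u v + wedge (w 2 y) (w 4 y) u v" for v
    using assms unfolding adapted_def by blast
  note d = frame_dual[OF coframe_det[OF adapted_coframe[OF assms(1)] assms(2)]]
  show "\<Omega> y u (frame w 3 y) = w 1 y \<bullet> u" "\<Omega> y u (frame w 4 y) = w 2 y \<bullet> u"
    "\<Omega> y u (frame w 1 y) = - (w 3 y \<bullet> u)" "\<Omega> y u (frame w 2 y) = - (w 4 y \<bullet> u)"
    unfolding \<Omega> wedge_def by (simp_all add: d)
qed

lemma adapted_nondegenerate:
  assumes "adapted V \<Omega> D w" "y \<in> V" "\<And>u. \<Omega> y u a = \<Omega> y u b"
  shows "a = b"
proof -
  note c = adapted_coframe[OF assms(1)] and v0 = coframe_det[OF adapted_coframe[OF assms(1)] assms(2)]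
  note d = frame_dual[OF v0]
  have \<Omega>: "\<Omega> y u v = wedge (w 1 y) (w 3 y) u v + wedge (w 2 y) (w 4 y) u v" for u v
    using assms unfolding adapted_def by blast
  have "w i y \<bullet> a = w i y \<bullet> b" for i
    using exhaust_4[of i] assms(3)[of "frame w 1 y"] assms(3)[of "frame w 2 y"]
      assms(3)[of "frame w 3 y"] assms(3)[of "frame w 4 y"]
    unfolding \<Omega> wedge_def by (auto simp: d)
  then show ?thesis using frame_expansion[OF v0, of a] frame_expansion[OF v0, of b] by simp
qed

text \<open>The annihilator and its derived system force a triangular change of \<open>w 1\<close>
  and \<open>w 2\<close>, and \<open>\<Omega>\<close> then dictates the change of e_3 and e_4. The
  vector e_2 may also acquire multiples of e_3 and e_4, but they do not affect the three functions
  listed, because the derivative of \<open>w 1\<close> vanishes on e_3, e_4.\<close>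

lemma adapted_change:
  assumes "adapted V \<Omega> D w" "adapted V' \<Omega> D w'" "y \<in> V" "y \<in> V'"
  obtains \<tau> \<mu> \<kappa> where "\<tau> \<noteq> 0" "\<mu> \<noteq> 0" "w' 1 y = \<tau> *\<^sub>R w 1 y" "w' 2 y = \<mu> *\<^sub>R w 2 y + \<kappa> *\<^sub>R w 1 y"
    "frame w' 3 y = \<tau> *\<^sub>R frame w 3 y" "frame w' 4 y = \<mu> *\<^sub>R frame w 4 y + \<kappa> *\<^sub>R frame w 3 y"
    "sc w' 1 2 3 y = \<tau>\<^sup>2 / \<mu> * sc w 1 2 3 y"
    "sc w' 1 2 4 y = \<tau> * sc w 1 2 4 y + \<tau> * \<kappa> / \<mu> * sc w 1 2 3 y"
    "sc w' 2 3 4 y = \<tau> * \<mu>\<^sup>2 * sc w 2 3 4 y"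
proof -
  note c = adapted_coframe[OF assms(1)] and c' = adapted_coframe[OF assms(2)]
  note v0 = coframe_det[OF c assms(3)] and v0' = coframe_det[OF c' assms(4)]
  note d = frame_dual[OF v0] and d' = frame_dual[OF v0']
  have sp1: "w' 1 z \<in> span {w 1 z}" if "z \<in> V' \<inter> V" for z
    using adapted_derived[OF assms(1)] adapted_derived[OF assms(2)] that span_base[of "w' 1 z" "{w' 1 z}"] by auto
  have sp2: "w' 2 z \<in> span {w 1 z, w 2 z}" if "z \<in> V' \<inter> V" for z
    using adapted_annihilator[OF assms(1)] adapted_annihilator[OF assms(2)] that span_base[of "w' 2 z" "{w' 1 z, w' 2 z}"] by auto
  obtain \<tau> where \<tau>: "w' 1 y = \<tau> *\<^sub>R w 1 y"
    using sp1[of y] assms by (auto simp: in_span_single_iff)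
  obtain \<kappa> \<mu> where \<mu>: "w' 2 y = \<kappa> *\<^sub>R w 1 y + \<mu> *\<^sub>R w 2 y"
    using sp2[of y] assms by (auto simp: in_span_pair_iff)
  have \<tau>0: "\<tau> \<noteq> 0" using d'[of 1 1] \<tau> by auto
  have w1f2: "w 1 y \<bullet> frame w' 2 y = 0" using d'[of 1 2] \<tau> \<tau>0 by simp
  have m: "\<mu> * (w 2 y \<bullet> frame w' 2 y) = 1" using d'[of 2 2] \<mu> w1f2 by (simp add: inner_add_left)
  then have \<mu>0: "\<mu> \<noteq> 0" by auto
  have w2f2: "w 2 y \<bullet> frame w' 2 y = 1 / \<mu>" using m \<mu>0 by (simp add: field_simps)
  have f3: "frame w' 3 y = \<tau> *\<^sub>R frame w 3 y"
  proof (rule adapted_nondegenerate[OF assms(1,3)])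
    fix u
    have \<Omega>: "\<Omega> y u v = wedge (w 1 y) (w 3 y) u v + wedge (w 2 y) (w 4 y) u v" for v
      using assms unfolding adapted_def by blast
    have "\<Omega> y u (\<tau> *\<^sub>R frame w 3 y) = \<tau> * (w 1 y \<bullet> u)" unfolding \<Omega> wedge_def by (simp add: d)
    then show "\<Omega> y u (frame w' 3 y) = \<Omega> y u (\<tau> *\<^sub>R frame w 3 y)"
      unfolding adapted_Omega(1)[OF assms(2,4)] \<tau> by simp
  qed
  have f4: "frame w' 4 y = \<mu> *\<^sub>R frame w 4 y + \<kappa> *\<^sub>R frame w 3 y"
  proof (rule adapted_nondegenerate[OF assms(1,3)])
    fix u
    have \<Omega>: "\<Omega> y u v = wedge (w 1 y) (w 3 y) u v + wedge (w 2 y) (w 4 y) u v" for v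
      using assms unfolding adapted_def by blast
    have "\<Omega> y u (\<mu> *\<^sub>R frame w 4 y + \<kappa> *\<^sub>R frame w 3 y) = \<mu> * (w 2 y \<bullet> u) + \<kappa> * (w 1 y \<bullet> u)"
      unfolding \<Omega> wedge_def by (simp add: d inner_add_right algebra_simps)
    then show "\<Omega> y u (frame w' 4 y) = \<Omega> y u (\<mu> *\<^sub>R frame w 4 y + \<kappa> *\<^sub>R frame w 3 y)"
      unfolding adapted_Omega(2)[OF assms(2,4)] \<mu> by (simp add: inner_add_left)
  qed
  define r t where "r = w 3 y \<bullet> frame w' 2 y" and "t = w 4 y \<bullet> frame w' 2 y"
  have f2: "frame w' 2 y = (1 / \<mu>) *\<^sub>R frame w 2 y + r *\<^sub>R frame w 3 y + t *\<^sub>R frame w 4 y"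
    using frame_expansion[OF v0, of "frame w' 2 y"] w1f2 w2f2 by (simp add: sum_4 r_def t_def)
  have e1: "ext_d1 (w' 1) y u v = \<tau> * ext_d1 (w 1) y u v" if "w 1 y \<bullet> u = 0" "w 1 y \<bullet> v = 0" for u v
    using ext_d1_section1[OF c assms(3) coframe_open[OF c'] assms(4) coframe_smooth[OF c'] sp1 that] d \<tau> by simp
  have e2: "ext_d1 (w' 2) y u v = \<kappa> * ext_d1 (w 1) y u v + \<mu> * ext_d1 (w 2) y u v"
    if "w 1 y \<bullet> u = 0" "w 1 y \<bullet> v = 0" "w 2 y \<bullet> u = 0" "w 2 y \<bullet> v = 0" for u v
    using ext_d1_section[OF c assms(3) coframe_open[OF c'] assms(4) coframe_smooth[OF c'] sp2 that] d \<mu>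
    by (simp add: inner_add_left)
  note B1 = bilinear_ext_d1_coframe[OF c assms(3), of 1] and B2 = bilinear_ext_d1_coframe[OF c assms(3), of 2]
  note bl = bilinear_ladd[OF B1] bilinear_radd[OF B1] bilinear_lmul[OF B1] bilinear_rmul[OF B1]
    bilinear_ladd[OF B2] bilinear_radd[OF B2] bilinear_lmul[OF B2] bilinear_rmul[OF B2]
  have 134: "ext_d1 (w 1) y (frame w 3 y) (frame w 4 y) = 0"
    using assms unfolding adapted_def sc_def by blast
  then have 143: "ext_d1 (w 1) y (frame w 4 y) (frame w 3 y) = 0"
    by (simp add: ext_d1_alt[of _ _ "frame w 4 y" "frame w 3 y"])
  have s123: "sc w' 1 2 3 y = \<tau>\<^sup>2 / \<mu> * sc w 1 2 3 y"
    unfolding sc_def f2 f3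
    by (subst e1) (simp_all add: inner_add_right d bl ext_d1_self 143 power2_eq_square)
  have s124: "sc w' 1 2 4 y = \<tau> * sc w 1 2 4 y + \<tau> * \<kappa> / \<mu> * sc w 1 2 3 y"
    unfolding sc_def f2 f4
    by (subst e1) (simp_all add: inner_add_right d bl ext_d1_self 143 134 \<mu>0 field_simps)
  have s234: "sc w' 2 3 4 y = \<tau> * \<mu>\<^sup>2 * sc w 2 3 4 y"
    unfolding sc_def f3 f4
    by (subst e2) (simp_all add: inner_add_right d bl ext_d1_self 143 134 power2_eq_square)
  show thesis
    by (rule that[OF \<tau>0 \<mu>0 \<tau> _ f3 f4 s123 s124 s234]) (simp add: \<mu>)
qed

text \<open>When the (2,3) coefficient of the derivative of \<open>w 1\<close> vanishes, the (2,4)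
  coefficient scales by \<tau> alone, so its normalisation fixes \<tau> and leaves \<mu> and
  \<kappa> free.\<close>

lemma degenerate_unique:
  assumes "degenerate_coframe V \<Omega> D w" "degenerate_coframe V' \<Omega> D w'" "y \<in> V" "y \<in> V'"
  shows "frame w' 3 y = frame w 3 y"
proof -
  have a: "adapted V \<Omega> D w" "adapted V' \<Omega> D w'" using assms by (simp_all add: degenerate_coframe_def)
  from adapted_change[OF a assms(3,4)] obtain \<tau> \<kappa> \<mu> where *: "frame w' 3 y = \<tau> *\<^sub>R frame w 3 y"
    "sc w' 1 2 4 y = \<tau> * sc w 1 2 4 y + \<tau> * \<kappa> / \<mu> * sc w 1 2 3 y" by metis
  then have "\<tau> = 1" using assms by (simp add: degenerate_coframe_def)
  then show ?thesis using * by simp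
qed

lemma canonical_unique12:
  assumes "canonical_coframe V \<Omega> D w" "canonical_coframe V' \<Omega> D w'" "y \<in> V" "y \<in> V'"
  shows "w' 1 y = w 1 y" "w' 2 y = w 2 y" "frame w' 3 y = frame w 3 y" "frame w' 4 y = frame w 4 y"
proof -
  have a: "adapted V \<Omega> D w" "adapted V' \<Omega> D w'" using assms by (simp_all add: canonical_coframe_def)
  obtain \<tau> \<mu> \<kappa> where *: "\<tau> \<noteq> 0" "\<mu> \<noteq> 0" "w' 1 y = \<tau> *\<^sub>R w 1 y" "w' 2 y = \<mu> *\<^sub>R w 2 y + \<kappa> *\<^sub>R w 1 y"
    "frame w' 3 y = \<tau> *\<^sub>R frame w 3 y" "frame w' 4 y = \<mu> *\<^sub>R frame w 4 y + \<kappa> *\<^sub>R frame w 3 y"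
    "sc w' 1 2 3 y = \<tau>\<^sup>2 / \<mu> * sc w 1 2 3 y"
    "sc w' 1 2 4 y = \<tau> * sc w 1 2 4 y + \<tau> * \<kappa> / \<mu> * sc w 1 2 3 y"
    "sc w' 2 3 4 y = \<tau> * \<mu>\<^sup>2 * sc w 2 3 4 y"
    by (rule adapted_change[OF a assms(3,4)])
  have "\<tau>\<^sup>2 / \<mu> = 1" "\<tau> * \<kappa> / \<mu> = 0" "\<tau> * \<mu>\<^sup>2 = 1"
  proof -
    have k: "sc w 1 2 3 y = 1" "sc w 1 2 4 y = 0" "sc w 2 3 4 y = 1"
      "sc w' 1 2 3 y = 1" "sc w' 1 2 4 y = 0" "sc w' 2 3 4 y = 1"
      using assms by (simp_all add: canonical_coframe_def)
    show "\<tau>\<^sup>2 / \<mu> = 1" using *(7) unfolding k by linarith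
    show "\<tau> * \<kappa> / \<mu> = 0" using *(8) unfolding k by linarith
    show "\<tau> * \<mu>\<^sup>2 = 1" using *(9) unfolding k by linarith
  qed
  \<comment> \<open>With \<open>\<mu> = \<tau>\<^sup>2\<close> the last equation becomes
    \<open>\<tau> ^ 5 = 1\<close>, whose only real solution is 1.\<close>
  then have \<kappa>: "\<kappa> = 0" and \<mu>: "\<mu> = \<tau>\<^sup>2" and "\<tau> * \<mu>\<^sup>2 = 1" using *(1,2) by (simp_all add: field_simps)
  then have "\<tau> ^ 5 = 1" by (simp add: eval_nat_numeral)
  then have "\<tau> = 1" using odd_real_root_power_cancel[of 5 \<tau>] by simp
  then show "w' 1 y = w 1 y" "w' 2 y = w 2 y" "frame w' 3 y = frame w 3 y" "frame w' 4 y = frame w 4 y"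
    using * \<kappa> \<mu> by simp_all
qed

text \<open>With \<open>w 1\<close>, \<open>w 2\<close>, e_3 and e_4 fixed, e_1 and e_2 can differ
  only by combinations of e_3 and e_4. \<open>\<Omega>\<close> makes the coefficient matrix
  symmetric, and its three entries are read off from the three remaining normalised functions, one
  at a time.\<close>

lemma canonical_unique:
  assumes "canonical_coframe V \<Omega> D w" "canonical_coframe V' \<Omega> D w'" "y \<in> V" "y \<in> V'"
  shows "w' i y = w i y"
proof -
  have a: "adapted V \<Omega> D w" "adapted V' \<Omega> D w'" using assms by (simp_all add: canonical_coframe_def)
  note c = adapted_coframe[OF a(1)] and c' = adapted_coframe[OF a(2)]
  note v0 = coframe_det[OF c assms(3)] and v0' = coframe_det[OF c' assms(4)]
  note d = frame_dual[OF v0] and d' = frame_dual[OF v0']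
  note u = canonical_unique12[OF assms]
  have o: "open (V \<inter> V')" "y \<in> V \<inter> V'" using c c' assms coframe_open by auto
  have D1: "ext_d1 (w' 1) y = ext_d1 (w 1) y" and D2: "ext_d1 (w' 2) y = ext_d1 (w 2) y"
    by (rule ext_d1_cong[OF o], use canonical_unique12[OF assms(1,2)] in blast)+
  let ?f = "\<lambda>i. frame w' i y" and ?e = "\<lambda>i. frame w i y"
  define r t where "r = w 3 y \<bullet> ?f 2" and "t = w 4 y \<bullet> ?f 2"
  have f2: "?f 2 = ?e 2 + r *\<^sub>R ?e 3 + t *\<^sub>R ?e 4"
    using frame_expansion[OF v0, of "?f 2"] d'[of 1 2] d'[of 2 2] u by (simp add: sum_4 r_def t_def)
  define \<alpha> \<beta> where "\<alpha> = w 3 y \<bullet> ?f 1" and "\<beta> = w 4 y \<bullet> ?f 1"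
  have f1: "?f 1 = ?e 1 + \<alpha> *\<^sub>R ?e 3 + \<beta> *\<^sub>R ?e 4"
    using frame_expansion[OF v0, of "?f 1"] d'[of 1 1] d'[of 2 1] u by (simp add: sum_4 \<alpha>_def \<beta>_def)
  have \<Omega>: "\<Omega> y p q = wedge (w 1 y) (w 3 y) p q + wedge (w 2 y) (w 4 y) p q" for p q
    using a assms unfolding adapted_def by blast
  have r\<beta>: "r = \<beta>"
  proof -
    have "\<Omega> y (?f 1) (?f 2) = 0" using adapted_Omega(4)[OF a(2) assms(4)] d' by simp
    moreover have "\<Omega> y (?f 1) (?f 2) = r - \<beta>"
      unfolding \<Omega> wedge_def f1 f2 by (simp add: inner_add_right d)
    ultimately show ?thesis by simp
  qed
  note B1 = bilinear_ext_d1_coframe[OF c assms(3), of 1] and B2 = bilinear_ext_d1_coframe[OF c assms(3), of 2]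
  note bl = bilinear_ladd[OF B1] bilinear_radd[OF B1] bilinear_lmul[OF B1] bilinear_rmul[OF B1]
    bilinear_ladd[OF B2] bilinear_radd[OF B2] bilinear_lmul[OF B2] bilinear_rmul[OF B2]
  have k: "sc w 1 2 3 y = 1" "sc w 1 2 4 y = 0" "sc w 2 3 4 y = 1" "sc w 1 1 2 y = 0" "sc w 2 2 3 y = 0" "sc w 2 2 4 y = 0"
     "sc w 1 3 4 y = 0"
    and k': "sc w' 1 1 2 y = 0" "sc w' 2 2 3 y = 0" "sc w' 2 2 4 y = 0" "sc w' 1 2 3 y = 1" "sc w' 1 2 4 y = 0"
      "sc w' 2 3 4 y = 1" "sc w' 1 3 4 y = 0"
    using assms by (simp_all add: canonical_coframe_def adapted_def)
  have "sc w' 2 2 3 y = sc w 2 2 3 y - t * sc w 2 3 4 y"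
    unfolding sc_def D2 f2 u(3) by (simp add: bl ext_d1_self ext_d1_alt[of _ _ "?e 4" "?e 3"])
  then have t: "t = 0" using k k' by simp
  have "sc w' 2 2 4 y = sc w 2 2 4 y + r * sc w 2 3 4 y"
    unfolding sc_def D2 f2 u(4) by (simp add: bl ext_d1_self)
  then have r: "r = 0" using k k' by simp
  have f2': "?f 2 = ?e 2" and f1': "?f 1 = ?e 1 + \<alpha> *\<^sub>R ?e 3" using f1 f2 t r r\<beta> by simp_all
  have "sc w' 1 1 2 y = sc w 1 1 2 y - \<alpha> * sc w 1 2 3 y"
    unfolding sc_def D1 f2' f1' by (simp add: bl ext_d1_alt[of _ _ "?e 3" "?e 2"])
  then have "\<alpha> = 0" using k k' by simp
  then have f: "?f j = ?e j" for j using exhaust_4[of j] f1' f2' u by auto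
  show ?thesis
  proof (rule covector_eqI[OF v0])
    show "w' i y \<bullet> ?e j = w i y \<bullet> ?e j" for j using d[of i j] d'[of i j] f[of j] by simp
  qed
qed

text \<open>Dividing \<open>w 1\<close> by the (2,4) coefficient \<open>q\<close> of its derivative
  normalises that coefficient; \<open>w 3\<close> is multiplied by \<open>q\<close> to keep
  \<open>\<Omega>\<close>.\<close>

lemma degenerate_exists:
  assumes "adapted V \<Omega> D w" "\<And>y. y \<in> V \<Longrightarrow> sc w 1 2 3 y = 0"
  shows "\<exists>w'. degenerate_coframe V \<Omega> D w'"
proof -
  note c = adapted_coframe[OF assms(1)] and o = coframe_open[OF adapted_coframe[OF assms(1)]]
  note s = coframe_smooth[OF c]
  define q where "q = sc w 1 2 4"
  have q0: "q y \<noteq> 0" if "y \<in> V" for y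
    using assms that unfolding adapted_def q_def by blast
  have sq: "smooth_on V q" unfolding q_def by (rule smooth_on_sc[OF c])
  let ?w1 = "\<lambda>y. (1 / q y) *\<^sub>R w 1 y" and ?w3 = "\<lambda>y. q y *\<^sub>R w 3 y"
  let ?e1 = "\<lambda>y. q y *\<^sub>R frame w 1 y" and ?e3 = "\<lambda>y. (1 / q y) *\<^sub>R frame w 3 y"
  let ?w = "pick4 ?w1 (w 2) ?w3 (w 4)"
  have sm: "smooth_on V ?w1" "smooth_on V ?w3"
    by (intro smooth_on_scaleR[OF o] smooth_on_divide[OF o] smooth_on_const s sq q0; assumption)+
  have dual: "\<forall>i j. pick4 (?w1 y) (w 2 y) (?w3 y) (w 4 y) i \<bullet> pick4 (?e1 y) (frame w 2 y) (?e3 y) (frame w 4 y) j = (if i = j then 1 else 0)"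
    if "y \<in> V" for y
    unfolding forall_4 using frame_dual[OF coframe_det[OF c that]] q0[OF that] by simp
  have c': "coframe V ?w" using coframe_pick4(1)[OF o sm(1) s sm(2) s dual] .
  have fr: "frame ?w j y = pick4 (?e1 y) (frame w 2 y) (?e3 y) (frame w 4 y) j" if "y \<in> V" for j y
    using coframe_pick4(2)[OF o sm(1) s sm(2) s dual that] .
  have D1: "ext_d1 ?w1 y u v = (1 / q y) * ext_d1 (w 1) y u v" if "y \<in> V" "w 1 y \<bullet> u = 0" "w 1 y \<bullet> v = 0" for y u v
    using ext_d1_section1[OF c that(1) o that(1) sm(1) _ that(2,3)] frame_dual[OF coframe_det[OF c that(1)], of 1 1]
    by (simp add: in_span_single_iff)
  have sc1: "sc ?w 1 2 3 y = 0" "sc ?w 1 2 4 y = 1" "sc ?w 1 3 4 y = 0" "sc ?w 2 3 4 y = sc w 2 3 4 y / q y" if y: "y \<in> V" for y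
  proof -
    note d = frame_dual[OF coframe_det[OF c y]]
    note B1 = bilinear_ext_d1_coframe[OF c y, of 1] and B2 = bilinear_ext_d1_coframe[OF c y, of 2]
    note bl = bilinear_lmul[OF B1] bilinear_rmul[OF B1] bilinear_lmul[OF B2] bilinear_rmul[OF B2]
    have k: "sc w 1 2 3 y = 0" "sc w 1 3 4 y = 0" using assms y unfolding adapted_def by blast+
    show "sc ?w 1 2 3 y = 0" "sc ?w 1 2 4 y = 1" "sc ?w 1 3 4 y = 0"
      unfolding sc_def using k q0[OF y] by (simp_all add: fr[OF y] D1[OF y] d bl, simp_all add: sc_def q_def)
    show "sc ?w 2 3 4 y = sc w 2 3 4 y / q y"
      unfolding sc_def by (simp add: fr[OF y] bl)
  qed
  have "adapted V \<Omega> D ?w"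
    unfolding adapted_def
  proof (intro conjI ballI allI)
    show "coframe V ?w" by (rule c')
  next
    fix y u v assume y: "y \<in> V"
    have "\<Omega> y u v = wedge (w 1 y) (w 3 y) u v + wedge (w 2 y) (w 4 y) u v" 
      using assms y unfolding adapted_def by blast
    then show "\<Omega> y u v = wedge (?w 1 y) (?w 3 y) u v + wedge (?w 2 y) (?w 4 y) u v"
      using q0[OF y] by (simp add: wedge_def field_simps)
  next
    fix y assume y: "y \<in> V"
    have "D y = {v. w 1 y \<bullet> v = 0 \<and> w 2 y \<bullet> v = 0}"
      using assms y unfolding adapted_def by blast
    then show "D y = {v. ?w 1 y \<bullet> v = 0 \<and> ?w 2 y \<bullet> v = 0}" using q0[OF y] by simp
    show "sc ?w 1 3 4 y = 0" using sc1[OF y] by blast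
    show "sc ?w 2 3 4 y \<noteq> 0" using sc1(4)[OF y] q0[OF y] assms y unfolding adapted_def by simp
    show "sc ?w 1 2 3 y \<noteq> 0 \<or> sc ?w 1 2 4 y \<noteq> 0" using sc1[OF y] by simp
  qed
  then have "degenerate_coframe V \<Omega> D ?w" using sc1 unfolding degenerate_coframe_def by blast
  then show ?thesis by blast
qed

text \<open>The two conditions on the scaling factors \<open>\<tau>\<close> of \<open>\<omega>\<^sub>1\<close> and \<open>\<mu>\<close> of \<open>\<omega>\<^sub>2\<close> amount to prescribing \<open>\<tau>\<^sup>5\<close>,
  which is why they are solvable without ambiguity of sign.\<close>

lemma rescaled_exists:
  assumes "adapted V \<Omega> D w" "\<And>y. y \<in> V \<Longrightarrow> sc w 1 2 3 y \<noteq> 0"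
  shows "\<exists>w'. adapted V \<Omega> D w' \<and> (\<forall>y\<in>V. sc w' 1 2 3 y = 1 \<and> sc w' 1 2 4 y = 0 \<and> sc w' 2 3 4 y = 1)"
proof -
  note c = adapted_coframe[OF assms(1)] and o = coframe_open[OF adapted_coframe[OF assms(1)]]
  note s = coframe_smooth[OF c]
  define p where "p = sc w 1 2 3"
  define k where "k = sc w 2 3 4"
  \<comment> \<open>\<open>\<nu>\<close> shears away the (2,4) coefficient. The requirements
    \<open>\<tau>\<^sup>2 * p / \<mu> = 1\<close> and \<open>\<tau> * \<mu>\<^sup>2 * k = 1\<close>
    express \<open>\<mu>\<close> through \<open>\<tau>\<close> and then read
    \<open>\<tau> ^ 5 * k * p\<^sup>2 = 1\<close>.\<close>
  define \<nu> where "\<nu> = (\<lambda>y. - sc w 1 2 4 y / p y)"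
  define \<tau> where "\<tau> = (\<lambda>y. root 5 (inverse (k y * p y ^ 2)))"
  define \<mu> where "\<mu> = (\<lambda>y. p y * \<tau> y ^ 2)"
  have p0: "p y \<noteq> 0" and k0: "k y \<noteq> 0" if "y \<in> V" for y
    using assms that unfolding adapted_def p_def k_def by blast+
  have sp: "smooth_on V p" and sk: "smooth_on V k" unfolding p_def k_def by (rule smooth_on_sc[OF c])+
  have kp0: "k y * p y ^ 2 \<noteq> 0" if "y \<in> V" for y using p0[OF that] k0[OF that] by simp
  have s\<nu>: "smooth_on V \<nu>" unfolding \<nu>_def
    by (intro smooth_on_divide[OF o] smooth_on_minus[OF o] smooth_on_sc[OF c] sp p0; assumption)
  have skp: "smooth_on V (\<lambda>y. inverse (k y * p y ^ 2))"
    by (rule smooth_on_inverse[OF o smooth_on_mult[OF o sk smooth_on_power[OF o sp]] kp0])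
  have s\<tau>: "smooth_on V \<tau>" unfolding \<tau>_def
    by (rule smooth_on_root[OF _ o skp]) (use kp0 in auto)
  have s\<mu>: "smooth_on V \<mu>" unfolding \<mu>_def
    by (rule smooth_on_mult[OF o sp smooth_on_power[OF o s\<tau>]])
  have \<tau>0: "\<tau> y \<noteq> 0" if "y \<in> V" for y unfolding \<tau>_def using kp0[OF that] by simp
  have \<mu>0: "\<mu> y \<noteq> 0" if "y \<in> V" for y unfolding \<mu>_def using p0[OF that] \<tau>0[OF that] by simp
  have \<tau>5: "\<tau> y ^ 5 * (k y * p y ^ 2) = 1" if "y \<in> V" for y
  proof -
    have "\<tau> y ^ 5 = inverse (k y * p y ^ 2)" unfolding \<tau>_def by (rule odd_real_root_pow) simp
    then show ?thesis using kp0[OF that] by (simp add: field_simps)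
  qed
  let ?w1 = "\<lambda>y. \<tau> y *\<^sub>R w 1 y" and ?w2 = "\<lambda>y. \<mu> y *\<^sub>R (w 2 y + \<nu> y *\<^sub>R w 1 y)"
    and ?w3 = "\<lambda>y. (1 / \<tau> y) *\<^sub>R (w 3 y - \<nu> y *\<^sub>R w 4 y)" and ?w4 = "\<lambda>y. (1 / \<mu> y) *\<^sub>R w 4 y"
  let ?e1 = "\<lambda>y. (1 / \<tau> y) *\<^sub>R (frame w 1 y - \<nu> y *\<^sub>R frame w 2 y)" and ?e2 = "\<lambda>y. (1 / \<mu> y) *\<^sub>R frame w 2 y"
    and ?e3 = "\<lambda>y. \<tau> y *\<^sub>R frame w 3 y" and ?e4 = "\<lambda>y. \<mu> y *\<^sub>R (frame w 4 y + \<nu> y *\<^sub>R frame w 3 y)"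
  let ?w = "pick4 ?w1 ?w2 ?w3 ?w4"
  note sr = smooth_on_scaleR[OF o] smooth_on_divide[OF o] smooth_on_add[OF o] smooth_on_diff[OF o] smooth_on_const s s\<tau> s\<mu> s\<nu> \<tau>0 \<mu>0
  have sm: "smooth_on V ?w1" "smooth_on V ?w2" "smooth_on V ?w3" "smooth_on V ?w4"
    by (intro sr; assumption)+
  have dual: "\<forall>i j. pick4 (?w1 y) (?w2 y) (?w3 y) (?w4 y) i \<bullet> pick4 (?e1 y) (?e2 y) (?e3 y) (?e4 y) j = (if i = j then 1 else 0)"
    if "y \<in> V" for y
    unfolding forall_4 using frame_dual[OF coframe_det[OF c that]] \<tau>0[OF that] \<mu>0[OF that]
    by (simp add: inner_add_left inner_add_right inner_diff_left inner_diff_right)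
  have c': "coframe V ?w" using coframe_pick4(1)[OF o sm dual] .
  have fr: "frame ?w j y = pick4 (?e1 y) (?e2 y) (?e3 y) (?e4 y) j" if "y \<in> V" for j y
    using coframe_pick4(2)[OF o sm dual that] .
  have D1: "ext_d1 ?w1 y u v = \<tau> y * ext_d1 (w 1) y u v" if "y \<in> V" "w 1 y \<bullet> u = 0" "w 1 y \<bullet> v = 0" for y u v
    using ext_d1_section1[OF c that(1) o that(1) sm(1) _ that(2,3)] frame_dual[OF coframe_det[OF c that(1)], of 1 1]
    by (simp add: in_span_single_iff)
  have D2: "ext_d1 ?w2 y u v = \<mu> y * \<nu> y * ext_d1 (w 1) y u v + \<mu> y * ext_d1 (w 2) y u v"
    if y: "y \<in> V" and uv: "w 1 y \<bullet> u = 0" "w 1 y \<bullet> v = 0" "w 2 y \<bullet> u = 0" "w 2 y \<bullet> v = 0" for y u v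
  proof -
    have "?w2 z \<in> span {w 1 z, w 2 z}" for z
      by (intro span_scale span_add) (auto intro: span_base span_scale)
    from ext_d1_section[OF c y o y sm(2) this uv] show ?thesis
      using frame_dual[OF coframe_det[OF c y]] by (simp add: inner_add_left)
  qed
  have sc1: "sc ?w 1 2 3 y = 1" "sc ?w 1 2 4 y = 0" "sc ?w 1 3 4 y = 0" "sc ?w 2 3 4 y = 1" if y: "y \<in> V" for y
  proof -
    note d = frame_dual[OF coframe_det[OF c y]]
    note B1 = bilinear_ext_d1_coframe[OF c y, of 1] and B2 = bilinear_ext_d1_coframe[OF c y, of 2]
    note bl = bilinear_ladd[OF B1] bilinear_radd[OF B1] bilinear_lmul[OF B1] bilinear_rmul[OF B1]
      bilinear_ladd[OF B2] bilinear_radd[OF B2] bilinear_lmul[OF B2] bilinear_rmul[OF B2]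
    have "sc w 1 3 4 y = 0" using assms y unfolding adapted_def by blast
    then have 134: "ext_d1 (w 1) y (frame w 3 y) (frame w 4 y) = 0" by (simp add: sc_def)
    have pq: "ext_d1 (w 1) y (frame w 2 y) (frame w 3 y) = p y"
      "ext_d1 (w 1) y (frame w 2 y) (frame w 4 y) = - (\<nu> y * p y)"
      "ext_d1 (w 2) y (frame w 3 y) (frame w 4 y) = k y"
      using p0[OF y] by (simp_all add: p_def \<nu>_def k_def sc_def)
    have "sc ?w 1 2 3 y = \<tau> y * (1 / \<mu> y * (\<tau> y * p y))"
      unfolding sc_def by (simp add: fr[OF y] D1[OF y] d bl pq)
    then show "sc ?w 1 2 3 y = 1" using \<mu>0[OF y] by (simp add: \<mu>_def power2_eq_square)
    show "sc ?w 1 2 4 y = 0" "sc ?w 1 3 4 y = 0"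
      unfolding sc_def by (simp_all add: fr[OF y] D1[OF y] d bl pq inner_add_right 134 ext_d1_self)
    have "sc ?w 2 3 4 y = \<mu> y * (\<tau> y * (\<mu> y * k y))"
      unfolding sc_def by (simp add: fr[OF y] D2[OF y] d bl pq inner_add_right 134 ext_d1_self)
    also have "\<dots> = \<tau> y ^ 5 * (k y * p y ^ 2)" unfolding \<mu>_def by (simp add: eval_nat_numeral mult_ac)
    finally show "sc ?w 2 3 4 y = 1" using \<tau>5[OF y] by simp
  qed
  have "adapted V \<Omega> D ?w"
    unfolding adapted_def
  proof (intro conjI ballI allI)
    show "coframe V ?w" by (rule c')
  next
    fix y u v assume y: "y \<in> V"
    have "\<Omega> y u v = wedge (w 1 y) (w 3 y) u v + wedge (w 2 y) (w 4 y) u v" 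
      using assms y unfolding adapted_def by blast
    moreover have "wedge (?w 1 y) (?w 3 y) u v = wedge (w 1 y) (w 3 y) u v - \<nu> y * wedge (w 1 y) (w 4 y) u v"
      using \<tau>0[OF y] by (simp add: wedge_def inner_diff_left) (simp add: algebra_simps)
    moreover have "wedge (?w 2 y) (?w 4 y) u v = wedge (w 2 y) (w 4 y) u v + \<nu> y * wedge (w 1 y) (w 4 y) u v"
      using \<mu>0[OF y] by (simp add: wedge_def inner_add_left) (simp add: algebra_simps)
    ultimately show "\<Omega> y u v = wedge (?w 1 y) (?w 3 y) u v + wedge (?w 2 y) (?w 4 y) u v" by simp
  next
    fix y assume y: "y \<in> V"
    have "D y = {v. w 1 y \<bullet> v = 0 \<and> w 2 y \<bullet> v = 0}"
      using assms y unfolding adapted_def by blast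
    moreover have "(?w 1 y \<bullet> v = 0 \<and> ?w 2 y \<bullet> v = 0) = (w 1 y \<bullet> v = 0 \<and> w 2 y \<bullet> v = 0)" for v
      using \<tau>0[OF y] \<mu>0[OF y] by (cases "w 1 y \<bullet> v = 0") (simp_all add: inner_add_left)
    ultimately show "D y = {v. ?w 1 y \<bullet> v = 0 \<and> ?w 2 y \<bullet> v = 0}" by (simp only:)
    show "sc ?w 1 3 4 y = 0" "sc ?w 2 3 4 y \<noteq> 0" "sc ?w 1 2 3 y \<noteq> 0 \<or> sc ?w 1 2 4 y \<noteq> 0"
      using sc1[OF y] by simp_all
  qed
  then show ?thesis using sc1 by blast
qed

lemma canonical_exists:
  assumes "adapted V \<Omega> D w0" "\<And>y. y \<in> V \<Longrightarrow> sc w0 1 2 3 y \<noteq> 0"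
  shows "\<exists>w'. canonical_coframe V \<Omega> D w'"
proof -
  obtain w where w: "adapted V \<Omega> D w"
    and n: "\<And>y. y \<in> V \<Longrightarrow> sc w 1 2 3 y = 1 \<and> sc w 1 2 4 y = 0 \<and> sc w 2 3 4 y = 1"
    using rescaled_exists[OF assms] by blast
  note c = adapted_coframe[OF w] and o = coframe_open[OF adapted_coframe[OF w]]
  note s = coframe_smooth[OF c]
  \<comment> \<open>Passing to e_1 - a e_3 - b e_4 and e_2 - b e_3 - g e_4 adds \<open>g\<close> to
    \<open>sc w 2 2 3\<close>, subtracts \<open>b\<close> from \<open>sc w 2 2 4\<close>, and adds
    \<open>a\<close> to \<open>sc w 1 1 2\<close> besides terms in \<open>b\<close> and
    \<open>g\<close>. The values are those that make all three vanish.\<close>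
  define g where "g = (\<lambda>y. - sc w 2 2 3 y)"
  define b where "b = sc w 2 2 4"
  define a where "a = (\<lambda>y. b y * sc w 1 1 3 y + g y * sc w 1 1 4 y - sc w 1 1 2 y)"
  have sm0: "smooth_on V g" "smooth_on V b" "smooth_on V a"
    unfolding a_def b_def g_def
    by (intro smooth_on_minus[OF o] smooth_on_add[OF o] smooth_on_diff[OF o] smooth_on_mult[OF o] smooth_on_sc[OF c])+
  let ?w3 = "\<lambda>y. w 3 y + a y *\<^sub>R w 1 y + b y *\<^sub>R w 2 y" and ?w4 = "\<lambda>y. w 4 y + b y *\<^sub>R w 1 y + g y *\<^sub>R w 2 y"
  let ?e1 = "\<lambda>y. frame w 1 y - a y *\<^sub>R frame w 3 y - b y *\<^sub>R frame w 4 y"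
    and ?e2 = "\<lambda>y. frame w 2 y - b y *\<^sub>R frame w 3 y - g y *\<^sub>R frame w 4 y"
  let ?w = "pick4 (w 1) (w 2) ?w3 ?w4"
  have sm: "smooth_on V ?w3" "smooth_on V ?w4"
    by (intro smooth_on_add[OF o] smooth_on_scaleR[OF o] sm0 s)+
  have dual: "\<forall>i j. pick4 (w 1 y) (w 2 y) (?w3 y) (?w4 y) i \<bullet> pick4 (?e1 y) (?e2 y) (frame w 3 y) (frame w 4 y) j = (if i = j then 1 else 0)"
    if "y \<in> V" for y
    unfolding forall_4 using frame_dual[OF coframe_det[OF c that]]
    by (simp add: inner_add_left inner_add_right inner_diff_left inner_diff_right)
  have c': "coframe V ?w" using coframe_pick4(1)[OF o s s sm dual] .
  have fr: "frame ?w j y = pick4 (?e1 y) (?e2 y) (frame w 3 y) (frame w 4 y) j" if "y \<in> V" for j y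
    using coframe_pick4(2)[OF o s s sm dual that] .
  have sc1: "sc ?w 1 2 3 y = 1 \<and> sc ?w 1 2 4 y = 0 \<and> sc ?w 2 3 4 y = 1 \<and> sc ?w 1 1 2 y = 0 \<and> sc ?w 2 2 3 y = 0
      \<and> sc ?w 2 2 4 y = 0" "sc ?w 1 3 4 y = 0" if y: "y \<in> V" for y
  proof -
    note B1 = bilinear_ext_d1_coframe[OF c y, of 1] and B2 = bilinear_ext_d1_coframe[OF c y, of 2]
    note bl = bilinear_lsub[OF B1] bilinear_rsub[OF B1] bilinear_lmul[OF B1] bilinear_rmul[OF B1]
      bilinear_lsub[OF B2] bilinear_rsub[OF B2] bilinear_lmul[OF B2] bilinear_rmul[OF B2]
    let ?e = "\<lambda>i. frame w i y"
    have "sc w 1 3 4 y = 0" using w y unfolding adapted_def by blast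
    then have v: "ext_d1 (w 1) y (?e 3) (?e 4) = 0" "ext_d1 (w 1) y (?e 2) (?e 3) = 1"
      "ext_d1 (w 1) y (?e 2) (?e 4) = 0" "ext_d1 (w 2) y (?e 3) (?e 4) = 1"
      "ext_d1 (w 2) y (?e 2) (?e 3) = - g y" "ext_d1 (w 2) y (?e 2) (?e 4) = b y"
      "ext_d1 (w 1) y (?e 1) (?e 2) = b y * ext_d1 (w 1) y (?e 1) (?e 3) + g y * ext_d1 (w 1) y (?e 1) (?e 4) - a y"
      using n[OF y] by (simp_all add: sc_def g_def b_def a_def)
    note al = ext_d1_self ext_d1_alt[of _ _ "?e 4" "?e 3"] ext_d1_alt[of _ _ "?e 3" "?e 2"] ext_d1_alt[of _ _ "?e 4" "?e 2"]
    show "sc ?w 1 2 3 y = 1 \<and> sc ?w 1 2 4 y = 0 \<and> sc ?w 2 3 4 y = 1 \<and> sc ?w 1 1 2 y = 0 \<and> sc ?w 2 2 3 y = 0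
        \<and> sc ?w 2 2 4 y = 0" "sc ?w 1 3 4 y = 0"
      unfolding sc_def by (simp_all add: fr[OF y] bl al v)
  qed
  have "adapted V \<Omega> D ?w"
    unfolding adapted_def
  proof (intro conjI ballI allI)
    show "coframe V ?w" by (rule c')
  next
    fix y u v assume y: "y \<in> V"
    have "\<Omega> y u v = wedge (w 1 y) (w 3 y) u v + wedge (w 2 y) (w 4 y) u v" 
      using w y unfolding adapted_def by blast
    then show "\<Omega> y u v = wedge (?w 1 y) (?w 3 y) u v + wedge (?w 2 y) (?w 4 y) u v"
      by (simp add: wedge_def inner_add_left algebra_simps)
  next
    fix y assume y: "y \<in> V"
    show "D y = {v. ?w 1 y \<bullet> v = 0 \<and> ?w 2 y \<bullet> v = 0}"
      using w y unfolding adapted_def by simp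
    show "sc ?w 1 3 4 y = 0" "sc ?w 2 3 4 y \<noteq> 0" "sc ?w 1 2 3 y \<noteq> 0 \<or> sc ?w 1 2 4 y \<noteq> 0"
      using sc1[OF y] by simp_all
  qed
  then have "canonical_coframe V \<Omega> D ?w" using sc1(1) unfolding canonical_coframe_def by blast
  then show ?thesis by blast
qed

section \<open>Naturality\<close>

text \<open>Preserving a nondegenerate form makes the derivative injective, hence bijective, so the
  preimages of the frame of \<open>w'\<close> are dual to the pulled back coframe. Structure
  functions carry over because the exterior derivative commutes with pullback.\<close>

lemma adapted_pull:
  assumes "open V" "smooth_on V F" "F ` V \<subseteq> V'" "adapted V' \<Omega>' D' w'"
    "\<And>y u v. y \<in> V \<Longrightarrow> \<Omega>' (F y) (frechet_derivative F (at y) u) (frechet_derivative F (at y) v) = \<Omega> y u v"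
    "\<And>y. y \<in> V \<Longrightarrow> frechet_derivative F (at y) ` D y = D' (F y)"
    "\<And>y u. y \<in> V \<Longrightarrow> (\<And>v. \<Omega> y u v = 0) \<Longrightarrow> u = 0"
  shows "adapted V \<Omega> D (\<lambda>i. pull1 F (w' i))"
    "y \<in> V \<Longrightarrow> frechet_derivative F (at y) (frame (\<lambda>i. pull1 F (w' i)) j y) = frame w' j (F y)"
    "y \<in> V \<Longrightarrow> sc (\<lambda>i. pull1 F (w' i)) i j k y = sc w' i j k (F y)"
proof -
  let ?D = "\<lambda>y. frechet_derivative F (at y)"
  let ?p = "\<lambda>i. pull1 F (w' i)"
  note c' = adapted_coframe[OF assms(4)] and o' = coframe_open[OF adapted_coframe[OF assms(4)]]
  have \<Omega>': "\<Omega>' z u v = wedge (w' 1 z) (w' 3 z) u v + wedge (w' 2 z) (w' 4 z) u v" if "z \<in> V'" for z u v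
    using assms(4) that unfolding adapted_def by blast
  have lin: "linear (?D y)" if "y \<in> V" for y by (rule smooth_on_linear_frechet[OF assms(2) that])
  have inj: "inj (?D y)" if y: "y \<in> V" for y
    unfolding linear_injective_0[OF lin[OF y]]
  proof (intro allI impI)
    fix u assume "?D y u = 0"
    then show "u = 0"
      using assms(7)[OF y, of u] assms(5)[OF y, of u] \<Omega>'[of "F y"] y assms(3) by (auto simp: wedge_def)
  qed
  have inner: "?p i y \<bullet> u = w' i (F y) \<bullet> ?D y u" if "y \<in> V" for i y u
    by (rule pull1_inner[OF smooth_on_differentiable[OF assms(2) that]])
  define e where "e y j = inv_into UNIV (?D y) (frame w' j (F y))" for y j
  have e: "?D y (e y j) = frame w' j (F y)" if "y \<in> V" for y j
    unfolding e_def by (rule surj_f_inv_f[OF linear_inj_imp_surj[OF lin[OF that] inj[OF that]]])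
  have dual: "?p i y \<bullet> e y j = (if i = j then 1 else 0)" if "y \<in> V" for i j y
    using frame_dual[OF coframe_det[OF c'], of "F y" i j] assms(3) that by (auto simp: inner e)
  have sm: "smooth_on V (?p i)" for i
    by (rule smooth_on_pull1[OF assms(1) o' assms(3,2) coframe_smooth[OF c']])
  have c: "coframe V ?p" by (rule coframe_of_dual(1)[OF assms(1) sm, where e = "\<lambda>j y. e y j"]) (rule dual)
  have fr: "frame ?p j y = e y j" if "y \<in> V" for j y
    by (rule coframe_of_dual(2)[OF assms(1) sm, where e = "\<lambda>j y. e y j"]) (rule dual, assumption, rule that)
  show DF: "?D y (frame ?p j y) = frame w' j (F y)" if "y \<in> V" for j y
    by (simp add: fr e that)
  show sc: "sc ?p i j k y = sc w' i j k (F y)" if "y \<in> V" for i j k y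
    unfolding sc_def ext_d1_pull1[OF assms(1) o' assms(3,2) coframe_smooth[OF c'] that] DF[OF that] ..
  show "adapted V \<Omega> D ?p"
    unfolding adapted_def
  proof (intro conjI ballI allI)
    show "coframe V ?p" by (rule c)
  next
    fix y u v assume y: "y \<in> V"
    then have Fy: "F y \<in> V'" using assms(3) by blast
    show "\<Omega> y u v = wedge (?p 1 y) (?p 3 y) u v + wedge (?p 2 y) (?p 4 y) u v"
      unfolding assms(5)[OF y, symmetric] \<Omega>'[OF Fy] wedge_def inner[OF y] ..
  next
    fix y assume y: "y \<in> V"
    then have Fy: "F y \<in> V'" using assms(3) by blast
    have D': "D' (F y) = {v. w' 1 (F y) \<bullet> v = 0 \<and> w' 2 (F y) \<bullet> v = 0}"
      using assms(4) Fy unfolding adapted_def by blast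
    have "v \<in> D y \<longleftrightarrow> ?D y v \<in> D' (F y)" for v
      unfolding assms(6)[OF y, symmetric] using inj[OF y] by (simp add: inj_image_mem_iff)
    then show "D y = {v. ?p 1 y \<bullet> v = 0 \<and> ?p 2 y \<bullet> v = 0}"
      unfolding D' inner[OF y] by blast
    show "sc ?p 1 3 4 y = 0" "sc ?p 2 3 4 y \<noteq> 0" "sc ?p 1 2 3 y \<noteq> 0 \<or> sc ?p 1 2 4 y \<noteq> 0"
      unfolding sc[OF y] using assms(4) Fy unfolding adapted_def by blast+
  qed
qed

section \<open>Integration of divergences over \<open>\<real>\<^sup>4\<close>\<close>

lemma directional_has_real_derivative:
  fixes h :: "'a::real_normed_vector \<Rightarrow> real"
  assumes "h differentiable (at (p + s *\<^sub>R w))"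
  shows "((\<lambda>s. h (p + s *\<^sub>R w)) has_real_derivative frechet_derivative h (at (p + s *\<^sub>R w)) w) (at s)"
proof -
  have "((\<lambda>s. p + s *\<^sub>R w) has_derivative (\<lambda>s. s *\<^sub>R w)) (at s)"
    by (auto intro!: derivative_eq_intros)
  from has_derivative_comp_at[OF this has_frechet[OF assms]]
  show ?thesis
    unfolding has_field_derivative_def linear_scale[OF linear_frechet_derivative[OF assms]]
    by (simp add: mult_commute_abs)
qed

lemma integrable_compact_support:
  fixes g :: "'a::euclidean_space \<Rightarrow> real"
  assumes "continuous_on UNIV g" "\<And>x. x \<notin> cball a r \<Longrightarrow> g x = 0"
  shows "integrable lborel g"
proof -
  have "integrable lborel (\<lambda>x. indicator (cball a r) x *\<^sub>R g x)"
    by (rule borel_integrable_compact[OF compact_cball continuous_on_subset[OF assms(1)]]) simp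
  moreover have "(\<lambda>x. indicator (cball a r) x *\<^sub>R g x) = g"
    using assms(2) by (intro ext) (auto simp: indicator_def)
  ultimately show ?thesis by simp
qed

lemma frechet_zero_outside:
  assumes "\<And>x. x \<notin> cball a r \<Longrightarrow> f x = 0" "x \<notin> cball a r"
  shows "frechet_derivative f (at x) v = 0"
proof -
  have "(f has_derivative (\<lambda>_. 0)) (at x)"
    by (rule has_derivative_transform_within_open[OF has_derivative_const, of "- cball a r"])
      (use assms in \<open>auto simp: open_Compl\<close>)
  from frechet_eqI[OF this] show ?thesis by simp
qed

lemma integral_shift_lborel:
  fixes f :: "'a::euclidean_space \<Rightarrow> real"
  assumes "continuous_on UNIV f"
  shows "integral\<^sup>L lborel (\<lambda>x. f (c + x)) = integral\<^sup>L lborel f"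
proof -
  have m: "f \<in> borel_measurable borel" by (rule borel_measurable_continuous_onI[OF assms])
  have "integral\<^sup>L lborel f = integral\<^sup>L (distr lborel borel ((+) c)) f" by (simp add: lborel_distr_plus)
  also have "\<dots> = integral\<^sup>L lborel (\<lambda>x. f (c + x))"
    by (rule integral_distr) (use m in auto)
  finally show ?thesis by simp
qed

text \<open>The difference quotients have integral zero by translation invariance of Lebesgue
  measure, and they converge to the derivative; dominated convergence passes to the limit.\<close>

lemma integral_directional_derivative:
  fixes f :: "real^4 \<Rightarrow> real"
  assumes "Ck_on 1 UNIV f" "\<And>x. x \<notin> cball a r \<Longrightarrow> f x = 0"
  shows "integrable lborel (\<lambda>x. frechet_derivative f (at x) v)"
    "integral\<^sup>L lborel (\<lambda>x. frechet_derivative f (at x) v) = 0"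
proof -
  let ?f' = "\<lambda>x. frechet_derivative f (at x) v"
  have df: "f differentiable (at x)" for x using assms(1) by simp
  have cf': "continuous_on UNIV ?f'" using assms(1) by simp
  have cf: "continuous_on UNIV f" by (rule Ck_on_imp_continuous_on[OF assms(1)])
  have z: "?f' x = 0" if "x \<notin> cball a r" for x by (rule frechet_zero_outside[OF assms(2) that])
  show "integrable lborel ?f'" by (rule integrable_compact_support[OF cf' z])
  have "bounded (?f' ` cball a r)"
    by (rule compact_imp_bounded[OF compact_continuous_image[OF continuous_on_subset[OF cf']]]) auto
  then obtain B0 where "\<forall>y\<in>?f' ` cball a r. norm y \<le> B0"
    unfolding bounded_iff by blast
  then have B0: "\<bar>?f' x\<bar> \<le> B0" if "x \<in> cball a r" for x
    using that by simp
  define B where "B = max 0 B0"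
  have B: "\<bar>?f' x\<bar> \<le> B" for x
    using B0[of x] z[of x] by (cases "x \<in> cball a r") (auto simp: B_def)
  \<comment> \<open>The step sizes are at most 1, so all difference quotients vanish outside the
    ball of radius \<open>r + norm v\<close>.\<close>
  define h where "h n = inverse (real (Suc n))" for n
  have h: "0 < h n" "h n \<le> 1" for n by (auto simp: h_def divide_simps)
  let ?s = "\<lambda>n x. (f (h n *\<^sub>R v + x) - f x) / h n"
  have ish: "integrable lborel (\<lambda>x. f (c + x))" for c
    by (rule integrable_compact_support[where a = "a - c" and r = r])
      (auto intro!: continuous_on_compose2[OF cf] continuous_intros assms(2) simp: dist_norm algebra_simps)
  have s0: "integral\<^sup>L lborel (?s n) = 0" for n
    using ish[of "h n *\<^sub>R v"] ish[of 0] integral_shift_lborel[OF cf] by simp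
  have "(\<lambda>n. integral\<^sup>L lborel (?s n)) \<longlonglongrightarrow> integral\<^sup>L lborel ?f'"
  proof (rule integral_dominated_convergence)
    show "?f' \<in> borel_measurable lborel" using borel_measurable_continuous_onI[OF cf'] by simp
    show "?s n \<in> borel_measurable lborel" for n
      using ish[of "h n *\<^sub>R v"] ish[of 0] by simp
    have "integrable lborel (\<lambda>x. indicator (cball a (r + norm v)) x *\<^sub>R B)"
      by (rule borel_integrable_compact) auto
    then show "integrable lborel (\<lambda>x. B * indicator (cball a (r + norm v)) x)" by (simp add: mult.commute)
    show "AE x in lborel. norm (?s n x) \<le> B * indicator (cball a (r + norm v)) x" for n
    proof (rule AE_I2)
      fix x
      show "norm (?s n x) \<le> B * indicator (cball a (r + norm v)) x"
      proof (cases "x \<in> cball a (r + norm v)")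
        case True
        have "\<exists>\<xi>. 0 < \<xi> \<and> \<xi> < h n \<and> f (x + h n *\<^sub>R v) - f (x + 0 *\<^sub>R v) = (h n - 0) * ?f' (x + \<xi> *\<^sub>R v)"
          by (rule MVT2[OF h(1)]) (rule directional_has_real_derivative[OF df])
        then obtain \<xi> where "f (x + h n *\<^sub>R v) - f x = h n * ?f' (x + \<xi> *\<^sub>R v)" by auto
        then have "?s n x = ?f' (x + \<xi> *\<^sub>R v)" using h(1)[of n] by (simp add: add.commute)
        then show ?thesis using True B by simp
      next
        case False
        have "norm (h n *\<^sub>R v) \<le> norm v" using h[of n] by (simp add: mult_left_le_one_le)
        moreover have "dist a x \<le> dist a (h n *\<^sub>R v + x) + norm (h n *\<^sub>R v)"
          using dist_triangle[of a x "h n *\<^sub>R v + x"] by (simp add: dist_norm)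
        ultimately have "x \<notin> cball a r" "h n *\<^sub>R v + x \<notin> cball a r" using False norm_ge_zero[of v]
          unfolding mem_cball not_le by linarith+
        then show ?thesis using assms(2) False by simp
      qed
    qed
    show "AE x in lborel. (\<lambda>n. ?s n x) \<longlonglongrightarrow> ?f' x"
    proof (rule AE_I2)
      fix x
      have "((\<lambda>s. f (x + s *\<^sub>R v)) has_real_derivative ?f' (x + 0 *\<^sub>R v)) (at 0)"
        by (rule directional_has_real_derivative[OF df])
      then have "((\<lambda>t. (f (x + (0 + t) *\<^sub>R v) - f (x + 0 *\<^sub>R v)) / t) \<longlongrightarrow> ?f' x) (at 0)"
        unfolding DERIV_def by simp
      moreover have "filterlim h (at 0) sequentially"
      proof -
        have "h \<longlonglongrightarrow> 0" using LIMSEQ_inverse_real_of_nat by (simp only: h_def[abs_def])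
        moreover have "h n \<noteq> 0" for n using h(1)[of n] by simp
        ultimately show ?thesis unfolding filterlim_at by simp
      qed
      ultimately have "((\<lambda>n. (f (x + (0 + h n) *\<^sub>R v) - f (x + 0 *\<^sub>R v)) / h n) \<longlongrightarrow> ?f' x) sequentially"
        by (rule filterlim_compose)
      then show "(\<lambda>n. ?s n x) \<longlonglongrightarrow> ?f' x" by (simp add: add.commute)
    qed
  qed
  then show "integral\<^sup>L lborel ?f' = 0" unfolding s0 by (simp add: LIMSEQ_const_iff)
qed

lemma Ck_on_extend_zero:
  assumes "open S" "cball a r \<subseteq> S" "Ck_on k S g" "\<And>x. x \<in> S \<Longrightarrow> x \<notin> cball a r \<Longrightarrow> g x = 0"
  shows "Ck_on k UNIV (\<lambda>x. if x \<in> S then g x else 0)"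
proof (rule Ck_on_local)
  fix x :: "real^4"
  show "\<exists>V. open V \<and> x \<in> V \<and> Ck_on k V (\<lambda>x. if x \<in> S then g x else 0)"
  proof (cases "x \<in> S")
    case True
    have "Ck_on k S (\<lambda>x. if x \<in> S then g x else 0)" by (rule Ck_on_cong[OF assms(1) _ assms(3)]) simp
    then show ?thesis using assms(1) True by blast
  next
    case False
    have o: "open (- cball a r)" by (simp add: open_Compl)
    have "Ck_on k (- cball a r) (\<lambda>x. if x \<in> S then g x else 0)"
      by (rule Ck_on_cong[OF o _ Ck_on_const[of _ _ 0]]) (use assms(4) in auto)
    moreover have "x \<in> - cball a r" using False assms(2) by blast
    ultimately show ?thesis using o by blast
  qed
qed

text \<open>The components of \<open>h\<close> times \<open>Y\<close>, extended by zero, have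
  partial derivatives of integral zero; by the product rule the relevant ones add up to the
  integrand.\<close>

lemma divergence_compact_support:
  fixes h :: "real^4 \<Rightarrow> real" and Y :: "real^4 \<Rightarrow> real^4"
  assumes "open S" "cball a r \<subseteq> S" "Ck_on 1 S h" "\<And>x. x \<in> S \<Longrightarrow> x \<notin> cball a r \<Longrightarrow> h x = 0"
    "Ck_on 1 S Y" "\<And>x. x \<in> S \<Longrightarrow> (\<Sum>m\<in>UNIV. frechet_derivative (\<lambda>z. Y z $ m) (at x) (axis m 1)) = d x"
  shows "integral\<^sup>L lborel (\<lambda>x. if x \<in> S then frechet_derivative h (at x) (Y x) + h x * d x else 0) = 0"
proof -
  let ?G = "\<lambda>m x. if x \<in> S then h x * Y x $ m else 0"
  have ckG: "Ck_on 1 UNIV (?G m)" for m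
  proof (rule Ck_on_extend_zero[OF assms(1,2)])
    show "Ck_on 1 S (\<lambda>x. h x * Y x $ m)"
      by (intro Ck_on_bilinear[OF bounded_bilinear_mult] Ck_on_linear[OF bounded_linear_vec_nth] assms(1,3,5))
  qed (simp add: assms(4))
  have G0: "?G m x = 0" if "x \<notin> cball a r" for m x using assms(4) that by auto
  note I = integral_directional_derivative[OF ckG G0]
  have dh: "h differentiable (at x)" and dY: "(\<lambda>z. Y z $ m) differentiable (at x)" if "x \<in> S" for x m
    using assms(3) Ck_on_linear[OF bounded_linear_vec_nth assms(1,5), of m] that by auto
  have eq: "(\<Sum>m\<in>UNIV. frechet_derivative (?G m) (at x) (axis m 1))
      = (if x \<in> S then frechet_derivative h (at x) (Y x) + h x * d x else 0)" for x
  proof (cases "x \<in> S")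
    case True
    have "(?G m has_derivative (\<lambda>v. h x * frechet_derivative (\<lambda>z. Y z $ m) (at x) v
        + frechet_derivative h (at x) v * Y x $ m)) (at x)" for m
      by (rule has_derivative_transform_within_open[OF has_derivative_mult[OF has_frechet[OF dh[OF True]]
            has_frechet[OF dY[OF True]]] assms(1) True]) simp
    note fr = frechet_eqI[OF this]
    have "frechet_derivative h (at x) (Y x) = (\<Sum>m\<in>UNIV. frechet_derivative h (at x) (axis m 1) * Y x $ m)"
      using linear_axis_expansion[OF linear_frechet_derivative[OF dh[OF True]], of "Y x"] by (simp add: mult.commute)
    then show ?thesis
      unfolding fr using True assms(6)[OF True] by (simp add: sum.distrib sum_distrib_left[symmetric])
  next
    case False
    then have "x \<notin> cball a r" using assms(2) by blast
    then have "frechet_derivative (?G m) (at x) v = 0" for m v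
      using frechet_zero_outside[of a r "?G m" x v, OF G0] by blast
    then show ?thesis using False by simp
  qed
  have "integral\<^sup>L lborel (\<lambda>x. \<Sum>m\<in>UNIV. frechet_derivative (?G m) (at x) (axis m 1)) = 0"
    using I by (simp add: Bochner_Integration.integral_sum)
  then show ?thesis unfolding eq .
qed

lemma change_of_variables_open:
  fixes F :: "real^4 \<Rightarrow> real"
  assumes "open S" "\<And>x. x \<in> S \<Longrightarrow> g differentiable (at x)" "inj_on g S"
    "continuous_on UNIV F" "\<And>y. y \<notin> cball a r \<Longrightarrow> F y = 0" "\<And>y. y \<notin> g ` S \<Longrightarrow> F y = 0"
    "open (g ` S)"
  shows "integral S (\<lambda>x. \<bar>det (matrix (frechet_derivative g (at x)))\<bar> * F (g x)) = integral\<^sup>L lborel F"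
proof -
  have iF: "integrable lborel F" by (rule integrable_compact_support[OF assms(4,5)])
  have gS: "g ` S \<in> sets lebesgue" and S: "S \<in> sets lebesgue" using assms by auto
  have abs: "F absolutely_integrable_on UNIV"
    using iF by (simp add: set_integrable_def integrable_completion)
  have "(\<lambda>y. if y \<in> g ` S then F y else 0) = F" using assms(6) by auto
  then have aF: "F absolutely_integrable_on (g ` S)"
    using abs absolutely_integrable_restrict_UNIV[of "g ` S" F] by simp
  have IF: "integral (g ` S) F = integral\<^sup>L lborel F"
    using integral_restrict_UNIV[of "g ` S" F] \<open>(\<lambda>y. if y \<in> g ` S then F y else 0) = F\<close> integral_lborel[OF iF] by simp
  \<comment> \<open>The change of variables theorem speaks of vector-valued functions; values in R^1
    bring a real function under it.\<close>
  let ?F = "\<lambda>y. vec (F y) :: real^1"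
  have der: "(g has_derivative frechet_derivative g (at x)) (at x within S)" if "x \<in> S" for x
    using has_frechet[OF assms(2)[OF that]] has_derivative_at_withinI by blast
  have "?F absolutely_integrable_on (g ` S) \<and> integral (g ` S) ?F = vec (integral\<^sup>L lborel F)"
    using aF IF by (simp add: absolutely_integrable_on_1_iff integral_on_1_eq)
  then have "(\<lambda>x. \<bar>det (matrix (frechet_derivative g (at x)))\<bar> *\<^sub>R ?F (g x)) absolutely_integrable_on S \<and>
      integral S (\<lambda>x. \<bar>det (matrix (frechet_derivative g (at x)))\<bar> *\<^sub>R ?F (g x)) = vec (integral\<^sup>L lborel F)"
    using has_absolute_integral_change_of_variables[OF S der assms(3), of ?F "vec (integral\<^sup>L lborel F)"] by simp
  then show ?thesis by (simp add: integral_on_1_eq)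
qed

section \<open>Charts\<close>

abbreviation cinv :: "'a chart \<Rightarrow> real^4 \<Rightarrow> 'a" where
  "cinv c \<equiv> inv_into (fst c) (snd c)"

lemma is_chart_topspace: "is_chart T c \<Longrightarrow> topspace (subtopology T (fst c)) = fst c"
  using openin_subset[of T "fst c"] by (auto simp: is_chart_def)

lemma is_chart_inj: "is_chart T c \<Longrightarrow> inj_on (snd c) (fst c)"
  using homeomorphic_imp_injective_map is_chart_topspace unfolding is_chart_def by metis

lemma is_chart_open: "is_chart T c \<Longrightarrow> openin T (fst c)" "is_chart T c \<Longrightarrow> open (cdom c)"
  by (simp_all add: is_chart_def)

lemma cinv_cdom:
  "x \<in> cdom c \<Longrightarrow> cinv c x \<in> fst c" "x \<in> cdom c \<Longrightarrow> snd c (cinv c x) = x"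
  by (auto simp: cdom_def inv_into_into f_inv_into_f)

lemma cinv_left: "is_chart T c \<Longrightarrow> p \<in> fst c \<Longrightarrow> cinv c (snd c p) = p"
  by (rule inv_into_f_f[OF is_chart_inj])

lemma chart_image_in_cdom: "p \<in> fst c \<Longrightarrow> snd c p \<in> cdom c"
  by (simp add: cdom_def)

lemma chart_open_image:
  assumes "is_chart T c" "W \<subseteq> fst c"
  shows "open (snd c ` W) \<longleftrightarrow> openin T W"
proof -
  have "openin (top_of_set (cdom c)) (snd c ` W) \<longleftrightarrow> openin (subtopology T (fst c)) W"
    using homeomorphic_map_openness[of _ _ "snd c" W] assms is_chart_topspace[OF assms(1)]
    unfolding is_chart_def by blast
  moreover have "snd c ` W \<subseteq> cdom c" using assms(2) by (auto simp: cdom_def)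
  ultimately show ?thesis
    using assms by (simp add: openin_open_eq openin_open_subtopology is_chart_open)
qed

lemma chart_compact_image:
  assumes "is_chart T c" "K \<subseteq> fst c" "compact (snd c ` K)"
  shows "compactin T K"
proof -
  have "compactin (top_of_set (cdom c)) (snd c ` K) \<longleftrightarrow> compactin (subtopology T (fst c)) K"
    using homeomorphic_map_compactness[of _ _ "snd c" K] assms is_chart_topspace[OF assms(1)]
    unfolding is_chart_def by blast
  moreover have "snd c ` K \<subseteq> cdom c" using assms(2) by (auto simp: cdom_def)
  ultimately show ?thesis using assms(3) by (simp add: compactin_subtopology)
qed

lemma chart_open_vimage:
  assumes "is_chart T c" "open U" "U \<subseteq> cdom c"
  shows "openin T {p \<in> fst c. snd c p \<in> U}"
proof -
  have "snd c ` {p \<in> fst c. snd c p \<in> U} = U" using assms(3) by (auto simp: cdom_def)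
  then show ?thesis using chart_open_image[OF assms(1), of "{p \<in> fst c. snd c p \<in> U}"] assms(2) by auto
qed

lemma rep_dom_eq:
  assumes "is_chart T c"
  shows "rep_dom c c' f = {x \<in> cdom c. f (cinv c x) \<in> fst c'}"
  unfolding rep_dom_def cdom_def using cinv_left[OF assms] by force

lemma rep_eq: "rep c c' f x = snd c' (f (cinv c x))"
  by (simp add: rep_def)

lemma open_rep_dom:
  assumes "is_chart T c" "is_chart T' c'" "continuous_map T T' f"
  shows "open (rep_dom c c' f)"
proof -
  have "openin T {p \<in> topspace T. f p \<in> fst c'}"
    using assms(3) is_chart_open(1)[OF assms(2)] by (simp add: openin_continuous_map_preimage)
  then have "openin T ({p \<in> topspace T. f p \<in> fst c'} \<inter> fst c)"
    using is_chart_open(1)[OF assms(1)] by blast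
  moreover have "{p \<in> topspace T. f p \<in> fst c'} \<inter> fst c = {p \<in> fst c. f p \<in> fst c'}"
    using openin_subset[OF is_chart_open(1)[OF assms(1)]] by auto
  ultimately have "openin T {p \<in> fst c. f p \<in> fst c'}" by simp
  then show ?thesis
    unfolding rep_dom_def using chart_open_image[OF assms(1), of "{p \<in> fst c. f p \<in> fst c'}"] by auto
qed

lemma manifold_chart: "smooth_manifold M \<Longrightarrow> c \<in> atlas M \<Longrightarrow> is_chart (mtop M) c"
  by (simp add: smooth_manifold_def)

lemma manifold_chart_exists:
  assumes "smooth_manifold M" "p \<in> points M"
  obtains c where "c \<in> atlas M" "p \<in> fst c"
  using assms unfolding smooth_manifold_def by blast

lemma open_transition_dom:
  assumes "smooth_manifold M" "c \<in> atlas M" "c' \<in> atlas M"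
  shows "open (rep_dom c c' id)"
  using open_rep_dom[OF manifold_chart manifold_chart, OF assms(1,2,1,3)] by simp

lemma transition_smooth:
  "smooth_manifold M \<Longrightarrow> c \<in> atlas M \<Longrightarrow> c' \<in> atlas M \<Longrightarrow> smooth_on (rep_dom c c' id) (rep c c' id)"
  by (simp add: smooth_manifold_def)

lemma transition_inverse:
  assumes "is_chart T c" "is_chart T c'" "x \<in> rep_dom c c' id"
  shows "rep c c' id x \<in> rep_dom c' c id" "rep c' c id (rep c c' id x) = x" "cinv c' (rep c c' id x) = cinv c x"
proof -
  have x: "x \<in> cdom c" "cinv c x \<in> fst c'" using assms(3) unfolding rep_dom_eq[OF assms(1)] by simp_all
  show "cinv c' (rep c c' id x) = cinv c x" using cinv_left[OF assms(2) x(2)] by (simp add: rep_eq)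
  then show "rep c c' id x \<in> rep_dom c' c id" "rep c' c id (rep c c' id x) = x"
    using x cinv_cdom[of x c] by (auto simp: rep_dom_eq[OF assms(2)] rep_eq chart_image_in_cdom)
qed

lemma transition_image:
  assumes "is_chart T c" "is_chart T c'"
  shows "rep c c' id ` rep_dom c c' id = rep_dom c' c id" "inj_on (rep c c' id) (rep_dom c c' id)"
proof -
  show "inj_on (rep c c' id) (rep_dom c c' id)"
    using transition_inverse(2)[OF assms] by (rule inj_on_inverseI)
  show "rep c c' id ` rep_dom c c' id = rep_dom c' c id"
  proof (intro Set.set_eqI iffI)
    fix z assume "z \<in> rep c c' id ` rep_dom c c' id"
    then show "z \<in> rep_dom c' c id" using transition_inverse(1)[OF assms] by blast
  next
    fix z assume "z \<in> rep_dom c' c id"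
    then show "z \<in> rep c c' id ` rep_dom c c' id"
      using transition_inverse(1,2)[OF assms(2,1), of z] by (metis imageI)
  qed
qed

section \<open>A vector field of constant divergence on a compact manifold\<close>

lemma max0_square_derivative:
  "((\<lambda>s::real. (max 0 s)\<^sup>2) has_real_derivative 2 * max 0 s) (at s)"
proof (cases s "0::real" rule: linorder_cases)
  case less
  have "((\<lambda>s::real. 0) has_real_derivative 2 * max 0 s) (at s)" using less by simp
  then show ?thesis
    by (rule DERIV_cong_ev[THEN iffD1, rotated 3])
      (use less eventually_nhds_in_open[of "{..<0}" s] in \<open>auto elim!: eventually_mono\<close>)
next
  case greater
  have "((\<lambda>s::real. s\<^sup>2) has_real_derivative 2 * max 0 s) (at s)"
    using greater by (auto intro!: derivative_eq_intros)
  then show ?thesis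
    by (rule DERIV_cong_ev[THEN iffD1, rotated 3])
      (use greater eventually_nhds_in_open[of "{0<..}" s] in \<open>auto elim!: eventually_mono\<close>)
next
  case equal
  have "((\<lambda>h::real. (max 0 h)\<^sup>2 / h) \<longlongrightarrow> 0) (at 0)"
  proof (rule Lim_null_comparison)
    show "((\<lambda>h::real. \<bar>h\<bar>) \<longlongrightarrow> 0) (at 0)" by (rule tendsto_rabs_zero[OF tendsto_ident_at])
    show "\<forall>\<^sub>F h::real in at 0. norm ((max 0 h)\<^sup>2 / h) \<le> \<bar>h\<bar>"
      by (rule always_eventually) (auto simp: max_def power2_eq_square)
  qed
  then show ?thesis using equal by (simp add: DERIV_def)
qed

text \<open>Squaring the truncated quadratic makes it continuously differentiable, which is the
  regularity that the integrations below ask of a partition of unity.\<close>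

definition bump :: "real^4 \<Rightarrow> real \<Rightarrow> real^4 \<Rightarrow> real" where
  "bump a r x = (max 0 (r\<^sup>2 - (x - a) \<bullet> (x - a)))\<^sup>2"

lemma bump_nonneg: "0 \<le> bump a r x" by (simp add: bump_def)

lemma bump_pos: "x \<in> ball a r \<Longrightarrow> 0 < bump a r x"
proof -
  assume "x \<in> ball a r"
  then have "norm (x - a) < r" by (simp add: dist_norm norm_minus_commute)
  then have "(norm (x - a))\<^sup>2 < r\<^sup>2" by (intro power_strict_mono) auto
  then show ?thesis by (simp add: bump_def power2_norm_eq_inner)
qed

lemma bump_zero: "0 < r \<Longrightarrow> x \<notin> cball a r \<Longrightarrow> bump a r x = 0"
proof -
  assume r: "0 < r" "x \<notin> cball a r"
  then have "r \<le> norm (x - a)" by (simp add: dist_norm norm_minus_commute)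
  then have "r\<^sup>2 \<le> (norm (x - a))\<^sup>2" using r by (intro power_mono) auto
  then show ?thesis by (simp add: bump_def power2_norm_eq_inner max_def)
qed

lemma Ck_on_bump: "Ck_on 1 UNIV (bump a r)"
proof -
  let ?q = "\<lambda>x. r\<^sup>2 - (x - a) \<bullet> (x - a)"
  have "(?q has_derivative (\<lambda>v. - (2 * ((x - a) \<bullet> v)))) (at x)" for x
    by (auto intro!: derivative_eq_intros simp: inner_commute)
  from has_derivative_comp_at[OF this max0_square_derivative[unfolded has_field_derivative_def]]
  have d: "(bump a r has_derivative (\<lambda>v. 2 * max 0 (?q x) * - (2 * ((x - a) \<bullet> v)))) (at x)" for x
    unfolding bump_def[abs_def] .
  have "continuous_on UNIV (\<lambda>x. 2 * max 0 (?q x) * - (2 * ((x - a) \<bullet> v)))" for v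
    by (intro continuous_intros)
  then show ?thesis
    using d frechet_eqI[OF d] by (auto simp: differentiable_def)
qed

text \<open>\<open>\<rho>\<close> is a positive density: it transforms with the absolute value of
  the Jacobian determinant, so no orientation is involved. The constant \<open>k\<close> is the
  divergence of \<open>X\<close> with respect to it.\<close>

locale const_divergence =
  fixes N :: "'b mfd" and X :: "'b chart \<Rightarrow> real^4 \<Rightarrow> real^4" and \<rho> :: "'b chart \<Rightarrow> real^4 \<Rightarrow> real" and k :: real
  assumes mfd: "smooth_manifold N" and cpt: "compact_space (mtop N)" and ne: "points N \<noteq> {}"
    and sX: "c \<in> atlas N \<Longrightarrow> smooth_on (cdom c) (X c)"
    and s\<rho>: "c \<in> atlas N \<Longrightarrow> smooth_on (cdom c) (\<rho> c)"
    and \<rho>_pos: "c \<in> atlas N \<Longrightarrow> x \<in> cdom c \<Longrightarrow> 0 < \<rho> c x"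
    and X_trans: "c \<in> atlas N \<Longrightarrow> c' \<in> atlas N \<Longrightarrow> x \<in> rep_dom c c' id \<Longrightarrow>
        X c' (rep c c' id x) = drep c c' id x (X c x)"
    and \<rho>_trans: "c \<in> atlas N \<Longrightarrow> c' \<in> atlas N \<Longrightarrow> x \<in> rep_dom c c' id \<Longrightarrow>
        \<rho> c x = \<bar>det (matrix (drep c c' id x))\<bar> * \<rho> c' (rep c c' id x)"
    and div: "c \<in> atlas N \<Longrightarrow> x \<in> cdom c \<Longrightarrow>
        (\<Sum>m\<in>UNIV. frechet_derivative (\<lambda>z. (\<rho> c z *\<^sub>R X c z) $ m) (at x) (axis m 1)) = k * \<rho> c x"
begin

definition C1 :: "('b \<Rightarrow> real) \<Rightarrow> bool" where
  "C1 f \<longleftrightarrow> (\<forall>c\<in>atlas N. Ck_on 1 (cdom c) (\<lambda>x. f (cinv c x)))"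

definition C0 :: "('b \<Rightarrow> real) \<Rightarrow> bool" where
  "C0 f \<longleftrightarrow> (\<forall>c\<in>atlas N. continuous_on (cdom c) (\<lambda>x. f (cinv c x)))"

definition supp :: "'b chart \<Rightarrow> real^4 \<Rightarrow> real \<Rightarrow> ('b \<Rightarrow> real) \<Rightarrow> bool" where
  "supp c a r f \<longleftrightarrow> c \<in> atlas N \<and> cball a r \<subseteq> cdom c \<and>
     (\<forall>p\<in>points N. \<not> (p \<in> fst c \<and> snd c p \<in> cball a r) \<longrightarrow> f p = 0)"

text \<open>The derivative along \<open>X\<close>. The chart is an arbitrary choice at each point;
  \<open>DX_chart\<close> shows that for \<open>C1\<close> functions any chart gives the same
  value.\<close>

definition DX :: "('b \<Rightarrow> real) \<Rightarrow> 'b \<Rightarrow> real" where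
  "DX f p = (let c = SOME c. c \<in> atlas N \<and> p \<in> fst c
     in frechet_derivative (\<lambda>x. f (cinv c x)) (at (snd c p)) (X c (snd c p)))"

text \<open>For a function supported inside the chart this is its integral over the manifold against
  the density; no global measure is constructed.\<close>

definition J :: "'b chart \<Rightarrow> ('b \<Rightarrow> real) \<Rightarrow> real" where
  "J c f = integral\<^sup>L lborel (\<lambda>x. if x \<in> cdom c then f (cinv c x) * \<rho> c x else 0)"

lemma chart: "c \<in> atlas N \<Longrightarrow> is_chart (mtop N) c"
  using manifold_chart[OF mfd] .

lemma chart_points: "c \<in> atlas N \<Longrightarrow> p \<in> fst c \<Longrightarrow> p \<in> points N"
  using openin_subset[OF is_chart_open(1)[OF chart]] by blast

lemma C1_diff: "C1 f \<Longrightarrow> c \<in> atlas N \<Longrightarrow> x \<in> cdom c \<Longrightarrow> (\<lambda>x. f (cinv c x)) differentiable (at x)"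
  by (simp add: C1_def)

lemma C1_C0: "C1 f \<Longrightarrow> C0 f"
  unfolding C1_def C0_def using Ck_on_imp_continuous_on by blast

lemma DX_chart:
  assumes "C1 f" "c \<in> atlas N" "x \<in> cdom c"
  shows "DX f (cinv c x) = frechet_derivative (\<lambda>x. f (cinv c x)) (at x) (X c x)"
proof -
  define p where "p = cinv c x"
  have p: "p \<in> fst c" "snd c p = x" using cinv_cdom[OF assms(3)] by (simp_all add: p_def)
  define c' where "c' = (SOME c. c \<in> atlas N \<and> p \<in> fst c)"
  have c': "c' \<in> atlas N" "p \<in> fst c'"
    using someI_ex[of "\<lambda>c. c \<in> atlas N \<and> p \<in> fst c"] assms(2) p(1) unfolding c'_def by blast+
  let ?g = "rep c c' id" and ?S = "rep_dom c c' id"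
  have xS: "x \<in> ?S" using assms(3) c'(2) unfolding rep_dom_eq[OF chart[OF assms(2)]] by (simp add: p_def)
  have oS: "open ?S" by (rule open_transition_dom[OF mfd assms(2) c'(1)])
  have gx: "?g x = snd c' p" by (simp add: rep_eq p_def)
  have d1: "(?g has_derivative drep c c' id x) (at x)"
    by (rule smooth_on_has_derivative[OF transition_smooth[OF mfd assms(2) c'(1)] xS])
  have d2: "((\<lambda>x. f (cinv c' x)) has_derivative frechet_derivative (\<lambda>x. f (cinv c' x)) (at (?g x))) (at (?g x))"
    by (rule has_frechet[OF C1_diff[OF assms(1) c'(1)]]) (simp add: gx chart_image_in_cdom c')
  have "((\<lambda>x. f (cinv c x)) has_derivative (\<lambda>v. frechet_derivative (\<lambda>x. f (cinv c' x)) (at (?g x)) (drep c c' id x v))) (at x)"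
    by (rule has_derivative_transform_within_open[OF has_derivative_comp_at[OF d1 d2] oS xS])
      (rule arg_cong[where f = f], rule transition_inverse(3)[OF chart[OF assms(2)] chart[OF c'(1)]])
  from frechet_eqI[OF this] show ?thesis
    unfolding DX_def Let_def p_def[symmetric] c'_def[symmetric] gx[symmetric]
    by (simp add: X_trans[OF assms(2) c'(1) xS])
qed

lemma C0_DX:
  assumes "C1 f"
  shows "C0 (DX f)"
  unfolding C0_def
proof
  fix c assume c: "c \<in> atlas N"
  have ck: "Ck_on 1 (cdom c) (\<lambda>x. f (cinv c x))" using assms c by (simp add: C1_def)
  have "continuous_on (cdom c) (\<lambda>x. \<Sum>m\<in>UNIV. X c x $ m * frechet_derivative (\<lambda>x. f (cinv c x)) (at x) (axis m 1))"
    using ck smooth_on_continuous_on[OF sX[OF c]] by (intro continuous_intros) auto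
  moreover have "DX f (cinv c x) = (\<Sum>m\<in>UNIV. X c x $ m * frechet_derivative (\<lambda>x. f (cinv c x)) (at x) (axis m 1))"
    if "x \<in> cdom c" for x
    unfolding DX_chart[OF assms c that]
    using linear_axis_expansion[OF linear_frechet_derivative[OF C1_diff[OF assms c that]], of "X c x"] by simp
  ultimately show "continuous_on (cdom c) (\<lambda>x. DX f (cinv c x))"
    using continuous_on_cong[of "cdom c" "cdom c" "\<lambda>x. DX f (cinv c x)"] by simp
qed

lemma supp_zero:
  assumes "supp c a r f" "x \<in> cdom c" "x \<notin> cball a r"
  shows "f (cinv c x) = 0"
proof -
  have "cinv c x \<in> points N" using assms(1) chart_points cinv_cdom(1)[OF assms(2)] unfolding supp_def by blast
  then show ?thesis using assms cinv_cdom[OF assms(2)] unfolding supp_def by simp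
qed

lemma J_continuous:
  assumes "C0 f" "supp c a r f"
  shows "continuous_on UNIV (\<lambda>x. if x \<in> cdom c then f (cinv c x) * \<rho> c x else 0)"
proof -
  have c: "c \<in> atlas N" "cball a r \<subseteq> cdom c" using assms(2) by (auto simp: supp_def)
  have "continuous_on (cdom c) (\<lambda>x. f (cinv c x) * \<rho> c x)"
    using assms(1) c smooth_on_continuous_on[OF s\<rho>[OF c(1)]] by (intro continuous_intros) (auto simp: C0_def)
  then have "Ck_on 0 (cdom c) (\<lambda>x. f (cinv c x) * \<rho> c x)" by simp
  from Ck_on_extend_zero[OF is_chart_open(2)[OF chart[OF c(1)]] c(2) this] supp_zero[OF assms(2)]
  show ?thesis by simp
qed

lemma J_integrable:
  assumes "C0 f" "supp c a r f"
  shows "integrable lborel (\<lambda>x. if x \<in> cdom c then f (cinv c x) * \<rho> c x else 0)"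
  by (rule integrable_compact_support[OF J_continuous[OF assms]]) (use supp_zero[OF assms(2)] in auto)

lemma J_cong: "(\<And>p. p \<in> fst c \<Longrightarrow> f p = g p) \<Longrightarrow> J c f = J c g"
  unfolding J_def by (rule Bochner_Integration.integral_cong) (auto simp: cinv_cdom)

lemma J_add:
  assumes "C0 f" "supp c a r f" "C0 g" "supp c a r g"
  shows "J c (\<lambda>p. f p + g p) = J c f + J c g"
proof -
  have "(\<lambda>x. if x \<in> cdom c then (f (cinv c x) + g (cinv c x)) * \<rho> c x else 0)
    = (\<lambda>x. (if x \<in> cdom c then f (cinv c x) * \<rho> c x else 0) + (if x \<in> cdom c then g (cinv c x) * \<rho> c x else 0))"
    by (auto simp: algebra_simps)
  then show ?thesis
    unfolding J_def using Bochner_Integration.integral_add[OF J_integrable[OF assms(1,2)] J_integrable[OF assms(3,4)]] by simp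
qed

lemma J_cmult: "J c (\<lambda>p. s * f p) = s * J c f"
proof -
  have "(\<lambda>x. if x \<in> cdom c then s * f (cinv c x) * \<rho> c x else 0) = (\<lambda>x. s * (if x \<in> cdom c then f (cinv c x) * \<rho> c x else 0))"
    by auto
  then show ?thesis unfolding J_def by simp
qed

lemma J_sum:
  assumes "\<And>i. i \<in> A \<Longrightarrow> C0 (f i)" "\<And>i. i \<in> A \<Longrightarrow> supp c a r (f i)"
  shows "J c (\<lambda>p. \<Sum>i\<in>A. f i p) = (\<Sum>i\<in>A. J c (f i))"
proof -
  have "(\<lambda>x. if x \<in> cdom c then (\<Sum>i\<in>A. f i (cinv c x)) * \<rho> c x else 0)
    = (\<lambda>x. \<Sum>i\<in>A. if x \<in> cdom c then f i (cinv c x) * \<rho> c x else 0)"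
    by (auto simp: sum_distrib_right)
  then show ?thesis
    unfolding J_def using Bochner_Integration.integral_sum[of A lborel, OF J_integrable[OF assms]] by simp
qed

text \<open>In the chart the integrand, multiplied by the density, is the divergence of the
  compactly supported field \<open>h\<close> times \<open>\<rho>\<close> times
  \<open>X\<close>.\<close>

lemma J_divergence:
  assumes "C1 h" "supp c a r h"
  shows "J c (\<lambda>p. DX h p + k * h p) = 0"
proof -
  have c: "c \<in> atlas N" "cball a r \<subseteq> cdom c" using assms(2) by (auto simp: supp_def)
  have o: "open (cdom c)" by (rule is_chart_open(2)[OF chart[OF c(1)]])
  have ckY: "Ck_on 1 (cdom c) (\<lambda>x. \<rho> c x *\<^sub>R X c x)"
    using smooth_on_scaleR[OF o s\<rho>[OF c(1)] sX[OF c(1)]] unfolding smooth_on_def by blast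
  have ckh: "Ck_on 1 (cdom c) (\<lambda>x. h (cinv c x))" using assms(1) c by (simp add: C1_def)
  have "integral\<^sup>L lborel (\<lambda>x. if x \<in> cdom c
      then frechet_derivative (\<lambda>x. h (cinv c x)) (at x) (\<rho> c x *\<^sub>R X c x) + h (cinv c x) * (k * \<rho> c x) else 0) = 0"
    by (rule divergence_compact_support[OF o c(2) ckh supp_zero[OF assms(2)] ckY div[OF c(1)]])
  moreover have "(\<lambda>x. if x \<in> cdom c
      then frechet_derivative (\<lambda>x. h (cinv c x)) (at x) (\<rho> c x *\<^sub>R X c x) + h (cinv c x) * (k * \<rho> c x) else 0)
    = (\<lambda>x. if x \<in> cdom c then (DX h (cinv c x) + k * h (cinv c x)) * \<rho> c x else 0)"
    using DX_chart[OF assms(1) c(1)] linear_scale[OF linear_frechet_derivative[OF C1_diff[OF assms(1) c(1)]]]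
    by (auto simp: algebra_simps)
  ultimately show ?thesis unfolding J_def by simp
qed

text \<open>The Jacobian of the transition map is absorbed by the transformation law of
  \<open>\<rho>\<close>, and both integrands vanish outside the overlap of the two charts.\<close>

lemma J_change:
  assumes "C0 f" "supp c a r f" "supp c' a' r' f"
  shows "J c f = J c' f"
proof -
  have c: "c \<in> atlas N" "c' \<in> atlas N" using assms by (auto simp: supp_def)
  note ch = chart[OF c(1)] chart[OF c(2)]
  let ?g = "rep c c' id" and ?S = "rep_dom c c' id"
  let ?E = "\<lambda>x. if x \<in> cdom c then f (cinv c x) * \<rho> c x else 0"
  let ?F = "\<lambda>x. if x \<in> cdom c' then f (cinv c' x) * \<rho> c' x else 0"
  have zero: "f p = 0" if "p \<in> points N" "p \<notin> fst c \<or> p \<notin> fst c'" for p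
    using assms that by (auto simp: supp_def)
  have oS: "open ?S" "open (rep_dom c' c id)" using open_transition_dom[OF mfd] c by blast+
  have "integral ?S (\<lambda>x. \<bar>det (matrix (frechet_derivative ?g (at x)))\<bar> * ?F (?g x)) = integral\<^sup>L lborel ?F"
  proof (rule change_of_variables_open[OF oS(1) _ transition_image(2)[OF ch] J_continuous[OF assms(1,3)]])
    show "?g differentiable (at x)" if "x \<in> ?S" for x
      using smooth_on_differentiable[OF transition_smooth[OF mfd c] that] .
    show "?F y = 0" if "y \<notin> cball a' r'" for y using supp_zero[OF assms(3)] that by simp
    show "open (?g ` ?S)" unfolding transition_image(1)[OF ch] by (rule oS)
    show "?F y = 0" if "y \<notin> ?g ` ?S" for y
    proof (cases "y \<in> cdom c'")
      case True
      then have "cinv c' y \<notin> fst c" using that unfolding transition_image(1)[OF ch] rep_dom_eq[OF ch(2)] by simp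
      then show ?thesis using zero[of "cinv c' y"] chart_points[OF c(2) cinv_cdom(1)[OF True]] by simp
    qed simp
  qed
  moreover have "integral ?S (\<lambda>x. \<bar>det (matrix (frechet_derivative ?g (at x)))\<bar> * ?F (?g x)) = integral ?S ?E"
  proof (rule integral_cong)
    fix x assume x: "x \<in> ?S"
    have "?g x \<in> cdom c'" "x \<in> cdom c"
      using transition_inverse(1)[OF ch x] x unfolding rep_dom_eq[OF ch(2)] rep_dom_eq[OF ch(1)] by simp_all
    then show "\<bar>det (matrix (frechet_derivative ?g (at x)))\<bar> * ?F (?g x) = ?E x"
      using \<rho>_trans[OF c x] transition_inverse(3)[OF ch x] by simp
  qed
  moreover have "integral ?S ?E = integral\<^sup>L lborel ?E"
  proof -
    have "(\<lambda>x. if x \<in> ?S then ?E x else 0) = ?E"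
    proof
      fix x
      show "(if x \<in> ?S then ?E x else 0) = ?E x"
        using zero[of "cinv c x"] chart_points[OF c(1) cinv_cdom(1), of x] by (auto simp: rep_dom_eq[OF ch(1)])
    qed
    then show ?thesis
      using integral_restrict_UNIV[of ?S ?E] integral_lborel[OF J_integrable[OF assms(1,2)]] by simp
  qed
  ultimately show ?thesis unfolding J_def by simp
qed

text \<open>A closed ball of a chart is compact, hence closed in the whole Hausdorff manifold. This
  is what permits extending functions from a chart by zero.\<close>

lemma closed_support:
  assumes "c \<in> atlas N" "cball a r \<subseteq> cdom c"
  shows "closedin (mtop N) {p \<in> fst c. snd c p \<in> cball a r}" (is "closedin _ ?K")
proof -
  have "snd c ` ?K = cball a r" using assms(2) by (auto simp: cdom_def)
  then have "compactin (mtop N) ?K"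
    using chart_compact_image[OF chart[OF assms(1)], of ?K] by auto
  moreover have "Hausdorff_space (mtop N)" using mfd by (simp add: smooth_manifold_def)
  ultimately show ?thesis by (rule compactin_imp_closedin[rotated])
qed

lemma open_off_support:
  assumes "c \<in> atlas N" "cball a r \<subseteq> cdom c" "c' \<in> atlas N"
  shows "open {z \<in> cdom c'. \<not> (cinv c' z \<in> fst c \<and> snd c (cinv c' z) \<in> cball a r)}" (is "open ?V")
proof -
  let ?K = "{p \<in> fst c. snd c p \<in> cball a r}"
  have "openin (mtop N) (fst c' - ?K)"
    by (rule openin_diff[OF is_chart_open(1)[OF chart[OF assms(3)]] closed_support[OF assms(1,2)]])
  then have "open (snd c' ` (fst c' - ?K))"
    using chart_open_image[OF chart[OF assms(3)], of "fst c' - ?K"] by simp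
  moreover have "snd c' ` (fst c' - ?K) = ?V"
  proof (intro Set.set_eqI iffI)
    fix z assume "z \<in> snd c' ` (fst c' - ?K)"
    then show "z \<in> ?V" using cinv_left[OF chart[OF assms(3)]] by (auto simp: cdom_def)
  next
    fix z assume z: "z \<in> ?V"
    then have "cinv c' z \<in> fst c' - ?K" "z = snd c' (cinv c' z)" using cinv_cdom[of z c'] by auto
    then show "z \<in> snd c' ` (fst c' - ?K)" by blast
  qed
  ultimately show ?thesis by simp
qed

lemma supp_DX:
  assumes "C1 f" "supp c a r f"
  shows "supp c a r (DX f)"
  unfolding supp_def
proof (intro conjI ballI impI)
  show c: "c \<in> atlas N" "cball a r \<subseteq> cdom c" using assms(2) by (auto simp: supp_def)
  fix p assume p: "p \<in> points N" "\<not> (p \<in> fst c \<and> snd c p \<in> cball a r)"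
  obtain c' where c': "c' \<in> atlas N" "p \<in> fst c'" using manifold_chart_exists[OF mfd p(1)] .
  let ?V = "{z \<in> cdom c'. \<not> (cinv c' z \<in> fst c \<and> snd c (cinv c' z) \<in> cball a r)}"
  have pc: "cinv c' (snd c' p) = p" by (rule cinv_left[OF chart[OF c'(1)] c'(2)])
  then have x: "snd c' p \<in> ?V" using p c' by (simp add: chart_image_in_cdom)
  have "((\<lambda>x. f (cinv c' x)) has_derivative (\<lambda>_. 0)) (at (snd c' p))"
  proof (rule has_derivative_transform_within_open[OF has_derivative_const open_off_support[OF c c'(1)] x])
    fix z assume "z \<in> ?V"
    then show "0 = f (cinv c' z)"
      using assms(2) chart_points[OF c'(1) cinv_cdom(1)] by (auto simp: supp_def)
  qed
  from frechet_eqI[OF this] show "DX f p = 0"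
    using DX_chart[OF assms(1) c'(1) chart_image_in_cdom[OF c'(2)]] pc by simp
qed

section \<open>A partition of unity by bumps in charts\<close>

definition \<psi> :: "'b chart \<times> (real^4) \<times> real \<Rightarrow> 'b \<Rightarrow> real" where
  "\<psi> = (\<lambda>(c, a, r) p. if p \<in> fst c then bump a r (snd c p) else 0)"

lemma \<psi>_supp:
  assumes "c \<in> atlas N" "cball a r \<subseteq> cdom c" "0 < r"
  shows "supp c a r (\<psi> (c, a, r))"
  unfolding supp_def \<psi>_def using assms bump_zero[OF assms(3)] by auto

text \<open>Points in the domain of \<open>c\<close> are handled by the transition map; all others
  lie in the open complement of the closed support.\<close>

lemma \<psi>_C1:
  assumes "c \<in> atlas N" "cball a r \<subseteq> cdom c" "0 < r"
  shows "C1 (\<psi> (c, a, r))"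
  unfolding C1_def
proof (intro ballI Ck_on_local)
  fix c' y assume c': "c' \<in> atlas N" and y: "y \<in> cdom c'"
  note ch = chart[OF c'] chart[OF assms(1)]
  show "\<exists>V. open V \<and> y \<in> V \<and> Ck_on 1 V (\<lambda>x. \<psi> (c, a, r) (cinv c' x))"
  proof (cases "cinv c' y \<in> fst c")
    case True
    let ?V = "rep_dom c' c id"
    have oV: "open ?V" by (rule open_transition_dom[OF mfd c' assms(1)])
    have "Ck_on 1 ?V (rep c' c id)" using transition_smooth[OF mfd c' assms(1)] by (simp add: smooth_on_def)
    then have "Ck_on 1 ?V (\<lambda>x. bump a r (rep c' c id x))"
      by (rule Ck_on_compose[OF oV open_UNIV subset_UNIV Ck_on_bump])
    then have "Ck_on 1 ?V (\<lambda>x. \<psi> (c, a, r) (cinv c' x))"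
      by (rule Ck_on_cong[OF oV, rotated]) (simp add: \<psi>_def rep_eq rep_dom_eq[OF ch(1)])
    moreover have "y \<in> ?V" using True y by (simp add: rep_dom_eq[OF ch(1)])
    ultimately show ?thesis using oV by blast
  next
    case False
    let ?V = "{z \<in> cdom c'. \<not> (cinv c' z \<in> fst c \<and> snd c (cinv c' z) \<in> cball a r)}"
    have oV: "open ?V" by (rule open_off_support[OF assms(1,2) c'])
    have "Ck_on 1 ?V (\<lambda>x. \<psi> (c, a, r) (cinv c' x))"
    proof (rule Ck_on_cong[OF oV _ Ck_on_const[of _ _ 0]])
      show "0 = \<psi> (c, a, r) (cinv c' z)" if "z \<in> ?V" for z
        using that bump_zero[OF assms(3)] by (auto simp: \<psi>_def)
    qed
    then show ?thesis using oV y False by blast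
  qed
qed

lemma finite_ball_cover:
  "\<exists>A. finite A \<and> A \<noteq> {} \<and> (\<forall>(c, a, r)\<in>A. c \<in> atlas N \<and> cball a r \<subseteq> cdom c \<and> 0 < r) \<and>
     (\<forall>p\<in>points N. \<exists>(c, a, r)\<in>A. p \<in> fst c \<and> snd c p \<in> ball a r)"
proof -
  define T where "T = {(c, a, r). c \<in> atlas N \<and> cball a r \<subseteq> cdom c \<and> (0::real) < r}"
  define U where "U = (\<lambda>(c :: 'b chart, a, r). {p \<in> fst c. snd c p \<in> ball a r})"
  have "\<forall>W\<in>U ` T. openin (mtop N) W"
  proof
    fix W assume "W \<in> U ` T"
    then obtain c a r where W: "W = {p \<in> fst c. snd c p \<in> ball a r}" "c \<in> atlas N" "cball a r \<subseteq> cdom c"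
      by (auto simp: U_def T_def)
    then show "openin (mtop N) W"
      using chart_open_vimage[OF chart[OF W(2)], of "ball a r"] ball_subset_cball[of a r] by blast
  qed
  moreover have cov: "points N \<subseteq> \<Union> (U ` T)"
  proof
    fix p assume "p \<in> points N"
    then obtain c where c: "c \<in> atlas N" "p \<in> fst c" using manifold_chart_exists[OF mfd] by blast
    have "open (cdom c)" by (rule is_chart_open(2)[OF chart[OF c(1)]])
    then obtain r where r: "r > 0" "cball (snd c p) r \<subseteq> cdom c"
      using chart_image_in_cdom[OF c(2)] open_contains_cball by blast
    then have "(c, snd c p, r) \<in> T" using c by (simp add: T_def)
    moreover have "p \<in> U (c, snd c p, r)" using c r by (simp add: U_def)
    ultimately show "p \<in> \<Union> (U ` T)" by blast
  qed
  ultimately obtain \<F> where F: "finite \<F>" "\<F> \<subseteq> U ` T" "points N \<subseteq> \<Union> \<F>"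
    using cpt unfolding compact_space_alt by meson
  obtain A where A: "A \<subseteq> T" "finite A" "\<F> = U ` A"
    using finite_subset_image[OF F(1,2)] by blast
  have "A \<noteq> {}" using ne F(3) A(3) by auto
  moreover have "\<forall>(c, a, r)\<in>A. c \<in> atlas N \<and> cball a r \<subseteq> cdom c \<and> 0 < r"
    using A(1) by (auto simp: T_def)
  moreover have "\<forall>p\<in>points N. \<exists>(c, a, r)\<in>A. p \<in> fst c \<and> snd c p \<in> ball a r"
  proof
    fix p assume "p \<in> points N"
    then obtain i where "i \<in> A" "p \<in> U i" using F(3) A(3) by blast
    then show "\<exists>(c, a, r)\<in>A. p \<in> fst c \<and> snd c p \<in> ball a r"
      by (intro bexI[of _ i]) (auto simp: U_def split: prod.splits)
  qed
  ultimately show ?thesis using A(2) by blast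
qed

text \<open>A nonnegative integrand with integral zero vanishes almost everywhere, but being
  continuous and positive somewhere it is nonzero on a nonempty open set.\<close>

lemma J_pos:
  assumes "C0 f" "supp c a r f" "\<And>p. p \<in> fst c \<Longrightarrow> 0 \<le> f p" "q \<in> fst c" "0 < f q"
  shows "0 < J c f"
proof -
  let ?E = "\<lambda>x. if x \<in> cdom c then f (cinv c x) * \<rho> c x else 0"
  have c: "c \<in> atlas N" using assms(2) by (simp add: supp_def)
  have nn: "0 \<le> ?E x" for x 
    using mult_nonneg_nonneg[OF assms(3)[OF cinv_cdom(1)] less_imp_le[OF \<rho>_pos[OF c]]] by simp
  have q: "?E (snd c q) > 0"
    using assms(4,5) \<rho>_pos[OF c chart_image_in_cdom[OF assms(4)]] cinv_left[OF chart[OF c] assms(4)]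
    by (simp add: chart_image_in_cdom)
  have "J c f \<noteq> 0"
  proof
    assume "J c f = 0"
    then have "AE x in lborel. ?E x = 0"
      using integral_nonneg_eq_0_iff_AE[OF J_integrable[OF assms(1,2)]] nn unfolding J_def by simp
    then obtain Z where Z: "{x. ?E x \<noteq> 0} \<subseteq> Z" "Z \<in> null_sets lborel"
      by (auto elim!: AE_E simp: null_sets_def)
    have "negligible Z" using null_sets_completionI[OF Z(2)] by (simp add: negligible_iff_null_sets)
    then have "negligible {x. ?E x \<noteq> 0}" using Z(1) by (rule negligible_subset)
    moreover have "open {x. ?E x \<noteq> 0}"
      using continuous_open_preimage[OF J_continuous[OF assms(1,2)] open_UNIV, of "- {0}"]
      by (simp add: vimage_def open_Compl)
    ultimately show False using q open_not_negligible by fastforce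
  qed
  moreover have "0 \<le> J c f" unfolding J_def by (rule Bochner_Integration.integral_nonneg) (rule nn)
  ultimately show ?thesis by simp
qed

text \<open>For a partition of unity \<open>h i\<close> the integrals of
  \<open>DX (h i) + k * h i\<close> vanish. In their sum the first terms cancel, because the
  \<open>h i\<close> add up to 1, and what remains is \<open>k\<close> times the total volume, which
  is positive.\<close>

theorem divergence_zero: "k = 0"
proof -
  obtain A where A: "finite A" "A \<noteq> {}" "\<forall>(c, a, r)\<in>A. c \<in> atlas N \<and> cball a r \<subseteq> cdom c \<and> 0 < r"
    "\<forall>p\<in>points N. \<exists>(c, a, r)\<in>A. p \<in> fst c \<and> snd c p \<in> ball a r"
    using finite_ball_cover by blast
  define chr where "chr i = fst i" for i :: "'b chart \<times> (real^4) \<times> real"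
  define cen where "cen i = fst (snd i)" for i :: "'b chart \<times> (real^4) \<times> real"
  define rad where "rad i = snd (snd i)" for i :: "'b chart \<times> (real^4) \<times> real"
  have i_eq: "i = (chr i, cen i, rad i)" for i by (simp add: chr_def cen_def rad_def)
  have iA: "chr i \<in> atlas N" "cball (cen i) (rad i) \<subseteq> cdom (chr i)" "0 < rad i" if "i \<in> A" for i
    using bspec[OF A(3) that] by (simp_all add: chr_def cen_def rad_def case_prod_unfold)
  have \<psi>: "C1 (\<psi> i)" "supp (chr i) (cen i) (rad i) (\<psi> i)" if "i \<in> A" for i
    using \<psi>_C1[OF iA[OF that]] \<psi>_supp[OF iA[OF that]] i_eq[of i] by simp_all
  have \<psi>_nn: "0 \<le> \<psi> i p" for i p by (simp add: \<psi>_def bump_nonneg split: prod.splits)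
  define \<Psi> where "\<Psi> p = (\<Sum>i\<in>A. \<psi> i p)" for p
  have \<Psi>_pos: "0 < \<Psi> p" if p: "p \<in> points N" for p
  proof -
    obtain i where i: "i \<in> A" "p \<in> fst (chr i)" "snd (chr i) p \<in> ball (cen i) (rad i)"
      using A(4) p unfolding chr_def cen_def rad_def by fastforce
    have "0 < \<psi> i p" using bump_pos[OF i(3)] i(2) by (subst i_eq[of i]) (simp add: \<psi>_def)
    then show ?thesis unfolding \<Psi>_def using i(1) A(1) \<psi>_nn by (intro sum_pos2[of A i]) auto
  qed
  define h where "h i p = \<psi> i p * inverse (\<Psi> p)" for i p
  have h_nn: "0 \<le> h i p" if "p \<in> points N" for i p
    unfolding h_def using \<psi>_nn \<Psi>_pos[OF that] by (simp add: less_imp_le)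
  have h_sum: "(\<Sum>i\<in>A. h i p) = 1" if "p \<in> points N" for p
    using \<Psi>_pos[OF that] unfolding h_def sum_distrib_right[symmetric] \<Psi>_def[symmetric] by simp
  have h_C1: "C1 (h i)" if i: "i \<in> A" for i
    unfolding C1_def
  proof
    fix c assume c: "c \<in> atlas N"
    have o: "open (cdom c)" by (rule is_chart_open(2)[OF chart[OF c]])
    have ck: "Ck_on 1 (cdom c) (\<lambda>x. \<psi> j (cinv c x))" if "j \<in> A" for j
      using \<psi>(1)[OF that] c unfolding C1_def by blast
    have "Ck_on 1 (cdom c) (\<lambda>x. \<Psi> (cinv c x))" unfolding \<Psi>_def by (rule Ck_on_sum[OF o ck])
    then have "Ck_on 1 (cdom c) (\<lambda>x. inverse (\<Psi> (cinv c x)))"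
      by (rule Ck_on_inverse[OF o]) (use \<Psi>_pos chart_points[OF c cinv_cdom(1)] in force)
    then show "Ck_on 1 (cdom c) (\<lambda>x. h i (cinv c x))"
      unfolding h_def by (rule Ck_on_bilinear[OF bounded_bilinear_mult o ck[OF i]])
  qed
  have h_supp: "supp (chr i) (cen i) (rad i) (h i)" if "i \<in> A" for i
    using \<psi>(2)[OF that] unfolding supp_def h_def by simp
  have DX_sum: "(\<Sum>i\<in>A. DX (h i) p) = 0" if p: "p \<in> points N" for p
  proof -
    obtain c where c: "c \<in> atlas N" "p \<in> fst c" using manifold_chart_exists[OF mfd p] .
    let ?x = "snd c p"
    have x: "?x \<in> cdom c" by (rule chart_image_in_cdom[OF c(2)])
    have o: "open (cdom c)" by (rule is_chart_open(2)[OF chart[OF c(1)]])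
    have "((\<lambda>x. \<Sum>i\<in>A. h i (cinv c x)) has_derivative
        (\<lambda>v. \<Sum>i\<in>A. frechet_derivative (\<lambda>x. h i (cinv c x)) (at ?x) v)) (at ?x)"
      by (rule has_derivative_sum) (rule has_frechet[OF C1_diff[OF h_C1 c(1) x]])
    moreover have "((\<lambda>x. \<Sum>i\<in>A. h i (cinv c x)) has_derivative (\<lambda>v. 0)) (at ?x)"
      by (rule has_derivative_transform_within_open[OF has_derivative_const[of 1] o x])
        (simp add: h_sum chart_points[OF c(1) cinv_cdom(1)])
    ultimately have "(\<lambda>v. \<Sum>i\<in>A. frechet_derivative (\<lambda>x. h i (cinv c x)) (at ?x) v) = (\<lambda>v. 0)"
      by (rule has_derivative_unique)
    from fun_cong[OF this, of "X c ?x"] show ?thesis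
      using DX_chart[OF h_C1 c(1) x] cinv_left[OF chart[OF c(1)] c(2)] by simp
  qed
  \<comment> \<open>The sum of the \<open>DX (h i)\<close> vanishes pointwise, whereas each integral
    is taken in its own chart. Splitting \<open>DX (h i)\<close> by the partition of unity gives
    pieces supported in both charts \<open>i\<close> and \<open>j\<close>; each piece is integrated
    in chart \<open>j\<close> instead, and there the sum over \<open>i\<close> can be taken under
    the integral.\<close>
  define W where "W i j p = h j p * DX (h i) p" for i j p
  have W_C0: "C0 (W i j)" if "i \<in> A" "j \<in> A" for i j
    unfolding C0_def W_def
    using C1_C0[OF h_C1[OF that(2)]] C0_DX[OF h_C1[OF that(1)]] unfolding C0_def by (auto intro: continuous_on_mult)
  have W_supp1: "supp (chr i) (cen i) (rad i) (W i j)" if "i \<in> A" for i j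
    using supp_DX[OF h_C1 h_supp, OF that that] unfolding supp_def W_def by auto
  have W_supp2: "supp (chr j) (cen j) (rad j) (W i j)" if "j \<in> A" for i j
    using h_supp[OF that] unfolding supp_def W_def by auto
  have "(\<Sum>i\<in>A. J (chr i) (DX (h i))) = (\<Sum>i\<in>A. \<Sum>j\<in>A. J (chr j) (W i j))"
  proof (rule sum.cong[OF refl])
    fix i assume i: "i \<in> A"
    have "J (chr i) (DX (h i)) = J (chr i) (\<lambda>p. \<Sum>j\<in>A. W i j p)"
    proof (rule J_cong)
      fix p assume "p \<in> fst (chr i)"
      then have "p \<in> points N" using chart_points iA(1)[OF i] by blast
      then show "DX (h i) p = (\<Sum>j\<in>A. W i j p)"
        unfolding W_def sum_distrib_right[symmetric] by (simp add: h_sum)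
    qed
    also have "\<dots> = (\<Sum>j\<in>A. J (chr i) (W i j))"
      by (rule J_sum[OF W_C0[OF i] W_supp1[OF i]])
    also have "\<dots> = (\<Sum>j\<in>A. J (chr j) (W i j))"
      by (rule sum.cong[OF refl], rule J_change[OF W_C0[OF i] W_supp1[OF i] W_supp2])
    finally show "J (chr i) (DX (h i)) = (\<Sum>j\<in>A. J (chr j) (W i j))" .
  qed
  also have "\<dots> = (\<Sum>j\<in>A. \<Sum>i\<in>A. J (chr j) (W i j))" by (rule sum.swap)
  also have "\<dots> = (\<Sum>j\<in>A. J (chr j) (\<lambda>p. \<Sum>i\<in>A. W i j p))"
    by (rule sum.cong[OF refl], rule J_sum[symmetric, OF W_C0 W_supp2])
  also have "\<dots> = (\<Sum>j\<in>A. 0)"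
  proof (rule sum.cong[OF refl])
    fix j assume j: "j \<in> A"
    have "J (chr j) (\<lambda>p. \<Sum>i\<in>A. W i j p) = J (chr j) (\<lambda>p. 0 * 0)"
    proof (rule J_cong)
      fix p assume "p \<in> fst (chr j)"
      then have "p \<in> points N" using chart_points iA(1)[OF j] by blast
      then show "(\<Sum>i\<in>A. W i j p) = 0 * 0"
        unfolding W_def sum_distrib_left[symmetric] by (simp add: DX_sum)
    qed
    then show "J (chr j) (\<lambda>p. \<Sum>i\<in>A. W i j p) = 0" using J_cmult[of "chr j" 0 "\<lambda>_. 0"] by simp
  qed
  finally have S0: "(\<Sum>i\<in>A. J (chr i) (DX (h i))) = 0" by simp
  have "J (chr i) (DX (h i)) + k * J (chr i) (h i) = 0" if i: "i \<in> A" for i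
  proof -
    have C: "C0 (\<lambda>p. k * h i p)" using C1_C0[OF h_C1[OF i]] unfolding C0_def by (auto intro: continuous_on_mult_left)
    have s: "supp (chr i) (cen i) (rad i) (\<lambda>p. k * h i p)" using h_supp[OF i] unfolding supp_def by simp
    show ?thesis
      using J_divergence[OF h_C1 h_supp, OF i i] J_add[OF C0_DX[OF h_C1[OF i]] supp_DX[OF h_C1 h_supp, OF i i] C s]
      by (simp add: J_cmult)
  qed
  then have "(\<Sum>i\<in>A. J (chr i) (DX (h i)) + k * J (chr i) (h i)) = 0" by simp
  then have k0: "k * (\<Sum>i\<in>A. J (chr i) (h i)) = 0"
    using S0 by (simp add: sum.distrib sum_distrib_left)
  have "0 < J (chr i) (h i)" if i: "i \<in> A" for i
  proof -
    have "cen i \<in> cdom (chr i)" using iA[OF i] by (auto simp: subset_iff)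
    then obtain q where q: "q \<in> fst (chr i)" "snd (chr i) q = cen i" using cinv_cdom by blast
    have "0 < \<psi> i q" using bump_pos[of "cen i" "cen i" "rad i"] iA(3)[OF i] q by (subst i_eq[of i]) (simp add: \<psi>_def)
    then have "0 < h i q" using \<Psi>_pos[OF chart_points[OF iA(1)[OF i] q(1)]] by (simp add: h_def)
    then show ?thesis
      using J_pos[OF C1_C0[OF h_C1[OF i]] h_supp[OF i] h_nn q(1)] chart_points[OF iA(1)[OF i]] by blast
  qed
  then have "0 < (\<Sum>i\<in>A. J (chr i) (h i))" using A(1,2) by (intro sum_pos) auto
  then show ?thesis using k0 by simp
qed

end

section \<open>Structure functions and closed forms\<close>

lemma ext_d2_sum:
  fixes f :: "'i \<Rightarrow> real^4 \<Rightarrow> real^4 \<Rightarrow> real^4 \<Rightarrow> real"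
  assumes "finite P" "\<And>p u v. p \<in> P \<Longrightarrow> (\<lambda>y. f p y u v) differentiable (at x)"
  shows "ext_d2 (\<lambda>y u v. \<Sum>p\<in>P. f p y u v) x u v z = (\<Sum>p\<in>P. ext_d2 (f p) x u v z)"
proof -
  have d: "((\<lambda>y. \<Sum>p\<in>P. f p y u v) has_derivative (\<lambda>h. \<Sum>p\<in>P. frechet_derivative (\<lambda>y. f p y u v) (at x) h)) (at x)" for u v
    by (rule has_derivative_sum) (rule has_frechet[OF assms(2)])
  show ?thesis
    unfolding ext_d2_def frechet_eqI[OF d] by (simp add: sum.distrib sum_subtractf)
qed

lemma coframe_differentiable: "coframe V w \<Longrightarrow> y \<in> V \<Longrightarrow> w i differentiable (at y)"
  by (rule smooth_on_differentiable[OF coframe_smooth])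

text \<open>The value on e_a, e_b, e_c of the exterior derivative of the wedge product of
  \<open>w i\<close> and \<open>w j\<close>, expressed by structure functions and Kronecker
  deltas.\<close>

definition dwedge :: "(4 \<Rightarrow> real^4 \<Rightarrow> real^4) \<Rightarrow> real^4 \<Rightarrow> 4 \<Rightarrow> 4 \<Rightarrow> 4 \<Rightarrow> 4 \<Rightarrow> 4 \<Rightarrow> real" where
  "dwedge w y i j a b c = sc w i a b y * (if j = c then 1 else 0) - sc w i a c y * (if j = b then 1 else 0)
     + sc w i b c y * (if j = a then 1 else 0)
     - ((if i = a then 1 else 0) * sc w j b c y - (if i = b then 1 else 0) * sc w j a c y + (if i = c then 1 else 0) * sc w j a b y)"

lemma ext_d2_wedge_frame:
  assumes "coframe V w" "y \<in> V"
  shows "ext_d2 (\<lambda>y. wedge (w i y) (w j y)) y (frame w a y) (frame w b y) (frame w c y) = dwedge w y i j a b c"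
  unfolding ext_d2_wedge[OF coframe_differentiable[OF assms] coframe_differentiable[OF assms]]
    frame_dual[OF coframe_det[OF assms]] dwedge_def sc_def ..

lemma adapted_closed:
  assumes "adapted V \<Omega> D w" "y \<in> V" "\<And>u v z. ext_d2 \<Omega> y u v z = 0"
  shows "dwedge w y 1 3 a b c + dwedge w y 2 4 a b c = 0"
proof -
  note c = adapted_coframe[OF assms(1)]
  note d = coframe_differentiable[OF c assms(2)]
  have "\<Omega> z = (\<lambda>u v. wedge (w 1 z) (w 3 z) u v + wedge (w 2 z) (w 4 z) u v)" if "z \<in> V" for z
    using assms(1) that unfolding adapted_def by blast
  then have e: "ext_d2 \<Omega> y = ext_d2 (\<lambda>z u v. wedge (w 1 z) (w 3 z) u v + wedge (w 2 z) (w 4 z) u v) y"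
    by (rule ext_d2_cong[OF coframe_open[OF c] assms(2)])
  have "ext_d2 (\<lambda>z. wedge (w 1 z) (w 3 z)) y u v z + ext_d2 (\<lambda>z. wedge (w 2 z) (w 4 z)) y u v z = 0" for u v z
    using ext_d2_add[of "\<lambda>z. wedge (w 1 z) (w 3 z)" y "\<lambda>z. wedge (w 2 z) (w 4 z)" u v z,
        OF wedge_differentiable[OF d d] wedge_differentiable[OF d d]] assms(3)[of u v z] unfolding e by linarith
  then show ?thesis unfolding ext_d2_wedge_frame[OF c assms(2), symmetric] .
qed

text \<open>Evaluated on e_2, e_3, e_4, the identity d(d w_1) = 0 says that
  \<open>sc w 1 1 3\<close> equals \<open>sc w 2 2 3 - sc w 4 3 4\<close>, and closedness of
  \<open>\<Omega>\<close> says that the latter is 1. The divergence of e_3 is minus the sum of these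
  two quantities.\<close>

lemma degenerate_divergence:
  assumes "degenerate_coframe V \<Omega> D w" "y \<in> V" "\<And>y u v z. y \<in> V \<Longrightarrow> ext_d2 \<Omega> y u v z = 0"
  shows "(\<Sum>i\<in>UNIV. sc w i 3 i y) = -2"
proof -
  have a: "adapted V \<Omega> D w" and k: "\<And>y. y \<in> V \<Longrightarrow> sc w 1 2 3 y = 0 \<and> sc w 1 2 4 y = 1 \<and> sc w 1 3 4 y = 0"
    using assms(1) unfolding degenerate_coframe_def adapted_def by blast+
  note c = adapted_coframe[OF a]
  note o = coframe_open[OF c] and d = coframe_differentiable[OF c assms(2)]
  \<comment> \<open>\<open>\<theta>\<close> collects the terms with a factor \<open>w 1\<close>, so
    that d w_1 is w_1 wedge \<theta> plus w_2 wedge w_4. Derivatives of its coefficients do not show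
    up on e_2, e_3, e_4, since there d \<theta> is multiplied by values of \<open>w 1\<close>, which
    are zero.\<close>
  define \<theta> where "\<theta> z = sc w 1 1 2 z *\<^sub>R w 2 z + sc w 1 1 3 z *\<^sub>R w 3 z + sc w 1 1 4 z *\<^sub>R w 4 z" for z
  have s\<theta>: "smooth_on V \<theta>" unfolding \<theta>_def
    by (intro smooth_on_add[OF o] smooth_on_scaleR[OF o] smooth_on_sc[OF c] coframe_smooth[OF c])
  have d\<theta>: "\<theta> differentiable (at y)" by (rule smooth_on_differentiable[OF s\<theta> assms(2)])
  have "ext_d1 (w 1) z = (\<lambda>u v. wedge (w 1 z) (\<theta> z) u v + wedge (w 2 z) (w 4 z) u v)" if z: "z \<in> V" for z
  proof (intro ext)
    fix u v
    show "ext_d1 (w 1) z u v = wedge (w 1 z) (\<theta> z) u v + wedge (w 2 z) (w 4 z) u v"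
      by (subst two_form_expansion[OF coframe_det[OF c z] bilinear_ext_d1_coframe[OF c z] ext_d1_self])
        (use k[OF z] in \<open>simp add: sc_def[symmetric] \<theta>_def wedge_def inner_add_left algebra_simps\<close>)
  qed
  then have e: "ext_d2 (ext_d1 (w 1)) y = ext_d2 (\<lambda>z u v. wedge (w 1 z) (\<theta> z) u v + wedge (w 2 z) (w 4 z) u v) y"
    by (rule ext_d2_cong[OF o assms(2)])
  have "ext_d2 (\<lambda>z. wedge (w 1 z) (\<theta> z)) y u v z + ext_d2 (\<lambda>z. wedge (w 2 z) (w 4 z)) y u v z = 0" for u v z
    using ext_d2_add[of "\<lambda>z. wedge (w 1 z) (\<theta> z)" y "\<lambda>z. wedge (w 2 z) (w 4 z)" u v z,
        OF wedge_differentiable[OF d d\<theta>] wedge_differentiable[OF d d]]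
      ext_d2_ext_d1[OF o coframe_smooth[OF c, of 1] assms(2), of u v z] unfolding e by linarith
  note this[of "frame w 2 y" "frame w 3 y" "frame w 4 y"]
  moreover have "ext_d2 (\<lambda>z. wedge (w 1 z) (\<theta> z)) y (frame w 2 y) (frame w 3 y) (frame w 4 y) = - sc w 1 1 3 y"
    unfolding ext_d2_wedge[OF d d\<theta>] sc_def[symmetric]
    using k[OF assms(2)] by (simp add: frame_dual[OF coframe_det[OF c assms(2)]] \<theta>_def inner_add_left)
  moreover have "ext_d2 (\<lambda>z. wedge (w 2 z) (w 4 z)) y (frame w 2 y) (frame w 3 y) (frame w 4 y) = sc w 2 2 3 y - sc w 4 3 4 y"
    unfolding ext_d2_wedge_frame[OF c assms(2)] dwedge_def by simp
  moreover have "- 1 + sc w 2 2 3 y - sc w 4 3 4 y = 0"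
    using adapted_closed[OF a assms(2) assms(3)[OF assms(2)], of 2 3 4] k[OF assms(2)] unfolding dwedge_def by simp
  ultimately have "sc w 1 1 3 y = 1" "sc w 2 2 3 y - sc w 4 3 4 y = 1" by linarith+
  then show ?thesis
    unfolding sum_4 using sc_alt[of w 1 3 1 y] sc_alt[of w 2 3 2 y] sc_self[of w 3 3 y] by simp
qed

text \<open>With constant coefficients the second exterior derivative of \<open>w i\<close> contains
  no derivatives of them; its vanishing is a component of the Jacobi identity.\<close>

lemma constant_structure_jacobi:
  assumes "coframe V w" "y \<in> V" "\<And>y j k. y \<in> V \<Longrightarrow> sc w i j k y = C j k"
  shows "C 1 2 * dwedge w y 1 2 a b c + C 1 3 * dwedge w y 1 3 a b c + C 1 4 * dwedge w y 1 4 a b c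
    + C 2 3 * dwedge w y 2 3 a b c + C 2 4 * dwedge w y 2 4 a b c + C 3 4 * dwedge w y 3 4 a b c = 0"
proof -
  note o = coframe_open[OF assms(1)] and d = coframe_differentiable[OF assms(1,2)]
  let ?P = "{(1, 2), (1, 3), (1, 4), (2, 3), (2, 4), (3, 4)} :: (4 \<times> 4) set"
  let ?f = "\<lambda>p z u v. C (fst p) (snd p) * wedge (w (fst p) z) (w (snd p) z) u v"
  have "ext_d1 (w i) z = (\<lambda>u v. \<Sum>p\<in>?P. ?f p z u v)" if z: "z \<in> V" for z
  proof (intro ext)
    fix u v
    show "ext_d1 (w i) z u v = (\<Sum>p\<in>?P. ?f p z u v)"
      by (subst two_form_expansion[OF coframe_det[OF assms(1) z] bilinear_ext_d1_coframe[OF assms(1) z] ext_d1_self])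
        (simp add: sc_def[symmetric] assms(3)[OF z])
  qed
  then have e: "ext_d2 (ext_d1 (w i)) y = ext_d2 (\<lambda>z u v. \<Sum>p\<in>?P. ?f p z u v) y"
    by (rule ext_d2_cong[OF o assms(2)])
  have s: "ext_d2 (\<lambda>z u v. \<Sum>p\<in>?P. ?f p z u v) y u v z = (\<Sum>p\<in>?P. ext_d2 (?f p) y u v z)" for u v z
    by (rule ext_d2_sum) (auto intro!: differentiable_mult differentiable_const wedge_differentiable d)
  have m: "ext_d2 (?f p) y u v z = C (fst p) (snd p) * ext_d2 (\<lambda>z. wedge (w (fst p) z) (w (snd p) z)) y u v z" for p u v z
    by (rule ext_d2_cmult) (rule wedge_differentiable[OF d d])
  have "(\<Sum>p\<in>?P. C (fst p) (snd p) * ext_d2 (\<lambda>z. wedge (w (fst p) z) (w (snd p) z)) y u v z) = 0" for u v z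
    unfolding m[symmetric] s[symmetric] e[symmetric] by (rule ext_d2_ext_d1[OF o coframe_smooth[OF assms(1)] assms(2)])
  from this[of "frame w a y" "frame w b y" "frame w c y"] show ?thesis
    unfolding ext_d2_wedge_frame[OF assms(1,2)] by simp
qed

text \<open>The constant missing from the conclusion is \<open>C 4 2 3\<close>, the parameter b. The
  linear relations \<open>O\<close> (closedness of \<open>\<Omega>\<close>) and \<open>U\<close>
  (vanishing divergences) are fed into the Jacobi identities for \<open>w 1\<close>,
  \<open>w 2\<close> and \<open>w 4\<close>, in an order that makes all but the last linear in what
  is still unknown.\<close>

lemma canonical_structure_constants:
  assumes "canonical_coframe V \<Omega> D w" "y \<in> V" "\<And>y u v z. y \<in> V \<Longrightarrow> ext_d2 \<Omega> y u v z = 0"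
    "\<And>y i j k. y \<in> V \<Longrightarrow> sc w i j k y = C i j k" "\<And>j. (\<Sum>i\<in>UNIV. C i j i) = 0"
  shows "C 1 1 2 = 0" "C 1 1 3 = 0" "C 1 1 4 = 0" "C 1 2 3 = 1" "C 1 2 4 = 0" "C 1 3 4 = 0"
    "C 2 1 2 = 0" "C 2 1 3 = 0" "C 2 1 4 = 0" "C 2 2 3 = 0" "C 2 2 4 = 0" "C 2 3 4 = 1"
    "C 3 1 2 = 0" "C 3 1 3 = 0" "C 3 1 4 = 0" "C 3 2 3 = 0" "C 3 2 4 = 0" "C 3 3 4 = 0"
    "C 4 1 2 = 0" "C 4 1 3 = 0" "C 4 1 4 = 0" "C 4 2 4 = 0" "C 4 3 4 = 0"
proof -
  have a: "adapted V \<Omega> D w" using assms(1) by (simp add: canonical_coframe_def)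
  note c = adapted_coframe[OF a]
  have k: "C 1 2 3 = 1" "C 1 2 4 = 0" "C 2 3 4 = 1" "C 1 1 2 = 0" "C 2 2 3 = 0" "C 2 2 4 = 0" "C 1 3 4 = 0"
    using assms(1) assms(4)[OF assms(2)] assms(2) unfolding canonical_coframe_def adapted_def by metis+
  have alt: "C i 2 1 = - C i 1 2" "C i 3 1 = - C i 1 3" "C i 4 1 = - C i 1 4" "C i 3 2 = - C i 2 3"
    "C i 4 2 = - C i 2 4" "C i 4 3 = - C i 3 4" "C i j j = 0" for i j
    using sc_alt[of w i _ _ y] sc_self[of w i j y] unfolding assms(4)[OF assms(2)] by blast+
  have dw: "dwedge w y i j a b c = C i a b * (if j = c then 1 else 0) - C i a c * (if j = b then 1 else 0)
     + C i b c * (if j = a then 1 else 0)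
     - ((if i = a then 1 else 0) * C j b c - (if i = b then 1 else 0) * C j a c + (if i = c then 1 else 0) * C j a b)"
    for i j a b c unfolding dwedge_def assms(4)[OF assms(2)] ..
  note cl = adapted_closed[OF a assms(2) assms(3)[OF assms(2)], unfolded dw]
  have O: "C 4 1 3 = C 3 2 3" "C 3 2 4 = C 2 1 2 + C 4 1 4" "C 2 1 3 = C 1 1 4 + C 3 3 4" "C 4 3 4 = 0"
    using cl[of 1 2 3] cl[of 1 2 4] cl[of 1 3 4] cl[of 2 3 4] k by simp_all
  have U: "C 2 1 2 + C 3 1 3 + C 4 1 4 = 0" "C 3 2 3 + C 4 2 4 = 0" "C 1 1 3 = 0" "C 1 1 4 + C 3 3 4 = 0"
    using assms(5)[of 1] assms(5)[of 2] assms(5)[of 3] assms(5)[of 4] k O(4) by (simp_all add: sum_4 alt)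
  note J1 = constant_structure_jacobi[where i = 1 and C = "C 1", OF c assms(2) assms(4), unfolded dw]
  have P: "C 1 1 4 = 0" "C 3 3 4 = 0" "C 2 1 3 = 0"
    using J1[of 2 3 4] k O U by (simp_all add: alt)
  have Q: "C 2 1 4 = 0" "C 2 1 2 + C 3 1 3 = 0" "C 3 1 4 = 0"
    using J1[of 1 3 4] J1[of 1 2 3] J1[of 1 2 4] k O U P by (simp_all add: alt)
  then have T14: "C 4 1 4 = 0" using U by simp
  note J2 = constant_structure_jacobi[where i = 2 and C = "C 2", OF c assms(2) assms(4), unfolded dw]
  have R: "C 2 1 2 = 0" using J2[of 1 3 4] k O U P Q T14 by (simp add: alt)
  have S: "C 3 1 2 = 0" "C 4 1 2 = 0"
    using J2[of 1 2 4] J2[of 1 2 3] k O U P Q T14 R by (simp_all add: alt)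
  note J4 = constant_structure_jacobi[where i = 4 and C = "C 4", OF c assms(2) assms(4), unfolded dw]
  \<comment> \<open>The one quadratic relation: after all substitutions it is a multiple of a
    square.\<close>
  have "C 3 2 3 * C 3 2 3 = 0"
  proof -
    have e: "C 4 2 4 = - C 3 2 3" "C 3 1 3 = 0" "C 3 2 4 = 0" using U Q R O T14 by simp_all
    show ?thesis using J4[of 1 2 3] k O U P Q T14 R S e by (simp add: alt)
  qed
  then have s: "C 3 2 3 = 0" by simp
  show "C 1 1 2 = 0" "C 1 1 3 = 0" "C 1 1 4 = 0" "C 1 2 3 = 1" "C 1 2 4 = 0" "C 1 3 4 = 0"
    "C 2 1 2 = 0" "C 2 1 3 = 0" "C 2 1 4 = 0" "C 2 2 3 = 0" "C 2 2 4 = 0" "C 2 3 4 = 1"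
    "C 3 1 2 = 0" "C 3 1 3 = 0" "C 3 1 4 = 0" "C 3 2 3 = 0" "C 3 2 4 = 0" "C 3 3 4 = 0"
    "C 4 1 2 = 0" "C 4 1 3 = 0" "C 4 1 4 = 0" "C 4 2 4 = 0" "C 4 3 4 = 0"
    using k O U P Q R S T14 s by simp_all
qed

section \<open>Germs of structure-preserving maps\<close>

text \<open>A common form for symmetries of \<open>M\<close> and for the projection to the quotient,
  both read in charts. Between nondegenerate forms such an \<open>F\<close> is automatically
  invertible near \<open>x\<close>.\<close>

definition germ_map where
  "germ_map \<Omega> D x \<Omega>' D' x' \<longleftrightarrow> (\<exists>V F. open V \<and> x \<in> V \<and> smooth_on V F \<and> F x = x' \<and>
     (\<forall>y\<in>V. (\<forall>u v. \<Omega>' (F y) (frechet_derivative F (at y) u) (frechet_derivative F (at y) v) = \<Omega> y u v) \<and>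
        frechet_derivative F (at y) ` D y = D' (F y)))"

lemma pull_adapted_germ:
  assumes "open V" "x \<in> V" "smooth_on V F" "x' = F x"
    "\<And>y u v. y \<in> V \<Longrightarrow> \<Omega>' (F y) (frechet_derivative F (at y) u) (frechet_derivative F (at y) v) = \<Omega> y u v"
    "\<And>y. y \<in> V \<Longrightarrow> frechet_derivative F (at y) ` D y = D' (F y)"
    "lag_engel_on S \<Omega> D" "x \<in> S" "adapted V' \<Omega>' D' w'" "x' \<in> V'"
  shows "\<exists>U. x \<in> U \<and> U \<subseteq> V \<inter> S \<and> adapted U \<Omega> D (\<lambda>i. pull1 F (w' i)) \<and>
     (\<forall>y\<in>U. F y \<in> V' \<and> (\<forall>i j k. sc (\<lambda>i. pull1 F (w' i)) i j k y = sc w' i j k (F y)) \<and>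
        (\<forall>j. frechet_derivative F (at y) (frame (\<lambda>i. pull1 F (w' i)) j y) = frame w' j (F y)))"
proof -
  define U where "U = {y \<in> V \<inter> S. F y \<in> V'}"
  have oS: "open S" using assms(7) by (simp add: lag_engel_on_def)
  have oV': "open V'" by (rule coframe_open[OF adapted_coframe[OF assms(9)]])
  have "continuous_on (V \<inter> S) F"
    using smooth_on_continuous_on[OF assms(3)] continuous_on_subset by blast
  from continuous_open_preimage[OF this open_Int[OF assms(1) oS] oV']
  have oU: "open U" by (simp add: U_def vimage_def Int_def)
  have sF: "smooth_on U F" by (rule smooth_on_subset[OF assms(3)]) (auto simp: U_def)
  have FU: "F ` U \<subseteq> V'" by (auto simp: U_def)
  have nd: "u = 0" if "y \<in> U" "\<And>v. \<Omega> y u v = 0" for y u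
    using assms(7) that unfolding lag_engel_on_def U_def by blast
  have pre: "\<Omega>' (F y) (frechet_derivative F (at y) u) (frechet_derivative F (at y) v) = \<Omega> y u v"
    "frechet_derivative F (at y) ` D y = D' (F y)" if "y \<in> U" for y u v
    using assms(5,6) that by (auto simp: U_def)
  have P: "adapted U \<Omega> D (\<lambda>i. pull1 F (w' i))"
    by (rule adapted_pull(1)[OF oU sF FU assms(9)]) (erule pre(1), erule pre(2), rule nd, assumption, blast)
  have Q1: "frechet_derivative F (at y) (frame (\<lambda>i. pull1 F (w' i)) j y) = frame w' j (F y)" if "y \<in> U" for y j
    by (rule adapted_pull(2)[OF oU sF FU assms(9) _ _ _ that]) (erule pre(1), erule pre(2), rule nd, assumption, blast)
  have Q2: "sc (\<lambda>i. pull1 F (w' i)) i j k y = sc w' i j k (F y)" if "y \<in> U" for y i j k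
    by (rule adapted_pull(3)[OF oU sF FU assms(9) _ _ _ that]) (erule pre(1), erule pre(2), rule nd, assumption, blast)
  have "x \<in> U" using assms by (simp add: U_def)
  moreover have "U \<subseteq> V \<inter> S" by (auto simp: U_def)
  ultimately show ?thesis using P Q1 Q2 FU by (intro exI[of _ U]) blast
qed

lemma adapted_restrict:
  assumes "adapted V \<Omega> D w" "U \<subseteq> V" "open U"
  shows "adapted U \<Omega> D w"
  using assms smooth_on_subset unfolding adapted_def coframe_def by blast

definition degenerate_at where
  "degenerate_at \<Omega> D x \<longleftrightarrow> (\<exists>V w. x \<in> V \<and> adapted V \<Omega> D w \<and> sc w 1 2 3 x = 0)"

text \<open>A change of adapted coframe multiplies \<open>sc w 1 2 3\<close> by a nonzero factor, so
  its vanishing at a point does not depend on the coframe.\<close>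

lemma degenerate_at_iff:
  assumes "adapted V \<Omega> D w" "x \<in> V"
  shows "degenerate_at \<Omega> D x \<longleftrightarrow> sc w 1 2 3 x = 0"
proof
  assume "degenerate_at \<Omega> D x"
  then obtain V' w' where w': "x \<in> V'" "adapted V' \<Omega> D w'" "sc w' 1 2 3 x = 0"
    unfolding degenerate_at_def by blast
  obtain \<tau> \<mu> \<kappa> where "\<tau> \<noteq> 0" "\<mu> \<noteq> 0" "sc w' 1 2 3 x = \<tau>\<^sup>2 / \<mu> * sc w 1 2 3 x"
    using adapted_change[OF assms(1) w'(2) assms(2) w'(1)] by metis
  then show "sc w 1 2 3 x = 0" using w'(3) by simp
qed (use assms in \<open>auto simp: degenerate_at_def\<close>)

lemma germ_map_degenerate:
  assumes "germ_map \<Omega> D x \<Omega>' D' x'" "lag_engel_on S \<Omega> D" "x \<in> S" "lag_engel_on S' \<Omega>' D'" "x' \<in> S'"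
  shows "degenerate_at \<Omega> D x \<longleftrightarrow> degenerate_at \<Omega>' D' x'"
proof -
  obtain V F where V: "open V" "x \<in> V" "smooth_on V F" "x' = F x"
    "\<And>y u v. y \<in> V \<Longrightarrow> \<Omega>' (F y) (frechet_derivative F (at y) u) (frechet_derivative F (at y) v) = \<Omega> y u v"
    "\<And>y. y \<in> V \<Longrightarrow> frechet_derivative F (at y) ` D y = D' (F y)"
    using assms(1) unfolding germ_map_def by blast
  obtain V' w' where w': "x' \<in> V'" "adapted V' \<Omega>' D' w'" using adapted_exists[OF assms(4,5)] by blast
  obtain U where U: "x \<in> U" "adapted U \<Omega> D (\<lambda>i. pull1 F (w' i))"
    "sc (\<lambda>i. pull1 F (w' i)) 1 2 3 x = sc w' 1 2 3 (F x)"
    using pull_adapted_germ[OF V assms(2,3) w'(2,1)] by blast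
  show ?thesis
    using degenerate_at_iff[OF U(2,1)] degenerate_at_iff[OF w'(2,1)] U(3) V(4) by simp
qed

lemma canonical_sc_unique:
  assumes "canonical_coframe V \<Omega> D w" "canonical_coframe V' \<Omega> D w'" "y \<in> V" "y \<in> V'"
  shows "sc w' i j k y = sc w i j k y"
proof -
  have c: "coframe V w" "coframe V' w'"
    using assms adapted_coframe unfolding canonical_coframe_def by blast+
  have "open (V \<inter> V')" "y \<in> V \<inter> V'" using assms c coframe_open by auto
  then have "ext_d1 (w' i) y = ext_d1 (w i) y"
    by (rule ext_d1_cong) (use canonical_unique[OF assms(1,2)] in blast)
  moreover have "frame w' j y = frame w j y" for j
    unfolding frame_def using canonical_unique[OF assms] by simp
  ultimately show ?thesis by (simp add: sc_def)
qed

text \<open>Apart from being adapted, a canonical coframe is characterised by its structure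
  functions, so its pullback is canonical again.\<close>

lemma germ_map_canonical_sc:
  assumes "germ_map \<Omega> D x \<Omega>' D' x'" "lag_engel_on S \<Omega> D" "x \<in> S"
    "canonical_coframe V' \<Omega>' D' w'" "x' \<in> V'"
  shows "\<exists>U w. x \<in> U \<and> U \<subseteq> S \<and> canonical_coframe U \<Omega> D w \<and> (\<forall>i j k. sc w i j k x = sc w' i j k x')"
proof -
  obtain V F where V: "open V" "x \<in> V" "smooth_on V F" "x' = F x"
    "\<And>y u v. y \<in> V \<Longrightarrow> \<Omega>' (F y) (frechet_derivative F (at y) u) (frechet_derivative F (at y) v) = \<Omega> y u v"
    "\<And>y. y \<in> V \<Longrightarrow> frechet_derivative F (at y) ` D y = D' (F y)"
    using assms(1) unfolding germ_map_def by blast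
  have a': "adapted V' \<Omega>' D' w'" using assms(4) by (simp add: canonical_coframe_def)
  obtain U where U: "x \<in> U" "U \<subseteq> V \<inter> S" "adapted U \<Omega> D (\<lambda>i. pull1 F (w' i))"
    "\<forall>y\<in>U. F y \<in> V' \<and> (\<forall>i j k. sc (\<lambda>i. pull1 F (w' i)) i j k y = sc w' i j k (F y)) \<and>
        (\<forall>j. frechet_derivative F (at y) (frame (\<lambda>i. pull1 F (w' i)) j y) = frame w' j (F y))"
    using pull_adapted_germ[OF V assms(2,3) a' assms(5)] by blast
  have "canonical_coframe U \<Omega> D (\<lambda>i. pull1 F (w' i))"
    using assms(4) U(3,4) unfolding canonical_coframe_def by simp
  then show ?thesis using U V(4) by (intro exI[of _ U] exI[of _ "\<lambda>i. pull1 F (w' i)"]) auto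
qed

section \<open>Lagrangian Engel structures in charts\<close>

lemma lagrangian_engel_chart:
  assumes "lagrangian_engel M \<Omega> D" "c \<in> atlas M"
  shows "lag_engel_on (cdom c) (\<Omega> c) (D c)"
proof -
  have "smooth_manifold M" using assms by (simp add: lagrangian_engel_def)
  then have "open (cdom c)" using is_chart_open(2)[OF manifold_chart[OF _ assms(2)]] by blast
  then show ?thesis
    using assms unfolding lagrangian_engel_def symplectic_form_def two_form_def engel_structure_def
      distribution_def lag_engel_on_def by blast
qed

lemma lagrangian_engel_manifold: "lagrangian_engel M \<Omega> D \<Longrightarrow> smooth_manifold M"
  by (simp add: lagrangian_engel_def)

lemma germ_map_of_smooth:
  assumes "open V" "V \<subseteq> rep_dom c c' f" "smooth_on V (rep c c' f)" "x \<in> V"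
    "c \<in> atlas M" "c' \<in> atlas N" "pulls_back2 M N f \<Theta> \<Omega>" "maps_distr M N f D E"
  shows "germ_map (\<Omega> c) (D c) x (\<Theta> c') (E c') (rep c c' f x)"
  unfolding germ_map_def
proof (intro exI[of _ V] exI[of _ "rep c c' f"] conjI ballI allI)
  fix y u v assume "y \<in> V"
  then have y: "y \<in> rep_dom c c' f" using assms(2) by blast
  show "\<Theta> c' (rep c c' f y) (drep c c' f y u) (drep c c' f y v) = \<Omega> c y u v"
    using assms(5-7) y unfolding pulls_back2_def by blast
next
  fix y assume "y \<in> V"
  then have y: "y \<in> rep_dom c c' f" using assms(2) by blast
  show "drep c c' f y ` D c y = E c' (rep c c' f y)"
    using assms(5,6,8) y unfolding maps_distr_def by blast
qed (use assms in auto)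

lemma symmetry_germ:
  assumes "lagrangian_engel M \<Omega> D" "f \<in> symmetries M \<Omega> D" "c \<in> atlas M" "c' \<in> atlas M" "p \<in> fst c" "f p \<in> fst c'"
  shows "germ_map (\<Omega> c) (D c) (snd c p) (\<Omega> c') (D c') (snd c' (f p))"
proof -
  note m = lagrangian_engel_manifold[OF assms(1)]
  note ch = manifold_chart[OF m assms(3)] manifold_chart[OF m assms(4)]
  have f: "smooth_map M M f" "pulls_back2 M M f \<Omega> \<Omega>" "maps_distr M M f D D"
    using assms(2) by (auto simp: symmetries_def diffeo_def)
  have o: "open (rep_dom c c' f)" using open_rep_dom[OF ch] f(1) by (simp add: smooth_map_def)
  have s: "smooth_on (rep_dom c c' f) (rep c c' f)" using f(1) assms(3,4) by (simp add: smooth_map_def)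
  have x: "snd c p \<in> rep_dom c c' f" unfolding rep_dom_def using assms(5,6) by blast
  have "rep c c' f (snd c p) = snd c' (f p)" using cinv_left[OF ch(1) assms(5)] by (simp add: rep_eq)
  then show ?thesis using germ_map_of_smooth[OF o subset_refl s x assms(3,4) f(2,3)] by simp
qed

lemma local_diffeo_germ:
  assumes "lagrangian_engel M \<Omega> D" "lagrangian_engel N \<Theta> E" "local_diffeo M N \<pi>"
    "pulls_back2 M N \<pi> \<Theta> \<Omega>" "maps_distr M N \<pi> D E"
    "c \<in> atlas M" "c' \<in> atlas N" "p \<in> fst c" "\<pi> p \<in> fst c'"
  shows "germ_map (\<Omega> c) (D c) (snd c p) (\<Theta> c') (E c') (snd c' (\<pi> p))"
proof -
  note m = lagrangian_engel_manifold[OF assms(1)] and n = lagrangian_engel_manifold[OF assms(2)]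
  note ch = manifold_chart[OF m assms(6)] manifold_chart[OF n assms(7)]
  have pM: "p \<in> points M" using openin_subset[OF is_chart_open(1)[OF ch(1)]] assms(8) by blast
  then obtain W where W: "openin (mtop M) W" "p \<in> W" "openin (mtop N) (\<pi> ` W)"
      "diffeo (open_submfd M W) (open_submfd N (\<pi> ` W)) \<pi>"
    using assms(3) unfolding local_diffeo_def by blast
  \<comment> \<open>Smoothness of \<open>\<pi>\<close> is given for the charts cut down to
    \<open>W\<close> and its image; on the smaller domain \<open>?S\<close> the local expression is
    the same as in the full charts.\<close>
  let ?c = "(fst c \<inter> W, snd c)" and ?c' = "(fst c' \<inter> \<pi> ` W, snd c')"
  let ?S = "rep_dom ?c ?c' \<pi>"
  have sm: "smooth_map (open_submfd M W) (open_submfd N (\<pi> ` W)) \<pi>" using W(4) by (simp add: diffeo_def)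
  have "?c \<in> atlas (open_submfd M W)" "?c' \<in> atlas (open_submfd N (\<pi> ` W))"
    using assms(6,7) by (auto simp: open_submfd_def)
  then have s: "smooth_on ?S (rep ?c ?c' \<pi>)" using sm unfolding smooth_map_def by blast
  have cont: "continuous_map (subtopology (mtop M) W) (subtopology (mtop N) (\<pi> ` W)) \<pi>"
    using sm by (simp add: smooth_map_def open_submfd_def)
  have inj: "inj_on (snd c) (fst c)" by (rule is_chart_inj[OF ch(1)])
  have S: "?S = snd c ` {q \<in> fst c \<inter> W. \<pi> q \<in> fst c'}" by (auto simp: rep_dom_def)
  have "openin (subtopology (mtop N) (\<pi> ` W)) (fst c' \<inter> \<pi> ` W)"
    using is_chart_open(1)[OF ch(2)] by (auto simp: openin_subtopology)
  from openin_continuous_map_preimage[OF cont this]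
  have "openin (subtopology (mtop M) W) {q \<in> W. \<pi> q \<in> fst c' \<inter> \<pi> ` W}"
    unfolding topspace_subtopology_subset[OF openin_subset[OF W(1)]] .
  then have "openin (mtop M) {q \<in> W. \<pi> q \<in> fst c' \<inter> \<pi> ` W}"
    using openin_open_subtopology[OF W(1)] by blast
  then have "openin (mtop M) (fst c \<inter> {q \<in> W. \<pi> q \<in> fst c' \<inter> \<pi> ` W})"
    by (rule openin_Int[OF is_chart_open(1)[OF ch(1)]])
  moreover have "fst c \<inter> {q \<in> W. \<pi> q \<in> fst c' \<inter> \<pi> ` W} = {q \<in> fst c \<inter> W. \<pi> q \<in> fst c'}" by auto
  ultimately have "openin (mtop M) {q \<in> fst c \<inter> W. \<pi> q \<in> fst c'}" by simp
  moreover have "{q \<in> fst c \<inter> W. \<pi> q \<in> fst c'} \<subseteq> fst c" by auto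
  ultimately have oS: "open ?S" unfolding S using chart_open_image[OF ch(1)] by blast
  have "smooth_on ?S (rep c c' \<pi>)"
  proof (rule smooth_on_cong[OF oS _ s])
    fix y assume "y \<in> ?S"
    then obtain q where q: "q \<in> fst c \<inter> W" "y = snd c q" unfolding S by blast
    have "inj_on (snd c) (fst c \<inter> W)" using inj by (rule inj_on_subset) auto
    then have "inv_into (fst c \<inter> W) (snd c) y = q" using q by (simp add: inv_into_f_f)
    moreover have "cinv c y = q" using q cinv_left[OF ch(1)] by simp
    ultimately show "rep ?c ?c' \<pi> y = rep c c' \<pi> y" by (simp add: rep_def)
  qed
  moreover have "?S \<subseteq> rep_dom c c' \<pi>" unfolding S by (auto simp: rep_dom_def)
  moreover have "snd c p \<in> ?S" unfolding S using assms(8,9) W(2) by blast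
  ultimately have "germ_map (\<Omega> c) (D c) (snd c p) (\<Theta> c') (E c') (rep c c' \<pi> (snd c p))"
    using germ_map_of_smooth[OF oS _ _ _ assms(6,7,4,5)] by blast
  then show ?thesis using cinv_left[OF ch(1) assms(8)] by (simp add: rep_eq)
qed

section \<open>Unimodularity\<close>

lemma frechet_cong:
  assumes "open S" "x \<in> S" "\<And>y. y \<in> S \<Longrightarrow> f y = g y"
  shows "frechet_derivative f (at x) = frechet_derivative g (at x)"
proof -
  have "(f has_derivative D) (at x) \<longleftrightarrow> (g has_derivative D) (at x)" for D
    using has_derivative_transform_within_open[OF _ assms(1,2), of f D UNIV g]
      has_derivative_transform_within_open[OF _ assms(1,2), of g D UNIV f] assms(3)
    by auto
  then show ?thesis unfolding frechet_derivative_def by simp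
qed

text \<open>The standard symplectic matrix: the matrix of \<open>\<Omega>\<close> in the frame dual
  to an adapted coframe.\<close>

definition J4 :: "real^4^4" where
  "J4 = (\<chi> i. pick4 (axis 3 1) (axis 4 1) (- axis 1 1) (- axis 2 1) i)"

lemma det_J4: "det J4 \<noteq> 0"
proof -
  have "J4 ** (- J4) = mat 1"
    by (simp add: vec_eq_iff forall_4 matrix_matrix_mult_def sum_4 J4_def mat_def axis_def)
  then have "det J4 * det (- J4) = 1" by (metis det_mul det_I)
  then show ?thesis by auto
qed

lemma adapted_matrix:
  assumes "adapted V \<Omega> D w" "y \<in> V"
  shows "(\<chi> a b. \<Omega> y (axis a 1) (axis b 1)) = transpose (\<chi> i. w i y) ** (J4 ** (\<chi> i. w i y))"
proof -
  have "\<Omega> y u v = wedge (w 1 y) (w 3 y) u v + wedge (w 2 y) (w 4 y) u v" for u v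
    using assms unfolding adapted_def by blast
  then show ?thesis
    by (simp add: vec_eq_iff matrix_matrix_mult_def transpose_def sum_4 J4_def axis_def wedge_def
        inner_axis[unfolded axis_def])
qed

text \<open>The coordinate matrix of \<open>\<Omega>\<close> has determinant \<open>det J4\<close>
  times the square of \<open>vdet w\<close>, for every adapted coframe \<open>w\<close>.\<close>

lemma adapted_vdet:
  assumes "adapted V \<Omega> D w" "adapted V' \<Omega> D w'" "y \<in> V" "y \<in> V'"
  shows "\<bar>vdet w' y\<bar> = \<bar>vdet w y\<bar>"
proof -
  have "transpose (\<chi> i. w i y) ** (J4 ** (\<chi> i. w i y)) = transpose (\<chi> i. w' i y) ** (J4 ** (\<chi> i. w' i y))"
    using adapted_matrix[OF assms(1,3)] adapted_matrix[OF assms(2,4)] by simp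
  from arg_cong[OF this, of det] have "vdet w y * (det J4 * vdet w y) = vdet w' y * (det J4 * vdet w' y)"
    by (simp only: vdet_def det_mul det_transpose)
  then have "(vdet w y)\<^sup>2 = (vdet w' y)\<^sup>2" using det_J4 by (simp add: power2_eq_square mult.left_commute)
  then show ?thesis by (auto simp: power2_eq_iff)
qed

lemma vdet_pull1:
  "vdet (\<lambda>i. pull1 F (w i)) y = vdet w (F y) * det (matrix (frechet_derivative F (at y)))"
proof -
  have "(\<chi> i. pull1 F (w i) y) = (\<chi> i. w i (F y)) ** matrix (frechet_derivative F (at y))"
    by (simp add: vec_eq_iff pull1_def matrix_matrix_mult_def matrix_def inner_vec_def)
  then show ?thesis unfolding vdet_def by (simp only: det_mul)
qed

lemma smooth_on_vdet: "coframe V w \<Longrightarrow> smooth_on V (vdet w)"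
  unfolding vdet_def[abs_def]
  by (rule smooth_on_det) (simp_all add: coframe_open coframe_smooth smooth_on_nth)

lemma chart_structure_transition:
  assumes "lagrangian_engel N \<Theta> E" "c \<in> atlas N" "c' \<in> atlas N" "x \<in> rep_dom c c' id"
    "adapted V' (\<Theta> c') (E c') w'" "rep c c' id x \<in> V'"
  shows "\<exists>U. x \<in> U \<and> U \<subseteq> cdom c \<and> adapted U (\<Theta> c) (E c) (\<lambda>i. pull1 (rep c c' id) (w' i)) \<and>
     (\<forall>y\<in>U. rep c c' id y \<in> V' \<and>
        (\<forall>i j k. sc (\<lambda>i. pull1 (rep c c' id) (w' i)) i j k y = sc w' i j k (rep c c' id y)) \<and>
        (\<forall>j. drep c c' id y (frame (\<lambda>i. pull1 (rep c c' id) (w' i)) j y) = frame w' j (rep c c' id y)))"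
proof -
  note m = lagrangian_engel_manifold[OF assms(1)]
  let ?V = "rep_dom c c' id"
  have p: "pulls_back2 N N id \<Theta> \<Theta>" "maps_distr N N id E E"
    using assms(1) by (auto simp: lagrangian_engel_def symplectic_form_def two_form_def engel_structure_def distribution_def)
  have pre: "\<Theta> c' (rep c c' id y) (drep c c' id y u) (drep c c' id y v) = \<Theta> c y u v"
    "drep c c' id y ` E c y = E c' (rep c c' id y)" if "y \<in> ?V" for y u v
    using p assms(2,3) that unfolding pulls_back2_def maps_distr_def by blast+
  have x: "x \<in> cdom c" using assms(4) unfolding rep_dom_eq[OF manifold_chart[OF m assms(2)]] by simp
  have "\<exists>U. x \<in> U \<and> U \<subseteq> ?V \<inter> cdom c \<and> adapted U (\<Theta> c) (E c) (\<lambda>i. pull1 (rep c c' id) (w' i)) \<and>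
     (\<forall>y\<in>U. rep c c' id y \<in> V' \<and>
        (\<forall>i j k. sc (\<lambda>i. pull1 (rep c c' id) (w' i)) i j k y = sc w' i j k (rep c c' id y)) \<and>
        (\<forall>j. drep c c' id y (frame (\<lambda>i. pull1 (rep c c' id) (w' i)) j y) = frame w' j (rep c c' id y)))"
    by (rule pull_adapted_germ[OF open_transition_dom[OF m assms(2,3)] assms(4) transition_smooth[OF m assms(2,3)] refl
      _ _ lagrangian_engel_chart[OF assms(1,2)] x assms(5,6)]) (erule pre(1), erule pre(2))
  then obtain U where "x \<in> U" and U: "U \<subseteq> ?V \<inter> cdom c" and "adapted U (\<Theta> c) (E c) (\<lambda>i. pull1 (rep c c' id) (w' i))"
     "\<forall>y\<in>U. rep c c' id y \<in> V' \<and>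
        (\<forall>i j k. sc (\<lambda>i. pull1 (rep c c' id) (w' i)) i j k y = sc w' i j k (rep c c' id y)) \<and>
        (\<forall>j. drep c c' id y (frame (\<lambda>i. pull1 (rep c c' id) (w' i)) j y) = frame w' j (rep c c' id y))"
    by (elim exE conjE)
  moreover have "U \<subseteq> cdom c" using U by blast
  ultimately show ?thesis by (intro exI[of _ U] conjI)
qed

text \<open>The predicate \<open>Q\<close> singles out a class of adapted coframes with the same dual vector \<open>e\<^sub>j\<close>, which is
  therefore a global vector field; its divergence for the volume of \<open>\<Omega>\<close> is the trace of the
  structure functions in \<open>dv\<close>.\<close>

lemma frame_divergence_zero:
  fixes N :: "'b mfd"
  assumes LE: "lagrangian_engel N \<Theta> E" and cpt: "compact_space (mtop N)" and ne: "points N \<noteq> {}"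
    and ex: "\<And>c x. c \<in> atlas N \<Longrightarrow> x \<in> cdom c \<Longrightarrow> \<exists>V w. x \<in> V \<and> Q V (\<Theta> c) (E c) w"
    and ad: "\<And>V \<Omega> D w. Q V \<Omega> D w \<Longrightarrow> adapted V \<Omega> D w"
    and uniq: "\<And>V V' \<Omega> D w w' y. Q V \<Omega> D w \<Longrightarrow> Q V' \<Omega> D w' \<Longrightarrow> y \<in> V \<Longrightarrow> y \<in> V' \<Longrightarrow> frame w' j y = frame w j y"
    and pull: "\<And>U V' \<Omega> D \<Omega>' D' F w w'. adapted U \<Omega> D w \<Longrightarrow> Q V' \<Omega>' D' w' \<Longrightarrow>
        \<forall>y\<in>U. F y \<in> V' \<and> (\<forall>i j k. sc w i j k y = sc w' i j k (F y)) \<Longrightarrow> Q U \<Omega> D w"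
    and dv: "\<And>c x V w. c \<in> atlas N \<Longrightarrow> x \<in> cdom c \<Longrightarrow> Q V (\<Theta> c) (E c) w \<Longrightarrow> x \<in> V \<Longrightarrow> (\<Sum>i\<in>UNIV. sc w i j i x) = k"
  shows "k = 0"
proof -
  note m = lagrangian_engel_manifold[OF LE]
  \<comment> \<open>A coframe is picked separately at each point. By \<open>val\<close> the
    resulting \<open>X\<close> and \<open>\<rho>\<close> do not depend on the choice, so near each
    point they coincide with those of one local coframe and are smooth.\<close>
  define g where "g c x = (SOME w. \<exists>V. x \<in> V \<and> Q V (\<Theta> c) (E c) w)" for c x
  define X where "X c x = frame (g c x) j x" for c x
  define \<rho> where "\<rho> c x = \<bar>vdet (g c x) x\<bar>" for c x
  have val: "X c x = frame w j x" "\<rho> c x = \<bar>vdet w x\<bar>" if Q: "Q V (\<Theta> c) (E c) w" "x \<in> V" for c x V w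
  proof -
    have "\<exists>V. x \<in> V \<and> Q V (\<Theta> c) (E c) w" using Q by (intro exI[of _ V] conjI)
    then have "\<exists>V. x \<in> V \<and> Q V (\<Theta> c) (E c) (g c x)"
      unfolding g_def by (rule someI[of "\<lambda>w. \<exists>V. x \<in> V \<and> Q V (\<Theta> c) (E c) w"])
    then obtain V' where V': "x \<in> V'" "Q V' (\<Theta> c) (E c) (g c x)" by (elim exE conjE)
    show "X c x = frame w j x" unfolding X_def by (rule uniq[OF Q(1) V'(2) Q(2) V'(1)])
    show "\<rho> c x = \<bar>vdet w x\<bar>" unfolding \<rho>_def by (rule adapted_vdet[OF ad[OF Q(1)] ad[OF V'(2)] Q(2) V'(1)])
  qed
  have "const_divergence N X \<rho> k"
  proof
    show "smooth_manifold N" "compact_space (mtop N)" "points N \<noteq> {}" by (rule m cpt ne)+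
  next
    fix c assume c: "c \<in> atlas N"
    show "smooth_on (cdom c) (X c)"
    proof (rule smooth_on_local)
      fix x assume "x \<in> cdom c"
      from ex[OF c this] obtain V w where V: "x \<in> V" "Q V (\<Theta> c) (E c) w" by (elim exE conjE)
      note cf = adapted_coframe[OF ad[OF V(2)]]
      have "smooth_on V (X c)"
        by (rule smooth_on_cong[OF coframe_open[OF cf] _ smooth_on_frame[OF cf]]) (simp add: val[OF V(2)])
      then show "\<exists>V. open V \<and> x \<in> V \<and> smooth_on V (X c)" using coframe_open[OF cf] V by blast
    qed
    show "smooth_on (cdom c) (\<rho> c)"
    proof (rule smooth_on_local)
      fix x assume "x \<in> cdom c"
      from ex[OF c this] obtain V w where V: "x \<in> V" "Q V (\<Theta> c) (E c) w" by (elim exE conjE)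
      note cf = adapted_coframe[OF ad[OF V(2)]]
      have "smooth_on V (\<rho> c)"
        by (rule smooth_on_cong[OF coframe_open[OF cf] _ smooth_on_abs[OF coframe_open[OF cf] smooth_on_vdet[OF cf] coframe_det[OF cf]]])
          (simp_all add: val[OF V(2)])
      then show "\<exists>V. open V \<and> x \<in> V \<and> smooth_on V (\<rho> c)" using coframe_open[OF cf] V by blast
    qed
    fix x assume x: "x \<in> cdom c"
    from ex[OF c x] obtain V w where V: "x \<in> V" "Q V (\<Theta> c) (E c) w" by (elim exE conjE)
    note cf = adapted_coframe[OF ad[OF V(2)]]
    show "0 < \<rho> c x" using coframe_det[OF cf V(1)] by (simp add: val[OF V(2,1)])
    have "frechet_derivative (\<lambda>z. (\<rho> c z *\<^sub>R X c z) $ l) (at x)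
        = frechet_derivative (\<lambda>z. (\<bar>vdet w z\<bar> *\<^sub>R frame w j z) $ l) (at x)" for l
      by (rule frechet_cong[OF coframe_open[OF cf] V(1)]) (simp add: val[OF V(2)])
    then show "(\<Sum>l\<in>UNIV. frechet_derivative (\<lambda>z. (\<rho> c z *\<^sub>R X c z) $ l) (at x) (axis l 1)) = k * \<rho> c x"
      using divergence_frame[OF cf V(1), of j] dv[OF c x V(2,1)] by (simp add: val[OF V(2,1)] mult.commute)
  next
    fix c c' x assume c: "c \<in> atlas N" "c' \<in> atlas N" and x: "x \<in> rep_dom c c' id"
    let ?F = "rep c c' id"
    have "?F x \<in> cdom c'"
      using transition_inverse(1)[OF manifold_chart[OF m c(1)] manifold_chart[OF m c(2)] x]
      unfolding rep_dom_eq[OF manifold_chart[OF m c(2)]] by simp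
    from ex[OF c(2) this] obtain V' w' where V': "?F x \<in> V'" "Q V' (\<Theta> c') (E c') w'" by (elim exE conjE)
    let ?p = "\<lambda>i. pull1 ?F (w' i)"
    obtain U where U: "x \<in> U" "adapted U (\<Theta> c) (E c) ?p"
      "\<forall>y\<in>U. ?F y \<in> V' \<and> (\<forall>i j k. sc ?p i j k y = sc w' i j k (?F y)) \<and>
        (\<forall>j. drep c c' id y (frame ?p j y) = frame w' j (?F y))"
      using chart_structure_transition[OF LE c x ad[OF V'(2)] V'(1)] by blast
    have Qp: "Q U (\<Theta> c) (E c) ?p" by (rule pull[OF U(2) V'(2), of ?F]) (use U(3) in blast)
    show "X c' (?F x) = drep c c' id x (X c x)"
      using U(1,3) by (simp add: val[OF Qp U(1)] val[OF V'(2,1)])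
    show "\<rho> c x = \<bar>det (matrix (drep c c' id x))\<bar> * \<rho> c' (?F x)"
      by (simp add: val[OF Qp U(1)] val[OF V'(2,1)] vdet_pull1 abs_mult)
  qed
  then show ?thesis by (rule const_divergence.divergence_zero)
qed

section \<open>Compact quotients of homogeneous structures\<close>

text \<open>The two points are lifted to \<open>M\<close>, where a symmetry takes one lift to the
  other; the projection is used at both ends in place of a symmetry of the quotient.\<close>

lemma quotient_germs:
  assumes "lagrangian_engel M \<Omega> D" "homogeneous M \<Omega> D" "compact_quotient M \<Omega> D \<Gamma> \<pi> N \<Theta> E"
    "c\<^sub>1 \<in> atlas N" "x\<^sub>1 \<in> cdom c\<^sub>1" "c\<^sub>2 \<in> atlas N" "x\<^sub>2 \<in> cdom c\<^sub>2"
  obtains d\<^sub>1 d\<^sub>2 y\<^sub>1 y\<^sub>2 where "d\<^sub>1 \<in> atlas M" "y\<^sub>1 \<in> cdom d\<^sub>1" "d\<^sub>2 \<in> atlas M" "y\<^sub>2 \<in> cdom d\<^sub>2"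
    "germ_map (\<Omega> d\<^sub>1) (D d\<^sub>1) y\<^sub>1 (\<Theta> c\<^sub>1) (E c\<^sub>1) x\<^sub>1"
    "germ_map (\<Omega> d\<^sub>2) (D d\<^sub>2) y\<^sub>2 (\<Theta> c\<^sub>2) (E c\<^sub>2) x\<^sub>2"
    "germ_map (\<Omega> d\<^sub>1) (D d\<^sub>1) y\<^sub>1 (\<Omega> d\<^sub>2) (D d\<^sub>2) y\<^sub>2"
proof -
  have q: "lagrangian_engel N \<Theta> E" "local_diffeo M N \<pi>" "pulls_back2 M N \<pi> \<Theta> \<Omega>" "maps_distr M N \<pi> D E"
    "\<pi> ` points M = points N"
    using assms(3) by (simp_all add: compact_quotient_def)
  note m = lagrangian_engel_manifold[OF assms(1)] and n = lagrangian_engel_manifold[OF q(1)]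
  have lift: "\<exists>d p. d \<in> atlas M \<and> p \<in> fst d \<and> \<pi> p \<in> fst c \<and> p \<in> points M \<and> snd c (\<pi> p) = x"
    if c: "c \<in> atlas N" "x \<in> cdom c" for c x
  proof -
    have "cinv c x \<in> points N"
      using cinv_cdom(1)[OF c(2)] openin_subset[OF is_chart_open(1)[OF manifold_chart[OF n c(1)]]] by blast
    then obtain p where p: "p \<in> points M" "\<pi> p = cinv c x" using q(5) by (metis imageE)
    obtain d where "d \<in> atlas M" "p \<in> fst d" using manifold_chart_exists[OF m p(1)] .
    then show ?thesis using p cinv_cdom[OF c(2)] by (intro exI[of _ d] exI[of _ p]) simp
  qed
  obtain d\<^sub>1 p\<^sub>1 where 1: "d\<^sub>1 \<in> atlas M" "p\<^sub>1 \<in> fst d\<^sub>1" "\<pi> p\<^sub>1 \<in> fst c\<^sub>1" "p\<^sub>1 \<in> points M" "snd c\<^sub>1 (\<pi> p\<^sub>1) = x\<^sub>1"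
    using lift[OF assms(4,5)] by blast
  obtain d\<^sub>2 p\<^sub>2 where 2: "d\<^sub>2 \<in> atlas M" "p\<^sub>2 \<in> fst d\<^sub>2" "\<pi> p\<^sub>2 \<in> fst c\<^sub>2" "p\<^sub>2 \<in> points M" "snd c\<^sub>2 (\<pi> p\<^sub>2) = x\<^sub>2"
    using lift[OF assms(6,7)] by blast
  obtain f where f: "f \<in> symmetries M \<Omega> D" "f p\<^sub>1 = p\<^sub>2"
    using assms(2) 1(4) 2(4) unfolding homogeneous_def by blast
  have g1: "germ_map (\<Omega> d\<^sub>1) (D d\<^sub>1) (snd d\<^sub>1 p\<^sub>1) (\<Theta> c\<^sub>1) (E c\<^sub>1) x\<^sub>1"
    using local_diffeo_germ[OF assms(1) q(1-4) 1(1) assms(4) 1(2,3)] 1(5) by simp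
  have g2: "germ_map (\<Omega> d\<^sub>2) (D d\<^sub>2) (snd d\<^sub>2 p\<^sub>2) (\<Theta> c\<^sub>2) (E c\<^sub>2) x\<^sub>2"
    using local_diffeo_germ[OF assms(1) q(1-4) 2(1) assms(6) 2(2,3)] 2(5) by simp
  have g12: "germ_map (\<Omega> d\<^sub>1) (D d\<^sub>1) (snd d\<^sub>1 p\<^sub>1) (\<Omega> d\<^sub>2) (D d\<^sub>2) (snd d\<^sub>2 p\<^sub>2)"
    using symmetry_germ[OF assms(1) f(1) 1(1) 2(1) 1(2)] f(2) 2(2) by simp
  show thesis
    by (rule that[OF 1(1) chart_image_in_cdom[OF 1(2)] 2(1) chart_image_in_cdom[OF 2(2)] g1 g2 g12])
qed

lemma quotient_degenerate_constant:
  assumes "lagrangian_engel M \<Omega> D" "homogeneous M \<Omega> D" "compact_quotient M \<Omega> D \<Gamma> \<pi> N \<Theta> E"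
    "c\<^sub>1 \<in> atlas N" "x\<^sub>1 \<in> cdom c\<^sub>1" "c\<^sub>2 \<in> atlas N" "x\<^sub>2 \<in> cdom c\<^sub>2"
  shows "degenerate_at (\<Theta> c\<^sub>1) (E c\<^sub>1) x\<^sub>1 \<longleftrightarrow> degenerate_at (\<Theta> c\<^sub>2) (E c\<^sub>2) x\<^sub>2"
proof -
  have N: "lagrangian_engel N \<Theta> E" using assms(3) by (simp add: compact_quotient_def)
  obtain d\<^sub>1 d\<^sub>2 y\<^sub>1 y\<^sub>2 where g: "d\<^sub>1 \<in> atlas M" "y\<^sub>1 \<in> cdom d\<^sub>1" "d\<^sub>2 \<in> atlas M" "y\<^sub>2 \<in> cdom d\<^sub>2"
    "germ_map (\<Omega> d\<^sub>1) (D d\<^sub>1) y\<^sub>1 (\<Theta> c\<^sub>1) (E c\<^sub>1) x\<^sub>1"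
    "germ_map (\<Omega> d\<^sub>2) (D d\<^sub>2) y\<^sub>2 (\<Theta> c\<^sub>2) (E c\<^sub>2) x\<^sub>2"
    "germ_map (\<Omega> d\<^sub>1) (D d\<^sub>1) y\<^sub>1 (\<Omega> d\<^sub>2) (D d\<^sub>2) y\<^sub>2"
    by (rule quotient_germs[OF assms])
  note L = lagrangian_engel_chart[OF N assms(4)] lagrangian_engel_chart[OF N assms(6)]
    lagrangian_engel_chart[OF assms(1) g(1)] lagrangian_engel_chart[OF assms(1) g(3)]
  show ?thesis
    using germ_map_degenerate[OF g(5) L(3) g(2) L(1) assms(5)] germ_map_degenerate[OF g(6) L(4) g(4) L(2) assms(7)]
      germ_map_degenerate[OF g(7) L(3) g(2) L(4) g(4)] by blast
qed

text \<open>At \<open>y\<^sub>1\<close> two canonical coframes are available, one pulled back along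
  the projection, the other along the symmetry followed by the projection; by uniqueness their
  structure functions agree.\<close>

lemma quotient_structure_constant:
  assumes "lagrangian_engel M \<Omega> D" "homogeneous M \<Omega> D" "compact_quotient M \<Omega> D \<Gamma> \<pi> N \<Theta> E"
    "c\<^sub>1 \<in> atlas N" "x\<^sub>1 \<in> cdom c\<^sub>1" "c\<^sub>2 \<in> atlas N" "x\<^sub>2 \<in> cdom c\<^sub>2"
    "canonical_coframe V\<^sub>1 (\<Theta> c\<^sub>1) (E c\<^sub>1) w\<^sub>1" "x\<^sub>1 \<in> V\<^sub>1" "canonical_coframe V\<^sub>2 (\<Theta> c\<^sub>2) (E c\<^sub>2) w\<^sub>2" "x\<^sub>2 \<in> V\<^sub>2"
  shows "sc w\<^sub>1 i j k x\<^sub>1 = sc w\<^sub>2 i j k x\<^sub>2"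
proof -
  obtain d\<^sub>1 d\<^sub>2 y\<^sub>1 y\<^sub>2 where g: "d\<^sub>1 \<in> atlas M" "y\<^sub>1 \<in> cdom d\<^sub>1" "d\<^sub>2 \<in> atlas M" "y\<^sub>2 \<in> cdom d\<^sub>2"
    "germ_map (\<Omega> d\<^sub>1) (D d\<^sub>1) y\<^sub>1 (\<Theta> c\<^sub>1) (E c\<^sub>1) x\<^sub>1"
    "germ_map (\<Omega> d\<^sub>2) (D d\<^sub>2) y\<^sub>2 (\<Theta> c\<^sub>2) (E c\<^sub>2) x\<^sub>2"
    "germ_map (\<Omega> d\<^sub>1) (D d\<^sub>1) y\<^sub>1 (\<Omega> d\<^sub>2) (D d\<^sub>2) y\<^sub>2"
    by (rule quotient_germs[OF assms(1-7)])
  note L = lagrangian_engel_chart[OF assms(1) g(1)] lagrangian_engel_chart[OF assms(1) g(3)]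
  obtain U w where U: "y\<^sub>1 \<in> U" "canonical_coframe U (\<Omega> d\<^sub>1) (D d\<^sub>1) w" "sc w i j k y\<^sub>1 = sc w\<^sub>1 i j k x\<^sub>1"
    using germ_map_canonical_sc[OF g(5) L(1) g(2) assms(8,9)] by blast
  obtain U' w' where U': "y\<^sub>2 \<in> U'" "canonical_coframe U' (\<Omega> d\<^sub>2) (D d\<^sub>2) w'" "sc w' i j k y\<^sub>2 = sc w\<^sub>2 i j k x\<^sub>2"
    using germ_map_canonical_sc[OF g(6) L(2) g(4) assms(10,11)] by blast
  obtain U'' w'' where U'': "y\<^sub>1 \<in> U''" "canonical_coframe U'' (\<Omega> d\<^sub>1) (D d\<^sub>1) w''" "sc w'' i j k y\<^sub>1 = sc w' i j k y\<^sub>2"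
    using germ_map_canonical_sc[OF g(7) L(1) g(2) U'(2,1)] by blast
  show ?thesis using canonical_sc_unique[OF U(2) U''(2) U(1) U''(1)] U(3) U'(3) U''(3) by simp
qed

lemma quotient_nonempty:
  assumes "homogeneous M \<Omega> D" "compact_quotient M \<Omega> D \<Gamma> \<pi> N \<Theta> E"
  shows "points N \<noteq> {}"
  using assms unfolding homogeneous_def compact_quotient_def by blast

lemma quotient_canonical_exists:
  assumes "lagrangian_engel M \<Omega> D" "homogeneous M \<Omega> D" "compact_quotient M \<Omega> D \<Gamma> \<pi> N \<Theta> E"
    "c \<in> atlas N" "x \<in> cdom c"
  shows "\<exists>V w. x \<in> V \<and> V \<subseteq> cdom c \<and> canonical_coframe V (\<Theta> c) (E c) w"
proof -
  have N: "lagrangian_engel N \<Theta> E" "compact_space (mtop N)" using assms(3) by (simp_all add: compact_quotient_def)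
  note L = lagrangian_engel_chart[OF N(1)]
  have nd: "\<not> degenerate_at (\<Theta> c) (E c) x" if c: "c \<in> atlas N" "x \<in> cdom c" for c x
  proof
    assume d: "degenerate_at (\<Theta> c) (E c) x"
    have all: "degenerate_at (\<Theta> c') (E c') x'" if "c' \<in> atlas N" "x' \<in> cdom c'" for c' x'
      using quotient_degenerate_constant[OF assms(1-3) c that] d by blast
    \<comment> \<open>If one point is degenerate then all are, and the vectors e_3 form a global
      field of divergence -2 on a compact manifold.\<close>
    have "(-2::real) = 0"
    proof (rule frame_divergence_zero[OF N quotient_nonempty[OF assms(2,3)], of degenerate_coframe 3])
      fix c x assume c: "c \<in> atlas N" and x: "x \<in> cdom c"
      obtain V w where V: "x \<in> V" "V \<subseteq> cdom c" "adapted V (\<Theta> c) (E c) w"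
        using adapted_exists[OF L[OF c] x] by blast
      have "sc w 1 2 3 y = 0" if "y \<in> V" for y
        using degenerate_at_iff[OF V(3) that] all[OF c] V(2) that by blast
      from degenerate_exists[OF V(3) this] V(1)
      show "\<exists>V w. x \<in> V \<and> degenerate_coframe V (\<Theta> c) (E c) w" by blast
      fix V w assume Q: "degenerate_coframe V (\<Theta> c) (E c) w" "x \<in> V"
      have o: "open (cdom c)" using L[OF c] by (simp add: lag_engel_on_def)
      have a: "adapted V (\<Theta> c) (E c) w" using Q by (simp add: degenerate_coframe_def)
      have "adapted (V \<inter> cdom c) (\<Theta> c) (E c) w"
        by (rule adapted_restrict[OF a _ open_Int[OF coframe_open[OF adapted_coframe[OF a]] o]]) auto
      then have "degenerate_coframe (V \<inter> cdom c) (\<Theta> c) (E c) w"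
        using Q(1) unfolding degenerate_coframe_def by blast
      then show "(\<Sum>i\<in>UNIV. sc w i 3 i x) = -2"
        by (rule degenerate_divergence) (use Q(2) x L[OF c] in \<open>auto simp: lag_engel_on_def\<close>)
    next
      show "adapted V \<Omega> D w" if "degenerate_coframe V \<Omega> D w" for V \<Omega> D w
        using that by (simp add: degenerate_coframe_def)
    next
      show "frame w' 3 y = frame w 3 y" if "degenerate_coframe V \<Omega> D w" "degenerate_coframe V' \<Omega> D w'" "y \<in> V" "y \<in> V'"
        for V V' \<Omega> D w w' y by (rule degenerate_unique[OF that])
    next
      show "degenerate_coframe U \<Omega> D w" if "adapted U \<Omega> D w" "degenerate_coframe V' \<Omega>' D' w'"
        "\<forall>y\<in>U. F y \<in> V' \<and> (\<forall>i j k. sc w i j k y = sc w' i j k (F y))"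
        for U V' \<Omega> D \<Omega>' D' F w w' using that unfolding degenerate_coframe_def by simp
    qed
    then show False by simp
  qed
  obtain V w where V: "x \<in> V" "V \<subseteq> cdom c" "adapted V (\<Theta> c) (E c) w"
    using adapted_exists[OF L[OF assms(4)] assms(5)] by blast
  have "sc w 1 2 3 y \<noteq> 0" if "y \<in> V" for y
    using degenerate_at_iff[OF V(3) that] nd[OF assms(4)] V(2) that by blast
  from canonical_exists[OF V(3) this] show ?thesis using V(1,2) by blast
qed

section \<open>From local canonical coframes to a global coframing\<close>

lemma vdet_independent:
  fixes w :: "4 \<Rightarrow> real^4 \<Rightarrow> real^4"
  assumes "vdet w y \<noteq> 0"
  shows "inj (\<lambda>i. w i y)" "independent (range (\<lambda>i::4. w i y))"
proof -
  show inj: "inj (\<lambda>i. w i y)"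
  proof (rule injI)
    fix i j assume "w i y = w j y"
    then have "(if i = i then 1 else 0 :: real) = (if j = i then 1 else 0)"
      using frame_dual[OF assms, of i i] frame_dual[OF assms, of j i] by simp
    then show "i = j" by (simp split: if_splits)
  qed
  have "UNIV \<subseteq> span (range (\<lambda>i. w i y))"
  proof
    fix \<alpha> :: "real^4"
    have "(\<Sum>i\<in>UNIV. (\<alpha> \<bullet> frame w i y) *\<^sub>R w i y) \<in> span (range (\<lambda>i. w i y))"
      by (intro span_sum span_scale span_base) auto
    then show "\<alpha> \<in> span (range (\<lambda>i. w i y))" using covector_expansion[OF assms, of \<alpha>] by simp
  qed
  moreover have "card (range (\<lambda>i. w i y)) \<le> dim (UNIV :: (real^4) set)"
    using card_image[OF inj] by (simp add: dim_UNIV)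
  ultimately show "independent (range (\<lambda>i. w i y))"
    by (intro card_le_dim_spanning[of _ UNIV]) auto
qed

lemma independent_vdet:
  fixes w :: "4 \<Rightarrow> real^4 \<Rightarrow> real^4"
  assumes "inj (\<lambda>i. w i y)" "independent (range (\<lambda>i::4. w i y))"
  shows "vdet w y \<noteq> 0"
proof -
  have "UNIV \<subseteq> span (range (\<lambda>i. w i y))"
    by (rule card_ge_dim_independent[OF subset_UNIV assms(2)]) (simp add: card_image[OF assms(1)] dim_UNIV)
  moreover have "rows (\<chi> i. w i y) = range (\<lambda>i. w i y)" by (auto simp: rows_def row_def)
  ultimately have "span (rows (\<chi> i. w i y)) = UNIV" by auto
  then show ?thesis
    unfolding vdet_def invertible_det_nz[symmetric] invertible_left_inverse matrix_left_invertible_span_rows .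
qed

lemma range_four: "range (f :: 4 \<Rightarrow> 'c) = {f 1, f 2, f 3, f 4}"
  by (simp add: UNIV_4)

lemma one_to_four: "{1..4::nat} = {1, 2, 3, 4}"
  by auto

text \<open>The structure equations contain all the normalisations, so a 0-adapted coframing that
  satisfies them is the canonical coframe in every chart. This gives the uniqueness part of the
  classification.\<close>

lemma structure_equations_canonical:
  assumes "lagrangian_engel N \<Theta> E" "zero_adapted N \<Theta> E \<omega>" "structure_equations N b \<omega>" "c \<in> atlas N"
  defines "w \<equiv> pick4 (\<omega> 1 c) (\<omega> 2 c) (\<omega> 3 c) (\<omega> 4 c)"
  shows "canonical_coframe (cdom c) (\<Theta> c) (E c) w" "x \<in> cdom c \<Longrightarrow> sc w 4 2 3 x = b"
proof -
  note L = lagrangian_engel_chart[OF assms(1,4)]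
  have o: "open (cdom c)" using L by (simp add: lag_engel_on_def)
  have cf: "coframing N \<omega>" using assms(2) by (simp add: zero_adapted_def)
  have sm: "smooth_on (cdom c) (\<omega> i c)" if "i \<in> {1..4}" for i
    using cf assms(4) that by (auto simp: coframing_def one_form_def)
  have c: "coframe (cdom c) w"
    unfolding coframe_def
  proof (intro conjI allI ballI)
    show "open (cdom c)" by (rule o)
    show "smooth_on (cdom c) (w i)" for i using sm by (simp add: w_def pick4_def)
    fix y assume y: "y \<in> cdom c"
    have ij: "inj_on (\<lambda>i. \<omega> i c y) {1..4}" "independent ((\<lambda>i. \<omega> i c y) ` {1..4})"
      using cf assms(4) y by (auto simp: coframing_def)
    have "inj (\<lambda>i. w i y)"
    proof (rule injI)
      fix i j assume "w i y = w j y"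
      then show "i = j" using ij(1) exhaust_4[of i] exhaust_4[of j] unfolding one_to_four inj_on_def
        by (auto simp: w_def)
    qed
    moreover have "range (\<lambda>i. w i y) = (\<lambda>i. \<omega> i c y) ` {1..4}"
      unfolding range_four one_to_four by (simp add: w_def)
    ultimately show "vdet w y \<noteq> 0" using independent_vdet ij(2) by metis
  qed
  have Z: "\<Theta> c y u v = wedge (w 1 y) (w 3 y) u v + wedge (w 2 y) (w 4 y) u v" 
    "annihilator (E c) y = span {w 1 y, w 2 y}" if "y \<in> cdom c" for y u v
    using assms(2,4) that unfolding zero_adapted_def by (simp_all add: w_def)
  have S: "ext_d1 (w 1) y u v = wedge (w 2 y) (w 3 y) u v" "ext_d1 (w 2) y u v = wedge (w 3 y) (w 4 y) u v"
    "ext_d1 (w 3) y u v = 0" "ext_d1 (w 4) y u v = b * wedge (w 2 y) (w 3 y) u v" if "y \<in> cdom c" for y u v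
    using assms(3,4) that unfolding structure_equations_def by (simp_all add: w_def)
  have sc: "sc w 1 2 3 y = 1" "sc w 1 2 4 y = 0" "sc w 1 3 4 y = 0" "sc w 2 3 4 y = 1" "sc w 1 1 2 y = 0"
    "sc w 2 2 3 y = 0" "sc w 2 2 4 y = 0" "sc w 4 2 3 y = b" if "y \<in> cdom c" for y
    unfolding sc_def S[OF that] wedge_def frame_dual[OF coframe_det[OF c that]] by simp_all
  show "sc w 4 2 3 x = b" if "x \<in> cdom c" by (rule sc(8)[OF that])
  have "adapted (cdom c) (\<Theta> c) (E c) w"
    unfolding adapted_def
  proof (intro conjI ballI allI)
    show "coframe (cdom c) w" by (rule c)
    show "\<Theta> c y u v = wedge (w 1 y) (w 3 y) u v + wedge (w 2 y) (w 4 y) u v" if "y \<in> cdom c" for y u v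
      by (rule Z(1)[OF that])
    fix y assume y: "y \<in> cdom c"
    note v0 = coframe_det[OF c y]
    let ?K = "{v. w 1 y \<bullet> v = 0 \<and> w 2 y \<bullet> v = 0}"
    have "subbundle (cdom c) 2 (E c)" using L by (simp add: lag_engel_on_def)
    then obtain e where e: "E c y = span ((\<lambda>i::nat. e i y) ` {..<2})" "dim (E c y) = 2"
      using y unfolding subbundle_def by blast
    show "E c y = ?K"
    proof (rule subspace_dim_equal)
      show "subspace (E c y)" unfolding e(1) by (rule subspace_span)
      show "subspace ?K" unfolding frame_kernel2[OF v0] by (rule subspace_span)
      have "w 1 y \<in> annihilator (E c) y" "w 2 y \<in> annihilator (E c) y"
        unfolding Z(2)[OF y] by (auto intro: span_base)
      then show "E c y \<subseteq> ?K" by (auto simp: annihilator_def)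
      have "dim ?K \<le> card {frame w 3 y, frame w 4 y}"
        unfolding frame_kernel2[OF v0] dim_span by (rule dim_le_card') simp
      also have "\<dots> \<le> 2" by (simp add: card_insert_if)
      finally show "dim ?K \<le> dim (E c y)" using e(2) by simp
    qed
    show "sc w 1 3 4 y = 0" "sc w 2 3 4 y \<noteq> 0" "sc w 1 2 3 y \<noteq> 0 \<or> sc w 1 2 4 y \<noteq> 0"
      using sc[OF y] by simp_all
  qed
  then show "canonical_coframe (cdom c) (\<Theta> c) (E c) w"
    unfolding canonical_coframe_def using sc by blast
qed

text \<open>Uniqueness glues the local canonical coframes to global forms. Their structure functions
  are constants, every dual vector is a global field and therefore divergence free, and this leaves
  \<open>C 4 2 3\<close> as the parameter.\<close>

lemma classification:
  assumes "lagrangian_engel M \<Omega> D" "homogeneous M \<Omega> D" "compact_quotient M \<Omega> D \<Gamma> \<pi> N \<Theta> E"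
  shows "\<exists>\<omega> b. zero_adapted N \<Theta> E \<omega> \<and> structure_equations N b \<omega> \<and>
     (\<forall>\<omega>' b'. zero_adapted N \<Theta> E \<omega>' \<and> structure_equations N b' \<omega>' \<longrightarrow>
        coframing_agree N \<omega> \<omega>' \<and> b' = b)"
proof -
  have N: "lagrangian_engel N \<Theta> E" "compact_space (mtop N)" using assms(3) by (simp_all add: compact_quotient_def)
  note L = lagrangian_engel_chart[OF N(1)] and m = lagrangian_engel_manifold[OF N(1)]
  note ex = quotient_canonical_exists[OF assms]
  obtain q where q: "q \<in> points N" using quotient_nonempty[OF assms(2,3)] by blast
  obtain c\<^sub>0 where c\<^sub>0: "c\<^sub>0 \<in> atlas N" "q \<in> fst c\<^sub>0" using manifold_chart_exists[OF m q] .
  define x\<^sub>0 where "x\<^sub>0 = snd c\<^sub>0 q"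
  have x\<^sub>0: "x\<^sub>0 \<in> cdom c\<^sub>0" unfolding x\<^sub>0_def by (rule chart_image_in_cdom[OF c\<^sub>0(2)])
  obtain V\<^sub>0 w\<^sub>0 where w\<^sub>0: "x\<^sub>0 \<in> V\<^sub>0" "V\<^sub>0 \<subseteq> cdom c\<^sub>0" "canonical_coframe V\<^sub>0 (\<Theta> c\<^sub>0) (E c\<^sub>0) w\<^sub>0"
    using ex[OF c\<^sub>0(1) x\<^sub>0] by blast
  define C where "C i j k = sc w\<^sub>0 i j k x\<^sub>0" for i j k
  have C: "sc w i j k x = C i j k" if "c \<in> atlas N" "x \<in> cdom c" "canonical_coframe V (\<Theta> c) (E c) w" "x \<in> V"
    for c x V w i j k
    unfolding C_def by (rule quotient_structure_constant[OF assms that(1,2) c\<^sub>0(1) x\<^sub>0 that(3,4) w\<^sub>0(3,1)])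
  have U: "(\<Sum>i\<in>UNIV. C i j i) = 0" for j
  proof (rule frame_divergence_zero[OF N quotient_nonempty[OF assms(2,3)], of canonical_coframe j])
    show "\<exists>V w. x \<in> V \<and> canonical_coframe V (\<Theta> c) (E c) w" if "c \<in> atlas N" "x \<in> cdom c" for c x
      using ex[OF that] by blast
    show "adapted V \<Omega> D w" if "canonical_coframe V \<Omega> D w" for V \<Omega> D w
      using that by (simp add: canonical_coframe_def)
    show "frame w' j y = frame w j y" if "canonical_coframe V \<Omega> D w" "canonical_coframe V' \<Omega> D w'" "y \<in> V" "y \<in> V'"
      for V V' \<Omega> D w w' y unfolding frame_def using canonical_unique[OF that] by simp
    show "canonical_coframe U \<Omega> D w" if "adapted U \<Omega> D w" "canonical_coframe V' \<Omega>' D' w'"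
        "\<forall>y\<in>U. F y \<in> V' \<and> (\<forall>i j k. sc w i j k y = sc w' i j k (F y))"
      for U V' \<Omega> D \<Omega>' D' F w w' using that unfolding canonical_coframe_def by simp
    show "(\<Sum>i\<in>UNIV. sc w i j i x) = (\<Sum>i\<in>UNIV. C i j i)"
      if "c \<in> atlas N" "x \<in> cdom c" "canonical_coframe V (\<Theta> c) (E c) w" "x \<in> V" for c x V w
      using C[OF that] by simp
  qed
  have closed: "ext_d2 (\<Theta> c) y u v z = 0" if "c \<in> atlas N" "y \<in> cdom c" for c y u v z
    using L[OF that(1)] that(2) by (simp add: lag_engel_on_def)
  note K = canonical_structure_constants[OF w\<^sub>0(3,1) closed[OF c\<^sub>0(1)] C[OF c\<^sub>0(1) _ w\<^sub>0(3)] U]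
  have K: "C 1 1 2 = 0" "C 1 1 3 = 0" "C 1 1 4 = 0" "C 1 2 3 = 1" "C 1 2 4 = 0" "C 1 3 4 = 0"
    "C 2 1 2 = 0" "C 2 1 3 = 0" "C 2 1 4 = 0" "C 2 2 3 = 0" "C 2 2 4 = 0" "C 2 3 4 = 1"
    "C 3 1 2 = 0" "C 3 1 3 = 0" "C 3 1 4 = 0" "C 3 2 3 = 0" "C 3 2 4 = 0" "C 3 3 4 = 0"
    "C 4 1 2 = 0" "C 4 1 3 = 0" "C 4 1 4 = 0" "C 4 2 4 = 0" "C 4 3 4 = 0"
    by (rule K; use w\<^sub>0(2) in blast)+
  define g where "g c x = (SOME w. \<exists>V. x \<in> V \<and> V \<subseteq> cdom c \<and> canonical_coframe V (\<Theta> c) (E c) w)" for c x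
  \<comment> \<open>Coframings are indexed by natural numbers, local coframes by the type
    \<open>4\<close>; \<open>of_nat\<close> translates between the indices.\<close>
  define \<omega> where "\<omega> n c x = g c x (of_nat n) x" for n :: nat and c x
  have val: "\<omega> n c x = w (of_nat n) x" if Q: "canonical_coframe V (\<Theta> c) (E c) w" "x \<in> V" "V \<subseteq> cdom c" for n c x V w
  proof -
    have "\<exists>V. x \<in> V \<and> V \<subseteq> cdom c \<and> canonical_coframe V (\<Theta> c) (E c) w" using Q by (intro exI[of _ V] conjI)
    then have "\<exists>V. x \<in> V \<and> V \<subseteq> cdom c \<and> canonical_coframe V (\<Theta> c) (E c) (g c x)"
      unfolding g_def by (rule someI[of "\<lambda>w. \<exists>V. x \<in> V \<and> V \<subseteq> cdom c \<and> canonical_coframe V (\<Theta> c) (E c) w"])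
    then obtain V' where V': "x \<in> V'" "canonical_coframe V' (\<Theta> c) (E c) (g c x)" by (elim exE conjE)
    show "\<omega> n c x = w (of_nat n) x" unfolding \<omega>_def by (rule canonical_unique[OF Q(1) V'(2) Q(2) V'(1)])
  qed
  have num: "of_nat 1 = (1::4)" "of_nat 2 = (2::4)" "of_nat 3 = (3::4)" "of_nat 4 = (4::4)"
    "of_nat (Suc 0) = (1::4)" by simp_all
  have smooth: "smooth_on (cdom c) (\<omega> n c)" if c: "c \<in> atlas N" for c n
  proof (rule smooth_on_local)
    fix x assume "x \<in> cdom c"
    then obtain V w where V: "x \<in> V" "V \<subseteq> cdom c" "canonical_coframe V (\<Theta> c) (E c) w" using ex[OF c] by blast
    then have cf: "coframe V w" using adapted_coframe unfolding canonical_coframe_def by blast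
    have "smooth_on V (\<omega> n c)"
      by (rule smooth_on_cong[OF coframe_open[OF cf] _ coframe_smooth[OF cf, of "of_nat n"]]) (simp add: val[OF V(3) _ V(2)])
    then show "\<exists>V. open V \<and> x \<in> V \<and> smooth_on V (\<omega> n c)" using coframe_open[OF cf] V by blast
  qed
  have pb: "pulls_back1 N N id (\<omega> n) (\<omega> n)" for n
    unfolding pulls_back1_def
  proof (intro ballI allI)
    fix c c' x u assume c: "c \<in> atlas N" "c' \<in> atlas N" and x: "x \<in> rep_dom c c' id"
    let ?F = "rep c c' id"
    have "?F x \<in> cdom c'"
      using transition_inverse(1)[OF manifold_chart[OF m c(1)] manifold_chart[OF m c(2)] x]
      unfolding rep_dom_eq[OF manifold_chart[OF m c(2)]] by simp
    then obtain V' w' where V': "?F x \<in> V'" "V' \<subseteq> cdom c'" "canonical_coframe V' (\<Theta> c') (E c') w'" using ex[OF c(2)] by blast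
    let ?p = "\<lambda>i. pull1 ?F (w' i)"
    have a': "adapted V' (\<Theta> c') (E c') w'" using V'(3) by (simp add: canonical_coframe_def)
    obtain U where U: "x \<in> U" "U \<subseteq> cdom c" "adapted U (\<Theta> c) (E c) ?p"
      "\<forall>y\<in>U. ?F y \<in> V' \<and> (\<forall>i j k. sc ?p i j k y = sc w' i j k (?F y))"
      using chart_structure_transition[OF N(1) c x a' V'(1)] by blast
    have Qp: "canonical_coframe U (\<Theta> c) (E c) ?p" using V'(3) U(3,4) unfolding canonical_coframe_def by simp
    show "\<omega> n c' (?F x) \<bullet> drep c c' id x u = \<omega> n c x \<bullet> u"
      unfolding val[OF V'(3,1,2)] val[OF Qp U(1,2)]
      using pull1_inner[OF smooth_on_differentiable[OF transition_smooth[OF m c] x]] by simp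
  qed
  have pt: "inj_on (\<lambda>i. \<omega> i c x) {1..4} \<and> independent ((\<lambda>i. \<omega> i c x) ` {1..4})"
    "\<Theta> c x u v = wedge (\<omega> 1 c x) (\<omega> 3 c x) u v + wedge (\<omega> 2 c x) (\<omega> 4 c x) u v"
    "annihilator (E c) x = span {\<omega> 1 c x, \<omega> 2 c x}" "derived (annihilator (E c)) x = span {\<omega> 1 c x}"
    "ext_d1 (\<omega> 1 c) x u v = wedge (\<omega> 2 c x) (\<omega> 3 c x) u v"
    "ext_d1 (\<omega> 2 c) x u v = wedge (\<omega> 3 c x) (\<omega> 4 c x) u v"
    "ext_d1 (\<omega> 3 c) x u v = 0" "ext_d1 (\<omega> 4 c) x u v = C 4 2 3 * wedge (\<omega> 2 c x) (\<omega> 3 c x) u v"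
    if c: "c \<in> atlas N" and x: "x \<in> cdom c" for c x u v
  proof -
    obtain V w where V: "x \<in> V" "V \<subseteq> cdom c" "canonical_coframe V (\<Theta> c) (E c) w" using ex[OF c x] by blast
    have a: "adapted V (\<Theta> c) (E c) w" using V(3) by (simp add: canonical_coframe_def)
    note cf = adapted_coframe[OF a] and v0 = coframe_det[OF adapted_coframe[OF a] V(1)]
    have v: "\<omega> 1 c x = w 1 x" "\<omega> 2 c x = w 2 x" "\<omega> 3 c x = w 3 x" "\<omega> 4 c x = w 4 x"
      using val[OF V(3,1,2)] num by metis+
    show "annihilator (E c) x = span {\<omega> 1 c x, \<omega> 2 c x}" unfolding v by (rule adapted_annihilator[OF a V(1)])
    show "derived (annihilator (E c)) x = span {\<omega> 1 c x}" unfolding v by (rule adapted_derived[OF a V(1)])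
    show "\<Theta> c x u v = wedge (\<omega> 1 c x) (\<omega> 3 c x) u v + wedge (\<omega> 2 c x) (\<omega> 4 c x) u v"
      unfolding v using a V(1) unfolding adapted_def by blast
    have d: "ext_d1 (\<omega> n c) x = ext_d1 (w (of_nat n)) x" for n
      by (rule ext_d1_cong[OF coframe_open[OF cf] V(1)]) (rule val[OF V(3) _ V(2)])
    note e = two_form_expansion[OF v0 bilinear_ext_d1_coframe[OF cf V(1)] ext_d1_self]
    note s = C[OF c x V(3,1), unfolded sc_def]
    show "ext_d1 (\<omega> 1 c) x u v = wedge (\<omega> 2 c x) (\<omega> 3 c x) u v"
      "ext_d1 (\<omega> 2 c) x u v = wedge (\<omega> 3 c x) (\<omega> 4 c x) u v"
      "ext_d1 (\<omega> 3 c) x u v = 0" "ext_d1 (\<omega> 4 c) x u v = C 4 2 3 * wedge (\<omega> 2 c x) (\<omega> 3 c x) u v"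
      unfolding d num v by (subst e, simp add: s K)+
    show "inj_on (\<lambda>i. \<omega> i c x) {1..4} \<and> independent ((\<lambda>i. \<omega> i c x) ` {1..4})"
    proof
      have "(\<lambda>i. \<omega> i c x) ` {1..4} = range (\<lambda>i. w i x)" unfolding one_to_four range_four by (simp add: v v[unfolded One_nat_def])
      then show "independent ((\<lambda>i. \<omega> i c x) ` {1..4})" using vdet_independent(2)[OF v0] by simp
      have ne: "w i x \<noteq> w j x" if "i \<noteq> j" for i j using vdet_independent(1)[OF v0] that by (auto dest: injD)
      show "inj_on (\<lambda>i. \<omega> i c x) {1..4}"
        unfolding one_to_four inj_on_def by (auto simp: v v[unfolded One_nat_def] dest: ne[rotated])
          (use ne in auto)
    qed
  qed
  have z: "zero_adapted N \<Theta> E \<omega>"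
    unfolding zero_adapted_def coframing_def one_form_def using smooth pb pt(1-4) by blast
  have s: "structure_equations N (C 4 2 3) \<omega>"
    unfolding structure_equations_def using pt(5-8) by blast
  have u: "coframing_agree N \<omega> \<omega>' \<and> b' = C 4 2 3" if h: "zero_adapted N \<Theta> E \<omega>'" "structure_equations N b' \<omega>'" for \<omega>' b'
  proof
    note W = structure_equations_canonical[OF N(1) h]
    let ?w = "\<lambda>c. pick4 (\<omega>' 1 c) (\<omega>' 2 c) (\<omega>' 3 c) (\<omega>' 4 c)"
    show "coframing_agree N \<omega> \<omega>'"
      unfolding coframing_agree_def
    proof (intro ballI)
      fix i c x assume i: "i \<in> {1..4::nat}" and c: "c \<in> atlas N" and x: "x \<in> cdom c"
      have "\<omega> i c x = ?w c (of_nat i) x" by (rule val[OF W(1)[OF c] x subset_refl])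
      also have "\<dots> = \<omega>' i c x" using i num unfolding one_to_four by auto
      finally show "\<omega> i c x = \<omega>' i c x" .
    qed
    show "b' = C 4 2 3" using C[OF c\<^sub>0(1) x\<^sub>0 W(1)[OF c\<^sub>0(1)] x\<^sub>0, of 4 2 3] W(2)[OF c\<^sub>0(1) x\<^sub>0] by simp
  qed
  show ?thesis using z s u by blast
qed

section \<open>Orbit manifolds\<close>

definition R4 :: "(real^4) mfd" where
  "R4 = \<lparr>mtop = euclidean, atlas = {(UNIV, id)}\<rparr>"

lemma R4_simps [simp]: "mtop R4 = euclidean" "atlas R4 = {(UNIV, id)}"
  by (simp_all add: R4_def)

lemma restrict_UNIV_eq: "restrict f UNIV = f"
  by (simp add: fun_eq_iff)

lemma inv_into_id: "x \<in> A \<Longrightarrow> inv_into A id x = x"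
  using inv_into_f_f[of id A x] by simp

text \<open>\<open>w\<close> is an invariant adapted coframe on \<open>\<real>\<^sup>4\<close>; since every element of \<open>G\<close> preserves it, the
  components of the induced tensors on the orbit space are the same in all charts that invert the
  projection.\<close>

locale orbit_model =
  fixes G :: "(real^4 \<Rightarrow> real^4) set" and w :: "4 \<Rightarrow> real^4 \<Rightarrow> real^4" and \<Omega> D
  assumes id_G: "id \<in> G"
    and comp_G: "g \<in> G \<Longrightarrow> h \<in> G \<Longrightarrow> g \<circ> h \<in> G"
    and inv_G: "g \<in> G \<Longrightarrow> \<exists>h\<in>G. h \<circ> g = id \<and> g \<circ> h = id"
    and smooth_G: "g \<in> G \<Longrightarrow> smooth_on UNIV g"
    and pres_G: "g \<in> G \<Longrightarrow> w i (g x) \<bullet> frechet_derivative g (at x) u = w i x \<bullet> u"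
    and disc_G: "finite {g \<in> G. g ` cball 0 R \<inter> cball 0 R \<noteq> {}}"
    and free_G: "g \<in> G \<Longrightarrow> g x = x \<Longrightarrow> g = id"
    and cocompact_G: "\<exists>R. \<forall>x. \<exists>g\<in>G. g x \<in> cball 0 R"
    and adapted_w: "adapted UNIV \<Omega> D w"
    and closed_\<Omega>: "ext_d2 \<Omega> x u v z = 0"
begin

definition orb :: "real^4 \<Rightarrow> (real^4) set" where "orb x = (\<lambda>g. g x) ` G"

lemma orb_eq_iff: "orb x = orb y \<longleftrightarrow> (\<exists>g\<in>G. g x = y)"
proof
  assume "orb x = orb y"
  moreover have "y \<in> orb y" using id_G by (auto simp: orb_def intro: rev_image_eqI)
  ultimately have "y \<in> orb x" by simp
  then show "\<exists>g\<in>G. g x = y" by (auto simp: orb_def)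
next
  assume "\<exists>g\<in>G. g x = y"
  then obtain g where g: "g \<in> G" "g x = y" by blast
  obtain h where h: "h \<in> G" "h \<circ> g = id" using inv_G[OF g(1)] by blast
  have hy: "h y = x" using g(2) h(2) by (auto simp: fun_eq_iff)
  show "orb x = orb y"
  proof (intro equalityI subsetI)
    fix z assume "z \<in> orb x"
    then obtain k where "k \<in> G" "z = k x" unfolding orb_def by blast
    then show "z \<in> orb y" using comp_G[of k h] h(1) hy by (auto simp: orb_def intro!: rev_image_eqI[of "k \<circ> h"])
  next
    fix z assume "z \<in> orb y"
    then obtain k where "k \<in> G" "z = k y" unfolding orb_def by blast
    then show "z \<in> orb x" using comp_G[of k g] g by (auto simp: orb_def intro!: rev_image_eqI[of "k \<circ> g"])
  qed
qed

lemma orb_G: "g \<in> G \<Longrightarrow> orb (g x) = orb x"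
  using orb_eq_iff[of x "g x"] by blast

lemma cont_G: "g \<in> G \<Longrightarrow> continuous_on UNIV g"
  using smooth_G smooth_on_continuous_on by blast

lemma isCont_G: "g \<in> G \<Longrightarrow> isCont g x"
  using cont_G continuous_on_eq_continuous_at open_UNIV by blast

lemma open_vimage_G: "g \<in> G \<Longrightarrow> open V \<Longrightarrow> open (g -` V)"
  using cont_G by (simp add: open_vimage)

lemma finite_G_meeting: "finite {g \<in> G. g ` cball x 1 \<inter> cball y 1 \<noteq> {}}"
proof (rule finite_subset[OF _ disc_G[of "norm x + norm y + 1"]])
  have "cball x 1 \<subseteq> cball 0 (norm x + norm y + 1)" "cball y 1 \<subseteq> cball 0 (norm x + norm y + 1)"
  proof -
    have "norm z \<le> norm x + norm y + 1" if "dist x z \<le> 1 \<or> dist y z \<le> 1" for z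
      using that norm_triangle_sub[of z x] norm_triangle_sub[of z y] norm_ge_zero[of x] norm_ge_zero[of y]
      unfolding dist_norm norm_minus_commute[of x] norm_minus_commute[of y] by linarith
    then show "cball x 1 \<subseteq> cball 0 (norm x + norm y + 1)" "cball y 1 \<subseteq> cball 0 (norm x + norm y + 1)"
      by (auto simp: dist_norm)
  qed
  then show "{g \<in> G. g ` cball x 1 \<inter> cball y 1 \<noteq> {}} \<subseteq>
      {g \<in> G. g ` cball 0 (norm x + norm y + 1) \<inter> cball 0 (norm x + norm y + 1) \<noteq> {}}" by blast
qed

text \<open>Only finitely many group elements carry the unit ball at \<open>x\<close> to a set
  meeting the one at \<open>y\<close>; continuity gives each of them a radius. With \<open>P\<close>
  always true this yields the Hausdorff property, with \<open>P g\<close> meaning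
  \<open>g \<noteq> id\<close> and \<open>x = y\<close> it yields the charts.\<close>

lemma separation:
  assumes "\<And>g. g \<in> G \<Longrightarrow> P g \<Longrightarrow> g x \<noteq> y"
  shows "\<exists>r>0. \<forall>g\<in>G. P g \<longrightarrow> g ` ball x r \<inter> ball y r = {}"
proof -
  define F where "F = {g \<in> G. P g \<and> g ` cball x 1 \<inter> cball y 1 \<noteq> {}}"
  have fin: "finite F" by (rule finite_subset[OF _ finite_G_meeting[of x y]]) (auto simp: F_def)
  have "\<exists>r>0. g ` ball x r \<inter> ball y r = {}" if g: "g \<in> F" for g
  proof -
    define e where "e = dist (g x) y / 2"
    have e: "e > 0" using assms[of g] g by (auto simp: F_def e_def)
    obtain d where d: "d > 0" "\<And>z. dist z x < d \<Longrightarrow> dist (g z) (g x) < e"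
      using isCont_G[of g x] g e unfolding continuous_at_eps_delta F_def by blast
    have "g z \<notin> ball y (min d e)" if "z \<in> ball x (min d e)" for z
    proof
      assume "g z \<in> ball y (min d e)"
      moreover have "dist (g z) (g x) < e" using d(2)[of z] that by (simp add: dist_commute)
      ultimately have "dist (g x) y < 2 * e" using dist_triangle[of "g x" y "g z"] by (simp add: dist_commute)
      then show False by (simp add: e_def)
    qed
    then show ?thesis using d(1) e by (intro exI[of _ "min d e"]) auto
  qed
  then obtain r where r: "\<And>g. g \<in> F \<Longrightarrow> r g > 0 \<and> g ` ball x (r g) \<inter> ball y (r g) = {}" by metis
  \<comment> \<open>The inserted 1 covers the elements outside \<open>F\<close> and the case of an
    empty \<open>F\<close>.\<close>
  define \<rho> where "\<rho> = Min (insert 1 (r ` F))"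
  have \<rho>: "\<rho> > 0" "\<rho> \<le> 1" "\<And>g. g \<in> F \<Longrightarrow> \<rho> \<le> r g"
    using fin r by (auto simp: \<rho>_def)
  have "g ` ball x \<rho> \<inter> ball y \<rho> = {}" if g: "g \<in> G" "P g" for g
  proof (cases "g \<in> F")
    case True
    have "ball x \<rho> \<subseteq> ball x (r g)" "ball y \<rho> \<subseteq> ball y (r g)" using \<rho>(3)[OF True] by (auto intro: subset_ball)
    then show ?thesis using r[OF True] by blast
  next
    case False
    have "ball x \<rho> \<subseteq> cball x 1" "ball y \<rho> \<subseteq> cball y 1" using \<rho>(2) by auto
    then show ?thesis using False g unfolding F_def by blast
  qed
  then show ?thesis using \<rho>(1) by blast
qed

lemma small_ball: "\<exists>r>0. inj_on orb (ball x r)"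
proof -
  obtain r where r: "r > 0" "\<forall>g\<in>G. g \<noteq> id \<longrightarrow> g ` ball x r \<inter> ball x r = {}"
    using separation[of "\<lambda>g. g \<noteq> id" x x] free_G by blast
  have "inj_on orb (ball x r)"
  proof (rule inj_onI)
    fix y z assume yz: "y \<in> ball x r" "z \<in> ball x r" "orb y = orb z"
    then obtain g where g: "g \<in> G" "g y = z" using orb_eq_iff by blast
    then have "g = id" using r(2) yz by blast
    then show "y = z" using g by simp
  qed
  then show ?thesis using r(1) by blast
qed

section \<open>Quotient topology and charts of the orbit space\<close>

definition otop :: "(real^4) set topology" where
  "otop = topology (\<lambda>U. U \<subseteq> range orb \<and> open (orb -` U))"

lemma openin_otop: "openin otop U \<longleftrightarrow> U \<subseteq> range orb \<and> open (orb -` U)"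
proof -
  have "istopology (\<lambda>U. U \<subseteq> range orb \<and> open (orb -` U))"
    unfolding istopology_def
  proof (intro conjI allI impI)
    fix S T assume "S \<subseteq> range orb \<and> open (orb -` S)" "T \<subseteq> range orb \<and> open (orb -` T)"
    then show "S \<inter> T \<subseteq> range orb" "open (orb -` (S \<inter> T))" by (blast, simp add: vimage_Int open_Int)
  next
    fix K assume K: "\<forall>S\<in>K. S \<subseteq> range orb \<and> open (orb -` S)"
    then show "\<Union>K \<subseteq> range orb" by blast
    show "open (orb -` \<Union>K)" unfolding vimage_Union by (rule open_UN) (use K in blast)
  qed
  then show ?thesis unfolding otop_def by (simp add: topology_inverse')
qed

lemma topspace_otop: "topspace otop = range orb"
proof -
  have "openin otop (range orb)" by (simp add: openin_otop vimage_def)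
  then show ?thesis using openin_topspace[of otop] unfolding topspace_def openin_otop by auto
qed

text \<open>The saturation of \<open>V\<close> is the union of its preimages under the group
  elements.\<close>

lemma orb_open: "open V \<Longrightarrow> openin otop (orb ` V)"
proof -
  assume V: "open V"
  have "orb -` (orb ` V) = (\<Union>g\<in>G. g -` V)"
  proof (intro equalityI subsetI)
    fix x assume "x \<in> orb -` (orb ` V)"
    then obtain v where v: "v \<in> V" "orb x = orb v" by blast
    then obtain g where "g \<in> G" "g x = v" unfolding orb_eq_iff by (elim bexE)
    then show "x \<in> (\<Union>g\<in>G. g -` V)" using v(1) by blast
  next
    fix x assume "x \<in> (\<Union>g\<in>G. g -` V)"
    then obtain g where g: "g \<in> G" "g x \<in> V" by blast
    show "x \<in> orb -` (orb ` V)" using orb_G[OF g(1), of x, symmetric] g(2) by (intro vimageI2) (rule image_eqI)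
  qed
  moreover have "open (\<Union>g\<in>G. g -` V)" by (rule open_UN) (use open_vimage_G V in blast)
  ultimately show ?thesis unfolding openin_otop by (simp add: image_mono)
qed

lemma orb_continuous: "continuous_map euclidean otop orb"
  unfolding continuous_map by (auto simp: topspace_otop openin_otop vimage_def)

lemma orb_continuous_sub: "continuous_map (subtopology euclidean W) (subtopology otop (orb ` W)) orb"
  using continuous_map_into_subtopology[OF continuous_map_from_subtopology[OF orb_continuous], of W "orb ` W"] by auto

lemma section_continuous:
  assumes "open B" "inj_on orb B"
  shows "continuous_map (subtopology otop (orb ` B)) (top_of_set B) (inv_into B orb)"
proof -
  have t: "topspace (subtopology otop (orb ` B)) = orb ` B"
    by (rule topspace_subtopology_subset[OF openin_subset[OF orb_open[OF assms(1)]]])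
  show ?thesis
    unfolding continuous_map t
  proof (intro conjI allI impI)
    show "inv_into B orb ` (orb ` B) \<subseteq> topspace (top_of_set B)" by (auto simp: inv_into_into)
    fix U assume "openin (top_of_set B) U"
    then have U: "open U" "U \<subseteq> B" using assms(1) by (auto simp: openin_open_eq)
    have "{p \<in> orb ` B. inv_into B orb p \<in> U} = orb ` U"
      using U(2) assms(2) by (auto simp: inv_into_f_f image_iff) 
    then have "openin otop {p \<in> orb ` B. inv_into B orb p \<in> U}" using orb_open[OF U(1)] by simp
    then show "openin (subtopology otop (orb ` B)) {p \<in> orb ` B. inv_into B orb p \<in> U}"
      by (subst openin_open_subtopology[OF orb_open[OF assms(1)]]) auto
  qed
qed

text \<open>The local inverse of the projection over a set on which the projection is
  injective.\<close>

definition ochart :: "(real^4) set \<Rightarrow> (real^4) set chart" where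
  "ochart B = (orb ` B, inv_into B orb)"

definition omfd :: "(real^4) set mfd" where
  "omfd = \<lparr>mtop = otop, atlas = {ochart (ball x r) |x r. 0 < r \<and> inj_on orb (ball x r)}\<rparr>"

lemma omfd_simps [simp]: "mtop omfd = otop"
  by (simp add: omfd_def)

lemma atlas_omfd:
  assumes "c \<in> atlas omfd"
  obtains B where "c = ochart B" "open B" "inj_on orb B"
  using assms unfolding omfd_def by auto

lemma cdom_ochart: "inj_on orb B \<Longrightarrow> cdom (ochart B) = B"
  by (auto simp: cdom_def ochart_def inv_into_f_f image_iff)

lemma ochart_is_chart:
  assumes "open B" "inj_on orb B"
  shows "is_chart otop (ochart B)"
  unfolding is_chart_def cdom_ochart[OF assms(2)]
proof (intro conjI)
  show "openin otop (fst (ochart B))" using orb_open[OF assms(1)] by (simp add: ochart_def)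
  have "homeomorphic_maps (subtopology otop (orb ` B)) (top_of_set B) (inv_into B orb) orb"
    unfolding homeomorphic_maps_def
  proof (intro conjI)
    show "continuous_map (subtopology otop (orb ` B)) (top_of_set B) (inv_into B orb)"
      by (rule section_continuous[OF assms])
    show "continuous_map (top_of_set B) (subtopology otop (orb ` B)) orb" by (rule orb_continuous_sub)
    show "\<forall>x\<in>topspace (subtopology otop (orb ` B)). orb (inv_into B orb x) = x"
      by (auto simp: f_inv_into_f)
    show "\<forall>y\<in>topspace (top_of_set B). inv_into B orb (orb y) = y"
      using assms(2) by (simp add: inv_into_f_f)
  qed
  then show "homeomorphic_map (subtopology otop (fst (ochart B))) (top_of_set B) (snd (ochart B))"
    unfolding homeomorphic_map_maps ochart_def by auto
qed (rule assms(1))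

lemma cinv_ochart:
  assumes "inj_on orb B" "x \<in> B" "orb x \<in> A" "A \<subseteq> orb ` B"
  shows "inv_into A (inv_into B orb) x = orb x"
proof -
  have "inj_on (inv_into B orb) A" by (rule inj_on_inv_into[OF assms(4)])
  then have "inv_into A (inv_into B orb) (inv_into B orb (orb x)) = orb x" by (rule inv_into_f_f[OF _ assms(3)])
  then show ?thesis using inv_into_f_f[OF assms(1,2)] by simp
qed

text \<open>The representative in \<open>B\<close> of the orbit of \<open>x\<close> is
  \<open>g x\<close> for some \<open>g\<close>; by injectivity of \<open>orb\<close> on
  \<open>B\<close> the same \<open>g\<close> gives the representative for all points near
  \<open>x\<close>.\<close>

lemma local_section:
  assumes "open B" "inj_on orb B" "orb x \<in> orb ` B"
  shows "\<exists>g\<in>G. \<exists>V. open V \<and> x \<in> V \<and> (\<forall>y\<in>V. g y \<in> B \<and> inv_into B orb (orb y) = g y)"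
proof -
  obtain z where z: "z \<in> B" "orb x = orb z" using assms(3) by blast
  then obtain g where g: "g \<in> G" "g x = z" using orb_eq_iff by blast
  have "inv_into B orb (orb y) = g y" if "g y \<in> B" for y
    using inv_into_f_f[OF assms(2) that] orb_G[OF g(1)] by simp
  then show ?thesis using g z(1) open_vimage_G[OF g(1) assms(1)] by (intro bexI[of _ g] exI[of _ "g -` B"]) auto
qed

text \<open>Transition maps and the local expressions of the projection and of its local inverses
  all have this form, so one lemma per tensor settles every transformation law.\<close>

definition G_like :: "(real^4) set \<Rightarrow> (real^4 \<Rightarrow> real^4) \<Rightarrow> bool" where
  "G_like S F \<longleftrightarrow> (\<forall>x\<in>S. \<exists>g\<in>G. \<exists>V. open V \<and> x \<in> V \<and> (\<forall>y\<in>V. F y = g y))"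

lemma G_like_smooth: "G_like S F \<Longrightarrow> smooth_on S F"
proof (rule smooth_on_local)
  fix x assume "G_like S F" "x \<in> S"
  then obtain g V where V: "g \<in> G" "open V" "x \<in> V" "\<And>y. y \<in> V \<Longrightarrow> F y = g y" unfolding G_like_def by metis
  have "smooth_on V F"
    by (rule smooth_on_cong[OF V(2) _ smooth_on_subset[OF smooth_G[OF V(1)] subset_UNIV]]) (simp add: V(4))
  then show "\<exists>V. open V \<and> x \<in> V \<and> smooth_on V F" using V by blast
qed

lemma G_like_derivative:
  assumes "G_like S F" "x \<in> S"
  shows "\<exists>g\<in>G. F x = g x \<and> frechet_derivative F (at x) = frechet_derivative g (at x)"
proof -
  obtain g V where V: "g \<in> G" "open V" "x \<in> V" "\<forall>y\<in>V. F y = g y" using assms unfolding G_like_def by metis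
  have "(F has_derivative frechet_derivative g (at x)) (at x)"
    by (rule has_derivative_transform_within_open[OF smooth_on_has_derivative[OF smooth_G[OF V(1)] UNIV_I] V(2,3)])
      (use V(4) in simp)
  then show ?thesis using frechet_eqI V by blast
qed

lemma G_like_pres:
  assumes "G_like S F" "x \<in> S"
  shows "w i (F x) \<bullet> frechet_derivative F (at x) u = w i x \<bullet> u"
  using G_like_derivative[OF assms] pres_G by metis

lemma \<Omega>_eq: "\<Omega> x u v = wedge (w 1 x) (w 3 x) u v + wedge (w 2 x) (w 4 x) u v"
  using adapted_w unfolding adapted_def by blast

lemma D_eq: "D x = {v. w 1 x \<bullet> v = 0 \<and> w 2 x \<bullet> v = 0}"
  using adapted_w unfolding adapted_def by blast

lemma coframe_w: "coframe UNIV w"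
  by (rule adapted_coframe[OF adapted_w])

lemma G_like_\<Omega>:
  assumes "G_like S F" "x \<in> S"
  shows "\<Omega> (F x) (frechet_derivative F (at x) u) (frechet_derivative F (at x) v) = \<Omega> x u v"
  unfolding \<Omega>_eq wedge_def G_like_pres[OF assms] ..

text \<open>A linear map that preserves the coframe takes the dual frame at \<open>x\<close> to the
  dual frame at \<open>y\<close>.\<close>

lemma preserving_surj:
  assumes "linear L" "\<And>i u. w i y \<bullet> L u = w i x \<bullet> u"
  shows "L ` D x = D y"
proof (intro Set.set_eqI iffI)
  fix v assume "v \<in> L ` D x"
  then show "v \<in> D y" using assms(2) unfolding D_eq by auto
next
  fix v assume v: "v \<in> D y"
  have d: "vdet w x \<noteq> 0" "vdet w y \<noteq> 0" using coframe_det[OF coframe_w] by auto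
  have "L (frame w j x) = frame w j y" for j
    by (rule frame_unique[OF d(2)]) (simp add: assms(2) frame_dual[OF d(1)])
  then have "L (\<Sum>j\<in>UNIV. (w j y \<bullet> v) *\<^sub>R frame w j x) = v"
    by (simp add: linear_sum[OF assms(1)] linear_scale[OF assms(1)] frame_expansion[OF d(2), symmetric])
  moreover have "(\<Sum>j\<in>UNIV. (w j y \<bullet> v) *\<^sub>R frame w j x) \<in> D x"
    using v unfolding D_eq by (simp add: inner_sum_right frame_dual[OF d(1)] if_distrib cong: if_cong)
  ultimately show "v \<in> L ` D x" by (intro image_eqI[OF sym])
qed

lemma G_like_D:
  assumes "G_like S F" "x \<in> S"
  shows "frechet_derivative F (at x) ` D x = D (F x)"
  by (rule preserving_surj[OF smooth_on_linear_frechet[OF G_like_smooth[OF assms(1)] assms(2)] G_like_pres[OF assms]])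

lemma fst_snd_ochart [simp]: "fst (ochart B) = orb ` B" "snd (ochart B) = inv_into B orb"
  by (simp_all add: ochart_def)

text \<open>All the charts that occur below, including those of the open submanifolds, restrict a local
  section \<open>inv_into B orb\<close> to an open subset of \<open>orb ` B\<close>.\<close>

lemma section_rep_dom:
  assumes "inj_on orb B" "A \<subseteq> orb ` B"
  shows "rep_dom (A, inv_into B orb) c f = {x \<in> B. orb x \<in> A \<and> f (orb x) \<in> fst c}"
proof (intro Set.set_eqI iffI)
  fix x assume "x \<in> rep_dom (A, inv_into B orb) c f"
  then obtain p where p: "p \<in> A" "f p \<in> fst c" "x = inv_into B orb p" unfolding rep_dom_def by auto
  then have "p \<in> orb ` B" using assms(2) by blast
  then show "x \<in> {x \<in> B. orb x \<in> A \<and> f (orb x) \<in> fst c}"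
    using p inv_into_into[of p orb B] f_inv_into_f[of p orb B] by simp
next
  fix x assume "x \<in> {x \<in> B. orb x \<in> A \<and> f (orb x) \<in> fst c}"
  then show "x \<in> rep_dom (A, inv_into B orb) c f"
    unfolding rep_dom_def using inv_into_f_f[OF assms(1), of x] by (auto intro!: rev_image_eqI[of "orb x"])
qed

lemma section_rep:
  assumes "inj_on orb B" "A \<subseteq> orb ` B" "x \<in> rep_dom (A, inv_into B orb) c f"
  shows "rep (A, inv_into B orb) c f x = snd c (f (orb x))"
proof -
  have "x \<in> B" "orb x \<in> A" using assms(3) unfolding section_rep_dom[OF assms(1,2)] by auto
  then show ?thesis using cinv_ochart[OF assms(1) _ _ assms(2)] by (simp add: rep_def)
qed

lemma G_like_cong:
  assumes "G_like S F" "open S" "\<And>x. x \<in> S \<Longrightarrow> F' x = F x"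
  shows "G_like S F'"
  unfolding G_like_def
proof
  fix x assume x: "x \<in> S"
  then obtain g V where V: "g \<in> G" "open V" "x \<in> V" "\<forall>y\<in>V. F y = g y" using assms(1) unfolding G_like_def by metis
  then show "\<exists>g\<in>G. \<exists>V. open V \<and> x \<in> V \<and> (\<forall>y\<in>V. F' y = g y)"
    using assms(2,3) x by (intro bexI[of _ g] exI[of _ "V \<inter> S"]) auto
qed

lemma G_like_section:
  assumes "open B" "inj_on orb B" "\<And>x. x \<in> S \<Longrightarrow> orb x \<in> orb ` B"
  shows "G_like S (\<lambda>x. inv_into B orb (orb x))"
  unfolding G_like_def
proof
  fix x assume "x \<in> S"
  from local_section[OF assms(1,2) assms(3)[OF this]]
  show "\<exists>g\<in>G. \<exists>V. open V \<and> x \<in> V \<and> (\<forall>y\<in>V. inv_into B orb (orb y) = g y)" by blast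
qed

lemma open_orb_vimage: "openin otop A \<Longrightarrow> open {x \<in> B. orb x \<in> A}" if "open B" for B
  using that openin_otop[of A] by (simp add: Collect_conj_eq vimage_def open_Int)

lemma G_like_transition:
  assumes "open B" "inj_on orb B" "A \<subseteq> orb ` B" "openin otop A"
    "open B'" "inj_on orb B'" "A' \<subseteq> orb ` B'" "openin otop A'"
  shows "G_like (rep_dom (A, inv_into B orb) (A', inv_into B' orb) id) (rep (A, inv_into B orb) (A', inv_into B' orb) id)"
    (is "G_like ?S ?F")
proof (rule G_like_cong)
  have S: "?S = {x \<in> B. orb x \<in> A \<and> orb x \<in> A'}" unfolding section_rep_dom[OF assms(2,3)] by simp
  have "openin otop (A \<inter> A')" using assms(4,8) by (rule openin_Int)
  then show "open ?S" unfolding S using open_orb_vimage[OF assms(1), of "A \<inter> A'"] by simp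
  show "G_like ?S (\<lambda>x. inv_into B' orb (orb x))"
    by (rule G_like_section[OF assms(5,6)]) (use assms(7) S in auto)
  show "?F x = inv_into B' orb (orb x)" if "x \<in> ?S" for x
    using section_rep[OF assms(2,3) that] by simp
qed

lemma section_atlas:
  assumes "c \<in> atlas omfd"
  obtains B where "open B" "inj_on orb B" "c = (orb ` B, inv_into B orb)"
  using atlas_omfd[OF assms] unfolding ochart_def by metis

lemma G_like_transition_atlas:
  assumes "c \<in> atlas omfd" "c' \<in> atlas omfd"
  shows "G_like (rep_dom c c' id) (rep c c' id)"
proof -
  obtain B where B: "open B" "inj_on orb B" "c = (orb ` B, inv_into B orb)" using section_atlas[OF assms(1)] .
  obtain B' where B': "open B'" "inj_on orb B'" "c' = (orb ` B', inv_into B' orb)" using section_atlas[OF assms(2)] .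
  show ?thesis
    unfolding B(3) B'(3)
    by (rule G_like_transition[OF B(1,2) subset_refl orb_open[OF B(1)] B'(1,2) subset_refl orb_open[OF B'(1)]])
qed

lemma G_like_orb:
  assumes "c' \<in> atlas omfd"
  shows "G_like (rep_dom (UNIV, id) c' orb) (rep (UNIV, id) c' orb)"
proof -
  obtain B' where B': "open B'" "inj_on orb B'" "c' = (orb ` B', inv_into B' orb)" using section_atlas[OF assms] .
  have S: "rep_dom (UNIV, id) c' orb = {x \<in> UNIV. orb x \<in> orb ` B'}" by (simp add: rep_dom_def B'(3))
  show ?thesis
  proof (rule G_like_cong)
    show "open (rep_dom (UNIV, id) c' orb)"
      unfolding S using open_orb_vimage[OF open_UNIV orb_open[OF B'(1)]] by simp
    show "G_like (rep_dom (UNIV, id) c' orb) (\<lambda>x. inv_into B' orb (orb x))"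
      by (rule G_like_section[OF B'(1,2)]) (simp add: S)
    show "rep (UNIV, id) c' orb x = inv_into B' orb (orb x)" for x
      by (simp add: rep_def B'(3) inv_into_id)
  qed
qed

lemma orb_separated:
  assumes "orb x \<noteq> orb y"
  shows "\<exists>U V. openin otop U \<and> openin otop V \<and> orb x \<in> U \<and> orb y \<in> V \<and> disjnt U V"
proof -
  obtain r where r: "r > 0" "\<forall>g\<in>G. True \<longrightarrow> g ` ball x r \<inter> ball y r = {}"
    using separation[of "\<lambda>_. True" x y] assms orb_eq_iff by blast
  have "disjnt (orb ` ball x r) (orb ` ball y r)"
    unfolding disjnt_def
  proof (rule equals0I)
    fix p assume "p \<in> orb ` ball x r \<inter> orb ` ball y r"
    then obtain a b where ab: "a \<in> ball x r" "b \<in> ball y r" "orb a = orb b" by auto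
    then obtain g where "g \<in> G" "g a = b" using orb_eq_iff by blast
    then show False using r(2) ab by blast
  qed
  then show ?thesis
    using orb_open[OF open_ball, of x r] orb_open[OF open_ball, of y r] r(1)
    by (intro exI[of _ "orb ` ball x r"] exI[of _ "orb ` ball y r"]) auto
qed

lemma smooth_manifold_omfd: "smooth_manifold omfd"
  unfolding smooth_manifold_def
proof (intro conjI ballI)
  show "Hausdorff_space (mtop omfd)"
    unfolding Hausdorff_space_def omfd_simps topspace_otop
  proof (intro allI impI)
    fix p q assume pq: "p \<in> range orb \<and> q \<in> range orb \<and> p \<noteq> q"
    then obtain x y where "p = orb x" "q = orb y" by blast
    then show "\<exists>U V. openin otop U \<and> openin otop V \<and> p \<in> U \<and> q \<in> V \<and> disjnt U V"
      using orb_separated[of x y] pq by simp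
  qed
  show "second_countable (mtop omfd)"
  proof -
    obtain \<B> :: "(real^4) set set" where B: "countable \<B>" "topological_basis \<B>" using ex_countable_basis by blast
    have "\<exists>V\<in>(`) orb ` \<B>. p \<in> V \<and> V \<subseteq> U" if U: "openin otop U" "p \<in> U" for U p
    proof -
      obtain x where x: "p = orb x" using U openin_subset[OF U(1)] by (auto simp: topspace_otop)
      have "open (orb -` U)" "x \<in> orb -` U" using U x by (auto simp: openin_otop)
      then obtain W where "W \<in> \<B>" "x \<in> W" "W \<subseteq> orb -` U" using topological_basisE[OF B(2)] by blast
      then show ?thesis using x by (intro bexI[of _ "orb ` W"]) auto
    qed
    moreover have "openin otop V" if "V \<in> (`) orb ` \<B>" for V
      using that orb_open topological_basis_open[OF B(2)] by blast
    ultimately show ?thesis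
      unfolding second_countable_def using B(1) by (intro exI[of _ "(`) orb ` \<B>"]) auto
  qed
  show "is_chart (mtop omfd) c" if "c \<in> atlas omfd" for c
    using atlas_omfd[OF that] ochart_is_chart by (metis omfd_simps)
  show "(\<Union>c\<in>atlas omfd. fst c) = points omfd"
  proof (intro Set.set_eqI iffI)
    fix p assume "p \<in> (\<Union>c\<in>atlas omfd. fst c)"
    then obtain c where c: "c \<in> atlas omfd" "p \<in> fst c" by blast
    obtain B where "c = ochart B" using atlas_omfd[OF c(1)] .
    then show "p \<in> points omfd" using c(2) unfolding omfd_simps topspace_otop by auto
  next
    fix p assume "p \<in> points omfd"
    then obtain x where x: "p = orb x" by (auto simp: topspace_otop)
    obtain r where r: "r > 0" "inj_on orb (ball x r)" using small_ball by blast
    then have "ochart (ball x r) \<in> atlas omfd" by (auto simp: omfd_def)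
    moreover have "p \<in> fst (ochart (ball x r))" using x r(1) by simp
    ultimately show "p \<in> (\<Union>c\<in>atlas omfd. fst c)" by blast
  qed
  show "smooth_on (rep_dom c c' id) (rep c c' id)" if "c \<in> atlas omfd" "c' \<in> atlas omfd" for c c'
    by (rule G_like_smooth[OF G_like_transition_atlas[OF that]])
qed

lemma smooth_manifold_R4: "smooth_manifold R4"
proof -
  have "is_chart euclidean (UNIV :: (real^4) set, id)"
    by (auto simp: is_chart_def cdom_def)
  moreover have "second_countable (euclidean :: (real^4) topology)"
  proof -
    obtain \<B> :: "(real^4) set set" where B: "countable \<B>" "topological_basis \<B>" using ex_countable_basis by blast
    then show ?thesis
      unfolding second_countable_def
      by (intro exI[of _ \<B>]) (use topological_basis_open[OF B(2)] topological_basisE[OF B(2)] in \<open>force\<close>)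
  qed
  moreover have "smooth_on (rep_dom (UNIV, id) (UNIV, id) id) (rep (UNIV, id) (UNIV, id) id :: real^4 \<Rightarrow> real^4)"
  proof -
    have "rep (UNIV, id) (UNIV, id) id = (\<lambda>x :: real^4. x)" by (intro ext) (simp add: rep_def inv_into_id)
    then show ?thesis by (simp add: rep_dom_def smooth_on_ident)
  qed
  moreover have "Hausdorff_space (euclidean :: (real^4) topology)" by (rule Hausdorff_space_euclidean)
  ultimately show ?thesis by (simp add: smooth_manifold_def)
qed

text \<open>Components that are the same in all charts obey the transformation laws because the
  transition maps preserve \<open>w\<close>. This applies alike to the orbit space and to R^4 with
  its single chart.\<close>

lemma lagrangian_engel_constant:
  assumes "smooth_manifold K" "\<And>c c'. c \<in> atlas K \<Longrightarrow> c' \<in> atlas K \<Longrightarrow> G_like (rep_dom c c' id) (rep c c' id)"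
  shows "lagrangian_engel K (\<lambda>c. \<Omega>) (\<lambda>c. D)"
proof -
  have oc: "open (cdom c)" if "c \<in> atlas K" for c
    using is_chart_open(2)[OF manifold_chart[OF assms(1) that]] .
  have ad: "adapted V \<Omega> D w" if "open V" for V by (rule adapted_restrict[OF adapted_w subset_UNIV that])
  have bil: "bilinear (\<Omega> x)" for x
    unfolding bilinear_def \<Omega>_eq[abs_def] wedge_def
    by (intro conjI allI linearI) (simp_all add: inner_add_right algebra_simps)
  have sm: "smooth_on S (\<lambda>x. \<Omega> x u v)" if "open S" for S u v
    unfolding \<Omega>_eq wedge_def
    by (intro smooth_on_add[OF that] smooth_on_diff[OF that] smooth_on_mult[OF that] smooth_on_inner[OF that] smooth_on_const
        smooth_on_subset[OF coframe_smooth[OF coframe_w] subset_UNIV])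
  have pb: "pulls_back2 K K id (\<lambda>c. \<Omega>) (\<lambda>c. \<Omega>)"
    unfolding pulls_back2_def using G_like_\<Omega>[OF assms(2)] by blast
  have md: "maps_distr K K id (\<lambda>c. D) (\<lambda>c. D)"
    unfolding maps_distr_def using G_like_D[OF assms(2)] by blast
  have nd: "(\<forall>v. \<Omega> x u v = 0) \<longleftrightarrow> u = 0" for x u
  proof
    assume *: "\<forall>v. \<Omega> x u v = 0"
    have "\<Omega> x v u = \<Omega> x v 0" for v
      using *[rule_format, of v] unfolding \<Omega>_eq wedge_def by simp
    then show "u = 0" using adapted_nondegenerate[OF adapted_w UNIV_I] by blast
  qed (simp add: \<Omega>_eq wedge_def)
  have lag: "\<Omega> x u v = 0" if "u \<in> D x" "v \<in> D x" for x u v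
    using that unfolding D_eq \<Omega>_eq wedge_def by simp
  have self: "\<Omega> x u u = 0" for x u unfolding \<Omega>_eq wedge_def by simp
  have sub: "subbundle (cdom c) 2 D" "subbundle (cdom c) 1 (derived (annihilator D))" if "c \<in> atlas K" for c
    by (rule adapted_subbundles[of "cdom c" \<Omega> D]; use oc[OF that] ad in blast)+
  have der: "derived (derived (annihilator D)) x = {0}" for x
    by (rule adapted_derived2[OF adapted_w UNIV_I])
  show ?thesis
    unfolding lagrangian_engel_def symplectic_form_def two_form_def engel_structure_def distribution_def
    using assms(1) bil self sm[OF oc] pb closed_\<Omega> nd sub md der lag by simp
qed

lemma lagrangian_engel_omfd: "lagrangian_engel omfd (\<lambda>c. \<Omega>) (\<lambda>c. D)"
  by (rule lagrangian_engel_constant[OF smooth_manifold_omfd G_like_transition_atlas])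

section \<open>The structure on R^4 and the action of the group on it\<close>

lemma G_like_id: "G_like S id"
  unfolding G_like_def using id_G by (intro ballI bexI[of _ id] exI[of _ UNIV]) auto

lemma rep_R4: "rep (UNIV, id) (UNIV, id) f = f" "rep_dom (UNIV, id) (UNIV, id) f = UNIV"
  by (auto simp: rep_def rep_dom_def inv_into_id fun_eq_iff)

lemma lagrangian_engel_R4: "lagrangian_engel R4 (\<lambda>c. \<Omega>) (\<lambda>c. D)"
  by (rule lagrangian_engel_constant[OF smooth_manifold_R4])
    (simp add: rep_R4 G_like_id)

text \<open>Stated for any invertible map preserving \<open>w\<close> and not only for elements of
  \<open>G\<close>, because homogeneity of the models rests on all left translations.\<close>

lemma preserving_symmetry:
  assumes "smooth_on UNIV f" "smooth_on UNIV h" "\<And>x. h (f x) = x" "\<And>x. f (h x) = x"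
    "\<And>i x u. w i (f x) \<bullet> frechet_derivative f (at x) u = w i x \<bullet> u"
  shows "f \<in> symmetries R4 (\<lambda>c. \<Omega>) (\<lambda>c. D)"
proof -
  have bij: "bij f" using assms(3,4) by (intro bijI') metis+
  have inv: "inv_into UNIV f = h" using assms(3,4) by (intro ext inv_f_eq[OF bij_is_inj[OF bij]]) simp
  have cont: "continuous_map euclidean euclidean f" "continuous_map euclidean euclidean h"
    using assms(1,2) smooth_on_continuous_on by auto
  have "f \<in> Bij (points R4)" using bij by (simp add: Bij_def)
  moreover have "diffeo R4 R4 f"
    unfolding diffeo_def smooth_map_def using bij cont assms(1,2) by (simp add: rep_R4 inv)
  moreover have "pulls_back2 R4 R4 f (\<lambda>c. \<Omega>) (\<lambda>c. \<Omega>)"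
    unfolding pulls_back2_def by (simp add: rep_R4 \<Omega>_eq wedge_def assms(5))
  moreover have "maps_distr R4 R4 f (\<lambda>c. D) (\<lambda>c. D)"
    unfolding maps_distr_def
    using preserving_surj[OF smooth_on_linear_frechet[OF assms(1) UNIV_I] assms(5)] by (simp add: rep_R4)
  ultimately show ?thesis by (simp add: symmetries_def)
qed

lemma G_symmetries: "G \<subseteq> symmetries R4 (\<lambda>c. \<Omega>) (\<lambda>c. D)"
proof
  fix g assume g: "g \<in> G"
  obtain h where h: "h \<in> G" "h \<circ> g = id" "g \<circ> h = id" using inv_G[OF g] by blast
  show "g \<in> symmetries R4 (\<lambda>c. \<Omega>) (\<lambda>c. D)"
    by (rule preserving_symmetry[OF smooth_G[OF g] smooth_G[OF h(1)] _ _ pres_G[OF g]])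
      (use h(2,3) in \<open>simp_all add: fun_eq_iff\<close>)
qed

lemma subgroup_G: "subgroup G (BijGroup (points R4))"
proof -
  have mult: "g \<otimes>\<^bsub>BijGroup UNIV\<^esub> h = g \<circ> h" if "g \<in> Bij UNIV" "h \<in> Bij UNIV" for g h :: "real^4 \<Rightarrow> real^4"
    using that by (simp add: BijGroup_def compose_def fun_eq_iff)
  have B: "g \<in> Bij UNIV" if "g \<in> G" for g
    using G_symmetries that by (auto simp: symmetries_def)
  show ?thesis
  proof (rule subgroup.intro)
    show "G \<subseteq> carrier (BijGroup (points R4))" using B by (auto simp: BijGroup_def)
    show "g \<otimes>\<^bsub>BijGroup (points R4)\<^esub> h \<in> G" if "g \<in> G" "h \<in> G" for g h
      using that comp_G B by (simp add: mult)
    show "\<one>\<^bsub>BijGroup (points R4)\<^esub> \<in> G" using id_G by (simp add: BijGroup_def restrict_UNIV_eq id_def)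
    show "inv\<^bsub>BijGroup (points R4)\<^esub> g \<in> G" if g: "g \<in> G" for g
    proof -
      obtain h where h: "h \<in> G" "h \<circ> g = id" "g \<circ> h = id" using inv_G[OF g] by blast
      have bij: "bij g" using o_bij[OF h(2,3)] .
      have "inv_into UNIV g = h" using h(2,3) by (intro ext inv_f_eq[OF bij_is_inj[OF bij]]) (simp add: fun_eq_iff)
      then show ?thesis using inv_BijGroup[OF B[OF g]] h(1) by (simp add: restrict_UNIV_eq)
    qed
  qed
qed

text \<open>Over a ball on which \<open>orb\<close> is injective, both \<open>orb\<close> and its
  inverse read in charts as a local section after \<open>orb\<close>, hence locally as group
  elements.\<close>

lemma local_diffeo_orb: "local_diffeo R4 omfd orb"
  unfolding local_diffeo_def
proof
  fix p assume "p \<in> points R4"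
  obtain r where r: "r > 0" "inj_on orb (ball p r)" using small_ball by blast
  let ?W = "ball p r"
  have tW: "topspace (subtopology otop (orb ` ?W)) = orb ` ?W"
    by (rule topspace_subtopology_subset[OF openin_subset[OF orb_open[OF open_ball]]])
  have smooth1: "smooth_on (rep_dom (?W, id) (orb ` B \<inter> orb ` ?W, inv_into B orb) orb)
      (rep (?W, id) (orb ` B \<inter> orb ` ?W, inv_into B orb) orb)" if B: "open B" "inj_on orb B" for B
  proof -
    let ?S = "rep_dom (?W, id) (orb ` B \<inter> orb ` ?W, inv_into B orb) orb"
    have S: "?S = {x \<in> ?W. orb x \<in> orb ` B \<inter> orb ` ?W}" by (auto simp: rep_dom_def)
    have "G_like ?S (rep (?W, id) (orb ` B \<inter> orb ` ?W, inv_into B orb) orb)"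
    proof (rule G_like_cong)
      show "open ?S"
        unfolding S by (rule open_orb_vimage[OF open_ball openin_Int[OF orb_open[OF B(1)] orb_open[OF open_ball]]])
      show "G_like ?S (\<lambda>x. inv_into B orb (orb x))"
        by (rule G_like_section[OF B]) (simp add: S)
      show "rep (?W, id) (orb ` B \<inter> orb ` ?W, inv_into B orb) orb x = inv_into B orb (orb x)" if "x \<in> ?S" for x
        using that unfolding S by (simp add: rep_def inv_into_id)
    qed
    then show ?thesis by (rule G_like_smooth)
  qed
  have smooth2: "smooth_on (rep_dom (orb ` B \<inter> orb ` ?W, inv_into B orb) (?W, id) (inv_into ?W orb))
      (rep (orb ` B \<inter> orb ` ?W, inv_into B orb) (?W, id) (inv_into ?W orb))" if B: "open B" "inj_on orb B" for B
  proof -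
    let ?A = "orb ` B \<inter> orb ` ?W"
    let ?S = "rep_dom (?A, inv_into B orb) (?W, id) (inv_into ?W orb)"
    have S: "?S = {x \<in> B. orb x \<in> ?A}"
      unfolding section_rep_dom[OF B(2) Int_lower1] using inv_into_into[of _ orb ?W] by auto
    have "G_like ?S (rep (?A, inv_into B orb) (?W, id) (inv_into ?W orb))"
    proof (rule G_like_cong)
      show "open ?S"
        unfolding S by (rule open_orb_vimage[OF B(1) openin_Int[OF orb_open[OF B(1)] orb_open[OF open_ball]]])
      show "G_like ?S (\<lambda>x. inv_into ?W orb (orb x))"
        by (rule G_like_section[OF open_ball r(2)]) (simp add: S)
      show "rep (?A, inv_into B orb) (?W, id) (inv_into ?W orb) x = inv_into ?W orb (orb x)" if "x \<in> ?S" for x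
        using section_rep[OF B(2) Int_lower1 that] by simp
    qed
    then show ?thesis by (rule G_like_smooth)
  qed
  have at: "\<exists>B. open B \<and> inj_on orb B \<and> c = (orb ` B \<inter> orb ` ?W, inv_into B orb)"
    if c: "c \<in> atlas (open_submfd omfd (orb ` ?W))" for c
  proof -
    obtain c0 where c0: "c0 \<in> atlas omfd" "c = (fst c0 \<inter> orb ` ?W, snd c0)"
      using c by (auto simp: open_submfd_def)
    obtain B where "open B" "inj_on orb B" "c0 = (orb ` B, inv_into B orb)" by (rule section_atlas[OF c0(1)])
    then show ?thesis using c0(2) by (intro exI[of _ B]) simp
  qed
  have d: "diffeo (open_submfd R4 ?W) (open_submfd omfd (orb ` ?W)) orb"
    unfolding diffeo_def
  proof (intro conjI)
    have pts: "points (open_submfd R4 ?W) = ?W" "points (open_submfd omfd (orb ` ?W)) = orb ` ?W"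
      using tW by (simp_all add: open_submfd_def)
    show "bij_betw orb (points (open_submfd R4 ?W)) (points (open_submfd omfd (orb ` ?W)))"
      unfolding pts using r(2) by (simp add: bij_betw_def)
    show "smooth_map (open_submfd R4 ?W) (open_submfd omfd (orb ` ?W)) orb"
      unfolding smooth_map_def
    proof (intro conjI ballI)
      show "continuous_map (mtop (open_submfd R4 ?W)) (mtop (open_submfd omfd (orb ` ?W))) orb"
        using orb_continuous_sub by (simp add: open_submfd_def)
      fix c c' assume "c \<in> atlas (open_submfd R4 ?W)" "c' \<in> atlas (open_submfd omfd (orb ` ?W))"
      then have "c = (?W, id)" "\<exists>B. open B \<and> inj_on orb B \<and> c' = (orb ` B \<inter> orb ` ?W, inv_into B orb)"
        using at by (simp_all add: open_submfd_def)
      then show "smooth_on (rep_dom c c' orb) (rep c c' orb)" using smooth1 by auto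
    qed
    show "smooth_map (open_submfd omfd (orb ` ?W)) (open_submfd R4 ?W) (inv_into (points (open_submfd R4 ?W)) orb)"
      unfolding smooth_map_def pts
    proof (intro conjI ballI)
      show "continuous_map (mtop (open_submfd omfd (orb ` ?W))) (mtop (open_submfd R4 ?W)) (inv_into ?W orb)"
        using section_continuous[OF open_ball r(2)] by (simp add: open_submfd_def)
      fix c' c assume "c \<in> atlas (open_submfd R4 ?W)" "c' \<in> atlas (open_submfd omfd (orb ` ?W))"
      then have "c = (?W, id)" "\<exists>B. open B \<and> inj_on orb B \<and> c' = (orb ` B \<inter> orb ` ?W, inv_into B orb)"
        using at by (simp_all add: open_submfd_def)
      then show "smooth_on (rep_dom c' c (inv_into ?W orb)) (rep c' c (inv_into ?W orb))" using smooth2 by auto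
    qed
  qed
  show "\<exists>W. openin (mtop R4) W \<and> p \<in> W \<and> openin (mtop omfd) (orb ` W) \<and>
      diffeo (open_submfd R4 W) (open_submfd omfd (orb ` W)) orb"
    using d r(1) orb_open[OF open_ball, of p r] by (intro exI[of _ ?W]) auto
qed

lemma compact_quotient_omfd: "compact_quotient R4 (\<lambda>c. \<Omega>) (\<lambda>c. D) G orb omfd (\<lambda>c. \<Omega>) (\<lambda>c. D)"
  unfolding compact_quotient_def
proof (intro conjI)
  show "acts_freely R4 G"
    unfolding acts_freely_def using free_G by (auto simp: BijGroup_def restrict_UNIV_eq simp flip: id_def)
  show "acts_properly_discontinuously R4 G"
    unfolding acts_properly_discontinuously_def
  proof (intro allI impI)
    fix K assume "compactin (mtop R4) K"
    then have "bounded K" by (simp add: compact_imp_bounded)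
    then obtain R where "K \<subseteq> cball 0 R" using bounded_subset_ballD[of K 0] ball_subset_cball by blast
    then show "finite {\<gamma> \<in> G. \<gamma> ` K \<inter> K \<noteq> {}}"
      by (intro finite_subset[OF _ disc_G[of R]]) blast
  qed
  show "compact_space (mtop omfd)"
  proof -
    obtain R where R: "\<And>x. \<exists>g\<in>G. g x \<in> cball 0 R" using cocompact_G by blast
    have "range orb \<subseteq> orb ` cball 0 R"
    proof
      fix p assume "p \<in> range orb"
      then obtain x where x: "p = orb x" by blast
      obtain g where g: "g \<in> G" "g x \<in> cball 0 R" using R by blast
      then show "p \<in> orb ` cball 0 R" using orb_G[OF g(1), of x] x by (intro image_eqI[OF _ g(2)]) simp
    qed
    then have "range orb = orb ` cball 0 R" by blast
    moreover have "compactin otop (orb ` cball 0 R)"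
      by (rule image_compactin[OF _ orb_continuous]) simp
    ultimately show ?thesis by (simp add: compact_space_def topspace_otop)
  qed
  show "orb ` points R4 = points omfd" by (simp add: topspace_otop)
  show "\<forall>p\<in>points R4. \<forall>q\<in>points R4. orb p = orb q \<longleftrightarrow> (\<exists>\<gamma>\<in>G. \<gamma> p = q)" using orb_eq_iff by blast
  show "pulls_back2 R4 omfd orb (\<lambda>c. \<Omega>) (\<lambda>c. \<Omega>)"
    unfolding pulls_back2_def using G_like_\<Omega>[OF G_like_orb] by simp
  show "maps_distr R4 omfd orb (\<lambda>c. D) (\<lambda>c. D)"
    unfolding maps_distr_def using G_like_D[OF G_like_orb] by simp
qed (rule subgroup_G G_symmetries lagrangian_engel_omfd local_diffeo_orb)+

lemma zero_adapted_omfd: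
  fixes \<omega> :: "nat \<Rightarrow> real^4 \<Rightarrow> real^4"
  assumes "\<And>y. \<omega> 1 y = w 1 y" "\<And>y. \<omega> 2 y = w 2 y" "\<And>y. \<omega> 3 y = w 3 y" "\<And>y. \<omega> 4 y = w 4 y"
  shows "zero_adapted omfd (\<lambda>c. \<Omega>) (\<lambda>c. D) (\<lambda>i c. \<omega> i)"
proof -
  have om: "\<exists>j. \<omega> i = w j" if "i \<in> {1..4}" for i
  proof -
    have "i = 1 \<or> i = 2 \<or> i = 3 \<or> i = 4" using that by auto
    then show ?thesis using assms by (metis ext)
  qed
  have form: "one_form omfd (\<lambda>c. \<omega> i)" if i: "i \<in> {1..4}" for i
  proof -
    obtain j where j: "\<omega> i = w j" using om[OF i] by blast
    have "smooth_on S (w j)" for S by (rule smooth_on_subset[OF coframe_smooth[OF coframe_w] subset_UNIV])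
    moreover have "pulls_back1 omfd omfd id (\<lambda>c. w j) (\<lambda>c. w j)"
      unfolding pulls_back1_def using G_like_pres[OF G_like_transition_atlas] by blast
    ultimately show ?thesis unfolding one_form_def j by blast
  qed
  have v0: "vdet w x \<noteq> 0" for x by (rule coframe_det[OF coframe_w UNIV_I])
  have "inj_on (\<lambda>i. \<omega> i x) {1..4} \<and> independent ((\<lambda>i. \<omega> i x) ` {1..4})" for x
  proof
    have ne: "w i x \<noteq> w j x" if "i \<noteq> j" for i j using vdet_independent(1)[OF v0] that by (auto dest: injD)
    have "(\<lambda>i. \<omega> i x) ` {1..4} = range (\<lambda>i. w i x)"
      unfolding one_to_four range_four by (simp add: assms assms[unfolded One_nat_def])
    then show "independent ((\<lambda>i. \<omega> i x) ` {1..4})" using vdet_independent(2)[OF v0] by simp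
    show "inj_on (\<lambda>i. \<omega> i x) {1..4}"
      unfolding one_to_four inj_on_def using ne[of 1 2] ne[of 1 3] ne[of 1 4] ne[of 2 3] ne[of 2 4] ne[of 3 4]
      by (simp add: assms assms[unfolded One_nat_def])
  qed
  then show ?thesis
    unfolding zero_adapted_def coframing_def
    using form adapted_annihilator[OF adapted_w UNIV_I] adapted_derived[OF adapted_w UNIV_I] \<Omega>_eq assms by simp
qed

end

section \<open>The one-parameter family of models\<close>

text \<open>For \<open>b = \<beta>\<^sup>2\<close> the functions are \<open>cos (\<beta> t)\<close>, \<open>sin (\<beta> t) / \<beta>\<close> and \<open>(1 - cos (\<beta> t)) / \<beta>\<^sup>2\<close>; they are the
  entries of \<open>exp (t B)\<close>. The conditions on \<open>T\<close> are those needed for the lattice below.\<close>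

lemma exponential_functions:
  fixes b :: real
  shows "\<exists>C S V T. (\<forall>t. (C has_real_derivative - b * S t) (at t)) \<and> (\<forall>t. (S has_real_derivative C t) (at t)) \<and>
     (\<forall>t. (V has_real_derivative S t) (at t)) \<and>
     (\<forall>s t. C (s + t) = C s * C t - b * S s * S t) \<and> (\<forall>s t. S (s + t) = S s * C t + C s * S t) \<and>
     (\<forall>s t. V (s + t) = V t + S s * S t + V s * C t) \<and> C 0 = 1 \<and> S 0 = 0 \<and> V 0 = 0 \<and>
     (\<forall>t. C (- t) = C t) \<and> (\<forall>t. S (- t) = - S t) \<and> (\<forall>t. V (- t) = V t) \<and> (\<forall>t. b * V t = 1 - C t) \<and>
     (0::real) < T \<and> S T \<noteq> 0 \<and> V T \<noteq> 0 \<and> 2 * C T \<in> \<int>"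
proof (cases b "0::real" rule: linorder_cases)
  case less
  define \<beta> where "\<beta> = sqrt (- b)"
  have \<beta>: "\<beta> > 0" "b = - (\<beta> * \<beta>)" using less by (simp_all add: \<beta>_def)
  \<comment> \<open>\<open>cosh (\<beta> * T) = 3/2\<close> makes \<open>2 * C T = 3\<close>, the
    first integer above its value 2 at time 0.\<close>
  define T where "T = arcosh (3/2) / \<beta>"
  have T: "T > 0" "cosh (\<beta> * T) = 3/2" using \<beta>(1) by (simp_all add: T_def cosh_arcosh_real)
  have sT: "sinh (\<beta> * T) \<noteq> 0" using \<beta>(1) T(1) by simp
  show ?thesis
    by (rule exI[of _ "\<lambda>t. cosh (\<beta> * t)"], rule exI[of _ "\<lambda>t. sinh (\<beta> * t) / \<beta>"],
        rule exI[of _ "\<lambda>t. (cosh (\<beta> * t) - 1) / (\<beta> * \<beta>)"], rule exI[of _ T])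
      (use \<beta> T sT in \<open>auto intro!: derivative_eq_intros simp: cosh_add sinh_add field_simps\<close>)
next
  case equal
  \<comment> \<open>The limit as b tends to 0: \<open>C\<close> is constantly 1, so
    \<open>2 * C T\<close> is an integer for every \<open>T\<close>.\<close>
  show ?thesis
    by (rule exI[of _ "\<lambda>t. 1"], rule exI[of _ "\<lambda>t. t"], rule exI[of _ "\<lambda>t. t * t / 2"], rule exI[of _ 1])
      (use equal in \<open>auto intro!: derivative_eq_intros simp: field_simps\<close>)
next
  case greater
  define \<beta> where "\<beta> = sqrt b"
  have \<beta>: "\<beta> > 0" "b = \<beta> * \<beta>" using greater by (simp_all add: \<beta>_def)
  \<comment> \<open>A quarter period: \<open>C T = 0\<close>, while \<open>S T\<close> and
    \<open>V T\<close> are nonzero.\<close>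
  define T where "T = pi / (2 * \<beta>)"
  have T: "T > 0" "\<beta> * T = pi / 2" using \<beta>(1) by (simp_all add: T_def)
  have T\<beta>: "T * \<beta> = pi / 2" by (subst mult.commute) (rule T(2))
  have cT: "cos (T * \<beta>) = 0" "sin (T * \<beta>) = 1" unfolding T\<beta> by simp_all
  show ?thesis
    by (rule exI[of _ "\<lambda>t. cos (\<beta> * t)"], rule exI[of _ "\<lambda>t. sin (\<beta> * t) / \<beta>"],
        rule exI[of _ "\<lambda>t. (1 - cos (\<beta> * t)) / (\<beta> * \<beta>)"], rule exI[of _ T])
      (use \<beta> T(1) cT in \<open>auto intro!: derivative_eq_intros simp: cos_add sin_add field_simps\<close>)
qed

section \<open>Vectors in R^4 given by coordinates\<close>

definition v4 :: "real \<Rightarrow> real \<Rightarrow> real \<Rightarrow> real \<Rightarrow> real^4" where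
  "v4 a b c d = (\<chi> i. pick4 a b c d i)"

lemma v4_nth [simp]: "v4 a b c d $ 1 = a" "v4 a b c d $ 2 = b" "v4 a b c d $ 3 = c" "v4 a b c d $ 4 = d"
  by (simp_all add: v4_def)

lemma v4_inner: "v4 a b c d \<bullet> u = a * u $ 1 + b * u $ 2 + c * u $ 3 + d * u $ 4"
  by (simp add: inner_vec_def sum_4)

lemma vec4_eq_iff: "(x :: real^4) = y \<longleftrightarrow> x $ 1 = y $ 1 \<and> x $ 2 = y $ 2 \<and> x $ 3 = y $ 3 \<and> x $ 4 = y $ 4"
  by (simp add: vec_eq_iff forall_4)

lemma v4_norm_le: "norm (v4 a b c d) \<le> \<bar>a\<bar> + \<bar>b\<bar> + \<bar>c\<bar> + \<bar>d\<bar>"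
  using norm_le_l1_cart[of "v4 a b c d"] by (simp add: sum_4)

lemma smooth_on_v4:
  assumes "open U" "smooth_on U f" "smooth_on U g" "smooth_on U h" "smooth_on U k"
  shows "smooth_on U (\<lambda>x. v4 (f x) (g x) (h x) (k x))"
  unfolding v4_def
proof (rule smooth_on_chi[OF assms(1)])
  show "smooth_on U (\<lambda>x. pick4 (f x) (g x) (h x) (k x) i)" for i
    using exhaust_4[of i] assms by auto
qed

lemma nth_le_norm: "\<bar>(v :: real^4) $ i\<bar> \<le> norm v"
  by (rule component_le_norm_cart)

lemma finite_bounded_int: "finite {i :: int. \<bar>real_of_int i\<bar> \<le> M}"
proof (rule finite_subset)
  show "{i :: int. \<bar>real_of_int i\<bar> \<le> M} \<subseteq> {- \<lceil>M\<rceil>..\<lceil>M\<rceil>}"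
    by (auto simp: abs_le_iff le_ceiling_iff) linarith+
qed simp

text \<open>\<open>C\<close>, \<open>S\<close> and \<open>V\<close> enter only through these
  identities, so the three signs of \<open>b\<close> are treated at once.\<close>

locale engel_model =
  fixes b :: real and C S V :: "real \<Rightarrow> real" and T :: real
  assumes dC: "(C has_real_derivative - b * S t) (at t)" and dS: "(S has_real_derivative C t) (at t)"
    and dV: "(V has_real_derivative S t) (at t)"
    and C_add: "C (s + t) = C s * C t - b * S s * S t" and S_add: "S (s + t) = S s * C t + C s * S t"
    and V_add: "V (s + t) = V t + S s * S t + V s * C t"
    and C0: "C 0 = 1" and S0: "S 0 = 0" and V0: "V 0 = 0"
    and C_even: "C (- t) = C t" and S_odd: "S (- t) = - S t" and V_even: "V (- t) = V t"
    and bV: "b * V t = 1 - C t"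
    and T_pos: "0 < T" and ST: "S T \<noteq> 0" and VT: "V T \<noteq> 0" and CT: "2 * C T \<in> \<int>"
begin

lemma CS: "C t * C t + b * (S t * S t) = 1"
  using C_add[of t "- t"] by (simp add: C0 C_even S_odd mult.assoc)

lemma SV: "S t * S t = V t * (1 + C t)"
  using V_add[of t "- t"] by (simp add: V0 C_even S_odd V_even algebra_simps)

lemma smooth_CSV:
  assumes "open U" "smooth_on U f"
  shows "smooth_on U (\<lambda>x. C (f x))" "smooth_on U (\<lambda>x. S (f x))" "smooth_on U (\<lambda>x. V (f x))"
proof -
  \<comment> \<open>Indices 0, 1, 2 stand for \<open>C\<close>, \<open>S\<close>, \<open>V\<close>;
    \<open>s i\<close> is the index of the derivative and \<open>a i\<close> its factor.\<close>
  define H where "H = (\<lambda>i::nat. if i = 0 then C else if i = 1 then S else V)"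
  define a where "a = (\<lambda>i::nat. if i = 0 then - b else 1)"
  define s where "s = (\<lambda>i::nat. if i = 0 then 1 else if i = 1 then 0 else (1::nat))"
  have "(H i has_real_derivative a i * H (s i) t) (at t)" for i t
    using dC dS dV by (auto simp: H_def a_def s_def)
  then have "smooth_on U (\<lambda>x. H i (f x))" for i by (rule smooth_on_real_family[OF assms])
  from this[of 0] this[of 1] this[of 2]
  show "smooth_on U (\<lambda>x. C (f x))" "smooth_on U (\<lambda>x. S (f x))" "smooth_on U (\<lambda>x. V (f x))"
    by (simp_all add: H_def)
qed

text \<open>These are the rows of the matrix of \<open>A (- (p $ 3))\<close>, with \<open>A\<close>
  as below; since \<open>A\<close> is a one-parameter group, they form the left-invariant coframe of
  the semidirect product.\<close>

definition w :: "4 \<Rightarrow> real^4 \<Rightarrow> real^4" where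
  "w = pick4 (\<lambda>p. v4 1 (- S (p $ 3)) 0 (- V (p $ 3))) (\<lambda>p. v4 0 (C (p $ 3)) 0 (S (p $ 3)))
     (\<lambda>p. v4 0 0 1 0) (\<lambda>p. v4 0 (- b * S (p $ 3)) 0 (C (p $ 3)))"

lemma w_inner:
  "w 1 p \<bullet> u = u $ 1 - S (p $ 3) * u $ 2 - V (p $ 3) * u $ 4" "w 2 p \<bullet> u = C (p $ 3) * u $ 2 + S (p $ 3) * u $ 4"
  "w 3 p \<bullet> u = u $ 3" "w 4 p \<bullet> u = C (p $ 3) * u $ 4 - b * S (p $ 3) * u $ 2"
  by (simp_all add: w_def v4_inner)

lemma dnth3:
  assumes "(f has_real_derivative f') (at (x $ 3))"
  shows "((\<lambda>y :: real^4. f (y $ 3)) has_derivative (\<lambda>u. u $ 3 * f')) (at x)"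
proof -
  have "((\<lambda>y :: real^4. y $ 3) has_derivative (\<lambda>u. u $ 3)) (at x)"
    by (rule bounded_linear_imp_has_derivative[OF bounded_linear_vec_nth])
  from has_derivative_compose[OF this assms[unfolded has_field_derivative_def]]
  show ?thesis by (simp add: mult.commute)
qed

lemma structure_w:
  "ext_d1 (w 1) x u v = wedge (w 2 x) (w 3 x) u v" "ext_d1 (w 2) x u v = wedge (w 3 x) (w 4 x) u v"
  "ext_d1 (w 3) x u v = 0" "ext_d1 (w 4) x u v = b * wedge (w 2 x) (w 3 x) u v"
proof -
  note d = dnth3[OF dC] dnth3[OF dS] dnth3[OF dV]
  have 1: "((\<lambda>y. v $ 1 - S (y $ 3) * v $ 2 - V (y $ 3) * v $ 4) has_derivative
      (\<lambda>u. - (u $ 3 * C (x $ 3)) * v $ 2 - (u $ 3 * S (x $ 3)) * v $ 4)) (at x)" for v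
    by (rule derivative_eq_intros d refl)+ simp
  have 2: "((\<lambda>y. C (y $ 3) * v $ 2 + S (y $ 3) * v $ 4) has_derivative
      (\<lambda>u. (u $ 3 * (- b * S (x $ 3))) * v $ 2 + (u $ 3 * C (x $ 3)) * v $ 4)) (at x)" for v
    by (rule derivative_eq_intros d refl)+ simp
  have 4: "((\<lambda>y. C (y $ 3) * v $ 4 - b * S (y $ 3) * v $ 2) has_derivative
      (\<lambda>u. (u $ 3 * (- b * S (x $ 3))) * v $ 4 - b * (u $ 3 * C (x $ 3)) * v $ 2)) (at x)" for v
    by (rule derivative_eq_intros d refl)+ simp
  show "ext_d1 (w 1) x u v = wedge (w 2 x) (w 3 x) u v" "ext_d1 (w 2) x u v = wedge (w 3 x) (w 4 x) u v"
    "ext_d1 (w 3) x u v = 0" "ext_d1 (w 4) x u v = b * wedge (w 2 x) (w 3 x) u v"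
    unfolding ext_d1_def wedge_def w_inner frechet_eqI[OF 1] frechet_eqI[OF 2] frechet_eqI[OF 4]
    by (simp_all add: algebra_simps)
qed

definition \<Omega> :: "real^4 \<Rightarrow> real^4 \<Rightarrow> real^4 \<Rightarrow> real" where
  "\<Omega> x u v = wedge (w 1 x) (w 3 x) u v + wedge (w 2 x) (w 4 x) u v"

definition D :: "real^4 \<Rightarrow> (real^4) set" where
  "D x = {v. w 1 x \<bullet> v = 0 \<and> w 2 x \<bullet> v = 0}"

lemma coframe_model: "coframe UNIV w"
proof -
  \<comment> \<open>The dual vectors are the columns of \<open>A (p $ 3)\<close>. By
    \<open>bV\<close> and \<open>SV\<close> the long first entries equal \<open>S (p $ 3)\<close>
    and \<open>- V (p $ 3)\<close>; in the form given here duality follows from \<open>CS\<close>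
    alone.\<close>
  let ?e1 = "\<lambda>p :: real^4. v4 1 0 0 0"
    and ?e2 = "\<lambda>p. v4 (S (p $ 3) * C (p $ 3) + V (p $ 3) * (b * S (p $ 3))) (C (p $ 3)) 0 (b * S (p $ 3))"
    and ?e3 = "\<lambda>p :: real^4. v4 0 0 1 0"
    and ?e4 = "\<lambda>p. v4 (V (p $ 3) * C (p $ 3) - S (p $ 3) * S (p $ 3)) (- S (p $ 3)) 0 (C (p $ 3))"
  have s: "smooth_on UNIV (w 1)" "smooth_on UNIV (w 2)" "smooth_on UNIV (w 3)" "smooth_on UNIV (w 4)"
    unfolding w_def pick4_simps
    by (intro smooth_on_v4 smooth_on_const smooth_on_minus smooth_on_mult smooth_CSV smooth_on_nth smooth_on_ident open_UNIV)+
  have w: "w = pick4 (w 1) (w 2) (w 3) (w 4)" unfolding w_def by (simp only: pick4_simps)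
  have dual: "\<forall>i j. pick4 (w 1 p) (w 2 p) (w 3 p) (w 4 p) i \<bullet> pick4 (?e1 p) (?e2 p) (?e3 p) (?e4 p) j = (if i = j then 1 else 0)" for p
    unfolding forall_4 using CS[of "p $ 3"] by (simp add: w_inner algebra_simps)
  show ?thesis
    by (subst w, rule coframe_pick4(1)[OF open_UNIV s, of ?e1 ?e2 ?e3 ?e4]) (rule dual)
qed

lemma adapted_model: "adapted UNIV \<Omega> D w"
proof -
  note d = frame_dual[OF coframe_det[OF coframe_model UNIV_I]]
  have "sc w 1 3 4 y = 0" "sc w 2 3 4 y = 1" "sc w 1 2 3 y = 1" for y
    unfolding sc_def structure_w wedge_def d by simp_all
  then show ?thesis unfolding adapted_def using coframe_model \<Omega>_def D_def by simp
qed

lemma closed_model: "ext_d2 \<Omega> x u v z = 0"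
proof -
  note d = coframe_differentiable[OF coframe_model UNIV_I[of x]]
  have "\<Omega> = (\<lambda>y u v. wedge (w 1 y) (w 3 y) u v + wedge (w 2 y) (w 4 y) u v)" by (intro ext) (rule \<Omega>_def)
  then show ?thesis
    using ext_d2_add[of "\<lambda>y. wedge (w 1 y) (w 3 y)" x "\<lambda>y. wedge (w 2 y) (w 4 y)" u v z,
        OF wedge_differentiable[OF d d] wedge_differentiable[OF d d]]
    by (simp add: ext_d2_wedge[OF d d] structure_w wedge_def algebra_simps)
qed

text \<open>The one-parameter group exp (s B), where B sends (p_1, p_2, p_3, p_4) to (p_2, - p_4, 0,
  b p_2). The third coordinate is the time of the acting factor.\<close>

definition A :: "real \<Rightarrow> real^4 \<Rightarrow> real^4" where
  "A s p = v4 (p $ 1 + S s * p $ 2 - V s * p $ 4) (C s * p $ 2 - S s * p $ 4) (p $ 3) (b * S s * p $ 2 + C s * p $ 4)"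

text \<open>Left translation by \<open>v\<close> in the semidirect product.\<close>

definition L :: "real^4 \<Rightarrow> real^4 \<Rightarrow> real^4" where
  "L v p = A (v $ 3) p + v"

lemma linear_A: "linear (A s)"
  by (rule linearI) (simp_all add: vec4_eq_iff A_def algebra_simps)

lemma A_zero: "A 0 p = p"
  by (simp add: vec4_eq_iff A_def C0 S0 V0)

lemma A_nth3 [simp]: "A s p $ 3 = p $ 3"
  by (simp add: A_def)

lemma A_add: "A s (A s' p) = A (s + s') p"
proof -
  have k: "S s' + S s * C s' - V s * (b * S s') = S (s + s')" "V s' + S s * S s' + V s * C s' = V (s + s')"
    "C s * C s' - S s * (b * S s') = C (s + s')" "C s * S s' + S s * C s' = S (s + s')"
    using bV[of s] unfolding S_add V_add C_add by algebra+
  have "A s (A s' p) $ 1 = p $ 1 + (S s' + S s * C s' - V s * (b * S s')) * p $ 2 - (V s' + S s * S s' + V s * C s') * p $ 4"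
    "A s (A s' p) $ 2 = (C s * C s' - S s * (b * S s')) * p $ 2 - (C s * S s' + S s * C s') * p $ 4"
    "A s (A s' p) $ 4 = b * (C s * S s' + S s * C s') * p $ 2 + (C s * C s' - S s * (b * S s')) * p $ 4"
    by (simp_all add: A_def algebra_simps)
  then show ?thesis unfolding k by (simp add: vec4_eq_iff A_def)
qed

lemma L_comp: "L v (L v' p) = L (A (v $ 3) v' + v) p"
  by (simp add: L_def linear_add[OF linear_A] A_add add.commute add.left_commute add.assoc)

lemma L_zero: "L 0 = id"
  by (simp add: L_def A_zero fun_eq_iff)

lemma L_inverse: "A (v $ 3) (- A (- v $ 3) v) + v = 0" "A (- A (- v $ 3) v $ 3) v + - A (- v $ 3) v = 0"
  by (simp_all add: linear_neg[OF linear_A] A_add A_zero)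

lemma L_has_derivative: "(L v has_derivative A (v $ 3)) (at x)"
  unfolding L_def[abs_def]
  using has_derivative_add[OF linear_imp_has_derivative[OF linear_A] has_derivative_const] by simp

lemma smooth_L: "smooth_on UNIV (L v)"
  unfolding L_def A_def
  by (intro smooth_on_add smooth_on_diff smooth_on_v4 smooth_on_const smooth_on_mult smooth_on_nth smooth_on_ident open_UNIV)

text \<open>This is the group law \<open>A (- (t + s)) (A s u) = A (- t) u\<close> read row by
  row.\<close>

lemma w_L: "w i (L v p) \<bullet> A (v $ 3) u = w i p \<bullet> u"
proof -
  define s t where "s = v $ 3" and "t = p $ 3"
  have 3: "L v p $ 3 = t + s" by (simp add: L_def s_def t_def)
  note k = CS[of s] SV[of s] bV[of s] bV[of t]
  have 1: "S s - S (t + s) * C s - V (t + s) * (b * S s) = - S t"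
    using k unfolding S_add V_add by algebra
  have 14: "- V s + S (t + s) * S s - V (t + s) * C s = - V t"
    using k unfolding S_add V_add by algebra
  have 2: "C (t + s) * C s + S (t + s) * (b * S s) = C t" "S (t + s) * C s - C (t + s) * S s = S t"
    using k unfolding S_add C_add by algebra+
  have i1: "w 1 (L v p) \<bullet> A s u = w 1 p \<bullet> u"
    unfolding w_inner 3 A_def v4_nth t_def[symmetric] using 1 14 by algebra
  have i2: "w 2 (L v p) \<bullet> A s u = w 2 p \<bullet> u"
  proof -
    have "w 2 (L v p) \<bullet> A s u =
        (C (t + s) * C s + S (t + s) * (b * S s)) * u $ 2 + (S (t + s) * C s - C (t + s) * S s) * u $ 4"
      unfolding w_inner 3 A_def v4_nth by (simp add: algebra_simps)
    then show ?thesis unfolding 2 by (simp add: w_inner t_def)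
  qed
  have i4: "w 4 (L v p) \<bullet> A s u = w 4 p \<bullet> u"
  proof -
    have "w 4 (L v p) \<bullet> A s u =
        (C (t + s) * C s + S (t + s) * (b * S s)) * u $ 4 - b * (S (t + s) * C s - C (t + s) * S s) * u $ 2"
      unfolding w_inner 3 A_def v4_nth by (simp add: algebra_simps)
    then show ?thesis unfolding 2 by (simp add: w_inner t_def)
  qed
  have i3: "w 3 (L v p) \<bullet> A s u = w 3 p \<bullet> u" by (simp add: w_inner)
  show ?thesis using exhaust_4[of i] i1 i2 i3 i4 unfolding s_def[symmetric] by auto
qed

text \<open>\<open>lam i j k n\<close> is \<open>i f\<^sub>1 + j f\<^sub>2 + k f\<^sub>3\<close> with \<open>f\<^sub>2\<close> the last coordinate vector and
  \<open>f\<^sub>1, f\<^sub>3\<close> its images under \<open>A (-T)\<close> and \<open>A T\<close>, shifted by \<open>n T\<close> in the third coordinate. By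
  Cayley-Hamilton for \<open>A T\<close>, whose trace on the first, second and fourth coordinates is the integer
  \<open>1 + 2 C T\<close>, these vectors form an \<open>A T\<close>-invariant lattice.\<close>

definition lam :: "int \<Rightarrow> int \<Rightarrow> int \<Rightarrow> int \<Rightarrow> real^4" where
  "lam i j k n = v4 (- V T * of_int (i + k)) (S T * of_int (i - k)) (of_int n * T) (C T * of_int (i + k) + of_int j)"

definition \<Lambda> :: "(real^4) set" where
  "\<Lambda> = {lam i j k n |i j k n. True}"

definition G :: "(real^4 \<Rightarrow> real^4) set" where
  "G = L ` \<Lambda>"

lemma A_T_lam: "\<exists>i' j' k'. A T (lam i j k n) = lam i' j' k' n" "\<exists>i' j' k'. A (- T) (lam i j k n) = lam i' j' k' n"
proof -
  obtain m where m: "2 * C T = of_int m" using CT by (auto elim: Ints_cases)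
  note k = CS[of T] SV[of T] m
  \<comment> \<open>\<open>A T\<close> sends f_1 to f_2 and f_2 to f_3. Its characteristic
    polynomial x^3 - (1 + m) x^2 + (1 + m) x - 1 on the three coordinates gives f_1 - (1 + m) f_2 +
    (1 + m) f_3 as the image of f_3. The inverse is obtained in the same way.\<close>
  have "A T (lam i j k n) = lam k (i - (1 + m) * k) (j + (1 + m) * k) n"
    unfolding vec4_eq_iff A_def lam_def v4_nth of_int_add of_int_diff of_int_mult of_int_1
    using k by (intro conjI refl) algebra+
  then show "\<exists>i' j' k'. A T (lam i j k n) = lam i' j' k' n" by blast
  have "A (- T) (lam i j k n) = lam ((1 + m) * i + j) (k - (1 + m) * i) i n"
    unfolding vec4_eq_iff A_def lam_def v4_nth of_int_add of_int_diff of_int_mult of_int_1 C_even S_odd V_even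
    using k by (intro conjI refl) algebra+
  then show "\<exists>i' j' k'. A (- T) (lam i j k n) = lam i' j' k' n" by blast
qed

lemma A_int_lam: "\<exists>i' j' k'. A (of_int l * T) (lam i j k n) = lam i' j' k' n"
proof (induction l rule: int_induct[where k = 0])
  case base
  then show ?case using A_zero by auto
next
  case (step1 l)
  then obtain i' j' k' where "A (of_int l * T) (lam i j k n) = lam i' j' k' n" by blast
  then have "A (of_int (l + 1) * T) (lam i j k n) = A T (lam i' j' k' n)"
    using A_add[of T "of_int l * T" "lam i j k n"] by (simp add: distrib_right add.commute)
  then show ?case using A_T_lam(1) by simp
next
  case (step2 l)
  then obtain i' j' k' where "A (of_int l * T) (lam i j k n) = lam i' j' k' n" by blast
  then have "A (of_int (l - 1) * T) (lam i j k n) = A (- T) (lam i' j' k' n)"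
    using A_add[of "- T" "of_int l * T" "lam i j k n"] by (simp add: left_diff_distrib)
  then show ?case using A_T_lam(2) by simp
qed

lemma \<Lambda>_A: "v \<in> \<Lambda> \<Longrightarrow> v' \<in> \<Lambda> \<Longrightarrow> A (v $ 3) v' \<in> \<Lambda>" "v \<in> \<Lambda> \<Longrightarrow> v' \<in> \<Lambda> \<Longrightarrow> A (- v $ 3) v' \<in> \<Lambda>"
proof -
  assume "v \<in> \<Lambda>" "v' \<in> \<Lambda>"
  then obtain i\<^sub>0 j\<^sub>0 k\<^sub>0 l i j k n where "v = lam i\<^sub>0 j\<^sub>0 k\<^sub>0 l" and "v' = lam i j k n"
    unfolding \<Lambda>_def by blast
  moreover from this have "v $ 3 = of_int l * T" by (simp add: lam_def)
  moreover from this have "- v $ 3 = of_int (- l) * T" by simp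
  ultimately show "A (v $ 3) v' \<in> \<Lambda>" "A (- v $ 3) v' \<in> \<Lambda>"
    using A_int_lam[of l i j k n] A_int_lam[of "- l" i j k n] by (auto simp: \<Lambda>_def)
qed

lemma \<Lambda>_add: "v \<in> \<Lambda> \<Longrightarrow> v' \<in> \<Lambda> \<Longrightarrow> v + v' \<in> \<Lambda>"
proof -
  assume "v \<in> \<Lambda>" "v' \<in> \<Lambda>"
  then obtain i j k n i' j' k' n' where "v = lam i j k n" "v' = lam i' j' k' n'" by (auto simp: \<Lambda>_def)
  then have "v + v' = lam (i + i') (j + j') (k + k') (n + n')"
    by (simp add: vec4_eq_iff lam_def algebra_simps)
  then show ?thesis by (auto simp: \<Lambda>_def)
qed

lemma \<Lambda>_minus: "v \<in> \<Lambda> \<Longrightarrow> - v \<in> \<Lambda>"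
proof -
  assume "v \<in> \<Lambda>"
  then obtain i j k n where "v = lam i j k n" by (auto simp: \<Lambda>_def)
  then have "- v = lam (- i) (- j) (- k) (- n)" by (simp add: vec4_eq_iff lam_def algebra_simps)
  then show ?thesis by (auto simp: \<Lambda>_def)
qed

lemma \<Lambda>_zero: "0 \<in> \<Lambda>"
proof -
  have "0 = lam 0 0 0 0" by (simp add: vec4_eq_iff lam_def)
  then show ?thesis unfolding \<Lambda>_def by blast
qed

text \<open>\<open>V T\<close>, \<open>S T\<close> and \<open>T\<close> are nonzero, so a bound on
  the vector bounds \<open>i + k\<close>, \<open>i - k\<close> and \<open>n\<close>, and then
  \<open>j\<close>.\<close>

lemma finite_\<Lambda>: "finite {v \<in> \<Lambda>. norm v \<le> R}"
proof -
  define M1 M2 M3 where "M1 = R / \<bar>V T\<bar>" and "M2 = R / \<bar>S T\<bar>" and "M3 = R / T"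
  define M where "M = max (max (M1 + M2) M3) (R + \<bar>C T\<bar> * M1)"
  let ?I = "{i :: int. \<bar>real_of_int i\<bar> \<le> M}"
  have "{v \<in> \<Lambda>. norm v \<le> R} \<subseteq> (\<lambda>(i, j, k, n). lam i j k n) ` (?I \<times> ?I \<times> ?I \<times> ?I)"
  proof
    fix v assume v: "v \<in> {v \<in> \<Lambda>. norm v \<le> R}"
    then obtain i j k n where l: "v = lam i j k n" by (auto simp: \<Lambda>_def)
    have n: "\<bar>v $ l\<bar> \<le> R" for l using nth_le_norm[of v l] v by simp
    have "\<bar>V T\<bar> * \<bar>of_int (i + k)\<bar> \<le> R" using n[of 1] by (simp add: l lam_def abs_mult)
    then have 1: "\<bar>real_of_int (i + k)\<bar> \<le> M1" using VT by (simp add: M1_def field_simps)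
    have "\<bar>S T\<bar> * \<bar>of_int (i - k)\<bar> \<le> R" using n[of 2] by (simp add: l lam_def abs_mult)
    then have 2: "\<bar>real_of_int (i - k)\<bar> \<le> M2" using ST by (simp add: M2_def field_simps)
    have "\<bar>of_int n\<bar> * T \<le> R" using n[of 3] T_pos by (simp add: l lam_def abs_mult)
    then have 3: "\<bar>real_of_int n\<bar> \<le> M3" using T_pos by (simp add: M3_def field_simps)
    have "\<bar>C T * of_int (i + k) + of_int j\<bar> \<le> R" using n[of 4] by (simp add: l lam_def)
    moreover have "\<bar>C T * of_int (i + k)\<bar> \<le> \<bar>C T\<bar> * M1"
      unfolding abs_mult using 1 by (intro mult_left_mono) auto
    ultimately have 4: "\<bar>real_of_int j\<bar> \<le> R + \<bar>C T\<bar> * M1" by linarith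
    have "\<bar>real_of_int i\<bar> \<le> M1 + M2" "\<bar>real_of_int k\<bar> \<le> M1 + M2" using 1 2 by linarith+
    then have "i \<in> ?I" "j \<in> ?I" "k \<in> ?I" "n \<in> ?I" using 3 4 by (auto simp: M_def)
    then show "v \<in> (\<lambda>(i, j, k, n). lam i j k n) ` (?I \<times> ?I \<times> ?I \<times> ?I)" using l by force
  qed
  then show ?thesis by (rule finite_subset) (simp add: finite_bounded_int)
qed

lemma A_bounded: "\<exists>K. \<forall>s p. \<bar>s\<bar> \<le> M \<longrightarrow> norm p \<le> R \<longrightarrow> norm (A s p) \<le> K"
proof -
  have "\<exists>B. \<forall>s. \<bar>s\<bar> \<le> M \<longrightarrow> \<bar>f s\<bar> \<le> B" if "\<And>t. isCont f t" for f :: "real \<Rightarrow> real"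
  proof -
    have "bounded (f ` cball 0 M)"
      by (rule compact_imp_bounded[OF compact_continuous_image[OF continuous_at_imp_continuous_on]]) (auto simp: that)
    then obtain B where "\<forall>y\<in>f ` cball 0 M. norm y \<le> B" unfolding bounded_iff by blast
    then show ?thesis by (intro exI[of _ B]) auto
  qed
  then obtain c s v where B: "\<And>t. \<bar>t\<bar> \<le> M \<Longrightarrow> \<bar>C t\<bar> \<le> c" "\<And>t. \<bar>t\<bar> \<le> M \<Longrightarrow> \<bar>S t\<bar> \<le> s" "\<And>t. \<bar>t\<bar> \<le> M \<Longrightarrow> \<bar>V t\<bar> \<le> v"
    using DERIV_isCont[OF dC] DERIV_isCont[OF dS] DERIV_isCont[OF dV] by meson
  define K where "K = (R + s * R + v * R) + (c * R + s * R) + R + (\<bar>b\<bar> * (s * R) + c * R)"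
  have "norm (A t p) \<le> K" if t: "\<bar>t\<bar> \<le> M" and p: "norm p \<le> R" for t p
  proof -
    have n: "\<bar>p $ i\<bar> \<le> R" for i using nth_le_norm[of p i] p by simp
    have nn: "0 \<le> c" "0 \<le> s" "0 \<le> v" using B[OF t] by linarith+
    have m: "\<bar>C t * p $ i\<bar> \<le> c * R" "\<bar>S t * p $ i\<bar> \<le> s * R" "\<bar>V t * p $ i\<bar> \<le> v * R" for i
      unfolding abs_mult using B[OF t] n nn by (auto intro!: mult_mono)
    have bs: "\<bar>b * S t * p $ 2\<bar> \<le> \<bar>b\<bar> * (s * R)"
      unfolding mult.assoc abs_mult[of b] using m(2)[of 2] by (intro mult_left_mono) auto
    have "norm (A t p) \<le> \<bar>p $ 1 + S t * p $ 2 - V t * p $ 4\<bar> + \<bar>C t * p $ 2 - S t * p $ 4\<bar> + \<bar>p $ 3\<bar> + \<bar>b * S t * p $ 2 + C t * p $ 4\<bar>"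
      unfolding A_def by (rule v4_norm_le)
    also have "\<dots> \<le> K" unfolding K_def 
    proof (intro add_mono)
      show "\<bar>p $ 1 + S t * p $ 2 - V t * p $ 4\<bar> \<le> R + s * R + v * R" using n[of 1] m(2)[of 2] m(3)[of 4] by linarith
      show "\<bar>C t * p $ 2 - S t * p $ 4\<bar> \<le> c * R + s * R" using m(1)[of 2] m(2)[of 4] by linarith
      show "\<bar>p $ 3\<bar> \<le> R" by (rule n)
      show "\<bar>b * S t * p $ 2 + C t * p $ 4\<bar> \<le> \<bar>b\<bar> * (s * R) + c * R" using bs m(1)[of 4] by linarith
    qed
    finally show ?thesis .
  qed
  then show ?thesis by blast
qed

text \<open>If \<open>L v\<close> moves a point of the ball into the ball, comparing third
  coordinates bounds \<open>v $ 3\<close>, hence \<open>A (v $ 3)\<close> on the ball, hence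
  \<open>v\<close> itself; and only finitely many lattice vectors are that short.\<close>

lemma disc_model: "finite {g \<in> G. g ` cball 0 R \<inter> cball 0 R \<noteq> {}}"
proof -
  obtain K where K: "\<And>s p. \<bar>s\<bar> \<le> 2 * R \<Longrightarrow> norm p \<le> R \<Longrightarrow> norm (A s p) \<le> K"
    using A_bounded[of "2 * R" R] by blast
  have "{g \<in> G. g ` cball 0 R \<inter> cball 0 R \<noteq> {}} \<subseteq> L ` {v \<in> \<Lambda>. norm v \<le> R + K}"
  proof
    fix g assume "g \<in> {g \<in> G. g ` cball 0 R \<inter> cball 0 R \<noteq> {}}"
    then have "g \<in> L ` \<Lambda>" "\<exists>p. p \<in> cball 0 R \<and> g p \<in> cball 0 R" unfolding G_def by blast+
    then obtain v p where "v \<in> \<Lambda>" "g = L v" "p \<in> cball 0 R" "g p \<in> cball 0 R" by blast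
    then have v: "v \<in> \<Lambda>" "g = L v" "norm p \<le> R" "norm (L v p) \<le> R" by simp_all
    have "v $ 3 = L v p $ 3 - p $ 3" by (simp add: L_def)
    then have "\<bar>v $ 3\<bar> \<le> 2 * R" using nth_le_norm[of "L v p" 3] nth_le_norm[of p 3] v(3,4) by linarith
    then have "norm (A (v $ 3) p) \<le> K" using K v(3) by blast
    moreover have "L v p - A (v $ 3) p = v" by (simp add: L_def)
    then have "norm v \<le> norm (L v p) + norm (A (v $ 3) p)" using norm_triangle_ineq4[of "L v p" "A (v $ 3) p"] by simp
    ultimately have "norm v \<le> R + K" using v(4) by linarith
    then show "g \<in> L ` {v \<in> \<Lambda>. norm v \<le> R + K}" using v by blast
  qed
  then show ?thesis by (rule finite_subset) (simp add: finite_\<Lambda>)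
qed

lemma frac_bound: "\<bar>x - of_int \<lfloor>x\<rfloor>\<bar> \<le> (1::real)"
  by linarith

lemma cocompact_model: "\<exists>R. \<forall>x. \<exists>g\<in>G. g x \<in> cball 0 R"
proof -
  define R where "R = \<bar>V T\<bar> * 2 + \<bar>S T\<bar> * 2 + T + (\<bar>C T\<bar> * 2 + 1)"
  have "\<exists>g\<in>G. g p \<in> cball 0 R" for p
  proof -
    \<comment> \<open>The shift by \<open>n\<close> times \<open>T\<close> brings the third
      coordinate into the interval from 0 to \<open>T\<close>. It also twists the point by
      \<open>A (of_int n * T)\<close>, so integer parts are taken for the twisted point
      \<open>q\<close>.\<close>
    define n where "n = - \<lfloor>p $ 3 / T\<rfloor>"
    define q where "q = A (of_int n * T) p"
    \<comment> \<open>\<open>a\<close>, \<open>e\<close>, \<open>c\<close> are the coordinates of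
      \<open>q\<close> in the basis f_1, f_2, f_3 of the lattice; \<open>\<alpha>\<close> and
      \<open>\<beta>\<close> are \<open>a + c\<close> and \<open>a - c\<close>.\<close>
    define \<alpha> \<beta> where "\<alpha> = - q $ 1 / V T" and "\<beta> = q $ 2 / S T"
    define a c e where "a = (\<alpha> + \<beta>) / 2" and "c = (\<alpha> - \<beta>) / 2" and "e = q $ 4 - C T * \<alpha>"
    define v where "v = lam (- \<lfloor>a\<rfloor>) (- \<lfloor>e\<rfloor>) (- \<lfloor>c\<rfloor>) n"
    have q: "q $ 1 = - V T * (a + c)" "q $ 2 = S T * (a - c)" "q $ 4 = C T * (a + c) + e"
      using VT ST by (simp_all add: a_def c_def e_def \<alpha>_def \<beta>_def field_simps)
    have q3: "q $ 3 = p $ 3" by (simp add: q_def)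
    have "L v p = q + v" by (simp add: L_def v_def lam_def q_def)
    also have "\<dots> = v4 (- V T * ((a - \<lfloor>a\<rfloor>) + (c - \<lfloor>c\<rfloor>))) (S T * ((a - \<lfloor>a\<rfloor>) - (c - \<lfloor>c\<rfloor>))) (p $ 3 - of_int \<lfloor>p $ 3 / T\<rfloor> * T)
        (C T * ((a - \<lfloor>a\<rfloor>) + (c - \<lfloor>c\<rfloor>)) + (e - \<lfloor>e\<rfloor>))"
      by (simp add: vec4_eq_iff q q3 v_def lam_def n_def algebra_simps)
    finally have Lv: "L v p = \<dots>" .
    have 1: "\<bar>(a - \<lfloor>a\<rfloor>) + (c - \<lfloor>c\<rfloor>)\<bar> \<le> 2" "\<bar>(a - \<lfloor>a\<rfloor>) - (c - \<lfloor>c\<rfloor>)\<bar> \<le> 2"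
      using frac_bound[of a] frac_bound[of c] by linarith+
    have 3: "\<bar>p $ 3 - of_int \<lfloor>p $ 3 / T\<rfloor> * T\<bar> \<le> T"
    proof -
      have "p $ 3 - of_int \<lfloor>p $ 3 / T\<rfloor> * T = (p $ 3 / T - of_int \<lfloor>p $ 3 / T\<rfloor>) * T" using T_pos by (simp add: field_simps)
      then show ?thesis using frac_bound[of "p $ 3 / T"] T_pos by (simp add: abs_mult)
    qed
    have m: "\<bar>- V T * ((a - \<lfloor>a\<rfloor>) + (c - \<lfloor>c\<rfloor>))\<bar> \<le> \<bar>V T\<bar> * 2" "\<bar>S T * ((a - \<lfloor>a\<rfloor>) - (c - \<lfloor>c\<rfloor>))\<bar> \<le> \<bar>S T\<bar> * 2"
      "\<bar>C T * ((a - \<lfloor>a\<rfloor>) + (c - \<lfloor>c\<rfloor>))\<bar> \<le> \<bar>C T\<bar> * 2"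
      unfolding abs_mult abs_minus_cancel using 1 by (intro mult_left_mono; simp)+
    have "norm (L v p) \<le> R"
      unfolding Lv R_def
    proof (intro order_trans[OF v4_norm_le] add_mono)
      show "\<bar>C T * ((a - \<lfloor>a\<rfloor>) + (c - \<lfloor>c\<rfloor>)) + (e - \<lfloor>e\<rfloor>)\<bar> \<le> \<bar>C T\<bar> * 2 + 1"
        using m(3) frac_bound[of e] by linarith
    qed (rule m 3)+
    moreover have "L v \<in> G" unfolding G_def v_def \<Lambda>_def by blast
    ultimately show ?thesis by (intro bexI[of _ "L v"]) auto
  qed
  then show ?thesis by blast
qed

sublocale orbit_model G w \<Omega> D
proof
  show "id \<in> G" using \<Lambda>_zero L_zero unfolding G_def by (metis imageI)
next
  fix g h assume "g \<in> G" "h \<in> G"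
  then obtain v v' where v: "v \<in> \<Lambda>" "g = L v" "v' \<in> \<Lambda>" "h = L v'" unfolding G_def by blast
  have "g \<circ> h = L (A (v $ 3) v' + v)" using v L_comp by (simp add: fun_eq_iff)
  then show "g \<circ> h \<in> G" using \<Lambda>_add[OF \<Lambda>_A(1)[OF v(1,3)] v(1)] unfolding G_def by simp
next
  fix g assume "g \<in> G"
  then obtain v where v: "v \<in> \<Lambda>" "g = L v" unfolding G_def by blast
  let ?u = "- A (- v $ 3) v"
  have "?u \<in> \<Lambda>" by (rule \<Lambda>_minus[OF \<Lambda>_A(2)[OF v(1) v(1)]])
  moreover have "L ?u \<circ> g = id" "g \<circ> L ?u = id"
    using v(2) L_zero L_inverse[of v] L_comp[of v ?u] L_comp[of ?u v] by (simp_all only: fun_eq_iff o_apply, simp_all)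
  ultimately show "\<exists>h\<in>G. h \<circ> g = id \<and> g \<circ> h = id" unfolding G_def by blast
next
  show "smooth_on UNIV g" if "g \<in> G" for g using that smooth_L unfolding G_def by blast
  show "w i (g x) \<bullet> frechet_derivative g (at x) u = w i x \<bullet> u" if "g \<in> G" for g i x u
    using that w_L frechet_eqI[OF L_has_derivative] unfolding G_def by force
  show "g = id" if g: "g \<in> G" "g x = x" for g x
  proof -
    obtain v where v: "g = L v" using g(1) unfolding G_def by blast
    have "v $ 3 = 0" using g(2) v by (simp add: L_def vec4_eq_iff)
    then have "v = 0" using g(2) v by (simp add: L_def A_zero)
    then show ?thesis using v L_zero by simp
  qed
qed (rule disc_model cocompact_model adapted_model closed_model)+

text \<open>Left translations by arbitrary vectors, not only by lattice vectors, preserve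
  \<open>w\<close>, and they act transitively.\<close>

lemma homogeneous_model: "homogeneous R4 (\<lambda>c. \<Omega>) (\<lambda>c. D)"
  unfolding homogeneous_def
proof (intro conjI ballI)
  show "points R4 \<noteq> {}" by simp
  show "connected_space (mtop R4)" using connectedin_topspace[of "euclidean :: (real^4) topology"] connected_UNIV[where 'a = "real^4"] by simp
  fix p q :: "real^4"
  \<comment> \<open>The solution of \<open>L v p = q\<close>: the third coordinates give
    \<open>v $ 3\<close> and thereby the matrix that acts on \<open>p\<close>.\<close>
  define v where "v = q - A (q $ 3 - p $ 3) p"
  have v3: "v $ 3 = q $ 3 - p $ 3" by (simp add: v_def)
  let ?u = "- A (- v $ 3) v"
  have "L v \<in> symmetries R4 (\<lambda>c. \<Omega>) (\<lambda>c. D)"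
  proof (rule preserving_symmetry[OF smooth_L smooth_L[of ?u]])
    show "L ?u (L v x) = x" "L v (L ?u x) = x" for x
      using L_zero L_inverse[of v] L_comp[of v ?u x] L_comp[of ?u v x] by simp_all
    show "w i (L v x) \<bullet> frechet_derivative (L v) (at x) u = w i x \<bullet> u" for i x u
      unfolding frechet_eqI[OF L_has_derivative] by (rule w_L)
  qed
  moreover have "L v p = q" unfolding L_def v3 by (simp add: v_def)
  ultimately show "\<exists>f\<in>symmetries R4 (\<lambda>c. \<Omega>) (\<lambda>c. D). f p = q" by blast
qed

lemma model:
  "\<exists>(M :: (real^4) mfd) \<Omega> D \<Gamma> (\<pi> :: real^4 \<Rightarrow> (real^4) set) N \<Theta> E \<omega>.
     lagrangian_engel M \<Omega> D \<and> homogeneous M \<Omega> D \<and> compact_quotient M \<Omega> D \<Gamma> \<pi> N \<Theta> E \<and>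
     zero_adapted N \<Theta> E \<omega> \<and> structure_equations N b \<omega>"
proof -
  let ?\<omega> = "\<lambda>(i::nat) (c :: (real^4) set chart). w (of_nat i)"
  have "zero_adapted omfd (\<lambda>c. \<Omega>) (\<lambda>c. D) ?\<omega>" by (rule zero_adapted_omfd) simp_all
  moreover have "structure_equations omfd b ?\<omega>"
    unfolding structure_equations_def using structure_w by simp
  ultimately show ?thesis
    by (intro exI[of _ R4] exI[of _ "\<lambda>c. \<Omega>"] exI[of _ "\<lambda>c. D"] exI[of _ G] exI[of _ orb] exI[of _ omfd]
        exI[of _ ?\<omega>] conjI lagrangian_engel_R4 homogeneous_model compact_quotient_omfd)
qed

end

theorem every_parameter_occurs:
  "\<exists>(M :: (real^4) mfd) \<Omega> D \<Gamma> (\<pi> :: real^4 \<Rightarrow> (real^4) set) N \<Theta> E \<omega>.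
     lagrangian_engel M \<Omega> D \<and> homogeneous M \<Omega> D \<and> compact_quotient M \<Omega> D \<Gamma> \<pi> N \<Theta> E \<and>
     zero_adapted N \<Theta> E \<omega> \<and> structure_equations N b \<omega>"
  using exponential_functions[of b]
  by (elim exE, intro engel_model.model) (unfold engel_model_def, elim conjE, intro conjI, assumption+)

theorem theorem4p1:
  shows "(\<forall>(M :: 'a mfd) \<Omega> D \<Gamma> (\<pi> :: 'a \<Rightarrow> 'b) N \<Theta> E.
            lagrangian_engel M \<Omega> D \<and> homogeneous M \<Omega> D \<and> compact_quotient M \<Omega> D \<Gamma> \<pi> N \<Theta> E \<longrightarrow>
            (\<exists>\<omega> b. zero_adapted N \<Theta> E \<omega> \<and> structure_equations N b \<omega> \<and>
               (\<forall>\<omega>' b'. zero_adapted N \<Theta> E \<omega>' \<and> structure_equations N b' \<omega>' \<longrightarrow>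
                  coframing_agree N \<omega> \<omega>' \<and> b' = b)))
       \<and> (\<forall>b. \<exists>(M :: (real^4) mfd) \<Omega> D \<Gamma> (\<pi> :: real^4 \<Rightarrow> (real^4) set) N \<Theta> E \<omega>.
            lagrangian_engel M \<Omega> D \<and> homogeneous M \<Omega> D \<and> compact_quotient M \<Omega> D \<Gamma> \<pi> N \<Theta> E \<and>
            zero_adapted N \<Theta> E \<omega> \<and> structure_equations N b \<omega>)"
  by (intro conjI allI impI) ((elim conjE, erule (2) classification), rule every_parameter_occurs)

end
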